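(* Let $\mathfrak g$ be a Kac-Moody Lie algebra, let $A$ be a finitely generated commutative associative unital $\mathbb C$-algebra, and let $\widetilde{\mathfrak g}=\mathfrak g'\otimes A\oplus\mathfrak h''$ and $\widetilde{\mathfrak h}=\mathfrak h'\otimes A\oplus\mathfrak h''$. Let $I$ and $J$ be coprime cofinite ideals of $A$ (i.e. $I+J=A$). Let $\psi_1,\psi_2:\widetilde{\mathfrak h}\to\mathbb C$ be linear maps such that $\psi_1|_{\mathfrak h'\otimes I}=0$, $\psi_2|_{\mathfrak h'\otimes J}=0$, $\psi_1|_{\mathfrak h}=\lambda$ and $\psi_2|_{\mathfrak h}=\mu$, where $\lambda,\mu\in\mathfrak h^*$ are dominant integral. Then, as $\widetilde{\mathfrak g}$-modules, $$W(\psi_1+\psi_2,\ I\cap J)\;\cong\; W(\psi_1,I)\otimes W(\psi_2,J).$$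
   Context: Setting. $\mathfrak g$ is a Kac-Moody Lie algebra over $\mathbb C$ with Cartan subalgebra $\mathfrak h$, triangular decomposition $\mathfrak g=N^-\oplus\mathfrak h\oplus N^+$, simple roots $\alpha_1,\dots,\alpha_l$, simple coroots $\alpha_1^\vee,\dots,\alpha_l^\vee$, and set of positive roots $\Delta^+$. Put $\mathfrak g'=[\mathfrak g,\mathfrak g]$, $\mathfrak h'=\mathfrak g'\cap\mathfrak h$, and fix a subspace $\mathfrak h''$ with $\mathfrak h=\mathfrak h'\oplus\mathfrak h''$. $A$ is a finitely generated commutative associative unital $\mathbb C$-algebra. An ideal $I$ of $A$ is cofinite if $\dim_{\mathbb C}A/I<\infty$. A weight $\lambda\in\mathfrak h^*$ is dominant integral if $\lambda(\alpha_i^\vee)\in\mathbb Z_{\ge0}$ for all $i$. The Lie algebra $\widetilde{\mathfrak g}=\mathfrak g'\otimes A\oplus\mathfrak h''$ has bracket $[X\otimes a,Y\otimes b]=[X,Y]\otimes ab$, $[h,X\otimes a]=[h,X]\otimes a$, $[h,h_1]=0$ for $X,Y\in\mathfrak g'$, $a,b\in A$, $h,h_1\in\mathfrak h''$. Put $\widetilde{\mathfrak h}=\mathfrak h'\otimes A\oplus\mathfrak h''$ and $\widetilde N^{\pm}=N^{\pm}\otimes A$, so $\widetilde{\mathfrak g}=\widetilde N^+\oplus\widetilde{\mathfrak h}\oplus\widetilde N^-$. We identify $\mathfrak g=\mathfrak g'\otimes1\oplus\mathfrak h''\subset\widetilde{\mathfrak g}$ and $\mathfrak h=\mathfrak h'\otimes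 1\oplus\mathfrak h''\subset\widetilde{\mathfrak h}$. Tensor products of $\widetilde{\mathfrak g}$-modules carry the usual action $x(u\otimes w)=xu\otimes w+u\otimes xw$. Verma module. For a linear map $\psi:\widetilde{\mathfrak h}\to\mathbb C$, $M(\psi)=U(\widetilde{\mathfrak g})\otimes_{U(\widetilde N^+\oplus\widetilde{\mathfrak h})}\mathbb C$, where $\widetilde N^+$ acts on $\mathbb C$ by $0$ and $\widetilde{\mathfrak h}$ acts by $\psi$; $v$ denotes its highest weight vector $1\otimes1$ (and its images in quotients). The module $M(\psi,I)$. Let $I$ be a cofinite ideal and $\psi$ a linear map with $\psi|_{\mathfrak h'\otimes I}=0$ and $\psi|_{\mathfrak h}=\lambda$ dominant integral. For $\alpha=\sum_i m_i\alpha_i\in\Delta^+$ put $N_{\lambda,\alpha}=\sum_i m_i\lambda(\alpha_i^\vee)$. Then $M(\psi,I)$ is the quotient of $M(\psi)$ by the submodule generated by all $(X_{-\alpha}\otimes a)v$ with $\alpha\in\Delta^+$, $X_{-\alpha}$ a root vector of root $-\alpha$, and $a\in I^{N_{\lambda,\alpha}}$ (with $I^0=A$). The Weyl module $W(\psi,I)$. A $\widetilde{\mathfrak g}$-module is called integrable if, as a $\mathfrak g$-module, $\mathfrak h$ acts diagonalizably and all Chevalley generators $X_{\pm\alpha_i}$ $(1\le i\le l)$ act locally nilpotently. $W(\psi,I)$ is the maximal integrable quotient of $M(\psi,I)$: it is an integrable quotient of $M(\psi,I)$ such that every integrable quotient of $M(\psi,I)$ is a quotient of $W(\psi,I)$.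 *)

theory Defs
  imports
    "HOL-Algebra.Module"
    "HOL-Algebra.QuotRing"
    "HOL-Algebra.Ideal_Product"
    "HOL-Algebra.Subrings"
    "HOL-Library.Poly_Mapping"
    "HOL-Analysis.Cartesian_Space"
begin

section \<open>Complex vector spaces\<close>

text \<open>Vector spaces, Lie algebras and representations are records extending the record
  \<^type>\<open>module\<close> of HOL-Algebra. That record extends rings, so spaces without a product
  have meaningless fields \<^const>\<open>mult\<close> and \<^const>\<open>one\<close>.\<close>

definition C_alg :: "(complex, complex) module" where
  "C_alg = \<lparr>carrier = UNIV, mult = (*), one = 1, zero = 0, add = (+), smult = (*)\<rparr>"

abbreviation lin_subspace :: "(complex, 'v, 'm) module_scheme \<Rightarrow> 'v set \<Rightarrow> bool" where
  "lin_subspace V K \<equiv> submodule K C_alg V"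

definition lin_span :: "(complex, 'v, 'm) module_scheme \<Rightarrow> 'v set \<Rightarrow> 'v set" where
  "lin_span V S = \<Inter> {K. lin_subspace V K \<and> S \<subseteq> K}"

definition fin_dim :: "(complex, 'v, 'm) module_scheme \<Rightarrow> bool" where
  "fin_dim V \<longleftrightarrow> (\<exists>F. finite F \<and> F \<subseteq> carrier V \<and> lin_span V F = carrier V)"

definition has_dim :: "(complex, 'v, 'm) module_scheme \<Rightarrow> nat \<Rightarrow> bool" where
  "has_dim V n \<longleftrightarrow>
     (\<exists>B. finite B \<and> card B = n \<and> B \<subseteq> carrier V \<and> lin_span V B = carrier V \<and>
          (\<forall>b\<in>B. b \<notin> lin_span V (B - {b})))"

definition lin_functional :: "(complex, 'v, 'm) module_scheme \<Rightarrow> ('v \<Rightarrow> complex) \<Rightarrow> bool" where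
  "lin_functional V \<phi> \<longleftrightarrow>
     (\<forall>x\<in>carrier V. \<forall>y\<in>carrier V. \<phi> (x \<oplus>\<^bsub>V\<^esub> y) = \<phi> x + \<phi> y) \<and>
     (\<forall>c. \<forall>x\<in>carrier V. \<phi> (c \<odot>\<^bsub>V\<^esub> x) = c * \<phi> x)"

definition quot_vs :: "(complex, 'v, 'm) module_scheme \<Rightarrow> 'v set \<Rightarrow> (complex, 'v set) module" where
  "quot_vs V K =
     \<lparr>carrier = a_rcosets\<^bsub>V\<^esub> K, mult = undefined, one = undefined,
      zero = K, add = set_add V, smult = (\<lambda>c X. \<Union>x\<in>X. K +>\<^bsub>V\<^esub> (c \<odot>\<^bsub>V\<^esub> x))\<rparr>"

definition free_vs :: "'x set \<Rightarrow> (complex, 'x \<Rightarrow>\<^sub>0 complex) module" where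
  "free_vs X =
     \<lparr>carrier = {p. Poly_Mapping.keys p \<subseteq> X}, mult = undefined, one = undefined,
      zero = 0, add = (+), smult = (\<lambda>c. Poly_Mapping.map (\<lambda>z. c * z))\<rparr>"

subsection \<open>Tensor products over the complex numbers\<close>

definition tensor_rels ::
  "(complex, 'v, 'm) module_scheme \<Rightarrow> (complex, 'w, 'n) module_scheme \<Rightarrow> ('v \<times> 'w \<Rightarrow>\<^sub>0 complex) set" where
  "tensor_rels V W =
     {Poly_Mapping.single (v \<oplus>\<^bsub>V\<^esub> v', w) 1 - Poly_Mapping.single (v, w) 1
        - Poly_Mapping.single (v', w) 1 | v v' w.
        v \<in> carrier V \<and> v' \<in> carrier V \<and> w \<in> carrier W} \<union>
     {Poly_Mapping.single (v, w \<oplus>\<^bsub>W\<^esub> w') 1 - Poly_Mapping.single (v, w) 1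
        - Poly_Mapping.single (v, w') 1 | v w w'.
        v \<in> carrier V \<and> w \<in> carrier W \<and> w' \<in> carrier W} \<union>
     {Poly_Mapping.single (c \<odot>\<^bsub>V\<^esub> v, w) 1 - Poly_Mapping.single (v, w) c | c v w.
        v \<in> carrier V \<and> w \<in> carrier W} \<union>
     {Poly_Mapping.single (v, c \<odot>\<^bsub>W\<^esub> w) 1 - Poly_Mapping.single (v, w) c | c v w.
        v \<in> carrier V \<and> w \<in> carrier W}"

definition tensor_ker ::
  "(complex, 'v, 'm) module_scheme \<Rightarrow> (complex, 'w, 'n) module_scheme \<Rightarrow> ('v \<times> 'w \<Rightarrow>\<^sub>0 complex) set" where
  "tensor_ker V W = lin_span (free_vs (carrier V \<times> carrier W)) (tensor_rels V W)"

definition tensor_cls ::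
  "(complex, 'v, 'm) module_scheme \<Rightarrow> (complex, 'w, 'n) module_scheme \<Rightarrow>
   ('v \<times> 'w \<Rightarrow>\<^sub>0 complex) \<Rightarrow> ('v \<times> 'w \<Rightarrow>\<^sub>0 complex) set" where
  "tensor_cls V W p = tensor_ker V W +>\<^bsub>free_vs (carrier V \<times> carrier W)\<^esub> p"

definition tensor_vs ::
  "(complex, 'v, 'm) module_scheme \<Rightarrow> (complex, 'w, 'n) module_scheme \<Rightarrow>
   (complex, ('v \<times> 'w \<Rightarrow>\<^sub>0 complex) set) module" where
  "tensor_vs V W = quot_vs (free_vs (carrier V \<times> carrier W)) (tensor_ker V W)"

definition tens ::
  "(complex, 'v, 'm) module_scheme \<Rightarrow> (complex, 'w, 'n) module_scheme \<Rightarrow>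
   'v \<Rightarrow> 'w \<Rightarrow> ('v \<times> 'w \<Rightarrow>\<^sub>0 complex) set" where
  "tens V W v w = tensor_cls V W (Poly_Mapping.single (v, w) 1)"

text \<open>The map \<open>f \<otimes> g\<close> for linear endomorphisms \<open>f\<close> of \<open>V\<close> and \<open>g\<close> of \<open>W\<close>; the union over the
  representatives \<open>p\<close> of a tensor is a single coset, and the union is only used to avoid a choice.\<close>

definition tensor_map ::
  "(complex, 'v, 'm) module_scheme \<Rightarrow> (complex, 'w, 'n) module_scheme \<Rightarrow> ('v \<Rightarrow> 'v) \<Rightarrow> ('w \<Rightarrow> 'w) \<Rightarrow>
   ('v \<times> 'w \<Rightarrow>\<^sub>0 complex) set \<Rightarrow> ('v \<times> 'w \<Rightarrow>\<^sub>0 complex) set" where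
  "tensor_map V W f g X =
     (\<Union>p\<in>X. tensor_cls V W
        (\<Sum>(v, w)\<in>Poly_Mapping.keys p.
           Poly_Mapping.single (f v, g w) (Poly_Mapping.lookup p (v, w))))"


section \<open>Lie algebras and their modules\<close>

record 'l lie_algebra_rec = "(complex, 'l) module" +
  brkt :: "'l \<Rightarrow> 'l \<Rightarrow> 'l"

locale lie_algebra = Module.module C_alg L for L :: "('l, 'm) lie_algebra_rec_scheme" (structure) +
  assumes brkt_closed: "\<lbrakk>x \<in> carrier L; y \<in> carrier L\<rbrakk> \<Longrightarrow> brkt L x y \<in> carrier L"
    and brkt_add_left: "\<lbrakk>x \<in> carrier L; y \<in> carrier L; z \<in> carrier L\<rbrakk> \<Longrightarrow>
          brkt L (x \<oplus>\<^bsub>L\<^esub> y) z = brkt L x z \<oplus>\<^bsub>L\<^esub> brkt L y z"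
    and brkt_add_right: "\<lbrakk>x \<in> carrier L; y \<in> carrier L; z \<in> carrier L\<rbrakk> \<Longrightarrow>
          brkt L x (y \<oplus>\<^bsub>L\<^esub> z) = brkt L x y \<oplus>\<^bsub>L\<^esub> brkt L x z"
    and brkt_smult_left: "\<lbrakk>x \<in> carrier L; y \<in> carrier L\<rbrakk> \<Longrightarrow>
          brkt L (c \<odot>\<^bsub>L\<^esub> x) y = c \<odot>\<^bsub>L\<^esub> brkt L x y"
    and brkt_smult_right: "\<lbrakk>x \<in> carrier L; y \<in> carrier L\<rbrakk> \<Longrightarrow>
          brkt L x (c \<odot>\<^bsub>L\<^esub> y) = c \<odot>\<^bsub>L\<^esub> brkt L x y"
    and brkt_self: "x \<in> carrier L \<Longrightarrow> brkt L x x = \<zero>\<^bsub>L\<^esub>"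
    and jacobi: "\<lbrakk>x \<in> carrier L; y \<in> carrier L; z \<in> carrier L\<rbrakk> \<Longrightarrow>
          brkt L x (brkt L y z) \<oplus>\<^bsub>L\<^esub> brkt L y (brkt L z x) \<oplus>\<^bsub>L\<^esub> brkt L z (brkt L x y) = \<zero>\<^bsub>L\<^esub>"

record ('l, 'v) lie_rep = "(complex, 'v) module" +
  act :: "'l \<Rightarrow> 'v \<Rightarrow> 'v"

definition rep_submodule ::
  "('l, 'm) lie_algebra_rec_scheme \<Rightarrow> ('l, 'v, 'n) lie_rep_scheme \<Rightarrow> 'v set \<Rightarrow> bool" where
  "rep_submodule L M K \<longleftrightarrow>
     lin_subspace M K \<and> (\<forall>x\<in>carrier L. \<forall>m\<in>K. act M x m \<in> K)"

definition gen_submodule ::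
  "('l, 'm) lie_algebra_rec_scheme \<Rightarrow> ('l, 'v, 'n) lie_rep_scheme \<Rightarrow> 'v set \<Rightarrow> 'v set" where
  "gen_submodule L M S = \<Inter> {K. rep_submodule L M K \<and> S \<subseteq> K}"

definition quot_rep :: "('l, 'v, 'n) lie_rep_scheme \<Rightarrow> 'v set \<Rightarrow> ('l, 'v set) lie_rep" where
  "quot_rep M K =
     \<lparr>carrier = carrier (quot_vs M K), mult = undefined, one = undefined,
      zero = zero (quot_vs M K), add = add (quot_vs M K), smult = smult (quot_vs M K),
      act = (\<lambda>x X. \<Union>m\<in>X. K +>\<^bsub>M\<^esub> act M x m)\<rparr>"

definition tensor_rep ::
  "('l, 'v, 'm) lie_rep_scheme \<Rightarrow> ('l, 'w, 'n) lie_rep_scheme \<Rightarrow>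
   ('l, ('v \<times> 'w \<Rightarrow>\<^sub>0 complex) set) lie_rep" where
  "tensor_rep M N =
     \<lparr>carrier = carrier (tensor_vs M N), mult = undefined, one = undefined,
      zero = zero (tensor_vs M N), add = add (tensor_vs M N), smult = smult (tensor_vs M N),
      act = (\<lambda>x X. tensor_map M N (act M x) (\<lambda>w. w) X
                     \<oplus>\<^bsub>tensor_vs M N\<^esub> tensor_map M N (\<lambda>v. v) (act N x) X)\<rparr>"

definition rep_isomorphic ::
  "('l, 'k) lie_algebra_rec_scheme \<Rightarrow> ('l, 'v, 'm) lie_rep_scheme \<Rightarrow> ('l, 'w, 'n) lie_rep_scheme \<Rightarrow> bool" where
  "rep_isomorphic L M N \<longleftrightarrow>
     (\<exists>f. bij_betw f (carrier M) (carrier N) \<and>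
          (\<forall>u\<in>carrier M. \<forall>v\<in>carrier M. f (u \<oplus>\<^bsub>M\<^esub> v) = f u \<oplus>\<^bsub>N\<^esub> f v) \<and>
          (\<forall>c. \<forall>v\<in>carrier M. f (c \<odot>\<^bsub>M\<^esub> v) = c \<odot>\<^bsub>N\<^esub> f v) \<and>
          (\<forall>x\<in>carrier L. \<forall>v\<in>carrier M. f (act M x v) = act N x (f v)))"

subsection \<open>Universal enveloping algebra\<close>

text \<open>The free associative unital algebra on the set \<open>X\<close>, with basis the words over \<open>X\<close>.\<close>

definition free_alg :: "'x set \<Rightarrow> (complex, 'x list \<Rightarrow>\<^sub>0 complex) module" where
  "free_alg X =
     \<lparr>carrier = {p. Poly_Mapping.keys p \<subseteq> lists X},
      mult = (\<lambda>p q. \<Sum>u\<in>Poly_Mapping.keys p. \<Sum>v\<in>Poly_Mapping.keys q.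
                Poly_Mapping.single (u @ v) (Poly_Mapping.lookup p u * Poly_Mapping.lookup q v)),
      one = Poly_Mapping.single [] 1,
      zero = 0, add = (+), smult = (\<lambda>c. Poly_Mapping.map (\<lambda>z. c * z))\<rparr>"

text \<open>The first two families of relations turn the free algebra on the underlying set of \<open>L\<close>
  into the tensor algebra of the vector space \<open>L\<close>.\<close>

definition uea_ideal :: "('l, 'm) lie_algebra_rec_scheme \<Rightarrow> ('l list \<Rightarrow>\<^sub>0 complex) set" where
  "uea_ideal L = genideal (free_alg (carrier L))
     ({Poly_Mapping.single [x \<oplus>\<^bsub>L\<^esub> y] 1 - Poly_Mapping.single [x] 1 - Poly_Mapping.single [y] 1 | x y.
         x \<in> carrier L \<and> y \<in> carrier L} \<union>
      {Poly_Mapping.single [c \<odot>\<^bsub>L\<^esub> x] 1 - Poly_Mapping.single [x] c | c x. x \<in> carrier L} \<union>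
      {Poly_Mapping.single [x, y] 1 - Poly_Mapping.single [y, x] 1
         - Poly_Mapping.single [brkt L x y] 1 | x y. x \<in> carrier L \<and> y \<in> carrier L})"

definition uea :: "('l, 'm) lie_algebra_rec_scheme \<Rightarrow> (complex, ('l list \<Rightarrow>\<^sub>0 complex) set) module" where
  "uea L = (let T = free_alg (carrier L); R = T Quot uea_ideal L in
     \<lparr>carrier = carrier R, mult = mult R, one = one R, zero = zero R, add = add R,
      smult = smult (quot_vs T (uea_ideal L))\<rparr>)"

definition uea_of :: "('l, 'm) lie_algebra_rec_scheme \<Rightarrow> 'l \<Rightarrow> ('l list \<Rightarrow>\<^sub>0 complex) set" where
  "uea_of L x = uea_ideal L +>\<^bsub>free_alg (carrier L)\<^esub> Poly_Mapping.single [x] 1"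

subsection \<open>Verma modules\<close>

type_synonym 'l verma_carrier = "(('l list \<Rightarrow>\<^sub>0 complex) set \<times> complex \<Rightarrow>\<^sub>0 complex) set"

definition uea_tensor_C :: "('l, 'm) lie_algebra_rec_scheme \<Rightarrow> ('l, 'l verma_carrier) lie_rep" where
  "uea_tensor_C L = (let V = tensor_vs (uea L) C_alg in
     \<lparr>carrier = carrier V, mult = undefined, one = undefined,
      zero = zero V, add = add V, smult = smult V,
      act = (\<lambda>x. tensor_map (uea L) C_alg (\<lambda>u. uea_of L x \<otimes>\<^bsub>uea L\<^esub> u) (\<lambda>z. z))\<rparr>)"

text \<open>The induced module \<open>U(L) \<otimes>\<^sub>U\<^sub>(\<^sub>b\<^sub>) \<complex>\<close> for \<open>b = P \<oplus> H\<close>, where \<open>P\<close> acts on the complex numbers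
  by 0 and \<open>H\<close> by \<open>\<psi>\<close>: the quotient of \<open>U(L) \<otimes> \<complex>\<close> by the span of the \<open>ux \<otimes> z - u \<otimes> xz\<close>. As \<open>b\<close>
  generates the algebra \<open>U(b)\<close>, it suffices to let \<open>x = n + h\<close> range over \<open>b\<close>.\<close>

definition verma_ker ::
  "('l, 'm) lie_algebra_rec_scheme \<Rightarrow> 'l set \<Rightarrow> 'l set \<Rightarrow> ('l \<Rightarrow> complex) \<Rightarrow> 'l verma_carrier set" where
  "verma_ker L P H \<psi> = lin_span (uea_tensor_C L)
     {tens (uea L) C_alg (u \<otimes>\<^bsub>uea L\<^esub> uea_of L (n \<oplus>\<^bsub>L\<^esub> h)) z
        \<ominus>\<^bsub>uea_tensor_C L\<^esub> tens (uea L) C_alg u (\<psi> h * z) | u n h z.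
        u \<in> carrier (uea L) \<and> n \<in> P \<and> h \<in> H}"

definition verma ::
  "('l, 'm) lie_algebra_rec_scheme \<Rightarrow> 'l set \<Rightarrow> 'l set \<Rightarrow> ('l \<Rightarrow> complex) \<Rightarrow>
   ('l, 'l verma_carrier set) lie_rep" where
  "verma L P H \<psi> = quot_rep (uea_tensor_C L) (verma_ker L P H \<psi>)"

definition verma_vec ::
  "('l, 'm) lie_algebra_rec_scheme \<Rightarrow> 'l set \<Rightarrow> 'l set \<Rightarrow> ('l \<Rightarrow> complex) \<Rightarrow> 'l verma_carrier set" where
  "verma_vec L P H \<psi> =
     verma_ker L P H \<psi> +>\<^bsub>uea_tensor_C L\<^esub> tens (uea L) C_alg \<one>\<^bsub>uea L\<^esub> 1"


section \<open>Kac--Moody algebras\<close>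

text \<open>\<open>sroot G i\<close> and \<open>coroot G i\<close> are the simple roots and coroots; only the restriction of
  \<open>sroot G i\<close> to the Cartan subalgebra is meaningful.\<close>

record ('g, 'i) km_algebra_rec = "'g lie_algebra_rec" +
  cartan :: "'g set"
  gcm :: "'i \<Rightarrow> 'i \<Rightarrow> int"
  chev_e :: "'i \<Rightarrow> 'g"
  chev_f :: "'i \<Rightarrow> 'g"
  sroot :: "'i \<Rightarrow> 'g \<Rightarrow> complex"
  coroot :: "'i \<Rightarrow> 'g"

text \<open>The Kac--Moody algebra of a generalized Cartan matrix, in the sense of Kac: the quotient of
  the Lie algebra given by the generators \<open>h, e\<^sub>i, f\<^sub>i\<close> and the relations below (over a realization
  of the matrix) by the largest ideal meeting the Cartan subalgebra trivially. The matrix need be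
  neither indecomposable nor symmetrizable.\<close>

locale kac_moody = lie_algebra G for G :: "('g, 'i::finite, 'm) km_algebra_rec_scheme" (structure) +
  assumes gcm_diag: "gcm G i i = 2"
    and gcm_nonpos: "i \<noteq> j \<Longrightarrow> gcm G i j \<le> 0"
    and gcm_zero_iff: "gcm G i j = 0 \<longleftrightarrow> gcm G j i = 0"
    and cartan_subspace: "lin_subspace G (cartan G)"
    and cartan_dim: "has_dim (G\<lparr>carrier := cartan G\<rparr>)
           (2 * CARD('i) - rank ((\<chi> i j. of_int (gcm G i j)) :: real^'i^'i))"
    and coroot_cartan: "coroot G i \<in> cartan G"
    and sroot_functional: "lin_functional (G\<lparr>carrier := cartan G\<rparr>) (sroot G i)"
    and sroot_coroot: "sroot G j (coroot G i) = of_int (gcm G i j)"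
    and coroot_indep: "finsum G (\<lambda>i. c i \<odot>\<^bsub>G\<^esub> coroot G i) UNIV = \<zero>\<^bsub>G\<^esub> \<Longrightarrow> c i = 0"
    and sroot_indep: "(\<forall>h\<in>cartan G. (\<Sum>i\<in>UNIV. c i * sroot G i h) = 0) \<Longrightarrow> c i = 0"
    and chev_e_closed: "chev_e G i \<in> carrier G"
    and chev_f_closed: "chev_f G i \<in> carrier G"
    and brkt_e_f: "brkt G (chev_e G i) (chev_f G j) = (if i = j then coroot G i else \<zero>\<^bsub>G\<^esub>)"
    and brkt_h_h: "\<lbrakk>h \<in> cartan G; k \<in> cartan G\<rbrakk> \<Longrightarrow> brkt G h k = \<zero>\<^bsub>G\<^esub>"
    and brkt_h_e: "h \<in> cartan G \<Longrightarrow> brkt G h (chev_e G i) = sroot G i h \<odot>\<^bsub>G\<^esub> chev_e G i"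
    and brkt_h_f: "h \<in> cartan G \<Longrightarrow> brkt G h (chev_f G i) = (- sroot G i h) \<odot>\<^bsub>G\<^esub> chev_f G i"
    and generated: "\<lbrakk>lin_subspace G S; \<forall>x\<in>S. \<forall>y\<in>S. brkt G x y \<in> S;
          cartan G \<subseteq> S; range (chev_e G) \<subseteq> S; range (chev_f G) \<subseteq> S\<rbrakk> \<Longrightarrow> S = carrier G"
    and no_ideals: "\<lbrakk>lin_subspace G K; \<forall>x\<in>carrier G. \<forall>y\<in>K. brkt G x y \<in> K;
          K \<inter> cartan G = {\<zero>\<^bsub>G\<^esub>}\<rbrakk> \<Longrightarrow> K = {\<zero>\<^bsub>G\<^esub>}"

definition derived :: "('g, 'm) lie_algebra_rec_scheme \<Rightarrow> 'g set" where
  "derived G = lin_span G {brkt G x y | x y. x \<in> carrier G \<and> y \<in> carrier G}"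

definition cartan' :: "('g, 'i, 'm) km_algebra_rec_scheme \<Rightarrow> 'g set" where
  "cartan' G = derived G \<inter> cartan G"

definition cartan_complement :: "('g, 'i, 'm) km_algebra_rec_scheme \<Rightarrow> 'g set \<Rightarrow> bool" where
  "cartan_complement G HC \<longleftrightarrow>
     lin_subspace G HC \<and> cartan' G \<inter> HC = {\<zero>\<^bsub>G\<^esub>} \<and> cartan' G <+>\<^bsub>G\<^esub> HC = cartan G"

definition root_space :: "('g, 'i, 'm) km_algebra_rec_scheme \<Rightarrow> ('g \<Rightarrow> complex) \<Rightarrow> 'g set" where
  "root_space G \<beta> = {x \<in> carrier G. \<forall>h\<in>cartan G. brkt G h x = \<beta> h \<odot>\<^bsub>G\<^esub> x}"

text \<open>A positive root \<open>\<Sum>i. m\<^sub>i \<alpha>\<^sub>i\<close> is represented by its coefficient vector \<open>m\<close>, which determines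
  and is determined by it since the simple roots are linearly independent.\<close>

definition root_of :: "('g, 'i::finite, 'm) km_algebra_rec_scheme \<Rightarrow> ('i \<Rightarrow> nat) \<Rightarrow> 'g \<Rightarrow> complex" where
  "root_of G m h = (\<Sum>i\<in>UNIV. of_nat (m i) * sroot G i h)"

definition pos_roots :: "('g, 'i::finite, 'm) km_algebra_rec_scheme \<Rightarrow> ('i \<Rightarrow> nat) set" where
  "pos_roots G = {m. (\<exists>i. m i \<noteq> 0) \<and> root_space G (root_of G m) \<noteq> {\<zero>\<^bsub>G\<^esub>}}"

definition nilp_pos :: "('g, 'i::finite, 'm) km_algebra_rec_scheme \<Rightarrow> 'g set" where
  "nilp_pos G = lin_span G (\<Union>m\<in>pos_roots G. root_space G (root_of G m))"

definition dominant_integral ::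
  "('g, 'i, 'm) km_algebra_rec_scheme \<Rightarrow> ('g \<Rightarrow> complex) \<Rightarrow> bool" where
  "dominant_integral G lam \<longleftrightarrow>
     lin_functional (G\<lparr>carrier := cartan G\<rparr>) lam \<and> (\<forall>i. lam (coroot G i) \<in> \<nat>)"

definition wt_pairing ::
  "('g, 'i::finite, 'm) km_algebra_rec_scheme \<Rightarrow> ('g \<Rightarrow> complex) \<Rightarrow> ('i \<Rightarrow> nat) \<Rightarrow> nat" where
  "wt_pairing G lam m = (THE n. of_nat n = (\<Sum>i\<in>UNIV. of_nat (m i) * lam (coroot G i)))"


section \<open>The coefficient algebra\<close>

definition fg_comm_alg :: "(complex, 'a, 'm) module_scheme \<Rightarrow> bool" where
  "fg_comm_alg A \<longleftrightarrow> algebra C_alg A \<and>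
     (\<exists>S. finite S \<and> S \<subseteq> carrier A \<and>
          (\<forall>B. subring B A \<and> lin_subspace A B \<and> S \<subseteq> B \<longrightarrow> B = carrier A))"

definition cofinite_ideal :: "(complex, 'a, 'm) module_scheme \<Rightarrow> 'a set \<Rightarrow> bool" where
  "cofinite_ideal A I \<longleftrightarrow> ideal I A \<and> fin_dim (quot_vs A I)"

primrec ideal_pow :: "('a, 'm) ring_scheme \<Rightarrow> 'a set \<Rightarrow> nat \<Rightarrow> 'a set" where
  "ideal_pow A I 0 = carrier A"
| "ideal_pow A I (Suc n) = ideal_prod A I (ideal_pow A I n)"


section \<open>The Lie algebra \<open>g' \<otimes> A \<oplus> h''\<close>\<close>

type_synonym ('g, 'a) current = "('g \<times> 'a \<Rightarrow>\<^sub>0 complex) set \<times> 'g"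

abbreviation derived_vs ::
  "('g, 'i, 'm) km_algebra_rec_scheme \<Rightarrow> ('g, 'i, 'm) km_algebra_rec_scheme" where
  "derived_vs G \<equiv> G\<lparr>carrier := derived G\<rparr>"

text \<open>The bilinear extension of \<open>[X \<otimes> a, Y \<otimes> b] = [X, Y] \<otimes> ab\<close>.\<close>

definition loop_brkt ::
  "('g, 'i, 'm) km_algebra_rec_scheme \<Rightarrow> (complex, 'a, 'n) module_scheme \<Rightarrow>
   ('g \<times> 'a \<Rightarrow>\<^sub>0 complex) set \<Rightarrow> ('g \<times> 'a \<Rightarrow>\<^sub>0 complex) set \<Rightarrow> ('g \<times> 'a \<Rightarrow>\<^sub>0 complex) set" where
  "loop_brkt G A S T =
     (\<Union>p\<in>S. \<Union>q\<in>T. tensor_cls (derived_vs G) A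
        (\<Sum>(x, a)\<in>Poly_Mapping.keys p. \<Sum>(y, b)\<in>Poly_Mapping.keys q.
           Poly_Mapping.single (brkt G x y, a \<otimes>\<^bsub>A\<^esub> b)
             (Poly_Mapping.lookup p (x, a) * Poly_Mapping.lookup q (y, b))))"

text \<open>Elements are pairs \<open>(s, h)\<close> standing for \<open>s + h\<close> with \<open>s\<close> in \<open>g' \<otimes> A\<close> and \<open>h\<close> in \<open>h''\<close>;
  here \<open>[h, X \<otimes> a] = [h, X] \<otimes> a\<close> is \<open>(ad h \<otimes> id) (X \<otimes> a)\<close>.\<close>

definition current_algebra ::
  "('g, 'i, 'm) km_algebra_rec_scheme \<Rightarrow> (complex, 'a, 'n) module_scheme \<Rightarrow> 'g set \<Rightarrow>
   ('g, 'a) current lie_algebra_rec" where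
  "current_algebra G A HC = (let V = tensor_vs (derived_vs G) A in
     \<lparr>carrier = carrier V \<times> HC, mult = undefined, one = undefined,
      zero = (\<zero>\<^bsub>V\<^esub>, \<zero>\<^bsub>G\<^esub>),
      add = (\<lambda>(s, h) (t, k). (s \<oplus>\<^bsub>V\<^esub> t, h \<oplus>\<^bsub>G\<^esub> k)),
      smult = (\<lambda>c (s, h). (c \<odot>\<^bsub>V\<^esub> s, c \<odot>\<^bsub>G\<^esub> h)),
      brkt = (\<lambda>(s, h) (t, k).
        (loop_brkt G A s t
           \<oplus>\<^bsub>V\<^esub> tensor_map (derived_vs G) A (brkt G h) (\<lambda>a. a) t
           \<ominus>\<^bsub>V\<^esub> tensor_map (derived_vs G) A (brkt G k) (\<lambda>a. a) s, \<zero>\<^bsub>G\<^esub>))\<rparr>)"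

definition loop_elt ::
  "('g, 'i, 'm) km_algebra_rec_scheme \<Rightarrow> (complex, 'a, 'n) module_scheme \<Rightarrow> 'g \<Rightarrow> 'a \<Rightarrow>
   ('g, 'a) current" where
  "loop_elt G A x a = (tens (derived_vs G) A x a, \<zero>\<^bsub>G\<^esub>)"

text \<open>The identification of \<open>g = g' \<oplus> h''\<close> with the subalgebra \<open>g' \<otimes> 1 \<oplus> h''\<close>.\<close>

definition g_embed ::
  "('g, 'i, 'm) km_algebra_rec_scheme \<Rightarrow> (complex, 'a, 'n) module_scheme \<Rightarrow> 'g set \<Rightarrow> 'g \<Rightarrow>
   ('g, 'a) current" where
  "g_embed G A HC x =
     (THE y. \<exists>x'\<in>derived G. \<exists>h\<in>HC. x = x' \<oplus>\<^bsub>G\<^esub> h \<and> y = (tens (derived_vs G) A x' \<one>\<^bsub>A\<^esub>, h))"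

definition tensor_sub ::
  "('g, 'i, 'm) km_algebra_rec_scheme \<Rightarrow> (complex, 'a, 'n) module_scheme \<Rightarrow> 'g set \<Rightarrow>
   ('g \<times> 'a \<Rightarrow>\<^sub>0 complex) set set" where
  "tensor_sub G A S =
     lin_span (tensor_vs (derived_vs G) A) {tens (derived_vs G) A x a | x a. x \<in> S \<and> a \<in> carrier A}"

definition current_cartan ::
  "('g, 'i, 'm) km_algebra_rec_scheme \<Rightarrow> (complex, 'a, 'n) module_scheme \<Rightarrow> 'g set \<Rightarrow>
   ('g, 'a) current set" where
  "current_cartan G A HC = tensor_sub G A (cartan' G) \<times> HC"

definition current_nilp_pos ::
  "('g, 'i::finite, 'm) km_algebra_rec_scheme \<Rightarrow> (complex, 'a, 'n) module_scheme \<Rightarrow>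
   ('g, 'a) current set" where
  "current_nilp_pos G A = tensor_sub G A (nilp_pos G) \<times> {\<zero>\<^bsub>G\<^esub>}"


section \<open>Weyl modules\<close>

definition integrable_rep ::
  "('g, 'i, 'm) km_algebra_rec_scheme \<Rightarrow> (complex, 'a, 'n) module_scheme \<Rightarrow> 'g set \<Rightarrow>
   (('g, 'a) current, 'v, 'k) lie_rep_scheme \<Rightarrow> bool" where
  "integrable_rep G A HC M \<longleftrightarrow>
     lin_span M {w \<in> carrier M. \<exists>\<mu>. \<forall>h\<in>cartan G. act M (g_embed G A HC h) w = \<mu> h \<odot>\<^bsub>M\<^esub> w}
       = carrier M \<and>
     (\<forall>i. \<forall>w\<in>carrier M.
        (\<exists>n. (act M (g_embed G A HC (chev_e G i)) ^^ n) w = \<zero>\<^bsub>M\<^esub>) \<and>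
        (\<exists>n. (act M (g_embed G A HC (chev_f G i)) ^^ n) w = \<zero>\<^bsub>M\<^esub>))"

definition hw_verma ::
  "('g, 'i::finite, 'm) km_algebra_rec_scheme \<Rightarrow> (complex, 'a, 'n) module_scheme \<Rightarrow> 'g set \<Rightarrow>
   (('g, 'a) current \<Rightarrow> complex) \<Rightarrow>
   (('g, 'a) current, ('g, 'a) current verma_carrier set) lie_rep" where
  "hw_verma G A HC \<psi> =
     verma (current_algebra G A HC) (current_nilp_pos G A) (current_cartan G A HC) \<psi>"

definition hw_vec ::
  "('g, 'i::finite, 'm) km_algebra_rec_scheme \<Rightarrow> (complex, 'a, 'n) module_scheme \<Rightarrow> 'g set \<Rightarrow>
   (('g, 'a) current \<Rightarrow> complex) \<Rightarrow> ('g, 'a) current verma_carrier set" where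
  "hw_vec G A HC \<psi> =
     verma_vec (current_algebra G A HC) (current_nilp_pos G A) (current_cartan G A HC) \<psi>"

definition hw_quot ::
  "('g, 'i::finite, 'm) km_algebra_rec_scheme \<Rightarrow> (complex, 'a, 'n) module_scheme \<Rightarrow> 'g set \<Rightarrow>
   (('g, 'a) current \<Rightarrow> complex) \<Rightarrow> 'a set \<Rightarrow>
   (('g, 'a) current, ('g, 'a) current verma_carrier set set) lie_rep" where
  "hw_quot G A HC \<psi> I =
     quot_rep (hw_verma G A HC \<psi>)
       (gen_submodule (current_algebra G A HC) (hw_verma G A HC \<psi>)
          {act (hw_verma G A HC \<psi>) (loop_elt G A x a) (hw_vec G A HC \<psi>) | x a m.
             m \<in> pos_roots G \<and> x \<in> root_space G (\<lambda>h. - root_of G m h) \<and>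
             a \<in> ideal_pow A I (wt_pairing G (\<lambda>h. \<psi> (g_embed G A HC h)) m)})"

text \<open>The maximal integrable quotient of \<open>M(\<psi>, I)\<close> is the quotient by the least submodule with
  integrable quotient.\<close>

definition weyl_module ::
  "('g, 'i::finite, 'm) km_algebra_rec_scheme \<Rightarrow> (complex, 'a, 'n) module_scheme \<Rightarrow> 'g set \<Rightarrow>
   (('g, 'a) current \<Rightarrow> complex) \<Rightarrow> 'a set \<Rightarrow>
   (('g, 'a) current, ('g, 'a) current verma_carrier set set set) lie_rep" where
  "weyl_module G A HC \<psi> I =
     quot_rep (hw_quot G A HC \<psi> I)
       (LEAST K. rep_submodule (current_algebra G A HC) (hw_quot G A HC \<psi> I) K \<and>
                 integrable_rep G A HC (quot_rep (hw_quot G A HC \<psi> I) K))"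

end

theory Submission
  imports Defs
begin

text \<open>Choose \<open>e\<^sub>n \<in> J\<^sup>n\<close> with \<open>1 - e\<^sub>n \<in> I\<^sup>n\<close>. A highest weight module satisfying the relations at \<open>v\<close>
  is smooth: each vector is killed by \<open>x \<otimes> I\<^sup>n\<close> for large \<open>n\<close>. Hence the tensor product is generated
  by \<open>v\<^sub>1 \<otimes> v\<^sub>2\<close>, since \<open>x \<otimes> ae\<^sub>n\<close> acts on the first factor only, and it is a quotient of
  \<open>W = W(\<psi>\<^sub>1 + \<psi>\<^sub>2, I \<inter> J)\<close>.

  For the inverse, the action on \<open>W\<close> is a sum of two commuting actions
  \<open>\<tau>\<^sub>1(x \<otimes> a) = \<tau>(x \<otimes> ae\<^sub>n)\<close> and \<open>\<tau>\<^sub>2(x \<otimes> a) = \<tau>(x \<otimes> a(1 - e\<^sub>n))\<close>, \<open>n\<close> large. Write \<open>F = F\<^sub>1 + F\<^sub>2\<close> for the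
  action of \<open>f\<^sub>i\<close>. As \<open>F\<close> is locally nilpotent, \<open>sl\<^sub>2\<close>-theory gives \<open>F\<^sub>1\<^sup>k v = 0\<close> for
  \<open>k = \<lambda>(\<alpha>\<^sub>i\<^sup>\<or>) + 1\<close>, whence \<open>\<tau>\<^sub>1(f\<^sub>i \<otimes> a)v = 0\<close> for \<open>a \<in> I\<^sup>k\<^sup>-\<^sup>1\<close> by a computation with the current algebra
  of \<open>sl\<^sub>2\<close>. So \<open>v\<close> generates images of \<open>W(\<psi>\<^sub>1, I)\<close> under \<open>\<tau>\<^sub>1\<close> and of \<open>W(\<psi>\<^sub>2, J)\<close> under \<open>\<tau>\<^sub>2\<close>, and
  these combine to a map \<open>W(\<psi>\<^sub>1, I) \<otimes> W(\<psi>\<^sub>2, J) \<rightarrow> W\<close>.\<close>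

section \<open>Linear algebra over the complex numbers\<close>

text \<open>The modules may be infinite-dimensional, so injectivity cannot come from counting
  dimensions; a left inverse is built instead, up to an embedding of W in a free vector space, where
  operator identities hold on a whole type. The exponents given by smoothness depend on the vector
  and on x, so no single \<open>e n\<close> splits the action, and the partial actions are eventual
  values of sequences of operators. The summand h'' carries no coefficients from A and cannot be
  divided: both partial representations keep its whole action, corrected by a scalar. Afterwards
  only the operators of g' \<otimes> A are compared; they suffice because the lowering ones alone
  generate W from v. Local nilpotence of a partial action is known only on a submodule containing v,
  and the universal property of W is stated accordingly. That W exists needs an argument: the power
  of an \<open>f_i\<close> killing a weight vector is bounded by data that do not depend on the
  integrable quotient, so an intersection of submodules with integrable quotient again has
  integrable quotient.\<close>

lemma C_alg_simps [simp]:
  "carrier C_alg = UNIV" "mult C_alg = (*)" "one C_alg = 1" "zero C_alg = 0" "add C_alg = (+)"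
  "smult C_alg = (*)"
  by (simp_all add: C_alg_def)

lemma C_alg_cring: "cring C_alg"
proof (rule cringI)
  show "abelian_group C_alg"
    by (rule abelian_groupI) (auto simp: algebra_simps intro: exI[of _ "- _"] add.left_inverse)
  show "comm_monoid C_alg"
    by (rule comm_monoidI) (auto simp: algebra_simps)
qed (auto simp: algebra_simps)

abbreviation cmod :: "(complex, 'v, 'm) module_scheme \<Rightarrow> bool" where
  "cmod V \<equiv> Module.module C_alg V"

text \<open>Additive inverses come from the scalar \<open>-1\<close>:
  \<open>(-1) x + 1 x = 0 x\<close>, and the last premise makes this zero.\<close>

lemma cmodI:
  assumes "\<And>x y. x \<in> carrier V \<Longrightarrow> y \<in> carrier V \<Longrightarrow> x \<oplus>\<^bsub>V\<^esub> y \<in> carrier V"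
    and "\<zero>\<^bsub>V\<^esub> \<in> carrier V"
    and "\<And>x y z. x \<in> carrier V \<Longrightarrow> y \<in> carrier V \<Longrightarrow> z \<in> carrier V \<Longrightarrow>
      (x \<oplus>\<^bsub>V\<^esub> y) \<oplus>\<^bsub>V\<^esub> z = x \<oplus>\<^bsub>V\<^esub> (y \<oplus>\<^bsub>V\<^esub> z)"
    and "\<And>x y. x \<in> carrier V \<Longrightarrow> y \<in> carrier V \<Longrightarrow> x \<oplus>\<^bsub>V\<^esub> y = y \<oplus>\<^bsub>V\<^esub> x"
    and "\<And>x. x \<in> carrier V \<Longrightarrow> \<zero>\<^bsub>V\<^esub> \<oplus>\<^bsub>V\<^esub> x = x"
    and sc: "\<And>c x. x \<in> carrier V \<Longrightarrow> c \<odot>\<^bsub>V\<^esub> x \<in> carrier V"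
    and "\<And>c d x. x \<in> carrier V \<Longrightarrow> (c + d) \<odot>\<^bsub>V\<^esub> x = c \<odot>\<^bsub>V\<^esub> x \<oplus>\<^bsub>V\<^esub> d \<odot>\<^bsub>V\<^esub> x"
    and "\<And>c x y. x \<in> carrier V \<Longrightarrow> y \<in> carrier V \<Longrightarrow>
      c \<odot>\<^bsub>V\<^esub> (x \<oplus>\<^bsub>V\<^esub> y) = c \<odot>\<^bsub>V\<^esub> x \<oplus>\<^bsub>V\<^esub> c \<odot>\<^bsub>V\<^esub> y"
    and "\<And>c d x. x \<in> carrier V \<Longrightarrow> (c * d) \<odot>\<^bsub>V\<^esub> x = c \<odot>\<^bsub>V\<^esub> (d \<odot>\<^bsub>V\<^esub> x)"
    and "\<And>x. x \<in> carrier V \<Longrightarrow> 1 \<odot>\<^bsub>V\<^esub> x = x"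
    and z: "\<And>x. x \<in> carrier V \<Longrightarrow> 0 \<odot>\<^bsub>V\<^esub> x = \<zero>\<^bsub>V\<^esub>"
  shows "cmod V"
proof -
  have "\<exists>y\<in>carrier V. y \<oplus>\<^bsub>V\<^esub> x = \<zero>\<^bsub>V\<^esub>" if "x \<in> carrier V" for x
    using assms(7)[OF that, of "-1" 1] that assms(10) z sc by (intro bexI[of _ "(-1) \<odot>\<^bsub>V\<^esub> x"]) auto
  then have "abelian_group V"
    using assms by (intro abelian_groupI) auto
  with assms show ?thesis
    by (intro moduleI C_alg_cring) auto
qed

lemma cmod_cong:
  assumes "cmod V" "carrier V' = carrier V" "zero V' = zero V" "add V' = add V" "smult V' = smult V"
  shows "cmod V'"
proof -
  interpret V: Module.module C_alg V by fact
  show ?thesis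
    using assms(2-) V.smult_l_distr V.smult_r_distr V.smult_assoc1 V.smult_one V.smult_l_null
    by (intro cmodI) (auto simp: V.a_ac)
qed

text \<open>The last two rules turn negatives and differences into multiples by \<open>-1\<close>,
  so that later computations involve only addition and scalars.\<close>

lemma cmod_simps:
  assumes "cmod V"
  shows "x \<in> carrier V \<Longrightarrow> y \<in> carrier V \<Longrightarrow> x \<oplus>\<^bsub>V\<^esub> y \<in> carrier V"
    and "\<zero>\<^bsub>V\<^esub> \<in> carrier V"
    and "x \<in> carrier V \<Longrightarrow> c \<odot>\<^bsub>V\<^esub> x \<in> carrier V"
    and "x \<in> carrier V \<Longrightarrow> \<zero>\<^bsub>V\<^esub> \<oplus>\<^bsub>V\<^esub> x = x"
    and "x \<in> carrier V \<Longrightarrow> x \<oplus>\<^bsub>V\<^esub> \<zero>\<^bsub>V\<^esub> = x"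
    and "x \<in> carrier V \<Longrightarrow> (c + d) \<odot>\<^bsub>V\<^esub> x = c \<odot>\<^bsub>V\<^esub> x \<oplus>\<^bsub>V\<^esub> d \<odot>\<^bsub>V\<^esub> x"
    and "x \<in> carrier V \<Longrightarrow> y \<in> carrier V \<Longrightarrow> c \<odot>\<^bsub>V\<^esub> (x \<oplus>\<^bsub>V\<^esub> y) = c \<odot>\<^bsub>V\<^esub> x \<oplus>\<^bsub>V\<^esub> c \<odot>\<^bsub>V\<^esub> y"
    and "x \<in> carrier V \<Longrightarrow> c \<odot>\<^bsub>V\<^esub> (d \<odot>\<^bsub>V\<^esub> x) = (c * d) \<odot>\<^bsub>V\<^esub> x"
    and "x \<in> carrier V \<Longrightarrow> 1 \<odot>\<^bsub>V\<^esub> x = x"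
    and "x \<in> carrier V \<Longrightarrow> 0 \<odot>\<^bsub>V\<^esub> x = \<zero>\<^bsub>V\<^esub>"
    and "c \<odot>\<^bsub>V\<^esub> \<zero>\<^bsub>V\<^esub> = \<zero>\<^bsub>V\<^esub>"
    and "x \<in> carrier V \<Longrightarrow> \<ominus>\<^bsub>V\<^esub> x = (-1) \<odot>\<^bsub>V\<^esub> x"
    and "x \<in> carrier V \<Longrightarrow> y \<in> carrier V \<Longrightarrow> x \<ominus>\<^bsub>V\<^esub> y = x \<oplus>\<^bsub>V\<^esub> (-1) \<odot>\<^bsub>V\<^esub> y"
proof -
  interpret V: Module.module C_alg V by fact
  show neg: "\<ominus>\<^bsub>V\<^esub> x = (-1) \<odot>\<^bsub>V\<^esub> x" if "x \<in> carrier V" for x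
  proof -
    have "x \<oplus>\<^bsub>V\<^esub> (-1) \<odot>\<^bsub>V\<^esub> x = \<zero>\<^bsub>V\<^esub>"
      using V.smult_l_distr[of 1 "-1" x] that V.smult_one[of x] V.smult_l_null[of x] by simp
    then show ?thesis
      using that by (intro V.add.inv_equality[unfolded a_inv_def[symmetric]]) (auto simp: V.a_comm)
  qed
  show "x \<in> carrier V \<Longrightarrow> y \<in> carrier V \<Longrightarrow> x \<ominus>\<^bsub>V\<^esub> y = x \<oplus>\<^bsub>V\<^esub> (-1) \<odot>\<^bsub>V\<^esub> y"
    by (simp add: a_minus_def neg)
qed (use Module.module.smult_l_distr[OF assms] Module.module.smult_r_distr[OF assms]
      Module.module.smult_assoc1[OF assms] Module.module.smult_one[OF assms]
      Module.module.smult_l_null[OF assms] Module.module.smult_r_null[OF assms]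
      Module.module.smult_closed[OF assms] abelian_monoid.a_closed[of V] abelian_monoid.zero_closed[of V]
      abelian_monoid.l_zero[of V] abelian_monoid.r_zero[of V] abelian_group.axioms(1)[of V]
      Module.module.axioms(2)[OF assms] in auto)

lemma cmod_ac:
  assumes "cmod V"
  shows "x \<in> carrier V \<Longrightarrow> y \<in> carrier V \<Longrightarrow> z \<in> carrier V \<Longrightarrow>
      (x \<oplus>\<^bsub>V\<^esub> y) \<oplus>\<^bsub>V\<^esub> z = x \<oplus>\<^bsub>V\<^esub> (y \<oplus>\<^bsub>V\<^esub> z)"
    and "x \<in> carrier V \<Longrightarrow> y \<in> carrier V \<Longrightarrow> x \<oplus>\<^bsub>V\<^esub> y = y \<oplus>\<^bsub>V\<^esub> x"
    and "x \<in> carrier V \<Longrightarrow> y \<in> carrier V \<Longrightarrow> z \<in> carrier V \<Longrightarrow>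
      x \<oplus>\<^bsub>V\<^esub> (y \<oplus>\<^bsub>V\<^esub> z) = y \<oplus>\<^bsub>V\<^esub> (x \<oplus>\<^bsub>V\<^esub> z)"
proof -
  interpret V: Module.module C_alg V by fact
  show "x \<in> carrier V \<Longrightarrow> y \<in> carrier V \<Longrightarrow> z \<in> carrier V \<Longrightarrow>
      (x \<oplus>\<^bsub>V\<^esub> y) \<oplus>\<^bsub>V\<^esub> z = x \<oplus>\<^bsub>V\<^esub> (y \<oplus>\<^bsub>V\<^esub> z)"
    "x \<in> carrier V \<Longrightarrow> y \<in> carrier V \<Longrightarrow> x \<oplus>\<^bsub>V\<^esub> y = y \<oplus>\<^bsub>V\<^esub> x"
    "x \<in> carrier V \<Longrightarrow> y \<in> carrier V \<Longrightarrow> z \<in> carrier V \<Longrightarrow>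
      x \<oplus>\<^bsub>V\<^esub> (y \<oplus>\<^bsub>V\<^esub> z) = y \<oplus>\<^bsub>V\<^esub> (x \<oplus>\<^bsub>V\<^esub> z)"
    by (auto simp: V.a_ac)
qed

text \<open>Turns an equality into a vanishing statement, for differences shown to lie in a kernel
  or in an intersection that is zero.\<close>

lemma cmod_sub_eq_zero:
  assumes "cmod V" "x \<in> carrier V" "y \<in> carrier V"
  shows "x \<oplus>\<^bsub>V\<^esub> (-1) \<odot>\<^bsub>V\<^esub> y = \<zero>\<^bsub>V\<^esub> \<longleftrightarrow> x = y"
proof
  note s = cmod_simps[OF assms(1)]
  have y: "y \<oplus>\<^bsub>V\<^esub> (-1) \<odot>\<^bsub>V\<^esub> y = \<zero>\<^bsub>V\<^esub>" "(-1) \<odot>\<^bsub>V\<^esub> y \<oplus>\<^bsub>V\<^esub> y = \<zero>\<^bsub>V\<^esub>"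
    using s(6)[of y 1 "-1"] s(6)[of y "-1" 1] assms s(9)[of y] s(10)[of y] by auto
  show "x = y" if "x \<oplus>\<^bsub>V\<^esub> (-1) \<odot>\<^bsub>V\<^esub> y = \<zero>\<^bsub>V\<^esub>"
  proof -
    have "x = (x \<oplus>\<^bsub>V\<^esub> (-1) \<odot>\<^bsub>V\<^esub> y) \<oplus>\<^bsub>V\<^esub> y"
      using assms s y(2) by (simp add: cmod_ac(1)[OF assms(1)])
    with that show ?thesis using assms s by simp
  qed
  show "x = y \<Longrightarrow> x \<oplus>\<^bsub>V\<^esub> (-1) \<odot>\<^bsub>V\<^esub> y = \<zero>\<^bsub>V\<^esub>" using y by simp
qed

lemma lin_subspace_iff:
  assumes "cmod V"
  shows "lin_subspace V K \<longleftrightarrow> K \<subseteq> carrier V \<and> \<zero>\<^bsub>V\<^esub> \<in> K \<and>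
    (\<forall>x\<in>K. \<forall>y\<in>K. x \<oplus>\<^bsub>V\<^esub> y \<in> K) \<and> (\<forall>c. \<forall>x\<in>K. c \<odot>\<^bsub>V\<^esub> x \<in> K)"
proof -
  interpret V: Module.module C_alg V by fact
  show ?thesis
  proof
    assume *: "lin_subspace V K"
    note E = V.submoduleE[OF *]
    obtain x where "x \<in> K" using E(2) by auto
    then have "\<zero>\<^bsub>V\<^esub> \<in> K" using E(4)[of 0 x] E(1) V.smult_l_null by (metis C_alg_simps(1,4) UNIV_I subsetD)
    with E show "K \<subseteq> carrier V \<and> \<zero>\<^bsub>V\<^esub> \<in> K \<and>
      (\<forall>x\<in>K. \<forall>y\<in>K. x \<oplus>\<^bsub>V\<^esub> y \<in> K) \<and> (\<forall>c. \<forall>x\<in>K. c \<odot>\<^bsub>V\<^esub> x \<in> K)" by auto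
  next
    assume "K \<subseteq> carrier V \<and> \<zero>\<^bsub>V\<^esub> \<in> K \<and>
      (\<forall>x\<in>K. \<forall>y\<in>K. x \<oplus>\<^bsub>V\<^esub> y \<in> K) \<and> (\<forall>c. \<forall>x\<in>K. c \<odot>\<^bsub>V\<^esub> x \<in> K)"
    then show "lin_subspace V K"
      using cmod_simps(12)[OF assms] by (intro V.submoduleI) auto
  qed
qed

lemma lin_subspace_carrier: "cmod V \<Longrightarrow> lin_subspace V (carrier V)"
  by (simp add: lin_subspace_iff cmod_simps)

lemma lin_subspace_zero: "cmod V \<Longrightarrow> lin_subspace V {\<zero>\<^bsub>V\<^esub>}"
  by (simp add: lin_subspace_iff cmod_simps)

lemma lin_subspace_cmod: "cmod V \<Longrightarrow> lin_subspace V K \<Longrightarrow> cmod (V\<lparr>carrier := K\<rparr>)"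
  by (rule submodule.submodule_is_module)

lemma lin_span_subspace:
  assumes "cmod V" "S \<subseteq> carrier V"
  shows "lin_subspace V (lin_span V S)"
  using assms lin_subspace_carrier[OF assms(1)]
  unfolding lin_span_def lin_subspace_iff[OF assms(1)] by blast

lemma lin_span_base: "x \<in> S \<Longrightarrow> x \<in> lin_span V S"
  by (auto simp: lin_span_def)

lemma lin_span_least: "lin_subspace V K \<Longrightarrow> S \<subseteq> K \<Longrightarrow> lin_span V S \<subseteq> K"
  by (auto simp: lin_span_def)

lemma lin_span_induct [consumes 3, case_names zero add smult base]:
  assumes "cmod V" "S \<subseteq> carrier V" "x \<in> lin_span V S"
    and "P \<zero>\<^bsub>V\<^esub>"
    and "\<And>x y. x \<in> carrier V \<Longrightarrow> y \<in> carrier V \<Longrightarrow> P x \<Longrightarrow> P y \<Longrightarrow> P (x \<oplus>\<^bsub>V\<^esub> y)"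
    and "\<And>c x. x \<in> carrier V \<Longrightarrow> P x \<Longrightarrow> P (c \<odot>\<^bsub>V\<^esub> x)"
    and "\<And>x. x \<in> S \<Longrightarrow> P x"
  shows "P x"
proof -
  have "lin_subspace V {x\<in>carrier V. P x}"
    using assms(4-6) unfolding lin_subspace_iff[OF assms(1)] by (auto simp: cmod_simps[OF assms(1)])
  then have "lin_span V S \<subseteq> {x\<in>carrier V. P x}"
    by (rule lin_span_least) (use assms in auto)
  with assms(3) show ?thesis by auto
qed

subsection \<open>Linear maps\<close>

text \<open>Nothing is said about values outside the carrier, so linear maps are only ever compared
  on the carrier.\<close>

definition lin_map :: "(complex, 'v, 'm) module_scheme \<Rightarrow> (complex, 'w, 'n) module_scheme \<Rightarrow> ('v \<Rightarrow> 'w) \<Rightarrow> bool" where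
  "lin_map V W f \<longleftrightarrow> (\<forall>x\<in>carrier V. f x \<in> carrier W) \<and>
     (\<forall>x\<in>carrier V. \<forall>y\<in>carrier V. f (x \<oplus>\<^bsub>V\<^esub> y) = f x \<oplus>\<^bsub>W\<^esub> f y) \<and>
     (\<forall>c. \<forall>x\<in>carrier V. f (c \<odot>\<^bsub>V\<^esub> x) = c \<odot>\<^bsub>W\<^esub> f x)"

lemma lin_mapI:
  assumes "\<And>x. x \<in> carrier V \<Longrightarrow> f x \<in> carrier W"
    and "\<And>x y. x \<in> carrier V \<Longrightarrow> y \<in> carrier V \<Longrightarrow> f (x \<oplus>\<^bsub>V\<^esub> y) = f x \<oplus>\<^bsub>W\<^esub> f y"
    and "\<And>c x. x \<in> carrier V \<Longrightarrow> f (c \<odot>\<^bsub>V\<^esub> x) = c \<odot>\<^bsub>W\<^esub> f x"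
  shows "lin_map V W f"
  using assms by (auto simp: lin_map_def)

lemma lin_mapD:
  assumes "lin_map V W f"
  shows "x \<in> carrier V \<Longrightarrow> f x \<in> carrier W"
    and "x \<in> carrier V \<Longrightarrow> y \<in> carrier V \<Longrightarrow> f (x \<oplus>\<^bsub>V\<^esub> y) = f x \<oplus>\<^bsub>W\<^esub> f y"
    and "x \<in> carrier V \<Longrightarrow> f (c \<odot>\<^bsub>V\<^esub> x) = c \<odot>\<^bsub>W\<^esub> f x"
  using assms by (auto simp: lin_map_def)

lemma lin_map_zero:
  assumes "cmod V" "cmod W" "lin_map V W f"
  shows "f \<zero>\<^bsub>V\<^esub> = \<zero>\<^bsub>W\<^esub>"
  using lin_mapD(3)[OF assms(3) cmod_simps(2)[OF assms(1)], of 0] lin_mapD(1)[OF assms(3) cmod_simps(2)[OF assms(1)]]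
  by (simp add: cmod_simps(10,11)[OF assms(2)] cmod_simps(11)[OF assms(1)])

lemma lin_map_comp: "lin_map V W f \<Longrightarrow> lin_map U V g \<Longrightarrow> lin_map U W (\<lambda>x. f (g x))"
  by (auto simp: lin_map_def)

lemma lin_map_id: "lin_map V V (\<lambda>x. x)"
  by (auto simp: lin_map_def)

lemma lin_map_add:
  assumes "cmod W" "lin_map V W f" "lin_map V W g"
  shows "lin_map V W (\<lambda>x. f x \<oplus>\<^bsub>W\<^esub> g x)"
  using assms by (auto simp: lin_map_def cmod_simps cmod_ac)

lemma lin_map_smult:
  assumes "cmod W" "lin_map V W f"
  shows "lin_map V W (\<lambda>x. c \<odot>\<^bsub>W\<^esub> f x)"
  using assms by (auto simp: lin_map_def cmod_simps mult.commute)

lemma lin_map_const_zero: "cmod W \<Longrightarrow> lin_map V W (\<lambda>x. \<zero>\<^bsub>W\<^esub>)"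
  by (auto simp: lin_map_def cmod_simps)

lemma lin_map_equalizer:
  assumes "cmod V" "cmod W" "lin_map V W f" "lin_map V W g"
  shows "lin_subspace V {x\<in>carrier V. f x = g x}"
  using lin_mapD[OF assms(3)] lin_mapD[OF assms(4)]
    lin_map_zero[OF assms(1,2,3)] lin_map_zero[OF assms(1,2,4)]
  by (auto simp: lin_subspace_iff[OF assms(1)] cmod_simps[OF assms(1)])

lemma lin_map_kernel:
  assumes "cmod V" "cmod W" "lin_map V W f"
  shows "lin_subspace V {x\<in>carrier V. f x = \<zero>\<^bsub>W\<^esub>}"
  by (rule lin_map_equalizer[OF assms lin_map_const_zero[OF assms(2)]])

lemma lin_map_vimage:
  assumes "cmod V" "cmod W" "lin_map V W f" "lin_subspace W K"
  shows "lin_subspace V {x\<in>carrier V. f x \<in> K}"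
  using lin_mapD[OF assms(3)] lin_map_zero[OF assms(1-3)] assms(4)
  by (auto simp: lin_subspace_iff[OF assms(1)] lin_subspace_iff[OF assms(2)] cmod_simps[OF assms(1)])

subsection \<open>Free vector spaces\<close>

text \<open>The scalar multiplication of \<open>free_vs\<close> and \<open>free_alg\<close>, named
  so that rewrite rules can speak of it.\<close>

definition pscale :: "complex \<Rightarrow> ('x \<Rightarrow>\<^sub>0 complex) \<Rightarrow> ('x \<Rightarrow>\<^sub>0 complex)" where
  "pscale c = Poly_Mapping.map (\<lambda>z. c * z)"

lemma lookup_pscale [simp]: "Poly_Mapping.lookup (pscale c p) x = c * Poly_Mapping.lookup p x"
  by (simp add: pscale_def Poly_Mapping.map.rep_eq when_def)

lemma keys_pscale: "Poly_Mapping.keys (pscale c p) \<subseteq> Poly_Mapping.keys p"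
  by (auto simp: in_keys_iff)

lemma pscale_single [simp]: "pscale c (Poly_Mapping.single x d) = Poly_Mapping.single x (c * d)"
  by (rule poly_mapping_eqI) (simp add: lookup_single when_def)

lemma free_vs_simps [simp]:
  "carrier (free_vs X) = {p. Poly_Mapping.keys p \<subseteq> X}" "zero (free_vs X) = 0"
  "add (free_vs X) = (+)" "smult (free_vs X) = pscale"
  by (simp_all add: free_vs_def pscale_def[abs_def])

lemma pscale_simps:
  "pscale (c + d) p = pscale c p + pscale d p" "pscale c (p + q) = pscale c p + pscale c q"
  "pscale (c * d) p = pscale c (pscale d p)" "pscale 1 p = p" "pscale 0 p = 0"
  by (rule poly_mapping_eqI, simp add: lookup_add algebra_simps)+

lemma pscale_commute: "pscale c (pscale d p) = pscale d (pscale c p)"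
  by (rule poly_mapping_eqI) simp

lemma pscale_minus: "pscale (-1) p = - p"
  by (rule poly_mapping_eqI; simp)

lemma free_vs_cmod: "cmod (free_vs (X :: 'x set))"
proof (rule cmodI)
  fix p q :: "'x \<Rightarrow>\<^sub>0 complex" assume "p \<in> carrier (free_vs X)" "q \<in> carrier (free_vs X)"
  then show "p \<oplus>\<^bsub>free_vs X\<^esub> q \<in> carrier (free_vs X)"
    using keys_add[of p q] by auto
next
  fix p :: "'x \<Rightarrow>\<^sub>0 complex" and c assume "p \<in> carrier (free_vs X)"
  then show "c \<odot>\<^bsub>free_vs X\<^esub> p \<in> carrier (free_vs X)"
    using keys_pscale[of c p] by auto
qed (simp_all add: pscale_simps add_ac)

lemma free_vs_diff:
  "p \<in> carrier (free_vs X) \<Longrightarrow> q \<in> carrier (free_vs X) \<Longrightarrow> p - q \<in> carrier (free_vs X)"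
  by (simp add: subset_iff in_keys_iff lookup_minus) (metis right_minus_eq)

lemma poly_mapping_sum_single:
  "p = (\<Sum>x\<in>Poly_Mapping.keys p. Poly_Mapping.single x (Poly_Mapping.lookup p x))"
  by (rule poly_mapping_eqI) (auto simp: lookup_sum lookup_single when_def in_keys_iff)

lemma free_vs_induct [consumes 1, case_names zero add smult single]:
  assumes "Poly_Mapping.keys p \<subseteq> X"
    and "P 0"
    and "\<And>p q. Poly_Mapping.keys p \<subseteq> X \<Longrightarrow> Poly_Mapping.keys q \<subseteq> X \<Longrightarrow> P p \<Longrightarrow> P q \<Longrightarrow> P (p + q)"
    and "\<And>c p. Poly_Mapping.keys p \<subseteq> X \<Longrightarrow> P p \<Longrightarrow> P (pscale c p)"
    and "\<And>x. x \<in> X \<Longrightarrow> P (Poly_Mapping.single x 1)"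
  shows "P p"
proof -
  have *: "P (\<Sum>x\<in>F. Poly_Mapping.single x (f x)) \<and>
      Poly_Mapping.keys (\<Sum>x\<in>F. Poly_Mapping.single x (f x)) \<subseteq> X"
    if "finite F" "F \<subseteq> X" for F f
    using that
  proof (induction F)
    case (insert x F)
    have "P (pscale (f x) (Poly_Mapping.single x 1))"
      using insert by (intro assms(4,5)) auto
    moreover have "Poly_Mapping.keys (Poly_Mapping.single x (f x)) \<subseteq> X" using insert by auto
    ultimately show ?case
      using insert keys_add[of "Poly_Mapping.single x (f x)" "\<Sum>x\<in>F. Poly_Mapping.single x (f x)"]
      by (auto intro!: assms(3))
  qed (use assms in auto)
  show ?thesis
    using *[of "Poly_Mapping.keys p" "Poly_Mapping.lookup p"] assms(1)
    by (simp flip: poly_mapping_sum_single)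
qed

definition lin_ext :: "(complex, 'w, 'n) module_scheme \<Rightarrow> ('x \<Rightarrow> 'w) \<Rightarrow> ('x \<Rightarrow>\<^sub>0 complex) \<Rightarrow> 'w" where
  "lin_ext W f p = finsum W (\<lambda>x. Poly_Mapping.lookup p x \<odot>\<^bsub>W\<^esub> f x) (Poly_Mapping.keys p)"

text \<open>The supports of \<open>p\<close>, \<open>q\<close> and \<open>p + q\<close> differ.
  Passing to one common finite index set makes the three sums comparable, since the added terms have
  coefficient zero.\<close>

lemma lin_ext_superset:
  assumes "cmod W" "finite S" "Poly_Mapping.keys p \<subseteq> S" "\<And>x. x \<in> S \<Longrightarrow> f x \<in> carrier W"
  shows "lin_ext W f p = finsum W (\<lambda>x. Poly_Mapping.lookup p x \<odot>\<^bsub>W\<^esub> f x) S"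
proof -
  interpret W: Module.module C_alg W by fact
  show ?thesis
    unfolding lin_ext_def using assms
    by (intro W.add.finprod_mono_neutral_cong_left) (auto simp: in_keys_iff cmod_simps)
qed

lemma lin_ext_lin_map:
  fixes X :: "'x set"
  assumes "cmod W" "\<And>x. x \<in> X \<Longrightarrow> f x \<in> carrier W"
  shows "lin_map (free_vs X) W (lin_ext W f)"
proof -
  interpret W: Module.module C_alg W by fact
  show ?thesis
  proof (rule lin_mapI; simp)
    fix p :: "'x \<Rightarrow>\<^sub>0 complex" assume p: "Poly_Mapping.keys p \<subseteq> X"
    show "lin_ext W f p \<in> carrier W"
      unfolding lin_ext_def using p assms by (intro W.finsum_closed) auto
    show "lin_ext W f (pscale c p) = c \<odot>\<^bsub>W\<^esub> lin_ext W f p" for c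
    proof -
      have "lin_ext W f (pscale c p) =
        finsum W (\<lambda>x. c \<odot>\<^bsub>W\<^esub> (Poly_Mapping.lookup p x \<odot>\<^bsub>W\<^esub> f x)) (Poly_Mapping.keys p)"
        using p assms keys_pscale[of c p]
        by (subst lin_ext_superset[OF assms(1) finite_keys[of p]])
          (auto intro!: W.add.finprod_cong' simp: cmod_simps)
      also have "\<dots> = c \<odot>\<^bsub>W\<^esub> lin_ext W f p"
        unfolding lin_ext_def using p assms by (intro W.finsum_smult_ldistr[symmetric]) auto
      finally show ?thesis .
    qed
    fix q :: "'x \<Rightarrow>\<^sub>0 complex" assume q: "Poly_Mapping.keys q \<subseteq> X"
    let ?S = "Poly_Mapping.keys p \<union> Poly_Mapping.keys q"
    have "lin_ext W f (p + q) = finsum W (\<lambda>x. Poly_Mapping.lookup (p + q) x \<odot>\<^bsub>W\<^esub> f x) ?S"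
      using p q assms keys_add[of p q] by (intro lin_ext_superset) auto
    also have "\<dots> = finsum W (\<lambda>x. Poly_Mapping.lookup p x \<odot>\<^bsub>W\<^esub> f x \<oplus>\<^bsub>W\<^esub>
        Poly_Mapping.lookup q x \<odot>\<^bsub>W\<^esub> f x) ?S"
      using p q assms by (intro W.add.finprod_cong') (auto simp: lookup_add cmod_simps)
    also have "\<dots> = finsum W (\<lambda>x. Poly_Mapping.lookup p x \<odot>\<^bsub>W\<^esub> f x) ?S \<oplus>\<^bsub>W\<^esub>
        finsum W (\<lambda>x. Poly_Mapping.lookup q x \<odot>\<^bsub>W\<^esub> f x) ?S"
      using p q assms by (intro W.finsum_addf) auto
    also have "\<dots> = lin_ext W f p \<oplus>\<^bsub>W\<^esub> lin_ext W f q"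
      using p q assms by (subst (1 2) lin_ext_superset[symmetric]) auto
    finally show "lin_ext W f (p + q) = lin_ext W f p \<oplus>\<^bsub>W\<^esub> lin_ext W f q" .
  qed
qed

lemma lin_ext_single:
  assumes "cmod W" "f x \<in> carrier W"
  shows "lin_ext W f (Poly_Mapping.single x c) = c \<odot>\<^bsub>W\<^esub> f x"
proof -
  interpret W: Module.module C_alg W by fact
  show ?thesis
    using assms by (subst lin_ext_superset[of W "{x}"]) auto
qed

lemma lin_ext_zero [simp]: "cmod W \<Longrightarrow> lin_ext W f 0 = \<zero>\<^bsub>W\<^esub>"
  using abelian_monoid.finsum_empty[of W] by (simp add: lin_ext_def Module.module_def abelian_group_def)

lemma free_vs_map_eq:
  assumes "cmod W" "lin_map (free_vs X) W f" "lin_map (free_vs X) W g"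
    and "\<And>x. x \<in> X \<Longrightarrow> f (Poly_Mapping.single x 1) = g (Poly_Mapping.single x 1)"
    and "Poly_Mapping.keys p \<subseteq> X"
  shows "f p = g p"
  using assms(5)
proof (induction rule: free_vs_induct)
  case zero then show ?case
    using lin_map_zero[OF free_vs_cmod assms(1,2)] lin_map_zero[OF free_vs_cmod assms(1,3)] by simp
qed (use assms lin_mapD[OF assms(2)] lin_mapD[OF assms(3)] in auto)

lemma finsum_free_vs:
  "finite S \<Longrightarrow> f \<in> S \<rightarrow> carrier (free_vs X) \<Longrightarrow> finsum (free_vs X) f S = sum f S"
proof (induction S rule: finite_induct)
  case empty
  interpret F: Module.module C_alg "free_vs X" by (rule free_vs_cmod)
  show ?case by (simp only: F.finsum_empty) simp
next
  case (insert x S)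
  interpret F: Module.module C_alg "free_vs X" by (rule free_vs_cmod)
  have "finsum (free_vs X) f (insert x S) = f x \<oplus>\<^bsub>free_vs X\<^esub> finsum (free_vs X) f S"
    using insert.hyps insert.prems by (intro F.finsum_insert) (auto simp: Pi_iff)
  with insert show ?case by (simp add: Pi_iff)
qed

lemma lin_ext_free_vs:
  assumes "\<And>x. x \<in> Poly_Mapping.keys p \<Longrightarrow> Poly_Mapping.keys (f x) \<subseteq> X"
  shows "lin_ext (free_vs X) f p = (\<Sum>x\<in>Poly_Mapping.keys p. pscale (Poly_Mapping.lookup p x) (f x))"
proof -
  have "(\<lambda>x. Poly_Mapping.lookup p x \<odot>\<^bsub>free_vs X\<^esub> f x) \<in> Poly_Mapping.keys p \<rightarrow> carrier (free_vs X)"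
    using assms by (auto dest: subsetD[OF keys_pscale])
  then show ?thesis
    unfolding lin_ext_def by (subst finsum_free_vs) auto
qed

subsection \<open>Quotient spaces\<close>

locale csub =
  fixes V :: "(complex, 'v, 'm) module_scheme" and K :: "'v set"
  assumes V: "cmod V" and K: "lin_subspace V K"
begin

sublocale V: Module.module C_alg V by (rule V)

sublocale abelian_subgroup K V
proof (rule abelian_subgroupI3)
  show "additive_subgroup K V"
    using K by (simp add: additive_subgroup_def submodule_def)
qed (rule V.abelian_group_axioms)

lemmas vs = cmod_simps[OF V] cmod_ac[OF V]
lemmas Ks = lin_subspace_iff[OF V, THEN iffD1, OF K]

abbreviation cls :: "'v \<Rightarrow> 'v set" where "cls \<equiv> a_r_coset V K"
abbreviation Q where "Q \<equiv> quot_vs V K"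

lemma cls_mem_iff: "x \<in> carrier V \<Longrightarrow> y \<in> carrier V \<Longrightarrow> y \<in> cls x \<longleftrightarrow> y \<oplus>\<^bsub>V\<^esub> (-1) \<odot>\<^bsub>V\<^esub> x \<in> K"
  by (simp add: a_rcos_module vs(12))

lemma cls_eq_iff: "x \<in> carrier V \<Longrightarrow> y \<in> carrier V \<Longrightarrow> cls x = cls y \<longleftrightarrow> x \<oplus>\<^bsub>V\<^esub> (-1) \<odot>\<^bsub>V\<^esub> y \<in> K"
  using cls_mem_iff a_repr_independence' a_rcos_self by metis

lemma cls_mem: "x \<in> carrier V \<Longrightarrow> y \<in> cls x \<longleftrightarrow> y \<in> carrier V \<and> cls y = cls x"
  using cls_mem_iff cls_eq_iff a_elemrcos_carrier by metis

lemma quot_carrier: "carrier Q = cls ` carrier V"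
  by (auto simp: quot_vs_def A_RCOSETS_def' a_r_coset_def')

lemma quot_obtain:
  assumes "X \<in> carrier Q" obtains x where "x \<in> carrier V" "X = cls x"
  using assms quot_carrier by auto

lemma quot_closed: "x \<in> carrier V \<Longrightarrow> cls x \<in> carrier Q"
  by (simp add: quot_carrier)

lemma quot_zero: "zero Q = cls \<zero>\<^bsub>V\<^esub>"
  using Ks by (simp add: quot_vs_def V.a_coset_add_zero)

lemma quot_add: "x \<in> carrier V \<Longrightarrow> y \<in> carrier V \<Longrightarrow> cls x \<oplus>\<^bsub>Q\<^esub> cls y = cls (x \<oplus>\<^bsub>V\<^esub> y)"
  by (simp add: quot_vs_def a_rcos_sum)

text \<open>Operations on cosets are defined as unions over representatives. Such a union collapses
  to one value once all representatives agree, because a coset is nonempty.\<close>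

lemma cls_UN:
  assumes "x \<in> carrier V" "\<And>y. y \<in> carrier V \<Longrightarrow> cls y = cls x \<Longrightarrow> g y = S"
  shows "(\<Union>y\<in>cls x. g y) = S"
  using assms cls_mem[OF assms(1)] by auto

lemma quot_smult: "x \<in> carrier V \<Longrightarrow> c \<odot>\<^bsub>Q\<^esub> cls x = cls (c \<odot>\<^bsub>V\<^esub> x)"
proof -
  assume x: "x \<in> carrier V"
  have "cls (c \<odot>\<^bsub>V\<^esub> y) = cls (c \<odot>\<^bsub>V\<^esub> x)" if "y \<in> carrier V" "cls y = cls x" for y
  proof -
    have "c \<odot>\<^bsub>V\<^esub> y \<oplus>\<^bsub>V\<^esub> (-1) \<odot>\<^bsub>V\<^esub> (c \<odot>\<^bsub>V\<^esub> x) = c \<odot>\<^bsub>V\<^esub> (y \<oplus>\<^bsub>V\<^esub> (-1) \<odot>\<^bsub>V\<^esub> x)"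
      using that x by (simp add: vs)
    then show ?thesis using that x Ks cls_eq_iff by (metis vs(3))
  qed
  then show ?thesis
    unfolding quot_vs_def using cls_UN[OF x, of "\<lambda>y. cls (c \<odot>\<^bsub>V\<^esub> y)"] by simp
qed

lemmas quot_simps = quot_closed quot_zero quot_add quot_smult

lemma quot_cmod: "cmod Q"
proof (rule cmodI)
  show "c \<odot>\<^bsub>Q\<^esub> X \<in> carrier Q" if "X \<in> carrier Q" for c X
    using that by (elim quot_obtain) (simp add: quot_simps vs)
  show "X \<oplus>\<^bsub>Q\<^esub> Y \<in> carrier Q" if "X \<in> carrier Q" "Y \<in> carrier Q" for X Y
    using that by (elim quot_obtain) (simp add: quot_simps vs)
  show "X \<oplus>\<^bsub>Q\<^esub> Y \<oplus>\<^bsub>Q\<^esub> Z = X \<oplus>\<^bsub>Q\<^esub> (Y \<oplus>\<^bsub>Q\<^esub> Z)"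
    if "X \<in> carrier Q" "Y \<in> carrier Q" "Z \<in> carrier Q" for X Y Z
    using that by (elim quot_obtain) (simp add: quot_simps vs)
  show "X \<oplus>\<^bsub>Q\<^esub> Y = Y \<oplus>\<^bsub>Q\<^esub> X" if "X \<in> carrier Q" "Y \<in> carrier Q" for X Y
    using that by (elim quot_obtain) (simp add: quot_simps vs(15))
  show "\<zero>\<^bsub>Q\<^esub> \<oplus>\<^bsub>Q\<^esub> X = X" if "X \<in> carrier Q" for X
    using that by (elim quot_obtain) (simp add: quot_simps vs)
  show "(c + d) \<odot>\<^bsub>Q\<^esub> X = c \<odot>\<^bsub>Q\<^esub> X \<oplus>\<^bsub>Q\<^esub> d \<odot>\<^bsub>Q\<^esub> X" if "X \<in> carrier Q" for c d X
    using that by (elim quot_obtain) (simp add: quot_simps vs)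
  show "c \<odot>\<^bsub>Q\<^esub> (X \<oplus>\<^bsub>Q\<^esub> Y) = c \<odot>\<^bsub>Q\<^esub> X \<oplus>\<^bsub>Q\<^esub> c \<odot>\<^bsub>Q\<^esub> Y"
    if "X \<in> carrier Q" "Y \<in> carrier Q" for c X Y
    using that by (elim quot_obtain) (simp add: quot_simps vs)
  show "(c * d) \<odot>\<^bsub>Q\<^esub> X = c \<odot>\<^bsub>Q\<^esub> (d \<odot>\<^bsub>Q\<^esub> X)" if "X \<in> carrier Q" for c d X
    using that by (elim quot_obtain) (simp add: quot_simps vs)
  show "1 \<odot>\<^bsub>Q\<^esub> X = X" if "X \<in> carrier Q" for X
    using that by (elim quot_obtain) (simp add: quot_simps vs)
  show "0 \<odot>\<^bsub>Q\<^esub> X = \<zero>\<^bsub>Q\<^esub>" if "X \<in> carrier Q" for X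
    using that by (elim quot_obtain) (simp add: quot_simps vs)
qed (simp add: quot_simps vs)

lemma cls_lin_map: "lin_map V Q cls"
  by (rule lin_mapI) (simp_all add: quot_simps)

lemma cls_zero_iff: "x \<in> carrier V \<Longrightarrow> cls x = \<zero>\<^bsub>Q\<^esub> \<longleftrightarrow> x \<in> K"
  by (simp add: quot_zero cls_eq_iff vs)

lemma lin_map_cls_cong:
  assumes "cmod W" "lin_map V W f" "\<And>x. x \<in> K \<Longrightarrow> f x = \<zero>\<^bsub>W\<^esub>"
    and "x \<in> carrier V" "y \<in> carrier V" "cls x = cls y"
  shows "f x = f y"
proof -
  have "f (x \<oplus>\<^bsub>V\<^esub> (-1) \<odot>\<^bsub>V\<^esub> y) = \<zero>\<^bsub>W\<^esub>"
    using assms cls_eq_iff by metis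
  then show ?thesis
    using assms(4,5) lin_mapD[OF assms(2)] cmod_sub_eq_zero[OF assms(1)] vs(3) by simp
qed

text \<open>The map induced on the quotient, taken through an arbitrary representative;
  \<open>qlift_cls\<close> removes the choice when \<open>f\<close> is constant on cosets.\<close>

definition qlift :: "('v \<Rightarrow> 'w) \<Rightarrow> 'v set \<Rightarrow> 'w" where
  "qlift f X = f (SOME x. x \<in> X)"

lemma qlift_cls:
  assumes "x \<in> carrier V" "\<And>y. y \<in> carrier V \<Longrightarrow> cls y = cls x \<Longrightarrow> f y = f x"
  shows "qlift f (cls x) = f x"
proof -
  have "(SOME y. y \<in> cls x) \<in> cls x"
    using a_rcos_self[OF assms(1)] by (rule someI)
  then show ?thesis
    unfolding qlift_def using assms cls_mem by metis
qed

lemma qlift_lin_map: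
  assumes "cmod W" "lin_map V W f" "\<And>x. x \<in> K \<Longrightarrow> f x = \<zero>\<^bsub>W\<^esub>"
  shows "lin_map Q W (qlift f)" "\<And>x. x \<in> carrier V \<Longrightarrow> qlift f (cls x) = f x"
proof -
  show *: "\<And>x. x \<in> carrier V \<Longrightarrow> qlift f (cls x) = f x"
    using qlift_cls lin_map_cls_cong[OF assms] by metis
  show "lin_map Q W (qlift f)"
  proof (rule lin_mapI)
    fix X Y assume "X \<in> carrier Q" "Y \<in> carrier Q"
    then show "qlift f (X \<oplus>\<^bsub>Q\<^esub> Y) = qlift f X \<oplus>\<^bsub>W\<^esub> qlift f Y"
      by (elim quot_obtain) (simp add: quot_simps * lin_mapD[OF assms(2)] vs)
  next
    fix X assume "X \<in> carrier Q"
    then show "qlift f X \<in> carrier W"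
      by (elim quot_obtain) (simp add: * lin_mapD[OF assms(2)])
  next
    fix c X assume "X \<in> carrier Q"
    then show "qlift f (c \<odot>\<^bsub>Q\<^esub> X) = c \<odot>\<^bsub>W\<^esub> qlift f X"
      by (elim quot_obtain) (simp add: quot_simps * lin_mapD[OF assms(2)] vs)
  qed
qed

end

subsection \<open>Tensor products\<close>

definition bilin :: "(complex, 'v, 'm) module_scheme \<Rightarrow> (complex, 'w, 'n) module_scheme \<Rightarrow>
    (complex, 'u, 'k) module_scheme \<Rightarrow> ('v \<Rightarrow> 'w \<Rightarrow> 'u) \<Rightarrow> bool" where
  "bilin V W U h \<longleftrightarrow> (\<forall>w\<in>carrier W. lin_map V U (\<lambda>v. h v w)) \<and> (\<forall>v\<in>carrier V. lin_map W U (h v))"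

locale ctensor =
  fixes V :: "(complex, 'v, 'm) module_scheme" and W :: "(complex, 'w, 'n) module_scheme"
  assumes cV: "cmod V" and cW: "cmod W"
begin

lemmas vvs = cmod_simps[OF cV] cmod_ac[OF cV]
lemmas wws = cmod_simps[OF cW] cmod_ac[OF cW]

abbreviation F where "F \<equiv> free_vs (carrier V \<times> carrier W)"

lemma single_closed: "v \<in> carrier V \<Longrightarrow> w \<in> carrier W \<Longrightarrow> Poly_Mapping.single (v, w) c \<in> carrier F"
  by auto

lemma tensor_rels_subset: "tensor_rels V W \<subseteq> carrier F"
  unfolding tensor_rels_def
  by (intro subsetI, elim UnE CollectE exE conjE; hypsubst; intro free_vs_diff single_closed vvs wws; assumption)

sublocale csub F "tensor_ker V W"
  unfolding csub_def tensor_ker_def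
  by (intro conjI free_vs_cmod lin_span_subspace tensor_rels_subset)

abbreviation T where "T \<equiv> tensor_vs V W"
abbreviation tn (infixl \<open>\<otimes>\<^sub>t\<close> 75) where "tn \<equiv> tens V W"

lemma tensor_vs_eq: "T = Q"
  by (simp add: tensor_vs_def)

lemma T_cmod: "cmod T"
  by (simp add: tensor_vs_eq quot_cmod)

lemmas ts = cmod_simps[OF T_cmod] cmod_ac[OF T_cmod]

lemma rel_zero:
  assumes "r \<in> tensor_rels V W" shows "cls r = \<zero>\<^bsub>T\<^esub>"
proof -
  have "r \<in> tensor_ker V W" unfolding tensor_ker_def using assms by (rule lin_span_base)
  moreover have "r \<in> carrier F" using assms tensor_rels_subset by auto
  ultimately show ?thesis by (simp add: tensor_vs_eq cls_zero_iff)
qed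

lemma tens_eq: "v \<otimes>\<^sub>t w = cls (Poly_Mapping.single (v, w) 1)"
  by (simp add: tens_def tensor_cls_def)

lemma tens_closed: "v \<in> carrier V \<Longrightarrow> w \<in> carrier W \<Longrightarrow> v \<otimes>\<^sub>t w \<in> carrier T"
  unfolding tens_eq tensor_vs_eq by (intro quot_closed single_closed)

lemma tens_scaled: "v \<in> carrier V \<Longrightarrow> w \<in> carrier W \<Longrightarrow>
    cls (Poly_Mapping.single (v, w) c) = c \<odot>\<^bsub>T\<^esub> (v \<otimes>\<^sub>t w)"
  using quot_smult[of "Poly_Mapping.single (v, w) 1" c]
  by (simp add: tens_eq tensor_vs_eq)

lemma cls_diff: "p \<in> carrier F \<Longrightarrow> q \<in> carrier F \<Longrightarrow> cls (p - q) = \<zero>\<^bsub>T\<^esub> \<longleftrightarrow> cls p = cls q"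
proof -
  assume p: "p \<in> carrier F" and q: "q \<in> carrier F"
  have "p - q \<in> carrier F"
    using p q by (rule free_vs_diff)
  then show ?thesis
    using p q by (simp add: tensor_vs_eq cls_zero_iff cls_eq_iff pscale_minus)
qed

lemma cls_plus: "p \<in> carrier F \<Longrightarrow> q \<in> carrier F \<Longrightarrow> cls (p + q) = cls p \<oplus>\<^bsub>T\<^esub> cls q"
  using quot_add[of p q] by (simp add: tensor_vs_eq)

lemma tens_add_left:
  assumes "v \<in> carrier V" "v' \<in> carrier V" "w \<in> carrier W"
  shows "(v \<oplus>\<^bsub>V\<^esub> v') \<otimes>\<^sub>t w = v \<otimes>\<^sub>t w \<oplus>\<^bsub>T\<^esub> v' \<otimes>\<^sub>t w"
proof -
  let ?p = "\<lambda>v. Poly_Mapping.single (v, w) (1::complex)"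
  have "?p (v \<oplus>\<^bsub>V\<^esub> v') - ?p v - ?p v' \<in> tensor_rels V W"
    using assms by (auto simp: tensor_rels_def)
  then have "cls (?p (v \<oplus>\<^bsub>V\<^esub> v') - (?p v + ?p v')) = \<zero>\<^bsub>T\<^esub>"
    using rel_zero by (simp add: diff_diff_eq)
  moreover have "?p v + ?p v' \<in> carrier F"
    using assms keys_add[of "?p v" "?p v'"] by auto
  ultimately have "cls (?p (v \<oplus>\<^bsub>V\<^esub> v')) = cls (?p v + ?p v')"
    using assms single_closed vvs by (subst (asm) cls_diff) auto
  then show ?thesis
    using assms single_closed by (simp add: tens_eq cls_plus)
qed

lemma tens_add_right:
  assumes "v \<in> carrier V" "w \<in> carrier W" "w' \<in> carrier W"
  shows "v \<otimes>\<^sub>t (w \<oplus>\<^bsub>W\<^esub> w') = v \<otimes>\<^sub>t w \<oplus>\<^bsub>T\<^esub> v \<otimes>\<^sub>t w'"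
proof -
  let ?p = "\<lambda>w. Poly_Mapping.single (v, w) (1::complex)"
  have "?p (w \<oplus>\<^bsub>W\<^esub> w') - ?p w - ?p w' \<in> tensor_rels V W"
    using assms by (auto simp: tensor_rels_def)
  then have "cls (?p (w \<oplus>\<^bsub>W\<^esub> w') - (?p w + ?p w')) = \<zero>\<^bsub>T\<^esub>"
    using rel_zero by (simp add: diff_diff_eq)
  moreover have "?p w + ?p w' \<in> carrier F"
    using assms keys_add[of "?p w" "?p w'"] by auto
  ultimately have "cls (?p (w \<oplus>\<^bsub>W\<^esub> w')) = cls (?p w + ?p w')"
    using assms single_closed wws by (subst (asm) cls_diff) auto
  then show ?thesis
    using assms single_closed by (simp add: tens_eq cls_plus)
qed

lemma tens_smult_left:
  assumes "v \<in> carrier V" "w \<in> carrier W"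
  shows "(c \<odot>\<^bsub>V\<^esub> v) \<otimes>\<^sub>t w = c \<odot>\<^bsub>T\<^esub> (v \<otimes>\<^sub>t w)"
proof -
  have "Poly_Mapping.single (c \<odot>\<^bsub>V\<^esub> v, w) 1 - Poly_Mapping.single (v, w) c \<in> tensor_rels V W"
    using assms by (auto simp: tensor_rels_def)
  then have "cls (Poly_Mapping.single (c \<odot>\<^bsub>V\<^esub> v, w) 1) = cls (Poly_Mapping.single (v, w) c)"
    by (intro cls_diff[THEN iffD1] single_closed rel_zero vvs assms)
  then show ?thesis using assms by (simp add: tens_scaled tens_eq[symmetric])
qed

lemma tens_smult_right:
  assumes "v \<in> carrier V" "w \<in> carrier W"
  shows "v \<otimes>\<^sub>t (c \<odot>\<^bsub>W\<^esub> w) = c \<odot>\<^bsub>T\<^esub> (v \<otimes>\<^sub>t w)"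
proof -
  have "Poly_Mapping.single (v, c \<odot>\<^bsub>W\<^esub> w) 1 - Poly_Mapping.single (v, w) c \<in> tensor_rels V W"
    using assms by (auto simp: tensor_rels_def)
  then have "cls (Poly_Mapping.single (v, c \<odot>\<^bsub>W\<^esub> w) 1) = cls (Poly_Mapping.single (v, w) c)"
    by (intro cls_diff[THEN iffD1] single_closed rel_zero wws assms)
  then show ?thesis using assms by (simp add: tens_scaled tens_eq[symmetric])
qed

lemma tens_zero: "v \<in> carrier V \<Longrightarrow> v \<otimes>\<^sub>t \<zero>\<^bsub>W\<^esub> = \<zero>\<^bsub>T\<^esub>" "w \<in> carrier W \<Longrightarrow> \<zero>\<^bsub>V\<^esub> \<otimes>\<^sub>t w = \<zero>\<^bsub>T\<^esub>"
proof -
  show "v \<otimes>\<^sub>t \<zero>\<^bsub>W\<^esub> = \<zero>\<^bsub>T\<^esub>" if "v \<in> carrier V"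
    using tens_smult_right[OF that wws(2), of 0] tens_closed[OF that wws(2)] by (simp add: ts(10) wws(2,10))
  show "\<zero>\<^bsub>V\<^esub> \<otimes>\<^sub>t w = \<zero>\<^bsub>T\<^esub>" if "w \<in> carrier W"
    using tens_smult_left[OF vvs(2) that, of 0] tens_closed[OF vvs(2) that] by (simp add: ts(10) vvs(2,10))
qed

text \<open>A scalar multiple of a pure tensor is again a pure tensor, so sums of pure tensors
  already exhaust the space.\<close>

lemma tensor_induct [consumes 1, case_names add tens]:
  assumes "X \<in> carrier T"
    and "\<And>X Y. X \<in> carrier T \<Longrightarrow> Y \<in> carrier T \<Longrightarrow> P X \<Longrightarrow> P Y \<Longrightarrow> P (X \<oplus>\<^bsub>T\<^esub> Y)"
    and "\<And>v w. v \<in> carrier V \<Longrightarrow> w \<in> carrier W \<Longrightarrow> P (v \<otimes>\<^sub>t w)"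
  shows "P X"
proof -
  \<comment> \<open>\<open>P\<close> is not known to be stable under scalars, so the claim is
    carried for all multiples at once.\<close>
  have "\<forall>c. P (c \<odot>\<^bsub>T\<^esub> cls p)" if "Poly_Mapping.keys p \<subseteq> carrier V \<times> carrier W" for p
    using that
  proof (induction rule: free_vs_induct)
    case zero
    have "cls 0 = \<zero>\<^bsub>T\<^esub>" using quot_zero by (simp add: tensor_vs_eq)
    then show ?case using assms(3)[OF vvs(2) wws(2)] by (simp add: ts tens_zero vvs)
  next
    case (add p q)
    then show ?case using quot_closed[of p] quot_closed[of q]
      by (auto simp: cls_plus ts simp flip: tensor_vs_eq intro!: assms(2))
  next
    case (smult c p)
    then show ?case using quot_closed[of p] quot_smult[of p c, symmetric]
      by (auto simp: ts simp flip: tensor_vs_eq)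
  next
    case (single x)
    then show ?case
      using assms(3) by (auto simp: vvs ts simp flip: tens_eq tens_smult_left)
  qed
  moreover obtain p where "p \<in> carrier F" "X = cls p"
    using assms(1) quot_obtain unfolding tensor_vs_eq by blast
  ultimately show ?thesis
    using assms(1) ts(9)[of X] by (metis (no_types, lifting) free_vs_simps(1) mem_Collect_eq)
qed

lemma tensor_span: "lin_span T {v \<otimes>\<^sub>t w | v w. v \<in> carrier V \<and> w \<in> carrier W} = carrier T"
  (is "lin_span T ?S = _")
proof
  have S: "?S \<subseteq> carrier T" using tens_closed by auto
  note sub = lin_span_subspace[OF T_cmod S, unfolded lin_subspace_iff[OF T_cmod]]
  then show "lin_span T ?S \<subseteq> carrier T" by auto
  show "carrier T \<subseteq> lin_span T ?S"
  proof
    fix X assume "X \<in> carrier T"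
    then show "X \<in> lin_span T ?S"
      by (induction rule: tensor_induct) (use sub in \<open>auto intro!: lin_span_base\<close>)
  qed
qed

definition tlift :: "(complex, 'u, 'k) module_scheme \<Rightarrow> ('v \<Rightarrow> 'w \<Rightarrow> 'u) \<Rightarrow>
    ('v \<times> 'w \<Rightarrow>\<^sub>0 complex) set \<Rightarrow> 'u" where
  "tlift U h = qlift (lin_ext U (case_prod h))"

context
  fixes U :: "(complex, 'u, 'k) module_scheme" and h
  assumes U: "cmod U" and h: "bilin V W U h"
begin

lemma h_closed: "v \<in> carrier V \<Longrightarrow> w \<in> carrier W \<Longrightarrow> h v w \<in> carrier U"
  using h by (auto simp: bilin_def lin_map_def)

lemma lin_ext_bilin: "lin_map F U (lin_ext U (case_prod h))"
  using h_closed by (intro lin_ext_lin_map U) auto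

text \<open>Each of the four families of relations is sent to zero by additivity or homogeneity of
  \<open>h\<close> in one argument; linearity extends this to their span.\<close>

lemma lin_ext_tensor_ker:
  assumes "r \<in> tensor_ker V W" shows "lin_ext U (case_prod h) r = \<zero>\<^bsub>U\<^esub>"
proof -
  let ?e = "lin_ext U (case_prod h)"
  have diff: "?e (p - q) = ?e p \<oplus>\<^bsub>U\<^esub> (-1) \<odot>\<^bsub>U\<^esub> ?e q" if "p \<in> carrier F" "q \<in> carrier F" for p q
  proof -
    have "Poly_Mapping.keys (- q) = Poly_Mapping.keys q"
      by (auto simp: in_keys_iff)
    then show ?thesis
      using lin_mapD(2)[OF lin_ext_bilin, of p "- q"] lin_mapD(3)[OF lin_ext_bilin, of q "-1"] that
      by (simp add: pscale_minus)
  qed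
  note dc = free_vs_diff[of _ "carrier V \<times> carrier W"]
  have s: "?e (Poly_Mapping.single (v, w) c) = c \<odot>\<^bsub>U\<^esub> h v w" if "v \<in> carrier V" "w \<in> carrier W" for v w c
    using h_closed that by (simp add: lin_ext_single U)
  note us = cmod_simps[OF U] cmod_ac[OF U] cmod_sub_eq_zero[OF U]
  note hl = lin_mapD[OF bspec[OF conjunct1[OF h[unfolded bilin_def]]]]
    lin_mapD[OF bspec[OF conjunct2[OF h[unfolded bilin_def]]]]
  have "tensor_rels V W \<subseteq> {p \<in> carrier F. ?e p = \<zero>\<^bsub>U\<^esub>}"
  proof
    fix r assume r: "r \<in> tensor_rels V W"
    have x: "x \<oplus>\<^bsub>U\<^esub> y \<oplus>\<^bsub>U\<^esub> (-1) \<odot>\<^bsub>U\<^esub> x \<oplus>\<^bsub>U\<^esub> (-1) \<odot>\<^bsub>U\<^esub> y = \<zero>\<^bsub>U\<^esub>"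
      if "x \<in> carrier U" "y \<in> carrier U" for x y
      using that us(17)[of "x \<oplus>\<^bsub>U\<^esub> y" "x \<oplus>\<^bsub>U\<^esub> y"] by (simp add: us)
    from r have "?e r = \<zero>\<^bsub>U\<^esub>"
      unfolding tensor_rels_def
      by (auto simp: diff dc single_closed s vvs wws hl us(1,9) x h_closed us(17) us(3)
          simp del: free_vs_simps)
    then show "r \<in> {p \<in> carrier F. ?e p = \<zero>\<^bsub>U\<^esub>}"
      using r tensor_rels_subset by auto
  qed
  then have "tensor_ker V W \<subseteq> {p \<in> carrier F. ?e p = \<zero>\<^bsub>U\<^esub>}"
    unfolding tensor_ker_def
    by (intro lin_span_least lin_map_kernel[OF free_vs_cmod U lin_ext_bilin])
  with assms show ?thesis by auto
qed

lemma tlift_lin_map: "lin_map T U (tlift U h)"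
  unfolding tlift_def tensor_vs_eq
  using lin_ext_tensor_ker by (rule qlift_lin_map(1)[OF U lin_ext_bilin])

lemma tlift_cls: "p \<in> carrier F \<Longrightarrow> tlift U h (cls p) = lin_ext U (case_prod h) p"
  unfolding tlift_def
  using lin_ext_tensor_ker by (rule qlift_lin_map(2)[OF U lin_ext_bilin])

lemma tlift_tens: "v \<in> carrier V \<Longrightarrow> w \<in> carrier W \<Longrightarrow> tlift U h (v \<otimes>\<^sub>t w) = h v w"
  unfolding tens_eq
  using h_closed single_closed by (simp add: tlift_cls lin_ext_single U cmod_simps)

end

lemma tensor_map_unique:
  assumes "cmod U" "lin_map T U f" "lin_map T U g"
    and "\<And>v w. v \<in> carrier V \<Longrightarrow> w \<in> carrier W \<Longrightarrow> f (v \<otimes>\<^sub>t w) = g (v \<otimes>\<^sub>t w)"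
    and "X \<in> carrier T"
  shows "f X = g X"
  using assms(5) by (induction rule: tensor_induct) (simp_all add: assms lin_mapD[OF assms(2)] lin_mapD[OF assms(3)])

lemma tens_comp_bilin:
  assumes "lin_map V V f" "lin_map W W g"
  shows "bilin V W T (\<lambda>v w. f v \<otimes>\<^sub>t g w)"
  using lin_mapD[OF assms(1)] lin_mapD[OF assms(2)] unfolding bilin_def
  by (intro conjI ballI lin_mapI) (simp_all add: tens_closed tens_add_left tens_add_right tens_smult_left tens_smult_right)

text \<open>The finite sum in the definition is itself a linear extension from basis elements. Its
  class is thus linear in the representative and agrees with the lifted map on basis elements, so it
  depends only on the tensor.\<close>

lemma tensor_map_eq:
  assumes f: "lin_map V V f" and g: "lin_map W W g" and X: "X \<in> carrier T"
  shows "tensor_map V W f g X = tlift T (\<lambda>v w. f v \<otimes>\<^sub>t g w) X"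
proof -
  let ?s = "\<lambda>p. \<Sum>(v, w)\<in>Poly_Mapping.keys p. Poly_Mapping.single (f v, g w) (Poly_Mapping.lookup p (v, w))"
  let ?t = "\<lambda>p. lin_ext F (\<lambda>(v, w). Poly_Mapping.single (f v, g w) 1) p"
  have c: "(\<lambda>(v, w). Poly_Mapping.single (f v, g w) (1::complex)) x \<in> carrier F"
    if "x \<in> carrier V \<times> carrier W" for x
    using that lin_mapD(1)[OF f] lin_mapD(1)[OF g] by auto
  have st: "?s p = ?t p" if "p \<in> carrier F" for p
    using that c by (subst lin_ext_free_vs) (auto intro!: sum.cong)
  note t = lin_ext_lin_map[OF free_vs_cmod, of "carrier V \<times> carrier W" "\<lambda>(v, w). Poly_Mapping.single (f v, g w) 1", OF c]
  note B = tens_comp_bilin[OF f g]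
  have "cls (?t p) = lin_ext T (\<lambda>(v, w). f v \<otimes>\<^sub>t g w) p" if "p \<in> carrier F" for p
  proof (rule free_vs_map_eq[OF T_cmod])
    show "lin_map F T (\<lambda>p. cls (?t p))"
      unfolding tensor_vs_eq by (rule lin_map_comp[OF cls_lin_map t])
    show "lin_map F T (lin_ext T (\<lambda>(v, w). f v \<otimes>\<^sub>t g w))"
      by (rule lin_ext_bilin[OF T_cmod B])
  next
    fix x assume x: "x \<in> carrier V \<times> carrier W"
    obtain v w where vw: "x = (v, w)" "v \<in> carrier V" "w \<in> carrier W" using x by auto
    have fg: "f v \<in> carrier V" "g w \<in> carrier W" using vw lin_mapD(1)[OF f] lin_mapD(1)[OF g] by auto
    have "?t (Poly_Mapping.single x 1) = Poly_Mapping.single (f v, g w) 1"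
      by (subst lin_ext_single[OF free_vs_cmod]) (use c[OF x] vw in \<open>auto\<close>)
    moreover have "lin_ext T (\<lambda>(v, w). f v \<otimes>\<^sub>t g w) (Poly_Mapping.single x 1) = f v \<otimes>\<^sub>t g w"
      by (subst lin_ext_single[OF T_cmod]) (use vw tens_closed[OF fg] in \<open>auto simp: ts\<close>)
    ultimately show "cls (?t (Poly_Mapping.single x 1)) =
        lin_ext T (\<lambda>(v, w). f v \<otimes>\<^sub>t g w) (Poly_Mapping.single x 1)"
      by (simp add: tens_eq)
  qed (use that in auto)
  then have *: "tensor_cls V W (?s p) = tlift T (\<lambda>v w. f v \<otimes>\<^sub>t g w) (cls p)" if "p \<in> carrier F" for p
    using that st by (simp add: tensor_cls_def tlift_cls[OF T_cmod B])
  obtain p where p: "p \<in> carrier F" "X = cls p"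
    using X quot_obtain unfolding tensor_vs_eq by blast
  have "(\<Union>q\<in>cls p. tensor_cls V W (?s q)) = tlift T (\<lambda>v w. f v \<otimes>\<^sub>t g w) (cls p)"
    by (rule cls_UN[OF p(1)]) (simp only: *)
  then show ?thesis by (simp add: tensor_map_def p(2))
qed

lemma tensor_map_lin_map:
  assumes "lin_map V V f" "lin_map W W g"
  shows "lin_map T T (tensor_map V W f g)"
  using tlift_lin_map[OF T_cmod tens_comp_bilin[OF assms]] tensor_map_eq[OF assms]
  by (auto simp: lin_map_def ts)

lemma tensor_map_tens:
  assumes "lin_map V V f" "lin_map W W g" "v \<in> carrier V" "w \<in> carrier W"
  shows "tensor_map V W f g (v \<otimes>\<^sub>t w) = f v \<otimes>\<^sub>t g w"
  using assms by (simp add: tensor_map_eq tens_closed tlift_tens[OF T_cmod tens_comp_bilin])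

end

subsection \<open>Realisation inside a free vector space\<close>

lemma pscale_vector_space: "vector_space (pscale :: complex \<Rightarrow> ('x \<Rightarrow>\<^sub>0 complex) \<Rightarrow> _)"
  by standard (simp_all add: pscale_simps)

text \<open>Every space is a retract of the free vector space on its underlying type. This transports
  computations with operators to a type on which addition is a total group operation.\<close>

lemma cmod_retract:
  fixes V :: "(complex, 'v, 'm) module_scheme"
  assumes "cmod V"
  obtains \<iota> :: "'v \<Rightarrow> ('v \<Rightarrow>\<^sub>0 complex)" and \<pi> :: "('v \<Rightarrow>\<^sub>0 complex) \<Rightarrow> 'v"
  where "lin_map V (free_vs UNIV) \<iota>" "lin_map (free_vs UNIV) V \<pi>"
    "\<And>v. v \<in> carrier V \<Longrightarrow> \<pi> (\<iota> v) = v"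
proof -
  note vs = cmod_simps[OF assms]
  interpret P: vector_space "pscale :: complex \<Rightarrow> ('v \<Rightarrow>\<^sub>0 complex) \<Rightarrow> _"
    by (rule pscale_vector_space)
  define f where "f v = (if v \<in> carrier V then v else \<zero>\<^bsub>V\<^esub>)" for v
  define \<pi> where "\<pi> = lin_ext V f"
  have \<pi>: "lin_map (free_vs UNIV) V \<pi>"
    unfolding \<pi>_def by (rule lin_ext_lin_map[OF assms]) (simp add: f_def vs)
  note \<pi>D = lin_mapD[OF \<pi>, simplified]
  have \<pi>s: "\<pi> (Poly_Mapping.single v 1) = v" if "v \<in> carrier V" for v
    unfolding \<pi>_def using that by (simp add: lin_ext_single[OF assms] f_def vs)
  \<comment> \<open>The kernel \<open>N\<close> of \<pi> is complemented: a basis \<open>B\<close>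
    of it is extended to a basis \<open>C\<close> of the free space. On the span \<open>S\<close> of
    \<open>C - B\<close> the map \<pi> is a bijection onto \<open>V\<close>, and the section is its
    inverse.\<close>
  define N where "N = {p. \<pi> p = \<zero>\<^bsub>V\<^esub>}"
  have N: "P.subspace N"
    unfolding N_def P.subspace_def
    using \<pi>D lin_map_zero[OF free_vs_cmod assms \<pi>] by (auto simp: vs)
  obtain B where B: "B \<subseteq> N" "P.independent B" "N \<subseteq> P.span B"
    using P.maximal_independent_subset[of N] by metis
  define C where "C = P.extend_basis B"
  have C: "B \<subseteq> C" "P.independent C" "P.span C = UNIV"
    unfolding C_def using P.extend_basis_superset[OF B(2)] P.independent_extend_basis[OF B(2)]
      P.span_extend_basis[OF B(2)] by auto
  define S where "S = P.span (C - B)"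
  have S: "P.subspace S" unfolding S_def by simp
  have sN: "P.span B = N" using B N by (metis P.span_minimal subset_antisym)
  have int: "p = 0" if "p \<in> S" "p \<in> N" for p
  proof -
    have p: "p \<in> P.span (C - B)" "p \<in> P.span B" using that sN by (simp_all add: S_def)
    then have "P.representation C p = P.representation B p"
      "P.representation C p = P.representation (C - B) p"
      using C by (auto intro!: P.representation_extend)
    then have "P.representation B p b = 0" for b
      using P.representation_ne_zero[of B p b] P.representation_ne_zero[of "C - B" p b] by auto
    then show ?thesis
      using P.sum_nonzero_representation_eq[OF B(2) p(2)] by simp
  qed
  have ex: "\<exists>s. s \<in> S \<and> \<pi> s = v" if "v \<in> carrier V" for v
  proof -
    have "Poly_Mapping.single v 1 \<in> P.span ((C - B) \<union> B)"
      using C by (simp add: Un_absorb2)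
    then obtain s n where "s \<in> S" "n \<in> N" "Poly_Mapping.single v 1 = s + n"
      unfolding P.span_Un S_def sN by auto
    then have "\<pi> (Poly_Mapping.single v 1) = \<pi> s"
      using \<pi>D by (simp add: N_def vs)
    with \<open>s \<in> S\<close> \<pi>s[OF that] show ?thesis by auto
  qed
  have uniq: "s = t" if "s \<in> S" "t \<in> S" "\<pi> s = \<pi> t" for s t
  proof -
    have "\<pi> (s + pscale (-1) t) = \<zero>\<^bsub>V\<^esub>"
      using that \<pi>D(1) cmod_sub_eq_zero[OF assms] by (simp only: \<pi>D(2,3))
    moreover have "s + pscale (-1) t \<in> S"
      using that S by (simp add: P.subspace_diff)
    ultimately show ?thesis using int[of "s + pscale (-1) t"] by (simp add: N_def pscale_minus)
  qed
  define \<iota> where "\<iota> v = (SOME s. s \<in> S \<and> \<pi> s = v)" for v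
  have \<iota>: "\<iota> v \<in> S" "\<pi> (\<iota> v) = v" if "v \<in> carrier V" for v
    using someI_ex[OF ex[OF that]] by (auto simp: \<iota>_def)
  have "lin_map V (free_vs UNIV) \<iota>"
  proof (rule lin_mapI; simp)
    fix x y assume "x \<in> carrier V" "y \<in> carrier V"
    then show "\<iota> (x \<oplus>\<^bsub>V\<^esub> y) = \<iota> x + \<iota> y"
      using \<iota> \<pi>D S by (intro uniq) (auto simp: vs P.subspace_add)
  next
    fix c x assume "x \<in> carrier V"
    then show "\<iota> (c \<odot>\<^bsub>V\<^esub> x) = pscale c (\<iota> x)"
      using \<iota> \<pi>D S by (intro uniq) (auto simp: vs P.subspace_scale)
  qed
  with \<pi> \<iota>(2) that show thesis by blast
qed

section \<open>Representations and Verma modules\<close>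

subsection \<open>The free associative algebra\<close>

lemma pscale_sum: "pscale c (sum f S) = (\<Sum>x\<in>S. pscale c (f x))"
proof (cases "finite S")
  case True
  then show ?thesis
    by (induction S) (auto simp: pscale_simps intro: poly_mapping_eqI)
qed (auto intro: poly_mapping_eqI)

lemma free_alg_simps [simp]:
  "carrier (free_alg X) = carrier (free_vs (lists X))" "zero (free_alg X) = 0"
  "add (free_alg X) = (+)" "smult (free_alg X) = pscale" "one (free_alg X) = Poly_Mapping.single [] 1"
  by (simp_all add: free_alg_def pscale_def[abs_def])

lemma free_alg_cmod: "cmod (free_alg X)"
  by (rule cmod_cong[OF free_vs_cmod[of "lists X"]]) simp_all

lemma keys_append_single:
  "u \<in> lists X \<Longrightarrow> v \<in> lists X \<Longrightarrow> Poly_Mapping.keys (Poly_Mapping.single (u @ v) (c :: complex)) \<subseteq> lists X"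
  by auto

lemma lin_ext_append_closed:
  assumes "q \<in> carrier (free_alg X)" "u \<in> lists X"
  shows "lin_ext (free_vs (lists X)) (\<lambda>v. Poly_Mapping.single (u @ v) 1) q \<in> carrier (free_vs (lists X))"
    and "lin_ext (free_vs (lists X)) (\<lambda>v. Poly_Mapping.single (v @ u) 1) q \<in> carrier (free_vs (lists X))"
  using assms
  by (intro lin_mapD(1)[OF lin_ext_lin_map[OF free_vs_cmod]]; simp)+

lemmas lin_ext_append_keys = lin_ext_append_closed[unfolded free_vs_simps mem_Collect_eq]

text \<open>Writing the product as a linear extension in either factor is what yields its linearity
  in both.\<close>

lemma free_alg_mult:
  assumes "p \<in> carrier (free_alg X)" "q \<in> carrier (free_alg X)"
  shows "p \<otimes>\<^bsub>free_alg X\<^esub> q = lin_ext (free_vs (lists X))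
      (\<lambda>u. lin_ext (free_vs (lists X)) (\<lambda>v. Poly_Mapping.single (u @ v) 1) q) p"
    and "p \<otimes>\<^bsub>free_alg X\<^esub> q = lin_ext (free_vs (lists X))
      (\<lambda>v. lin_ext (free_vs (lists X)) (\<lambda>u. Poly_Mapping.single (u @ v) 1) p) q"
proof -
  have k: "Poly_Mapping.keys p \<subseteq> lists X" "Poly_Mapping.keys q \<subseteq> lists X"
    using assms by auto
  have m: "p \<otimes>\<^bsub>free_alg X\<^esub> q = (\<Sum>u\<in>Poly_Mapping.keys p. \<Sum>v\<in>Poly_Mapping.keys q.
      Poly_Mapping.single (u @ v) (Poly_Mapping.lookup p u * Poly_Mapping.lookup q v))"
    by (simp add: free_alg_def)
  show "p \<otimes>\<^bsub>free_alg X\<^esub> q = lin_ext (free_vs (lists X))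
      (\<lambda>u. lin_ext (free_vs (lists X)) (\<lambda>v. Poly_Mapping.single (u @ v) 1) q) p"
  proof -
    have "lin_ext (free_vs (lists X)) (\<lambda>u. lin_ext (free_vs (lists X)) (\<lambda>v. Poly_Mapping.single (u @ v) 1) q) p =
      (\<Sum>u\<in>Poly_Mapping.keys p. pscale (Poly_Mapping.lookup p u)
        (lin_ext (free_vs (lists X)) (\<lambda>v. Poly_Mapping.single (u @ v) 1) q))"
      by (intro lin_ext_free_vs lin_ext_append_keys(1)[OF assms(2)] subsetD[OF k(1)])
    also have "\<dots> = p \<otimes>\<^bsub>free_alg X\<^esub> q"
      unfolding m
    proof (rule sum.cong[OF refl])
      fix u assume "u \<in> Poly_Mapping.keys p"
      with k have "u \<in> lists X" by auto
      then have "lin_ext (free_vs (lists X)) (\<lambda>v. Poly_Mapping.single (u @ v) 1) q =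
          (\<Sum>v\<in>Poly_Mapping.keys q. pscale (Poly_Mapping.lookup q v) (Poly_Mapping.single (u @ v) 1))"
        using k by (intro lin_ext_free_vs keys_append_single) auto
      then show "pscale (Poly_Mapping.lookup p u) (lin_ext (free_vs (lists X)) (\<lambda>v. Poly_Mapping.single (u @ v) 1) q) =
        (\<Sum>v\<in>Poly_Mapping.keys q. Poly_Mapping.single (u @ v) (Poly_Mapping.lookup p u * Poly_Mapping.lookup q v))"
        by (simp add: pscale_sum)
    qed
    finally show ?thesis ..
  qed
  show "p \<otimes>\<^bsub>free_alg X\<^esub> q = lin_ext (free_vs (lists X))
      (\<lambda>v. lin_ext (free_vs (lists X)) (\<lambda>u. Poly_Mapping.single (u @ v) 1) p) q"
  proof -
    have "lin_ext (free_vs (lists X)) (\<lambda>v. lin_ext (free_vs (lists X)) (\<lambda>u. Poly_Mapping.single (u @ v) 1) p) q =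
      (\<Sum>v\<in>Poly_Mapping.keys q. pscale (Poly_Mapping.lookup q v)
        (lin_ext (free_vs (lists X)) (\<lambda>u. Poly_Mapping.single (u @ v) 1) p))"
      by (intro lin_ext_free_vs lin_ext_append_keys(2)[OF assms(1)] subsetD[OF k(2)])
    also have "\<dots> = p \<otimes>\<^bsub>free_alg X\<^esub> q"
      unfolding m
    proof (subst sum.swap, rule sum.cong[OF refl])
      fix v assume "v \<in> Poly_Mapping.keys q"
      with k have "v \<in> lists X" by auto
      then have "lin_ext (free_vs (lists X)) (\<lambda>u. Poly_Mapping.single (u @ v) 1) p =
          (\<Sum>u\<in>Poly_Mapping.keys p. pscale (Poly_Mapping.lookup p u) (Poly_Mapping.single (u @ v) 1))"
        using k by (intro lin_ext_free_vs keys_append_single) auto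
      then show "pscale (Poly_Mapping.lookup q v) (lin_ext (free_vs (lists X)) (\<lambda>u. Poly_Mapping.single (u @ v) 1) p) =
        (\<Sum>u\<in>Poly_Mapping.keys p. Poly_Mapping.single (u @ v) (Poly_Mapping.lookup p u * Poly_Mapping.lookup q v))"
        by (simp add: pscale_sum mult.commute)
    qed
    finally show ?thesis ..
  qed
qed

lemma lin_map_cong:
  assumes "lin_map V W f" "\<And>x. x \<in> carrier V \<Longrightarrow> f x = g x"
    and "\<And>x y. x \<in> carrier V \<Longrightarrow> y \<in> carrier V \<Longrightarrow> x \<oplus>\<^bsub>V\<^esub> y \<in> carrier V"
    and "\<And>c x. x \<in> carrier V \<Longrightarrow> c \<odot>\<^bsub>V\<^esub> x \<in> carrier V"
  shows "lin_map V W g"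
  using assms by (simp add: lin_map_def)

lemma free_alg_mult_lin:
  assumes "q \<in> carrier (free_alg X)"
  shows "lin_map (free_vs (lists X)) (free_vs (lists X)) (\<lambda>p. p \<otimes>\<^bsub>free_alg X\<^esub> q)"
    and "lin_map (free_vs (lists X)) (free_vs (lists X)) (\<lambda>p. q \<otimes>\<^bsub>free_alg X\<^esub> p)"
proof -
  note c = cmod_simps(1,3)[OF free_vs_cmod[of "lists X"]]
  show "lin_map (free_vs (lists X)) (free_vs (lists X)) (\<lambda>p. p \<otimes>\<^bsub>free_alg X\<^esub> q)"
    by (rule lin_map_cong[OF lin_ext_lin_map[OF free_vs_cmod lin_ext_append_closed(1)[OF assms]]])
      (use assms c free_alg_mult(1)[of _ X q] in auto)
  show "lin_map (free_vs (lists X)) (free_vs (lists X)) (\<lambda>p. q \<otimes>\<^bsub>free_alg X\<^esub> p)"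
    by (rule lin_map_cong[OF lin_ext_lin_map[OF free_vs_cmod lin_ext_append_closed(2)[OF assms]]])
      (use assms c free_alg_mult(2)[of q X] in auto)
qed

lemma free_alg_mult_single:
  "Poly_Mapping.single u a \<otimes>\<^bsub>free_alg X\<^esub> Poly_Mapping.single v b = Poly_Mapping.single (u @ v) (a * b)"
  by (simp add: free_alg_def)

text \<open>Both sides of the associative law are linear in each factor, so one factor after the
  other is reduced to words, where the law is associativity of append.\<close>

lemma free_alg_ring: "ring (free_alg X)"
proof -
  let ?F = "free_vs (lists X)" and ?T = "free_alg X"
  note lin = free_alg_mult_lin
  have cl: "p \<otimes>\<^bsub>?T\<^esub> q \<in> carrier ?T" if "p \<in> carrier ?T" "q \<in> carrier ?T" for p q
    using lin_mapD(1)[OF lin(1)[OF that(2)], of p] that(1) by simp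
  have s: "Poly_Mapping.single u 1 \<in> carrier ?T" if "u \<in> lists X" for u
    using that by simp
  have "p \<otimes>\<^bsub>?T\<^esub> q \<otimes>\<^bsub>?T\<^esub> r = p \<otimes>\<^bsub>?T\<^esub> (q \<otimes>\<^bsub>?T\<^esub> r)"
    if p: "p \<in> carrier ?T" and q: "q \<in> carrier ?T" and r: "r \<in> carrier ?T" for p q r
  proof (rule free_vs_map_eq[OF free_vs_cmod, where X="lists X" and p=p])
    show "lin_map ?F ?F (\<lambda>p. p \<otimes>\<^bsub>?T\<^esub> q \<otimes>\<^bsub>?T\<^esub> r)"
      by (rule lin_map_comp[OF lin(1)[OF r] lin(1)[OF q]])
    show "lin_map ?F ?F (\<lambda>p. p \<otimes>\<^bsub>?T\<^esub> (q \<otimes>\<^bsub>?T\<^esub> r))"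
      by (rule lin(1)[OF cl[OF q r]])
    fix u assume u: "u \<in> lists X"
    show "Poly_Mapping.single u 1 \<otimes>\<^bsub>?T\<^esub> q \<otimes>\<^bsub>?T\<^esub> r = Poly_Mapping.single u 1 \<otimes>\<^bsub>?T\<^esub> (q \<otimes>\<^bsub>?T\<^esub> r)"
    proof (rule free_vs_map_eq[OF free_vs_cmod, where X="lists X" and p=q])
      show "lin_map ?F ?F (\<lambda>q. Poly_Mapping.single u 1 \<otimes>\<^bsub>?T\<^esub> q \<otimes>\<^bsub>?T\<^esub> r)"
        by (rule lin_map_comp[OF lin(1)[OF r] lin(2)[OF s[OF u]]])
      show "lin_map ?F ?F (\<lambda>q. Poly_Mapping.single u 1 \<otimes>\<^bsub>?T\<^esub> (q \<otimes>\<^bsub>?T\<^esub> r))"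
        by (rule lin_map_comp[OF lin(2)[OF s[OF u]] lin(1)[OF r]])
      fix v assume v: "v \<in> lists X"
      show "Poly_Mapping.single u 1 \<otimes>\<^bsub>?T\<^esub> Poly_Mapping.single v 1 \<otimes>\<^bsub>?T\<^esub> r =
          Poly_Mapping.single u 1 \<otimes>\<^bsub>?T\<^esub> (Poly_Mapping.single v 1 \<otimes>\<^bsub>?T\<^esub> r)"
      proof (rule free_vs_map_eq[OF free_vs_cmod, where X="lists X" and p=r])
        show "lin_map ?F ?F (\<lambda>r. Poly_Mapping.single u 1 \<otimes>\<^bsub>?T\<^esub> Poly_Mapping.single v 1 \<otimes>\<^bsub>?T\<^esub> r)"
          by (rule lin(2)[OF cl[OF s[OF u] s[OF v]]])
        show "lin_map ?F ?F (\<lambda>r. Poly_Mapping.single u 1 \<otimes>\<^bsub>?T\<^esub> (Poly_Mapping.single v 1 \<otimes>\<^bsub>?T\<^esub> r))"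
          by (rule lin_map_comp[OF lin(2)[OF s[OF u]] lin(2)[OF s[OF v]]])
      qed (use r in \<open>simp_all add: free_alg_mult_single\<close>)
    qed (use q in simp_all)
  qed (use p in simp_all)
  note assoc = this
  have o: "Poly_Mapping.single [] 1 \<in> carrier ?T" by simp
  have one: "\<one>\<^bsub>?T\<^esub> \<otimes>\<^bsub>?T\<^esub> p = p" "p \<otimes>\<^bsub>?T\<^esub> \<one>\<^bsub>?T\<^esub> = p" if p: "p \<in> carrier ?T" for p
    using free_vs_map_eq[OF free_vs_cmod lin(2)[OF o] lin_map_id, of p] p
      free_vs_map_eq[OF free_vs_cmod lin(1)[OF o] lin_map_id, of p]
    by (simp_all add: free_alg_mult_single)
  show ?thesis
  proof (rule ringI)
    show "abelian_group ?T" using free_alg_cmod by (rule Module.module.axioms(2))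
    show "Group.monoid ?T" using o by (intro monoidI cl assoc one) (auto simp del: free_vs_simps)
    fix p q r assume "p \<in> carrier ?T" "q \<in> carrier ?T" "r \<in> carrier ?T"
    then show "(p \<oplus>\<^bsub>?T\<^esub> q) \<otimes>\<^bsub>?T\<^esub> r = p \<otimes>\<^bsub>?T\<^esub> r \<oplus>\<^bsub>?T\<^esub> q \<otimes>\<^bsub>?T\<^esub> r"
      "r \<otimes>\<^bsub>?T\<^esub> (p \<oplus>\<^bsub>?T\<^esub> q) = r \<otimes>\<^bsub>?T\<^esub> p \<oplus>\<^bsub>?T\<^esub> r \<otimes>\<^bsub>?T\<^esub> q"
      using lin_mapD(2)[OF lin(1)[of r X], of p q] lin_mapD(2)[OF lin(2)[of r X], of p q] by simp_all
  qed
qed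

text \<open>Scalars act as multiples of the empty word, so a two-sided ideal is a subspace. This
  lets the enveloping algebra be treated as a quotient of vector spaces as well as of rings.\<close>

lemma free_alg_smult_eq:
  assumes "p \<in> carrier (free_alg X)"
  shows "pscale c p = Poly_Mapping.single [] c \<otimes>\<^bsub>free_alg X\<^esub> p"
proof -
  have "Poly_Mapping.single [] c \<in> carrier (free_alg X)" by simp
  from free_alg_mult_lin(2)[OF this] have l1: "lin_map (free_vs (lists X)) (free_vs (lists X))
      (\<lambda>p. Poly_Mapping.single [] c \<otimes>\<^bsub>free_alg X\<^esub> p)" .
  have l2: "lin_map (free_vs (lists X)) (free_vs (lists X)) (\<lambda>p. pscale c p)"
    using lin_map_smult[OF free_vs_cmod lin_map_id, of "lists X" c] by simp
  show ?thesis
    by (rule free_vs_map_eq[OF free_vs_cmod l2 l1]) (use assms in \<open>simp_all add: free_alg_mult_single\<close>)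
qed

subsection \<open>Representations\<close>

text \<open>Enveloping algebras, representations and induced modules are developed from these data,
  so that all of it applies to the current algebra as soon as its bracket is shown to be
  closed.\<close>

locale prelie =
  fixes L :: "('l, 'm) lie_algebra_rec_scheme"
  assumes L: "cmod L"
    and brkt_closed: "x \<in> carrier L \<Longrightarrow> y \<in> carrier L \<Longrightarrow> brkt L x y \<in> carrier L"

definition lrep :: "('l, 'm) lie_algebra_rec_scheme \<Rightarrow> ('l, 'v, 'n) lie_rep_scheme \<Rightarrow> bool" where
  "lrep L M \<longleftrightarrow> cmod M \<and> (\<forall>x\<in>carrier L. lin_map M M (act M x)) \<and>
     (\<forall>m\<in>carrier M. lin_map L M (\<lambda>x. act M x m)) \<and>
     (\<forall>x\<in>carrier L. \<forall>y\<in>carrier L. \<forall>m\<in>carrier M.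
        act M x (act M y m) = act M y (act M x m) \<oplus>\<^bsub>M\<^esub> act M (brkt L x y) m)"

lemma lrepD:
  assumes "lrep L M"
  shows "cmod M" and "x \<in> carrier L \<Longrightarrow> lin_map M M (act M x)"
    and "m \<in> carrier M \<Longrightarrow> lin_map L M (\<lambda>x. act M x m)"
    and "x \<in> carrier L \<Longrightarrow> y \<in> carrier L \<Longrightarrow> m \<in> carrier M \<Longrightarrow>
        act M x (act M y m) = act M y (act M x m) \<oplus>\<^bsub>M\<^esub> act M (brkt L x y) m"
    and "x \<in> carrier L \<Longrightarrow> m \<in> carrier M \<Longrightarrow> act M x m \<in> carrier M"
proof -
  show l: "x \<in> carrier L \<Longrightarrow> lin_map M M (act M x)"
    using assms unfolding lrep_def by blast
  show "x \<in> carrier L \<Longrightarrow> m \<in> carrier M \<Longrightarrow> act M x m \<in> carrier M"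
    using lin_mapD(1)[OF l] .
qed (use assms in \<open>unfold lrep_def, blast+\<close>)

definition rep_hom :: "('l, 'm) lie_algebra_rec_scheme \<Rightarrow> ('l, 'v, 'n) lie_rep_scheme \<Rightarrow>
    ('l, 'w, 'k) lie_rep_scheme \<Rightarrow> ('v \<Rightarrow> 'w) \<Rightarrow> bool" where
  "rep_hom L M N f \<longleftrightarrow> lin_map M N f \<and> (\<forall>x\<in>carrier L. \<forall>m\<in>carrier M. f (act M x m) = act N x (f m))"

definition cyclic_rep :: "('l, 'm) lie_algebra_rec_scheme \<Rightarrow> ('l, 'v, 'n) lie_rep_scheme \<Rightarrow> 'v \<Rightarrow> bool" where
  "cyclic_rep L M v \<longleftrightarrow> v \<in> carrier M \<and> (\<forall>K. rep_submodule L M K \<and> v \<in> K \<longrightarrow> K = carrier M)"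

lemma rep_submoduleD:
  assumes "rep_submodule L M K"
  shows "lin_subspace M K" "x \<in> carrier L \<Longrightarrow> m \<in> K \<Longrightarrow> act M x m \<in> K"
  using assms by (auto simp: rep_submodule_def)

lemma rep_submodule_subset: "cmod M \<Longrightarrow> rep_submodule L M K \<Longrightarrow> K \<subseteq> carrier M"
  by (simp add: rep_submodule_def lin_subspace_iff)

lemma rep_submodule_carrier: "lrep L M \<Longrightarrow> rep_submodule L M (carrier M)"
  by (simp add: rep_submodule_def lin_subspace_carrier lrepD)

lemma rep_submodule_Inter:
  assumes "lrep L M" "\<And>K. K \<in> \<K> \<Longrightarrow> rep_submodule L M K" "\<K> \<noteq> {}"
  shows "rep_submodule L M (\<Inter> \<K>)"
  using assms(2,3) unfolding rep_submodule_def lin_subspace_iff[OF lrepD(1)[OF assms(1)]] by blast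

lemma gen_submodule_rep:
  assumes "lrep L M" "S \<subseteq> carrier M"
  shows "rep_submodule L M (gen_submodule L M S)" "S \<subseteq> gen_submodule L M S"
    "rep_submodule L M K \<Longrightarrow> S \<subseteq> K \<Longrightarrow> gen_submodule L M S \<subseteq> K"
proof -
  show "rep_submodule L M (gen_submodule L M S)"
    unfolding gen_submodule_def using rep_submodule_carrier[OF assms(1)] assms
    by (intro rep_submodule_Inter) auto
qed (auto simp: gen_submodule_def)

lemma rep_hom_vimage:
  assumes "lrep L M" "lrep L N" "rep_hom L M N f" "rep_submodule L N K"
  shows "rep_submodule L M {m\<in>carrier M. f m \<in> K}"
  using lin_map_vimage[OF lrepD(1)[OF assms(1)] lrepD(1)[OF assms(2)], of f K] assms
  by (auto simp: rep_submodule_def rep_hom_def lrepD(5))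

lemma rep_hom_kernel:
  assumes "lrep L M" "lrep L N" "rep_hom L M N f"
  shows "rep_submodule L M {m\<in>carrier M. f m = \<zero>\<^bsub>N\<^esub>}"
proof -
  have "rep_submodule L N {\<zero>\<^bsub>N\<^esub>}"
    using lin_subspace_zero[OF lrepD(1)[OF assms(2)]] lin_map_zero[OF lrepD(1)[OF assms(2)] lrepD(1)[OF assms(2)] lrepD(2)[OF assms(2)]]
    by (auto simp: rep_submodule_def)
  from rep_hom_vimage[OF assms this] show ?thesis by simp
qed

lemma quot_rep_simps [simp]:
  "carrier (quot_rep M K) = carrier (quot_vs M K)" "zero (quot_rep M K) = zero (quot_vs M K)"
  "add (quot_rep M K) = add (quot_vs M K)" "smult (quot_rep M K) = smult (quot_vs M K)"
  by (simp_all add: quot_rep_def)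

lemma lin_map_carrier_cong:
  assumes "carrier V' = carrier V" "add V' = add V" "smult V' = smult V"
    and "carrier W' = carrier W" "add W' = add W" "smult W' = smult W"
  shows "lin_map V' W' f = lin_map V W f"
  by (simp add: lin_map_def assms)

locale qrep = prelie L for L :: "('l, 'm) lie_algebra_rec_scheme" +
  fixes M :: "('l, 'v, 'n) lie_rep_scheme" and K :: "'v set"
  assumes M: "lrep L M" and KM: "rep_submodule L M K"
begin

sublocale csub M K
  using M KM by (simp add: csub_def lrepD rep_submodule_def)

abbreviation QR where "QR \<equiv> quot_rep M K"

lemma QR_obtain:
  assumes "X \<in> carrier QR" obtains m where "m \<in> carrier M" "X = cls m"
  using assms that by (auto simp: quot_carrier)

lemma QR_cmod: "cmod QR"
  by (rule cmod_cong[OF quot_cmod]) simp_all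

lemma QR_lin_map: "lin_map QR W f = lin_map Q W f" "lin_map W QR g = lin_map W Q g"
  by (intro lin_map_carrier_cong; simp)+

lemma QR_act: 
  assumes "x \<in> carrier L" "m \<in> carrier M" shows "act QR x (cls m) = cls (act M x m)"
proof -
  have "cls (act M x y) = cls (act M x m)" if "y \<in> carrier M" "cls y = cls m" for y
  proof (rule lin_map_cls_cong[OF quot_cmod lin_map_comp[OF cls_lin_map lrepD(2)[OF M assms(1)]]])
    fix k assume "k \<in> K"
    then show "cls (act M x k) = \<zero>\<^bsub>Q\<^esub>"
      using rep_submoduleD(2)[OF KM assms(1)] Ks by (subst cls_zero_iff) auto
  qed (use that assms in auto)
  then show ?thesis
    using cls_UN[OF assms(2), of "\<lambda>y. cls (act M x y)"] by (simp add: quot_rep_def)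
qed

lemma QR_lrep: "lrep L QR"
  unfolding lrep_def
proof (intro conjI ballI QR_cmod)
  note a = lin_mapD[OF lrepD(2)[OF M]] lin_mapD[OF lrepD(3)[OF M]]
  note l = cmod_simps(1,3)[OF L] brkt_closed
  show "lin_map QR QR (act QR x)" if "x \<in> carrier L" for x
    using that by (intro lin_mapI; simp; elim quot_obtain; simp add: QR_act quot_simps a vs)
  show "lin_map L QR (\<lambda>x. act QR x X)" if X: "X \<in> carrier QR" for X
  proof -
    obtain m where "m \<in> carrier M" "X = cls m" using X by (rule QR_obtain)
    then show ?thesis by (intro lin_mapI) (simp_all add: QR_act quot_simps a l)
  qed
  fix x y X assume x: "x \<in> carrier L" "y \<in> carrier L" "X \<in> carrier QR"
  obtain m where "m \<in> carrier M" "X = cls m" using x(3) by (rule QR_obtain)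
  with x show "act QR x (act QR y X) = act QR y (act QR x X) \<oplus>\<^bsub>QR\<^esub> act QR (brkt L x y) X"
    using lrepD(4)[OF M x(1,2)] by (simp add: QR_act quot_simps a l)
qed

lemma cls_rep_hom: "rep_hom L M QR cls"
  using cls_lin_map by (simp add: rep_hom_def QR_lin_map QR_act)

lemma qlift_rep_hom:
  assumes "lrep L N" "rep_hom L M N f" "\<And>x. x \<in> K \<Longrightarrow> f x = \<zero>\<^bsub>N\<^esub>"
  shows "rep_hom L QR N (qlift f)" "\<And>x. x \<in> carrier M \<Longrightarrow> qlift f (cls x) = f x"
proof -
  have f: "lin_map M N f" using assms(2) by (simp add: rep_hom_def)
  note q = qlift_lin_map[OF lrepD(1)[OF assms(1)] f assms(3)]
  show "\<And>x. x \<in> carrier M \<Longrightarrow> qlift f (cls x) = f x" by (rule q(2))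
  show "rep_hom L QR N (qlift f)"
    unfolding rep_hom_def QR_lin_map
  proof (intro conjI ballI q(1))
    fix x X assume "x \<in> carrier L" "X \<in> carrier QR"
    then show "qlift f (act QR x X) = act N x (qlift f X)"
      using assms(2) by (auto elim!: quot_obtain simp: QR_act q(2) lrepD(5)[OF M] rep_hom_def)
  qed
qed

lemma QR_cyclic:
  assumes "cyclic_rep L M v" shows "cyclic_rep L QR (cls v)"
  unfolding cyclic_rep_def
proof (intro conjI allI impI)
  show "cls v \<in> carrier QR" using assms by (simp add: cyclic_rep_def quot_closed)
  fix K' assume K': "rep_submodule L QR K' \<and> cls v \<in> K'"
  have "{m\<in>carrier M. cls m \<in> K'} = carrier M"
    using rep_hom_vimage[OF M QR_lrep cls_rep_hom, of K'] K' assms by (auto simp: cyclic_rep_def)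
  then show "K' = carrier QR"
    using rep_submodule_subset[OF QR_cmod, of L K'] K' by (auto simp: quot_carrier)
qed

end

subsection \<open>The universal enveloping algebra\<close>

context prelie
begin

abbreviation TA where "TA \<equiv> free_alg (carrier L)"
abbreviation UI where "UI \<equiv> uea_ideal L"
abbreviation U where "U \<equiv> uea L"
abbreviation ux where "ux \<equiv> uea_of L"
abbreviation sg :: "'l list \<Rightarrow> 'l list \<Rightarrow>\<^sub>0 complex" where "sg w \<equiv> Poly_Mapping.single w 1"

definition uea_gens :: "('l list \<Rightarrow>\<^sub>0 complex) set" where
  "uea_gens = {sg [x \<oplus>\<^bsub>L\<^esub> y] - sg [x] - sg [y] | x y. x \<in> carrier L \<and> y \<in> carrier L} \<union>
      {sg [c \<odot>\<^bsub>L\<^esub> x] - Poly_Mapping.single [x] c | c x. x \<in> carrier L} \<union>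
      {sg [x, y] - sg [y, x] - sg [brkt L x y] | x y. x \<in> carrier L \<and> y \<in> carrier L}"

lemmas ls = cmod_simps[OF L] cmod_ac[OF L] brkt_closed

lemma TA_diff: "p \<in> carrier TA \<Longrightarrow> q \<in> carrier TA \<Longrightarrow> p - q \<in> carrier TA"
  unfolding free_alg_simps by (rule free_vs_diff)

lemma TA_single: "set w \<subseteq> carrier L \<Longrightarrow> Poly_Mapping.single w c \<in> carrier TA"
  by auto

lemma uea_gens_subset: "uea_gens \<subseteq> carrier TA"
  unfolding uea_gens_def
  by (intro subsetI, elim UnE CollectE exE conjE; hypsubst; intro TA_diff TA_single) (simp_all add: ls)

lemma uea_ideal_eq: "UI = genideal TA uea_gens"
  by (simp add: uea_ideal_def uea_gens_def)

sublocale TA: ring TA by (rule free_alg_ring)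

sublocale UI: ideal UI TA
  unfolding uea_ideal_eq by (rule TA.genideal_ideal[OF uea_gens_subset])

lemma uea_gens_UI: "r \<in> uea_gens \<Longrightarrow> r \<in> UI"
  unfolding uea_ideal_eq using TA.genideal_self[OF uea_gens_subset] by blast

lemma UI_least: "ideal K TA \<Longrightarrow> uea_gens \<subseteq> K \<Longrightarrow> UI \<subseteq> K"
  unfolding uea_ideal_eq by (rule TA.genideal_minimal)

sublocale Us: csub TA UI
proof (unfold csub_def, intro conjI)
  show "cmod TA" by (rule free_alg_cmod)
  show "lin_subspace TA UI"
    unfolding lin_subspace_iff[OF free_alg_cmod]
  proof (intro conjI allI ballI)
    fix c p assume p: "p \<in> UI"
    then have "p \<in> carrier TA" by (rule UI.Icarr)
    moreover have "Poly_Mapping.single [] c \<in> carrier TA" by simp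
    ultimately show "c \<odot>\<^bsub>TA\<^esub> p \<in> UI"
      using UI.I_l_closed[OF p] free_alg_smult_eq[of p] by (metis free_alg_simps(4))
  qed (use UI.Icarr UI.zero_closed UI.a_closed in auto)
qed

lemma U_simps [simp]:
  "carrier U = carrier (quot_vs TA UI)" "zero U = zero (quot_vs TA UI)"
  "add U = add (quot_vs TA UI)" "smult U = smult (quot_vs TA UI)"
  by (simp_all add: uea_def Let_def FactRing_def quot_vs_def)

lemma U_cmod: "cmod U"
  by (rule cmod_cong[OF Us.quot_cmod]) simp_all

lemmas us = cmod_simps[OF U_cmod] cmod_ac[OF U_cmod]

lemma U_mult: "p \<in> carrier TA \<Longrightarrow> q \<in> carrier TA \<Longrightarrow> Us.cls p \<otimes>\<^bsub>U\<^esub> Us.cls q = Us.cls (p \<otimes>\<^bsub>TA\<^esub> q)"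
  by (simp add: uea_def Let_def FactRing_def UI.rcoset_mult_add)

lemma U_one: "\<one>\<^bsub>U\<^esub> = Us.cls (sg [])"
  by (simp add: uea_def Let_def FactRing_def)

lemma U_obtain:
  assumes "u \<in> carrier U" obtains p where "p \<in> carrier TA" "u = Us.cls p"
  using assms that unfolding U_simps Us.quot_carrier by blast

lemma cls_closed: "p \<in> carrier TA \<Longrightarrow> Us.cls p \<in> carrier U"
  by (simp add: Us.quot_closed del: free_alg_simps)

lemma U_mult_closed: "u \<in> carrier U \<Longrightarrow> w \<in> carrier U \<Longrightarrow> u \<otimes>\<^bsub>U\<^esub> w \<in> carrier U"
  by (elim U_obtain) (simp add: U_mult cls_closed TA.m_closed del: free_alg_simps U_simps)

lemma U_mult_assoc:
  "u \<in> carrier U \<Longrightarrow> w \<in> carrier U \<Longrightarrow> z \<in> carrier U \<Longrightarrow> u \<otimes>\<^bsub>U\<^esub> w \<otimes>\<^bsub>U\<^esub> z = u \<otimes>\<^bsub>U\<^esub> (w \<otimes>\<^bsub>U\<^esub> z)"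
  by (elim U_obtain) (simp add: U_mult TA.m_closed TA.m_assoc del: free_alg_simps U_simps)

lemma U_mult_one: "u \<in> carrier U \<Longrightarrow> \<one>\<^bsub>U\<^esub> \<otimes>\<^bsub>U\<^esub> u = u" "u \<in> carrier U \<Longrightarrow> u \<otimes>\<^bsub>U\<^esub> \<one>\<^bsub>U\<^esub> = u"
  using TA.l_one TA.r_one TA.one_closed by (auto elim!: U_obtain simp: U_mult U_one simp del: U_simps)

lemma U_one_closed: "\<one>\<^bsub>U\<^esub> \<in> carrier U"
  unfolding U_one by (rule cls_closed) simp

lemma U_cls_lin:
  "p \<in> carrier TA \<Longrightarrow> q \<in> carrier TA \<Longrightarrow> Us.cls p \<oplus>\<^bsub>U\<^esub> Us.cls q = Us.cls (p + q)"
  "p \<in> carrier TA \<Longrightarrow> c \<odot>\<^bsub>U\<^esub> Us.cls p = Us.cls (pscale c p)"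
  using Us.quot_add[of p q] Us.quot_smult[of p c] by simp_all

lemma U_mult_lin:
  assumes "u \<in> carrier U"
  shows "lin_map U U (\<lambda>w. u \<otimes>\<^bsub>U\<^esub> w)" "lin_map U U (\<lambda>w. w \<otimes>\<^bsub>U\<^esub> u)"
proof -
  obtain p where p: "p \<in> carrier TA" "u = Us.cls p" using assms U_obtain by blast
  note l = lin_mapD[OF free_alg_mult_lin(1)[OF p(1)]] lin_mapD[OF free_alg_mult_lin(2)[OF p(1)]]
  note cl = cmod_simps(1,3)[OF free_alg_cmod[of "carrier L"], unfolded free_alg_simps(3,4)]
  note * = U_mult cls_closed TA.m_closed U_cls_lin cl l[unfolded free_alg_simps(1)[symmetric] free_vs_simps(3,4)]
  show "lin_map U U (\<lambda>w. u \<otimes>\<^bsub>U\<^esub> w)"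
    unfolding p(2) by (rule lin_mapI; elim U_obtain; simp add: * p(1) del: free_alg_simps U_simps)
  show "lin_map U U (\<lambda>w. w \<otimes>\<^bsub>U\<^esub> u)"
    unfolding p(2) by (rule lin_mapI; elim U_obtain; simp add: * p(1) del: free_alg_simps U_simps)
qed

lemma ux_eq: "ux x = Us.cls (sg [x])"
  by (simp add: uea_of_def)

lemma ux_closed: "x \<in> carrier L \<Longrightarrow> ux x \<in> carrier U"
  unfolding ux_eq by (intro cls_closed TA_single) simp

lemma cls_diff_eq:
  assumes "p - q \<in> UI" "p \<in> carrier TA" "q \<in> carrier TA" shows "Us.cls p = Us.cls q"
  using assms Us.cls_eq_iff[of p q] by (simp add: pscale_minus)

lemma TA_add: "p \<in> carrier TA \<Longrightarrow> q \<in> carrier TA \<Longrightarrow> p + q \<in> carrier TA"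
  using TA.a_closed by simp

lemma ux_lin: "lin_map L U ux"
proof (rule lin_mapI)
  fix x y assume xy: "x \<in> carrier L" "y \<in> carrier L"
  have "sg [x \<oplus>\<^bsub>L\<^esub> y] - sg [x] - sg [y] \<in> uea_gens"
    using xy unfolding uea_gens_def by blast
  then have "sg [x \<oplus>\<^bsub>L\<^esub> y] - (sg [x] + sg [y]) \<in> UI"
    by (simp add: uea_gens_UI diff_diff_eq[symmetric])
  then have "Us.cls (sg [x \<oplus>\<^bsub>L\<^esub> y]) = Us.cls (sg [x] + sg [y])"
    by (rule cls_diff_eq) (intro TA_add TA_single; simp add: xy ls)+
  then show "ux (x \<oplus>\<^bsub>L\<^esub> y) = ux x \<oplus>\<^bsub>U\<^esub> ux y"
    using U_cls_lin(1)[OF TA_single TA_single, of "[x]" "[y]" 1 1] xy by (simp add: ux_eq)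
next
  fix c x assume x: "x \<in> carrier L"
  have "sg [c \<odot>\<^bsub>L\<^esub> x] - Poly_Mapping.single [x] c \<in> uea_gens"
    using x unfolding uea_gens_def by blast
  then have "Us.cls (sg [c \<odot>\<^bsub>L\<^esub> x]) = Us.cls (Poly_Mapping.single [x] c)"
    using x ls by (intro cls_diff_eq[OF uea_gens_UI] TA_single) auto
  then show "ux (c \<odot>\<^bsub>L\<^esub> x) = c \<odot>\<^bsub>U\<^esub> ux x"
    using U_cls_lin(2)[OF TA_single, of "[x]" c 1] x by (simp add: ux_eq)
qed (rule ux_closed)

lemma ux_brkt:
  assumes "x \<in> carrier L" "y \<in> carrier L"
  shows "ux x \<otimes>\<^bsub>U\<^esub> ux y = ux y \<otimes>\<^bsub>U\<^esub> ux x \<oplus>\<^bsub>U\<^esub> ux (brkt L x y)"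
proof -
  have "sg [x, y] - sg [y, x] - sg [brkt L x y] \<in> uea_gens"
    using assms unfolding uea_gens_def by blast
  then have "sg [x, y] - (sg [y, x] + sg [brkt L x y]) \<in> UI"
    by (simp add: uea_gens_UI diff_diff_eq[symmetric])
  then have "Us.cls (sg [x, y]) = Us.cls (sg [y, x] + sg [brkt L x y])"
    by (rule cls_diff_eq) (intro TA_add TA_single; simp add: assms ls)+
  moreover have "Us.cls (sg [y, x] + sg [brkt L x y]) = Us.cls (sg [y, x]) \<oplus>\<^bsub>U\<^esub> ux (brkt L x y)"
    unfolding ux_eq using assms ls by (intro U_cls_lin(1)[symmetric] TA_single) auto
  moreover have "ux x \<otimes>\<^bsub>U\<^esub> ux y = Us.cls (sg [x, y])" "ux y \<otimes>\<^bsub>U\<^esub> ux x = Us.cls (sg [y, x])"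
    unfolding ux_eq using assms U_mult[OF TA_single TA_single, of "[x]" "[y]" 1 1]
      U_mult[OF TA_single TA_single, of "[y]" "[x]" 1 1] by (simp_all add: free_alg_mult_single)
  ultimately show ?thesis by simp
qed

text \<open>The enveloping algebra is spanned by words, and a word arises from the unit by repeated
  left multiplication with elements of \<open>L\<close>.\<close>

lemma U_induct [consumes 1, case_names zero add smult one mult]:
  assumes "u \<in> carrier U"
    and "P \<zero>\<^bsub>U\<^esub>"
    and "\<And>u w. u \<in> carrier U \<Longrightarrow> w \<in> carrier U \<Longrightarrow> P u \<Longrightarrow> P w \<Longrightarrow> P (u \<oplus>\<^bsub>U\<^esub> w)"
    and "\<And>c u. u \<in> carrier U \<Longrightarrow> P u \<Longrightarrow> P (c \<odot>\<^bsub>U\<^esub> u)"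
    and "P \<one>\<^bsub>U\<^esub>"
    and "\<And>x u. x \<in> carrier L \<Longrightarrow> u \<in> carrier U \<Longrightarrow> P u \<Longrightarrow> P (ux x \<otimes>\<^bsub>U\<^esub> u)"
  shows "P u"
proof -
  have w: "P (Us.cls (sg w))" if "set w \<subseteq> carrier L" for w
    using that
  proof (induction w)
    case Nil then show ?case using assms(5) by (simp add: U_one)
  next
    case (Cons x w)
    then have "P (ux x \<otimes>\<^bsub>U\<^esub> Us.cls (sg w))"
      by (intro assms(6) cls_closed TA_single) auto
    then show ?case
      using Cons.prems U_mult[OF TA_single TA_single, of "[x]" w 1 1] by (simp add: ux_eq free_alg_mult_single)
  qed
  have "P (Us.cls p)" if "Poly_Mapping.keys p \<subseteq> lists (carrier L)" for p
    using that
  proof (induction rule: free_vs_induct)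
    case zero then show ?case using assms(2) Us.quot_zero by simp
  next
    case (add p q)
    then show ?case using assms(3)[of "Us.cls p" "Us.cls q"] U_cls_lin(1)[of p q] cls_closed by simp
  next
    case (smult c p)
    then show ?case using assms(4)[of "Us.cls p" c] U_cls_lin(2)[of p c] cls_closed by simp
  qed (use w in \<open>auto simp: in_lists_conv_set subset_iff\<close>)
  then show ?thesis using assms(1) by (elim U_obtain) simp
qed

subsection \<open>Evaluation of words in a representation\<close>

lemma wact_closed: "lrep L M \<Longrightarrow> m \<in> carrier M \<Longrightarrow> set w \<subseteq> carrier L \<Longrightarrow> foldr (act M) w m \<in> carrier M"
  by (induction w) (auto simp: lrepD(5))

lemma wact_lin: "lrep L M \<Longrightarrow> set w \<subseteq> carrier L \<Longrightarrow> lin_map M M (foldr (act M) w)"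
proof (induction w)
  case Nil then show ?case using lin_map_id[of M] by (simp add: id_def)
next
  case (Cons x w)
  then show ?case using lin_map_comp[OF lrepD(2)[OF Cons.prems(1), of x], of M "foldr (act M) w"]
    by (simp add: comp_def)
qed

text \<open>\<open>ev M m\<close> is the orbit map \<open>p \<mapsto> p m\<close> on the free
  algebra; \<open>uev M m\<close> is the map it induces on the enveloping algebra.\<close>

definition ev :: "('l, 'v, 'n) lie_rep_scheme \<Rightarrow> 'v \<Rightarrow> ('l list \<Rightarrow>\<^sub>0 complex) \<Rightarrow> 'v" where
  "ev M m = lin_ext M (\<lambda>w. foldr (act M) w m)"

definition uev :: "('l, 'v, 'n) lie_rep_scheme \<Rightarrow> 'v \<Rightarrow> ('l list \<Rightarrow>\<^sub>0 complex) set \<Rightarrow> 'v" where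
  "uev M m = Us.qlift (ev M m)"

context
  fixes M :: "('l, 'v, 'n) lie_rep_scheme"
  assumes M: "lrep L M"
begin

lemmas ms = cmod_simps[OF lrepD(1)[OF M]] cmod_ac[OF lrepD(1)[OF M]]

lemma ev_lin: "m \<in> carrier M \<Longrightarrow> lin_map TA M (ev M m)"
  unfolding ev_def using lin_ext_lin_map[OF lrepD(1)[OF M], of "lists (carrier L)" "\<lambda>w. foldr (act M) w m"]
    wact_closed[OF M]
  by (subst lin_map_carrier_cong[where V="free_vs (lists (carrier L))" and W=M]) (auto simp: in_lists_conv_set subset_iff)

lemma ev_word: "m \<in> carrier M \<Longrightarrow> set w \<subseteq> carrier L \<Longrightarrow> ev M m (Poly_Mapping.single w c) = c \<odot>\<^bsub>M\<^esub> foldr (act M) w m"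
  unfolding ev_def using wact_closed[OF M] by (intro lin_ext_single lrepD(1)[OF M])

lemma ev_lin_vec: "p \<in> carrier TA \<Longrightarrow> lin_map M M (\<lambda>m. ev M m p)"
proof -
  assume "p \<in> carrier TA"
  then have "Poly_Mapping.keys p \<subseteq> lists (carrier L)" by simp
  then show ?thesis
  proof (induction rule: free_vs_induct)
    case zero
    show ?case using lin_map_const_zero[OF lrepD(1)[OF M]] lrepD(1)[OF M] by (simp add: ev_def)
  next
    case (add p q)
    have "lin_map M M (\<lambda>m. ev M m p \<oplus>\<^bsub>M\<^esub> ev M m q)"
      by (rule lin_map_add[OF lrepD(1)[OF M] add(3,4)])
    then show ?case
      by (rule lin_map_cong) (use add lin_mapD(2)[OF ev_lin, of _ p q] in \<open>auto simp: ms\<close>)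
  next
    case (smult c p)
    have "lin_map M M (\<lambda>m. c \<odot>\<^bsub>M\<^esub> ev M m p)"
      by (rule lin_map_smult[OF lrepD(1)[OF M] smult(2)])
    then show ?case
      by (rule lin_map_cong) (use smult lin_mapD(3)[OF ev_lin, of _ p c] in \<open>auto simp: ms\<close>)
  next
    case (single w)
    then have w: "set w \<subseteq> carrier L" by auto
    show ?case
      by (rule lin_map_cong[OF wact_lin[OF M w]])
        (use w wact_closed[OF M] in \<open>auto simp: ev_word ms\<close>)
  qed
qed

text \<open>Both sides are linear in \<open>p\<close> and in \<open>q\<close>; on words the identity
  says that \<open>foldr\<close> over an append is a composition.\<close>

lemma ev_mult:
  assumes "m \<in> carrier M" "p \<in> carrier TA" "q \<in> carrier TA"
  shows "ev M m (p \<otimes>\<^bsub>TA\<^esub> q) = ev M (ev M m q) p"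
proof -
  let ?F = "free_vs (lists (carrier L))"
  have lF: "lin_map ?F W f = lin_map TA W f" "lin_map W ?F g = lin_map W TA g" for W :: "('l, 'v, 'n) lie_rep_scheme" and f g
    by (intro lin_map_carrier_cong; simp)+
  note m1 = free_alg_mult_lin
  have e: "lin_map ?F M (ev M m)" if "m \<in> carrier M" for m using ev_lin[OF that] by (simp add: lF)
  have s: "sg w \<in> carrier TA" if "w \<in> lists (carrier L)" for w using that by simp
  have evc: "ev M m q \<in> carrier M" using lin_mapD(1)[OF ev_lin] assms by blast
  show ?thesis
  proof (rule free_vs_map_eq[OF lrepD(1)[OF M], where X="lists (carrier L)" and p=p])
    show "lin_map ?F M (\<lambda>p. ev M m (p \<otimes>\<^bsub>TA\<^esub> q))"
      by (rule lin_map_comp[OF e[OF assms(1)] m1(1)[OF assms(3)]])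
    show "lin_map ?F M (ev M (ev M m q))" by (rule e[OF evc])
    fix w assume w: "w \<in> lists (carrier L)"
    show "ev M m (sg w \<otimes>\<^bsub>TA\<^esub> q) = ev M (ev M m q) (sg w)"
    proof (rule free_vs_map_eq[OF lrepD(1)[OF M], where X="lists (carrier L)" and p=q])
      show "lin_map ?F M (\<lambda>q. ev M m (sg w \<otimes>\<^bsub>TA\<^esub> q))"
        by (rule lin_map_comp[OF e[OF assms(1)] m1(2)[OF s[OF w]]])
      show "lin_map ?F M (\<lambda>q. ev M (ev M m q) (sg w))"
        by (rule lin_map_comp[OF ev_lin_vec[OF s[OF w]] e[OF assms(1)]])
      fix w' assume w': "w' \<in> lists (carrier L)"
      have sw: "set w \<subseteq> carrier L" "set w' \<subseteq> carrier L" using w w' by auto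
      show "ev M m (sg w \<otimes>\<^bsub>TA\<^esub> sg w') = ev M (ev M m (sg w')) (sg w)"
        using sw assms(1) wact_closed[OF M] by (simp add: free_alg_mult_single ev_word ms)
    qed (use assms in simp)
  qed (use assms in simp)
qed

text \<open>The polynomials that annihilate every vector form a two-sided ideal, those annihilating
  one given vector only a left ideal. Hence the quantifier over all vectors inside \<open>K\<close>,
  although the claim concerns one \<open>m\<close>.\<close>

lemma ev_UI:
  assumes "p \<in> UI" "m \<in> carrier M" shows "ev M m p = \<zero>\<^bsub>M\<^esub>"
proof -
  define K where "K = {p\<in>carrier TA. \<forall>m\<in>carrier M. ev M m p = \<zero>\<^bsub>M\<^esub>}"
  have K: "lin_subspace TA K"
    unfolding K_def lin_subspace_iff[OF free_alg_cmod]
    using lin_mapD[OF ev_lin] lin_map_zero[OF free_alg_cmod lrepD(1)[OF M] ev_lin]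
    by (auto simp: cmod_simps[OF free_alg_cmod[of "carrier L"]] ms simp del: free_alg_simps)
  have evc: "ev M m q \<in> carrier M" if "q \<in> carrier TA" "m \<in> carrier M" for m q
    using lin_mapD(1)[OF ev_lin] that by blast
  have z: "ev M \<zero>\<^bsub>M\<^esub> q = \<zero>\<^bsub>M\<^esub>" if "q \<in> carrier TA" for q
    using lin_map_zero[OF lrepD(1)[OF M] lrepD(1)[OF M] ev_lin_vec[OF that]] .
  have "ideal K TA"
  proof (rule idealI)
    show "ring TA" by (rule free_alg_ring)
    show "subgroup K (add_monoid TA)" using K by (simp add: submodule_def)
    fix a x assume "a \<in> K" "x \<in> carrier TA"
    then show "x \<otimes>\<^bsub>TA\<^esub> a \<in> K" "a \<otimes>\<^bsub>TA\<^esub> x \<in> K"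
      unfolding K_def by (auto simp: ev_mult evc z TA.m_closed simp del: free_alg_simps)
  qed
  moreover have "uea_gens \<subseteq> K"
  proof
    fix r assume r: "r \<in> uea_gens"
    note d = lin_mapD[OF lrepD(2)[OF M]] lin_mapD[OF lrepD(3)[OF M]]
    have diff: "ev M m (p - q) = ev M m p \<oplus>\<^bsub>M\<^esub> (-1) \<odot>\<^bsub>M\<^esub> ev M m q"
      if "p \<in> carrier TA" "q \<in> carrier TA" "m \<in> carrier M" for p q m
    proof -
      have "- q \<in> carrier TA" using TA_diff[of 0 q] that(2) by simp
      then show ?thesis
        using lin_mapD(2)[OF ev_lin, of m p "- q"] lin_mapD(3)[OF ev_lin, of m q "-1"] that
        by (simp add: pscale_minus)
    qed
    have x: "x \<oplus>\<^bsub>M\<^esub> y \<oplus>\<^bsub>M\<^esub> (-1) \<odot>\<^bsub>M\<^esub> x \<oplus>\<^bsub>M\<^esub> (-1) \<odot>\<^bsub>M\<^esub> y = \<zero>\<^bsub>M\<^esub>"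
      if "x \<in> carrier M" "y \<in> carrier M" for x y
      using that cmod_sub_eq_zero[OF lrepD(1)[OF M], of "x \<oplus>\<^bsub>M\<^esub> y" "x \<oplus>\<^bsub>M\<^esub> y"] by (simp add: ms)
    have "ev M m r = \<zero>\<^bsub>M\<^esub>" if m: "m \<in> carrier M" for m
    proof -
      note s = diff TA_diff TA_single ev_word m ls ms(1-9) d x cmod_sub_eq_zero[OF lrepD(1)[OF M]]
      consider (a) x y where "x \<in> carrier L" "y \<in> carrier L" "r = sg [x \<oplus>\<^bsub>L\<^esub> y] - sg [x] - sg [y]"
        | (b) c x where "x \<in> carrier L" "r = sg [c \<odot>\<^bsub>L\<^esub> x] - Poly_Mapping.single [x] c"
        | (c) x y where "x \<in> carrier L" "y \<in> carrier L" "r = sg [x, y] - sg [y, x] - sg [brkt L x y]"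
        using r unfolding uea_gens_def by blast
      then show ?thesis
      proof cases
        case a then show ?thesis by (simp add: s del: free_alg_simps)
      next
        case b
        then have "act M x m \<in> carrier M" using lrepD(5)[OF M] m by blast
        then have "c \<odot>\<^bsub>M\<^esub> act M x m \<oplus>\<^bsub>M\<^esub> - c \<odot>\<^bsub>M\<^esub> act M x m = \<zero>\<^bsub>M\<^esub>"
          using ms(6)[of "act M x m" c "- c"] by (simp add: ms)
        with b show ?thesis by (simp add: s del: free_alg_simps)
      next
        case c
        then have "act M x (act M y m) = act M y (act M x m) \<oplus>\<^bsub>M\<^esub> act M (brkt L x y) m"
          using lrepD(4)[OF M] m by blast
        with c show ?thesis by (simp add: s del: free_alg_simps)
      qed
    qed
    then show "r \<in> K" using r uea_gens_subset by (auto simp: K_def)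
  qed
  ultimately have "UI \<subseteq> K" by (rule UI_least)
  with assms show ?thesis by (auto simp: K_def)
qed

lemma uev_lin: "m \<in> carrier M \<Longrightarrow> lin_map U M (uev M m)"
  unfolding uev_def
  using Us.qlift_lin_map(1)[OF lrepD(1)[OF M] ev_lin[of m]] ev_UI[of _ m]
  by (subst lin_map_carrier_cong[where V="quot_vs TA UI" and W=M]) auto

lemma uev_cls: "m \<in> carrier M \<Longrightarrow> p \<in> carrier TA \<Longrightarrow> uev M m (Us.cls p) = ev M m p"
  unfolding uev_def
  using Us.qlift_lin_map(2)[OF lrepD(1)[OF M] ev_lin[of m]] ev_UI[of _ m] by blast

lemma uev_one: "m \<in> carrier M \<Longrightarrow> uev M m \<one>\<^bsub>U\<^esub> = m"
  unfolding U_one by (subst uev_cls) (auto simp: ev_word ms)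

lemma uev_ux_left: "m \<in> carrier M \<Longrightarrow> x \<in> carrier L \<Longrightarrow> u \<in> carrier U \<Longrightarrow> uev M m (ux x \<otimes>\<^bsub>U\<^esub> u) = act M x (uev M m u)"
  using TA_single[of "[x]" 1] lin_mapD(1)[OF ev_lin] lrepD(5)[OF M]
  by (elim U_obtain) (simp add: ux_eq U_mult uev_cls ev_mult ev_word ms TA.m_closed del: free_alg_simps U_simps)

lemma uev_ux_right: "m \<in> carrier M \<Longrightarrow> x \<in> carrier L \<Longrightarrow> u \<in> carrier U \<Longrightarrow> uev M m (u \<otimes>\<^bsub>U\<^esub> ux x) = uev M (act M x m) u"
  using TA_single[of "[x]" 1] lrepD(5)[OF M]
  by (elim U_obtain) (simp add: ux_eq U_mult uev_cls ev_mult ev_word ms TA.m_closed del: free_alg_simps U_simps)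

lemma uev_lin_vec: "m \<in> carrier M \<Longrightarrow> u \<in> carrier U \<Longrightarrow> uev M (c \<odot>\<^bsub>M\<^esub> m) u = c \<odot>\<^bsub>M\<^esub> uev M m u"
  using lin_mapD(3)[OF ev_lin_vec] by (elim U_obtain) (simp add: uev_cls ms del: free_alg_simps U_simps)

end

end

subsection \<open>Verma modules\<close>

lemma C_alg_cmod: "cmod C_alg"
  by (rule cmodI) (auto simp: algebra_simps)

locale verma_setup = prelie L for L :: "('l, 'm) lie_algebra_rec_scheme" +
  fixes P H :: "'l set" and \<psi> :: "'l \<Rightarrow> complex"
  assumes P: "P \<subseteq> carrier L" and H: "H \<subseteq> carrier L"
begin

abbreviation UC where "UC \<equiv> uea_tensor_C L"
abbreviation VM where "VM \<equiv> verma L P H \<psi>"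
abbreviation vv where "vv \<equiv> verma_vec L P H \<psi>"

sublocale T: ctensor U C_alg
  by (simp add: ctensor_def U_cmod C_alg_cmod)

lemma UC_simps [simp]:
  "carrier UC = carrier T.T" "zero UC = zero T.T" "add UC = add T.T" "smult UC = smult T.T"
  "act UC = (\<lambda>x. tensor_map U C_alg (\<lambda>u. ux x \<otimes>\<^bsub>U\<^esub> u) (\<lambda>z. z))"
  by (simp_all add: uea_tensor_C_def Let_def)

lemma UC_cmod: "cmod UC"
  by (rule cmod_cong[OF T.T_cmod]) simp_all

lemma UC_lin_map: "lin_map UC W f = lin_map T.T W f" "lin_map W UC g = lin_map W T.T g"
  by (intro lin_map_carrier_cong; simp)+

abbreviation tu where "tu \<equiv> tens U C_alg"

lemma UC_act_lin: "x \<in> carrier L \<Longrightarrow> lin_map T.T T.T (act UC x)"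
  unfolding UC_simps by (intro T.tensor_map_lin_map U_mult_lin ux_closed lin_map_id)

lemma UC_act: "x \<in> carrier L \<Longrightarrow> u \<in> carrier U \<Longrightarrow> act UC x (tu u z) = tu (ux x \<otimes>\<^bsub>U\<^esub> u) z"
  by (simp add: T.tensor_map_tens U_mult_lin ux_closed lin_map_id del: U_simps)

lemma UC_lrep: "lrep L UC"
  unfolding lrep_def
proof (intro conjI ballI UC_cmod)
  show "lin_map UC UC (act UC x)" if "x \<in> carrier L" for x
    using UC_act_lin[OF that] by (simp only: UC_lin_map)
  note ac = UC_act_lin[THEN lin_mapD(1)]
  note ml = lin_mapD[OF U_mult_lin(2)]
  have add: "act UC (x \<oplus>\<^bsub>L\<^esub> y) X = act UC x X \<oplus>\<^bsub>T.T\<^esub> act UC y X"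
    if "x \<in> carrier L" "y \<in> carrier L" "X \<in> carrier T.T" for x y X
  proof -
    have l1: "lin_map T.T T.T (act UC (x \<oplus>\<^bsub>L\<^esub> y))" using that ls by (intro UC_act_lin)
    have l2: "lin_map T.T T.T (\<lambda>X. act UC x X \<oplus>\<^bsub>T.T\<^esub> act UC y X)"
      using that by (intro lin_map_add T.T_cmod UC_act_lin)
    show ?thesis
    proof (rule T.tensor_map_unique[OF T.T_cmod l1 l2])
  qed (use that in \<open>simp_all add: UC_act ls lin_mapD[OF ux_lin] ml ux_closed U_mult_closed T.tens_add_left del: U_simps UC_simps\<close>)
  qed
  have sm: "act UC (c \<odot>\<^bsub>L\<^esub> x) X = c \<odot>\<^bsub>T.T\<^esub> act UC x X"
    if "x \<in> carrier L" "X \<in> carrier T.T" for c x X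
  proof -
    have l1: "lin_map T.T T.T (act UC (c \<odot>\<^bsub>L\<^esub> x))" using that ls by (intro UC_act_lin)
    have l2: "lin_map T.T T.T (\<lambda>X. c \<odot>\<^bsub>T.T\<^esub> act UC x X)"
      using that by (intro lin_map_smult T.T_cmod UC_act_lin)
    show ?thesis
    proof (rule T.tensor_map_unique[OF T.T_cmod l1 l2])
  qed (use that in \<open>simp_all add: UC_act ls lin_mapD[OF ux_lin] ml ux_closed U_mult_closed T.tens_smult_left del: U_simps UC_simps\<close>)
  qed
  show "lin_map L UC (\<lambda>x. act UC x X)" if "X \<in> carrier UC" for X
    unfolding UC_lin_map using that add sm ac by (intro lin_mapI) (simp_all only: UC_simps(1))
  fix x y X assume x: "x \<in> carrier L" "y \<in> carrier L" "X \<in> carrier UC"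
  have "act UC x (act UC y X) = act UC y (act UC x X) \<oplus>\<^bsub>T.T\<^esub> act UC (brkt L x y) X"
  proof -
    have l1: "lin_map T.T T.T (\<lambda>X. act UC x (act UC y X))"
      by (rule lin_map_comp[OF UC_act_lin[OF x(1)] UC_act_lin[OF x(2)]])
    have l2: "lin_map T.T T.T (\<lambda>X. act UC y (act UC x X) \<oplus>\<^bsub>T.T\<^esub> act UC (brkt L x y) X)"
      by (rule lin_map_add[OF T.T_cmod lin_map_comp[OF UC_act_lin[OF x(2)] UC_act_lin[OF x(1)]]
          UC_act_lin[OF brkt_closed[OF x(1,2)]]])
    show ?thesis
    proof (rule T.tensor_map_unique[OF T.T_cmod l1 l2])
    fix u z assume u: "u \<in> carrier U" "z \<in> carrier C_alg"
    have "ux x \<otimes>\<^bsub>U\<^esub> (ux y \<otimes>\<^bsub>U\<^esub> u) = ux y \<otimes>\<^bsub>U\<^esub> (ux x \<otimes>\<^bsub>U\<^esub> u) \<oplus>\<^bsub>U\<^esub> ux (brkt L x y) \<otimes>\<^bsub>U\<^esub> u"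
      using x u ux_brkt[OF x(1,2)] ml(2)[of u "ux y \<otimes>\<^bsub>U\<^esub> ux x" "ux (brkt L x y)"]
      by (simp add: U_mult_assoc[symmetric] ux_closed U_mult_closed brkt_closed del: U_simps)
    then show "act UC x (act UC y (tu u z)) = act UC y (act UC x (tu u z)) \<oplus>\<^bsub>T.T\<^esub> act UC (brkt L x y) (tu u z)"
      using x u by (simp add: UC_act ux_closed U_mult_closed brkt_closed T.tens_add_left del: U_simps UC_simps)
  qed (use x in simp)
  qed
  then show "act UC x (act UC y X) = act UC y (act UC x X) \<oplus>\<^bsub>UC\<^esub> act UC (brkt L x y) X"
    by (simp only: UC_simps(3))
qed

definition verma_gens where
  "verma_gens = {tu (u \<otimes>\<^bsub>U\<^esub> ux (n \<oplus>\<^bsub>L\<^esub> h)) z \<oplus>\<^bsub>T.T\<^esub> (-1) \<odot>\<^bsub>T.T\<^esub> tu u (\<psi> h * z) | u n h z.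
        u \<in> carrier U \<and> n \<in> P \<and> h \<in> H}"

lemma nh_closed: "n \<in> P \<Longrightarrow> h \<in> H \<Longrightarrow> n \<oplus>\<^bsub>L\<^esub> h \<in> carrier L"
  using P H ls by blast

lemma tu_closed: "u \<in> carrier U \<Longrightarrow> tu u z \<in> carrier T.T"
  using T.tens_closed by simp

lemma verma_ker_eq: "verma_ker L P H \<psi> = lin_span UC verma_gens"
proof -
  have e: "tu (u \<otimes>\<^bsub>U\<^esub> ux (n \<oplus>\<^bsub>L\<^esub> h)) z \<ominus>\<^bsub>UC\<^esub> tu u (\<psi> h * z) =
      tu (u \<otimes>\<^bsub>U\<^esub> ux (n \<oplus>\<^bsub>L\<^esub> h)) z \<oplus>\<^bsub>T.T\<^esub> (-1) \<odot>\<^bsub>T.T\<^esub> tu u (\<psi> h * z)"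
    if "u \<in> carrier U" "n \<in> P" "h \<in> H" for u n h z
    using cmod_simps(13)[OF UC_cmod] tu_closed U_mult_closed[OF _ ux_closed[OF nh_closed]] that
    by (simp del: U_simps UC_simps(5))
  have "{tu (u \<otimes>\<^bsub>U\<^esub> ux (n \<oplus>\<^bsub>L\<^esub> h)) z \<ominus>\<^bsub>UC\<^esub> tu u (\<psi> h * z) | u n h z.
        u \<in> carrier U \<and> n \<in> P \<and> h \<in> H} = verma_gens"
    unfolding verma_gens_def by (intro Collect_cong ex_cong1 iffI conjI; elim conjE; simp only: e)
  then show ?thesis by (simp add: verma_ker_def)
qed

lemma verma_gens_subset: "verma_gens \<subseteq> carrier UC"
  unfolding verma_gens_def using nh_closed by (auto simp: T.ts tu_closed U_mult_closed ux_closed simp del: U_simps)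

text \<open>The algebra acts by left multiplication while the relations are imposed on the right.
  Therefore \<open>x\<close> sends the relation of \<open>u\<close> to the relation of
  \<open>x u\<close>, and already the generating set is stable.\<close>

lemma verma_ker_submodule: "rep_submodule L UC (verma_ker L P H \<psi>)"
  unfolding rep_submodule_def verma_ker_eq
proof (intro conjI ballI)
  show sub: "lin_subspace UC (lin_span UC verma_gens)"
    by (rule lin_span_subspace[OF UC_cmod verma_gens_subset])
  fix x m assume x: "x \<in> carrier L" and m: "m \<in> lin_span UC verma_gens"
  have "act UC x g \<in> lin_span UC verma_gens" if gg: "g \<in> verma_gens" for g
  proof -
    obtain u n h z where g: "g = tu (u \<otimes>\<^bsub>U\<^esub> ux (n \<oplus>\<^bsub>L\<^esub> h)) z \<oplus>\<^bsub>T.T\<^esub> (-1) \<odot>\<^bsub>T.T\<^esub> tu u (\<psi> h * z)"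
      "u \<in> carrier U" "n \<in> P" "h \<in> H"
      using gg unfolding verma_gens_def by blast
    note c = U_mult_closed ux_closed nh_closed[OF g(3,4)] tu_closed g(2) x T.ts(3)
    have "act UC x g = tu (ux x \<otimes>\<^bsub>U\<^esub> u \<otimes>\<^bsub>U\<^esub> ux (n \<oplus>\<^bsub>L\<^esub> h)) z \<oplus>\<^bsub>T.T\<^esub> (-1) \<odot>\<^bsub>T.T\<^esub> tu (ux x \<otimes>\<^bsub>U\<^esub> u) (\<psi> h * z)"
      unfolding g(1) using lin_mapD[OF UC_act_lin[OF x]] by (simp add: c UC_act U_mult_assoc del: U_simps UC_simps)
    also have "\<dots> \<in> verma_gens"
      unfolding verma_gens_def using g x by (auto intro!: exI simp: U_mult_closed ux_closed simp del: U_simps)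
    finally show ?thesis by (rule lin_span_base)
  qed
  then have "lin_span UC verma_gens \<subseteq> {m\<in>carrier UC. act UC x m \<in> lin_span UC verma_gens}"
    using verma_gens_subset
    by (intro lin_span_least lin_map_vimage[OF UC_cmod UC_cmod lrepD(2)[OF UC_lrep x] sub]) blast
  with m show "act UC x m \<in> lin_span UC verma_gens" by blast
qed

sublocale VQ: qrep L UC "verma_ker L P H \<psi>"
  by (unfold_locales; (rule UC_lrep verma_ker_submodule)?)

lemma VM_eq: "VM = quot_rep UC (verma_ker L P H \<psi>)"
  by (simp add: verma_def)

lemma verma_lrep: "lrep L VM"
  unfolding VM_eq by (rule VQ.QR_lrep)

lemma vv_eq: "vv = VQ.cls (tu \<one>\<^bsub>U\<^esub> 1)"
  by (simp add: verma_vec_def)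

lemma UC_cyclic: "cyclic_rep L UC (tu \<one>\<^bsub>U\<^esub> 1)"
  unfolding cyclic_rep_def
proof (intro conjI allI impI)
  show "tu \<one>\<^bsub>U\<^esub> 1 \<in> carrier UC" by (simp add: tu_closed U_one_closed del: U_simps)
  fix K assume K: "rep_submodule L UC K \<and> tu \<one>\<^bsub>U\<^esub> 1 \<in> K"
  note Ks = rep_submoduleD(1)[OF conjunct1[OF K], unfolded lin_subspace_iff[OF UC_cmod] UC_simps]
  have one: "1 \<in> carrier C_alg" by simp
  have u: "tu u 1 \<in> K" if "u \<in> carrier U" for u
    using that
  proof (induction rule: U_induct)
    case zero then show ?case using Ks T.tens_zero(2)[OF one] by simp
  next
    case (add u w)
    then show ?case using Ks T.tens_add_left[OF add(1,2) one] by (simp del: U_simps)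
  next
    case (smult c u)
    then show ?case using Ks T.tens_smult_left[OF smult(1) one] by (simp del: U_simps)
  next
    case one then show ?case using K by simp
  next
    case (mult x u)
    then show ?case using rep_submoduleD(2)[OF conjunct1[OF K] mult(1,3)] UC_act[OF mult(1,2)] by (simp del: UC_simps)
  qed
  have "X \<in> K" if "X \<in> carrier T.T" for X
    using that
  proof (induction rule: T.tensor_induct)
    case (add X Y) then show ?case using Ks by simp
  next
    case (tens w z)
    then show ?case using Ks u[OF tens(1)] T.tens_smult_right[OF tens(1) one, of z] by simp
  qed
  then show "K = carrier UC" using Ks by auto
qed

lemma verma_cyclic: "cyclic_rep L VM vv"
  unfolding VM_eq vv_eq by (rule VQ.QR_cyclic[OF UC_cyclic])

lemma verma_hw:
  assumes "n \<in> P" "h \<in> H"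
  shows "act VM (n \<oplus>\<^bsub>L\<^esub> h) vv = \<psi> h \<odot>\<^bsub>VM\<^esub> vv"
proof -
  note nh = nh_closed[OF assms]
  note c = tu_closed U_one_closed U_mult_one ux_closed[OF nh]
  have t: "tu \<one>\<^bsub>U\<^esub> (\<psi> h * 1) = \<psi> h \<odot>\<^bsub>T.T\<^esub> tu \<one>\<^bsub>U\<^esub> 1"
    using T.tens_smult_right[of "\<one>\<^bsub>U\<^esub>" 1 "\<psi> h"] U_one_closed by simp
  have "act VM (n \<oplus>\<^bsub>L\<^esub> h) vv = VQ.cls (tu (ux (n \<oplus>\<^bsub>L\<^esub> h)) 1)"
    unfolding VM_eq vv_eq using nh by (simp add: VQ.QR_act UC_act c del: U_simps UC_simps(5))
  also have "\<dots> = VQ.cls (\<psi> h \<odot>\<^bsub>UC\<^esub> tu \<one>\<^bsub>U\<^esub> 1)"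
  proof (subst VQ.cls_eq_iff)
    have "tu (\<one>\<^bsub>U\<^esub> \<otimes>\<^bsub>U\<^esub> ux (n \<oplus>\<^bsub>L\<^esub> h)) 1 \<oplus>\<^bsub>T.T\<^esub> (-1) \<odot>\<^bsub>T.T\<^esub> tu \<one>\<^bsub>U\<^esub> (\<psi> h * 1) \<in> verma_gens"
      unfolding verma_gens_def using assms U_one_closed by blast
    then show "tu (ux (n \<oplus>\<^bsub>L\<^esub> h)) 1 \<oplus>\<^bsub>UC\<^esub> - 1 \<odot>\<^bsub>UC\<^esub> (\<psi> h \<odot>\<^bsub>UC\<^esub> tu \<one>\<^bsub>U\<^esub> 1) \<in> verma_ker L P H \<psi>"
      unfolding verma_ker_eq using c t by (intro lin_span_base) (simp del: U_simps)
  qed (use c T.ts in \<open>simp_all del: U_simps\<close>)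
  also have "\<dots> = \<psi> h \<odot>\<^bsub>VM\<^esub> vv"
    unfolding VM_eq vv_eq using VQ.quot_smult[of "tu \<one>\<^bsub>U\<^esub> 1" "\<psi> h"] c by (simp del: U_simps)
  finally show ?thesis .
qed

text \<open>The map is induced by \<open>u \<otimes> z \<mapsto> z (u m)\<close>. It kills the
  kernel because \<open>u (n + h) m = \<psi>(h) u m\<close> by the hypothesis on
  \<open>m\<close>.\<close>

theorem verma_universal:
  fixes N :: "('l, 'v, 'n) lie_rep_scheme"
  assumes N: "lrep L N" and m: "m \<in> carrier N"
    and hw: "\<And>n h. n \<in> P \<Longrightarrow> h \<in> H \<Longrightarrow> act N (n \<oplus>\<^bsub>L\<^esub> h) m = \<psi> h \<odot>\<^bsub>N\<^esub> m"
  shows "\<exists>f. rep_hom L VM N f \<and> f vv = m"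
proof -
  note ns = cmod_simps[OF lrepD(1)[OF N]] cmod_ac[OF lrepD(1)[OF N]]
  define g where "g = T.tlift N (\<lambda>u z. z \<odot>\<^bsub>N\<^esub> uev N m u)"
  note ul = lin_mapD[OF uev_lin[OF N m]]
  have bl: "bilin U C_alg N (\<lambda>u z. z \<odot>\<^bsub>N\<^esub> uev N m u)"
    unfolding bilin_def using ul by (intro conjI ballI lin_mapI) (simp_all add: ns mult.commute del: U_simps)
  have g: "lin_map T.T N g" unfolding g_def by (rule T.tlift_lin_map[OF lrepD(1)[OF N] bl])
  have gt: "g (tu u z) = z \<odot>\<^bsub>N\<^esub> uev N m u" if "u \<in> carrier U" for u z
    unfolding g_def using T.tlift_tens[OF lrepD(1)[OF N] bl that, of z] by simp
  have gx: "g (act UC x X) = act N x (g X)" if "x \<in> carrier L" "X \<in> carrier T.T" for x X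
  proof (rule T.tensor_map_unique[OF lrepD(1)[OF N] lin_map_comp[OF g UC_act_lin[OF that(1)]] lin_map_comp[OF lrepD(2)[OF N that(1)] g]])
    fix u z assume "u \<in> carrier U" "z \<in> carrier C_alg"
    then show "g (act UC x (tu u z)) = act N x (g (tu u z))"
      using that ul(1)
      by (simp add: UC_act gt U_mult_closed ux_closed uev_ux_left[OF N m] lin_mapD(3)[OF lrepD(2)[OF N]] del: U_simps UC_simps)
  qed (use that in simp)
  have gh: "rep_hom L UC N g"
    unfolding rep_hom_def UC_lin_map using g gx by (auto simp del: UC_simps(5))
  have "g r = \<zero>\<^bsub>N\<^esub>" if rr: "r \<in> verma_gens" for r
  proof -
    obtain u n h z where r: "r = tu (u \<otimes>\<^bsub>U\<^esub> ux (n \<oplus>\<^bsub>L\<^esub> h)) z \<oplus>\<^bsub>T.T\<^esub> (-1) \<odot>\<^bsub>T.T\<^esub> tu u (\<psi> h * z)"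
      "u \<in> carrier U" "n \<in> P" "h \<in> H"
      using rr unfolding verma_gens_def by blast
    note c = U_mult_closed ux_closed nh_closed[OF r(3,4)] tu_closed r(2) T.ts(3)
    have "uev N m (u \<otimes>\<^bsub>U\<^esub> ux (n \<oplus>\<^bsub>L\<^esub> h)) = \<psi> h \<odot>\<^bsub>N\<^esub> uev N m u"
      using r nh_closed[OF r(3,4)] by (simp add: uev_ux_right[OF N m] hw uev_lin_vec[OF N m] del: U_simps)
    moreover have "b \<odot>\<^bsub>N\<^esub> y \<oplus>\<^bsub>N\<^esub> (- b) \<odot>\<^bsub>N\<^esub> y = \<zero>\<^bsub>N\<^esub>" if "y \<in> carrier N" for b y
      using ns(6)[OF that, of b "- b"] that by (simp add: ns(10))
    ultimately show ?thesis
      unfolding r(1) using ul(1)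
      by (simp add: lin_mapD[OF g] c gt ns mult.commute del: U_simps)
  qed
  then have "lin_span UC verma_gens \<subseteq> {X\<in>carrier UC. g X = \<zero>\<^bsub>N\<^esub>}"
    using verma_gens_subset g
    by (intro lin_span_least lin_map_kernel[OF UC_cmod lrepD(1)[OF N]]) (auto simp: UC_lin_map)
  then have ker: "g X = \<zero>\<^bsub>N\<^esub>" if "X \<in> verma_ker L P H \<psi>" for X
    using that verma_ker_eq by auto
  note q = VQ.qlift_rep_hom[OF N gh ker]
  have "VQ.qlift g vv = m"
    unfolding vv_eq using U_one_closed m ul(1)
    by (subst q(2)) (simp_all add: tu_closed gt uev_one[OF N m] ns del: U_simps)
  with q(1) show ?thesis unfolding VM_eq by blast
qed

end

section \<open>Operators on vector spaces\<close>

subsection \<open>Simultaneous eigenvectors\<close>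

text \<open>Applying \<open>D h\<close> to the relation and subtracting \<open>wt b h\<close> times
  it removes the term of \<open>b\<close> and scales the term of \<open>k\<close> by
  \<open>wt k h - wt b h\<close>. By induction the scaled terms vanish, and for each
  \<open>k\<close> some \<open>h\<close> makes the factor nonzero.\<close>

lemma simultaneous_eigenvectors_independent:
  fixes sc :: "complex \<Rightarrow> 'u::ab_group_add \<Rightarrow> 'u" and y :: "'k \<Rightarrow> 'u"
  assumes "vector_space sc" "finite B"
    and D: "\<And>h x y. h \<in> T \<Longrightarrow> D h (x + y) = D h x + D h y" "\<And>h c x. h \<in> T \<Longrightarrow> D h (sc c x) = sc c (D h x)"
    and "\<And>k h. k \<in> B \<Longrightarrow> h \<in> T \<Longrightarrow> D h (y k) = sc (wt k h) (y k)"
    and "\<And>k k'. k \<in> B \<Longrightarrow> k' \<in> B \<Longrightarrow> k \<noteq> k' \<Longrightarrow> \<exists>h\<in>T. wt k h \<noteq> wt k' h"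
    and "sum y B = 0"
  shows "\<forall>k\<in>B. y k = 0"
proof -
  interpret vector_space sc by fact
  show ?thesis
    using assms(2,5-7)
  proof (induction B arbitrary: y rule: finite_induct)
    case (insert b B)
    have D0: "D h 0 = 0" if "h \<in> T" for h using D(2)[OF that, of 0 0] by simp
    have Ds: "D h (sum f S) = (\<Sum>k\<in>S. D h (f k))" if "h \<in> T" "finite S" for h S and f :: "'k \<Rightarrow> 'u"
      using that(2) by (induction S) (use D D0 that in auto)
    have yb: "y b = - sum y B" using insert.prems(3) insert.hyps by (simp add: eq_neg_iff_add_eq_0)
    have *: "\<forall>k\<in>B. sc (wt k h - wt b h) (y k) = 0" if h: "h \<in> T" for h
    proof (rule insert.IH)
      have "(\<Sum>k\<in>B. sc (wt k h - wt b h) (y k)) = (\<Sum>k\<in>B. D h (y k)) - sc (wt b h) (sum y B)"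
        using insert.prems(1) h by (simp add: scale_left_diff_distrib sum_subtractf scale_sum_right)
      also have "(\<Sum>k\<in>B. D h (y k)) = D h (sum y B)"
        using Ds h insert.hyps by simp
      also have "sum y B = - y b" using yb by simp
      also have "D h (- y b) = - sc (wt b h) (y b)"
        using D(2)[OF h, of "-1" "y b"] insert.prems(1)[of b h] h by simp
      finally show "(\<Sum>k\<in>B. sc (wt k h - wt b h) (y k)) = 0" by simp
    qed (use insert.prems D(2) in \<open>auto simp: mult.commute\<close>)
    have "y k = 0" if k: "k \<in> B" for k
    proof -
      have "k \<noteq> b" using k insert.hyps by auto
      then obtain h where "h \<in> T" "wt k h \<noteq> wt b h" using insert.prems(2)[of k b] k by auto
      then show ?thesis using * k by auto
    qed
    then show ?case using yb by simp
  qed simp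
qed

text \<open>Write \<open>x\<close> as a finite sum of vectors \<open>y k\<close>. Applying
  \<open>D h\<close> and subtracting \<gamma>\<open>h\<close> times \<open>x\<close> gives a
  relation among eigenvectors, so every nonzero \<open>y k\<close> has weight \<gamma>. As weights
  are separated, exactly one term remains. The finite sums are formed in the free space, where
  addition is total.\<close>

lemma eigenvector_in_sum_of_eigenspaces:
  fixes V :: "(complex, 'v, 'm) module_scheme" and Y :: "'k \<Rightarrow> 'v set"
  assumes V: "cmod V" and D: "\<And>h. h \<in> T \<Longrightarrow> lin_map V V (D h)"
    and Y: "\<And>k. k \<in> X \<Longrightarrow> lin_subspace V (Y k)"
    and eig: "\<And>k y h. k \<in> X \<Longrightarrow> y \<in> Y k \<Longrightarrow> h \<in> T \<Longrightarrow> D h y = wt k h \<odot>\<^bsub>V\<^esub> y"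
    and dist: "\<And>k k'. k \<in> X \<Longrightarrow> k' \<in> X \<Longrightarrow> k \<noteq> k' \<Longrightarrow> \<exists>h\<in>T. wt k h \<noteq> wt k' h"
    and x: "x \<in> lin_span V (\<Union>k\<in>X. Y k)" "\<And>h. h \<in> T \<Longrightarrow> D h x = \<gamma> h \<odot>\<^bsub>V\<^esub> x" "x \<noteq> \<zero>\<^bsub>V\<^esub>"
  shows "\<exists>k\<in>X. x \<in> Y k \<and> (\<forall>h\<in>T. wt k h = \<gamma> h)"
proof -
  note vs = cmod_simps[OF V]
  note Ys = Y[unfolded lin_subspace_iff[OF V]]
  obtain \<iota> :: "'v \<Rightarrow> ('v \<Rightarrow>\<^sub>0 complex)" and \<pi>
    where \<iota>: "lin_map V (free_vs UNIV) \<iota>" and \<pi>: "lin_map (free_vs UNIV) V \<pi>"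
    and \<pi>\<iota>: "\<And>v. v \<in> carrier V \<Longrightarrow> \<pi> (\<iota> v) = v"
    using cmod_retract[OF V] by blast
  note \<iota>D = lin_mapD[OF \<iota>, simplified] and \<pi>D = lin_mapD[OF \<pi>, simplified]
  have \<iota>0: "\<iota> \<zero>\<^bsub>V\<^esub> = 0" using lin_map_zero[OF V free_vs_cmod \<iota>] by simp
  have inj: "v = w" if "\<iota> v = \<iota> w" "v \<in> carrier V" "w \<in> carrier V" for v w
    using that \<pi>\<iota> by metis
  interpret P: vector_space "pscale :: complex \<Rightarrow> ('v \<Rightarrow>\<^sub>0 complex) \<Rightarrow> _" by (rule pscale_vector_space)
  have sub: "(\<Union>k\<in>X. Y k) \<subseteq> carrier V" using Ys by blast
  have "\<exists>B y. finite B \<and> B \<subseteq> X \<and> (\<forall>k\<in>B. y k \<in> Y k) \<and> \<iota> x = (\<Sum>k\<in>B. \<iota> (y k))"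
    using V sub x(1)
  proof (induction rule: lin_span_induct)
    case zero
    show ?case by (rule exI[of _ "{}"]) (simp add: \<iota>0)
  next
    case (add x1 x2)
    obtain B1 y1 where 1: "finite B1" "B1 \<subseteq> X" "\<forall>k\<in>B1. y1 k \<in> Y k" "\<iota> x1 = (\<Sum>k\<in>B1. \<iota> (y1 k))"
      using add by blast
    obtain B2 y2 where 2: "finite B2" "B2 \<subseteq> X" "\<forall>k\<in>B2. y2 k \<in> Y k" "\<iota> x2 = (\<Sum>k\<in>B2. \<iota> (y2 k))"
      using add by blast
    \<comment> \<open>Padding with zero puts both decompositions over the common index set
      \<open>B1 \<union> B2\<close>.\<close>
    define z1 where "z1 k = (if k \<in> B1 then y1 k else \<zero>\<^bsub>V\<^esub>)" for k
    define z2 where "z2 k = (if k \<in> B2 then y2 k else \<zero>\<^bsub>V\<^esub>)" for k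
    have z: "z1 k \<in> Y k" "z2 k \<in> Y k" if "k \<in> X" for k using that 1 2 Ys by (auto simp: z1_def z2_def)
    have zc: "z1 k \<in> carrier V" "z2 k \<in> carrier V" if "k \<in> B1 \<union> B2" for k using that 1 2 z Ys by blast+
    have "\<iota> x1 = (\<Sum>k\<in>B1 \<union> B2. \<iota> (z1 k))"
      unfolding 1(4) by (rule sum.mono_neutral_cong_left) (use 1 2 in \<open>auto simp: z1_def \<iota>0\<close>)
    moreover have "\<iota> x2 = (\<Sum>k\<in>B1 \<union> B2. \<iota> (z2 k))"
      unfolding 2(4) by (rule sum.mono_neutral_cong_left) (use 1 2 in \<open>auto simp: z2_def \<iota>0\<close>)
    ultimately have "\<iota> (x1 \<oplus>\<^bsub>V\<^esub> x2) = (\<Sum>k\<in>B1 \<union> B2. \<iota> (z1 k \<oplus>\<^bsub>V\<^esub> z2 k))"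
      using add zc by (simp add: \<iota>D sum.distrib)
    moreover have "\<forall>k\<in>B1 \<union> B2. z1 k \<oplus>\<^bsub>V\<^esub> z2 k \<in> Y k" using z Ys 1 2 by blast
    ultimately show ?case
      using 1 2 by (intro exI[of _ "B1 \<union> B2"] exI[of _ "\<lambda>k. z1 k \<oplus>\<^bsub>V\<^esub> z2 k"]) auto
  next
    case (smult c x1)
    obtain B1 y1 where 1: "finite B1" "B1 \<subseteq> X" "\<forall>k\<in>B1. y1 k \<in> Y k" "\<iota> x1 = (\<Sum>k\<in>B1. \<iota> (y1 k))"
      using smult by blast
    have "y1 k \<in> carrier V" if "k \<in> B1" for k using that 1 Ys by blast
    then have "\<iota> (c \<odot>\<^bsub>V\<^esub> x1) = (\<Sum>k\<in>B1. \<iota> (c \<odot>\<^bsub>V\<^esub> y1 k))"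
      using smult 1 by (simp add: \<iota>D P.scale_sum_right)
    then show ?case
      using 1 Ys by (intro exI[of _ B1] exI[of _ "\<lambda>k. c \<odot>\<^bsub>V\<^esub> y1 k"]) auto
  next
    case (base x1)
    then obtain k where "k \<in> X" "x1 \<in> Y k" by auto
    then show ?case by (intro exI[of _ "{k}"] exI[of _ "\<lambda>_. x1"]) simp
  qed
  then obtain B y where B: "finite B" "B \<subseteq> X" "\<forall>k\<in>B. y k \<in> Y k" "\<iota> x = (\<Sum>k\<in>B. \<iota> (y k))" by blast
  have yc: "y k \<in> carrier V" if "k \<in> B" for k using that B Ys by blast
  have xc: "x \<in> carrier V"
    using lin_span_subspace[OF V sub] x(1) by (auto simp: lin_subspace_iff[OF V])
  define D' where "D' h p = \<iota> (D h (\<pi> p))" for h p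
  have D': "D' h (p + q) = D' h p + D' h q" "D' h (pscale c p) = pscale c (D' h p)" if "h \<in> T" for h p q c
    using that D'_def \<pi>D \<iota>D lin_mapD[OF D[OF that]] by auto
  have D'0: "D' h 0 = 0" if "h \<in> T" for h using D'(2)[OF that, of 0 0] by simp
  have D's: "D' h (sum f S) = (\<Sum>k\<in>S. D' h (f k))" if "h \<in> T" "finite S" for h S and f :: "'k \<Rightarrow> _"
    using that(2) by (induction S) (use D' D'0 that in auto)
  have D'y: "D' h (\<iota> (y k)) = pscale (wt k h) (\<iota> (y k))" if "k \<in> B" "h \<in> T" for k h
    using that B yc eig[of k "y k" h] by (auto simp: D'_def \<pi>\<iota> \<iota>D)
  have "\<forall>k\<in>B. pscale (wt k h - \<gamma> h) (\<iota> (y k)) = 0" if h: "h \<in> T" for h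
  proof (rule simultaneous_eigenvectors_independent[where D=D' and T=T and wt=wt, OF pscale_vector_space B(1)])
    have "(\<Sum>k\<in>B. D' h (\<iota> (y k))) = D' h (\<iota> x)" using B h by (simp add: D's)
    also have "\<dots> = pscale (\<gamma> h) (\<iota> x)" using x(2)[OF h] xc by (simp add: D'_def \<pi>\<iota> \<iota>D)
    finally show "(\<Sum>k\<in>B. pscale (wt k h - \<gamma> h) (\<iota> (y k))) = 0"
      using B(4) D'y h by (simp add: P.scale_left_diff_distrib sum_subtractf P.scale_sum_right)
    show "\<exists>h\<in>T. wt k h \<noteq> wt k' h" if "k \<in> B" "k' \<in> B" "k \<noteq> k'" for k k'
      using dist that B(2) by blast
  qed (use D' D'y B in \<open>auto simp: mult.commute\<close>)
  then have gam: "wt k h = \<gamma> h" if "h \<in> T" "k \<in> B" "\<iota> (y k) \<noteq> 0" for k h using that by auto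
  obtain k where k: "k \<in> B" "\<iota> (y k) \<noteq> 0"
  proof (rule ccontr)
    assume "\<not> thesis"
    then have "\<forall>k\<in>B. \<iota> (y k) = 0" using that by blast
    then have "\<iota> x = \<iota> \<zero>\<^bsub>V\<^esub>" using B(4) \<iota>0 by simp
    then show False using inj[OF _ xc] vs(2) x(3) by blast
  qed
  have "\<iota> (y k') = 0" if "k' \<in> B - {k}" for k'
    using gam[of _ k] gam[of _ k'] k that dist[of k k'] B(2) by fastforce
  then have "\<iota> x = \<iota> (y k)" using B k by (simp add: sum.remove[OF B(1) k(1)])
  then have "x = y k" using inj xc yc k by blast
  then show ?thesis using k B gam by (intro bexI[of _ k]) auto
qed

subsection \<open>Nilpotent operators and \<open>sl\<^sub>2\<close>-triples\<close>

locale cvec = vector_space sc for sc :: "complex \<Rightarrow> 'u::ab_group_add \<Rightarrow> 'u"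
begin

definition lin :: "('u \<Rightarrow> 'u) \<Rightarrow> bool" where
  "lin f \<longleftrightarrow> (\<forall>x y. f (x + y) = f x + f y) \<and> (\<forall>c x. f (sc c x) = sc c (f x))"

lemma linD:
  assumes "lin f"
  shows "f (x + y) = f x + f y" "f (sc c x) = sc c (f x)" "f 0 = 0" "f (- x) = - f x" "f (x - y) = f x - f y"
proof -
  show a: "\<And>x y. f (x + y) = f x + f y" and s: "\<And>c x. f (sc c x) = sc c (f x)"
    using assms by (auto simp: lin_def)
  show "f 0 = 0" using s[of 0 0] by simp
  show m: "\<And>x. f (- x) = - f x" using s[of "-1"] by simp
  show "f (x - y) = f x - f y" using a[of x "- y"] m by simp
qed

lemma lin_pow: "lin f \<Longrightarrow> lin (f ^^ n)"
  by (induction n) (auto simp: lin_def)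

lemma pow_zero_mono: "lin f \<Longrightarrow> (f ^^ n) w = 0 \<Longrightarrow> n \<le> m \<Longrightarrow> (f ^^ m) w = 0"
  using linD(3)[OF lin_pow[of f "m - n"]] funpow_add[of "m - n" n f] by simp

lemma pow_comm: "(\<And>x. A (B x) = B (A x)) \<Longrightarrow> (A ^^ n) (B x) = B ((A ^^ n) x)"
  by (induction n) auto

text \<open>Only one factor of the power is expanded: the remaining power is applied to
  \<open>A w\<close> and to \<open>B w\<close>, for which one of the two exponents has dropped by
  one. Commutation keeps the other exponent valid, so induction on \<open>a + b\<close> replaces the
  binomial formula.\<close>

lemma commuting_nilpotent_sum:
  assumes "lin A" "lin B" "\<And>x. A (B x) = B (A x)" "(A ^^ a) w = 0" "(B ^^ b) w = 0"
  shows "((\<lambda>x. A x + B x) ^^ (a + b)) w = 0"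
  using assms(4,5)
proof (induction "a + b" arbitrary: a b w)
  case 0 then show ?case by simp
next
  case (Suc n)
  let ?S = "\<lambda>x. A x + B x"
  have S: "lin ?S" using assms(1,2) by (auto simp: lin_def add_ac scale_right_distrib)
  show ?case
  proof (cases "a = 0 \<or> b = 0")
    case True
    then have "w = 0" using Suc.prems by auto
    then show ?thesis using linD(3)[OF lin_pow[OF S]] by simp
  next
    case False
    then obtain a' b' where ab: "a = Suc a'" "b = Suc b'" by (metis not0_implies_Suc)
    have "(A ^^ a') (A w) = 0" "(B ^^ b') (B w) = 0"
      using Suc.prems ab by (simp_all add: funpow_swap1)
    moreover have "(B ^^ b) (A w) = 0" "(A ^^ a) (B w) = 0"
      using pow_comm[of B A b w] pow_comm[of A B a w] assms(3) Suc.prems linD(3)[OF assms(1)] linD(3)[OF assms(2)]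
      by simp_all
    moreover have "n = a' + b" "n = a + b'" using Suc.hyps(2) ab by simp_all
    ultimately have "(?S ^^ n) (A w) = 0" "(?S ^^ n) (B w) = 0"
      using Suc.hyps(1)[of a' b "A w"] Suc.hyps(1)[of a b' "B w"] by simp_all
    then have "(?S ^^ Suc n) w = 0"
      using linD(1)[OF lin_pow[OF S]] by (simp only: funpow_Suc_right comp_apply) simp
    then show ?thesis using Suc.hyps(2) by simp
  qed
qed

end

locale sl2_triple = cvec sc for sc :: "complex \<Rightarrow> 'u::ab_group_add \<Rightarrow> 'u" +
  fixes E F H :: "'u \<Rightarrow> 'u"
  assumes lin: "lin E" "lin F" "lin H"
    and EF: "E (F x) = F (E x) + H x"
    and HE: "H (E x) = E (H x) + sc 2 (E x)"
    and HF: "H (F x) = F (H x) - sc 2 (F x)"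
begin

lemmas lins = linD[OF lin(1)] linD[OF lin(2)] linD[OF lin(3)]

lemma H_pow:
  assumes "H w = sc c w" shows "H ((F ^^ n) w) = sc (c - 2 * of_nat n) ((F ^^ n) w)"
proof (induction n)
  case (Suc n)
  let ?y = "(F ^^ n) w"
  have "H ((F ^^ Suc n) w) = sc (c - 2 * of_nat n) (F ?y) - sc 2 (F ?y)"
    by (simp add: HF Suc.IH lins)
  also have "\<dots> = sc (c - 2 * of_nat n - 2) (F ?y)"
    by (simp only: scale_left_diff_distrib)
  finally show ?case by (simp add: diff_diff_eq add.commute)
qed (use assms in simp)

text \<open>The identity \<open>[E, F^(n+1)] = (n+1) F^n (H - n)\<close>, evaluated on a vector of
  weight \<open>c\<close>.\<close>

lemma E_pow_F:
  assumes "H w = sc c w"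
  shows "E ((F ^^ Suc n) w) = (F ^^ Suc n) (E w) + sc (of_nat (Suc n) * (c - of_nat n)) ((F ^^ n) w)"
proof (induction n)
  case 0 then show ?case using assms by (simp add: EF)
next
  case (Suc n)
  have "E ((F ^^ Suc (Suc n)) w) = F (E ((F ^^ Suc n) w)) + H ((F ^^ Suc n) w)"
    by (simp add: EF)
  also have "\<dots> = (F ^^ Suc (Suc n)) (E w) + sc (of_nat (Suc n) * (c - of_nat n) + (c - 2 * of_nat (Suc n))) ((F ^^ Suc n) w)"
    unfolding Suc.IH H_pow[OF assms] by (simp add: lins scale_left_distrib)
  also have "of_nat (Suc n) * (c - of_nat n) + (c - 2 * of_nat (Suc n)) = of_nat (Suc (Suc n)) * (c - of_nat (Suc n))"
    by (simp add: algebra_simps)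
  finally show ?case .
qed

end

text \<open>An exponent that kills a vector of weight \<open>c\<close> annihilated by \<open>E ^^ k\<close>, uniformly over all
  \<open>sl\<^sub>2\<close>-modules on which \<open>F\<close> is locally nilpotent.\<close>

fun nil_bound :: "complex \<Rightarrow> nat \<Rightarrow> nat" where
  "nil_bound c 0 = 0"
| "nil_bound c (Suc k) = max (nil_bound (c + 2) k) (nat \<lceil>norm c\<rceil> + 1)"

context sl2_triple
begin

text \<open>\<open>E w\<close> has weight \<open>c + 2\<close> and is killed by one power of
  \<open>E\<close> less, so induction bounds its nilpotency under \<open>F\<close>. Beyond that
  bound \<open>E (F^(n+1) w)\<close> is \<open>(n+1)(c-n) F^n w\<close>, with nonzero coefficient
  because \<open>n\<close> exceeds \<open>|c|\<close>. Hence vanishing of \<open>F^(n+1) w\<close>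
  forces that of \<open>F^n w\<close>, and any exponent that works can be lowered to the
  bound.\<close>

lemma nil_bound:
  assumes "(E ^^ k) w = 0" "H w = sc c w" "\<And>x. \<exists>n. (F ^^ n) x = 0"
  shows "(F ^^ nil_bound c k) w = 0"
  using assms(1,2)
proof (induction k arbitrary: w c)
  case 0 then show ?case by simp
next
  case (Suc k)
  let ?N = "nil_bound c (Suc k)"
  have "H (E w) = sc (c + 2) (E w)"
    using Suc.prems by (simp add: HE lins scale_left_distrib)
  moreover have "(E ^^ k) (E w) = 0" using Suc.prems by (simp add: funpow_swap1)
  ultimately have "(F ^^ nil_bound (c + 2) k) (E w) = 0" by (rule Suc.IH[rotated])
  then have z: "(F ^^ n) (E w) = 0" if "n \<ge> ?N" for n
    using pow_zero_mono[OF lin(2)] that by force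
  have "(F ^^ n) w = 0 \<Longrightarrow> n \<ge> ?N \<Longrightarrow> (F ^^ ?N) w = 0" for n
  proof (induction n)
    case (Suc n)
    show ?case
    proof (cases "Suc n = ?N")
      case False
      then have n: "n \<ge> ?N" using Suc.prems(2) by linarith
      have "E ((F ^^ Suc n) w) = sc (of_nat (Suc n) * (c - of_nat n)) ((F ^^ n) w)"
        unfolding E_pow_F[OF \<open>H w = sc c w\<close>] using z[OF le_SucI[OF n]] by (simp only: add_0)
      moreover have "c \<noteq> of_nat n"
      proof
        assume "c = of_nat n"
        then have "norm c = real n" by simp
        with n show False by simp
      qed
      ultimately have "(F ^^ n) w = 0"
        using Suc.prems linD(3)[OF lin(1)] by (auto simp del: of_nat_Suc)
      then show ?thesis using Suc.IH n by blast
    qed (use Suc in simp)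
  qed simp
  moreover obtain n where "(F ^^ n) w = 0" using assms(3) by blast
  then have "(F ^^ max n ?N) w = 0" using pow_zero_mono[OF lin(2)] by (metis max.cobounded1)
  ultimately show ?case by (metis max.cobounded2)
qed

text \<open>\<open>E_pow_F\<close> with \<open>E w = 0\<close>, iterated. The product is nonzero
  whenever \<open>c\<close> is not a natural number, which is how the next lemma uses it.\<close>

lemma singular_pow:
  assumes "E w = 0" "H w = sc c w"
  shows "(E ^^ n) ((F ^^ n) w) = sc (\<Prod>j<n. of_nat (Suc j) * (c - of_nat j)) w"
    "(E ^^ Suc n) ((F ^^ n) w) = 0"
proof -
  show *: "(E ^^ n) ((F ^^ n) w) = sc (\<Prod>j<n. of_nat (Suc j) * (c - of_nat j)) w" for n
  proof (induction n)
    case (Suc n)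
    have "(E ^^ Suc n) ((F ^^ Suc n) w) = (E ^^ n) (E ((F ^^ Suc n) w))"
      by (simp add: funpow_swap1)
    also have "\<dots> = (E ^^ n) (sc (of_nat (Suc n) * (c - of_nat n)) ((F ^^ n) w))"
      unfolding E_pow_F[OF assms(2)] using assms(1) linD(3)[OF lin_pow[OF lin(2)], of "Suc n"] by simp
    finally show ?case
      using Suc by (simp add: linD(2)[OF lin_pow[OF lin(1)]] mult.commute del: of_nat_Suc)
  qed simp
  show "(E ^^ Suc n) ((F ^^ n) w) = 0"
    using * assms by (simp add: lins)
qed

text \<open>If \<open>F' = F + F\<^sub>2\<close> with \<open>F\<^sub>2\<close> commuting with the triple, then \<open>E ^^ K\<close> sees only the term
  \<open>F ^^ K\<close> in the expansion of \<open>F' ^^ K\<close> on a singular vector.\<close>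

lemma singular_nilpotent_perturbation:
  assumes F2: "lin F2" "\<And>x. E (F2 x) = F2 (E x)" "\<And>x. F (F2 x) = F2 (F x)" "\<And>x. H (F2 x) = F2 (H x)"
    and w: "E w = 0" "H w = sc c w" and c: "\<And>j::nat. c \<noteq> of_nat j"
    and nil: "((\<lambda>x. F x + F2 x) ^^ K) w = 0"
  shows "w = 0"
proof -
  define S where "S = {y. E y = 0 \<and> H y = sc c y}"
  \<comment> \<open>\<open>S\<close> consists of the singular vectors of weight \<open>c\<close> and
    is stable under \<open>F2\<close>. \<open>Q n\<close> collects what has degree below
    \<open>n\<close> in \<open>F\<close>; the operator \<open>E^n\<close> kills it.\<close>
  define Q where "Q n = span {(F ^^ a) y | a y. a < n \<and> y \<in> S}" for n
  have F2S: "F2 y \<in> S" if "y \<in> S" for y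
    using that by (simp add: S_def F2 linD[OF F2(1)])
  have QF: "F q + F2 q \<in> Q (Suc n)" if "q \<in> Q n" for q n
    using that unfolding Q_def
  proof (induction rule: span_induct_alt)
    case base then show ?case by (simp add: lins linD[OF F2(1)] span_zero)
  next
    case (step d x q)
    then obtain a y where x: "x = (F ^^ a) y" "a < n" "y \<in> S" by auto
    have "F x \<in> {(F ^^ a) y | a y. a < Suc n \<and> y \<in> S}"
      using x by (intro CollectI exI[of _ "Suc a"] exI[of _ y]) simp
    moreover have "F2 x = (F ^^ a) (F2 y)" unfolding x using pow_comm[of F F2, OF F2(3)] by simp
    then have "F2 x \<in> {(F ^^ a) y | a y. a < Suc n \<and> y \<in> S}"
      using x F2S by (intro CollectI exI[of _ a] exI[of _ "F2 y"]) simp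
    ultimately have "sc d (F x + F2 x) \<in> span {(F ^^ a) y | a y. a < Suc n \<and> y \<in> S}"
      by (intro span_add span_scale span_base)
    then have "sc d (F x + F2 x) + (F q + F2 q) \<in> span {(F ^^ a) y | a y. a < Suc n \<and> y \<in> S}"
      by (rule span_add) (rule step)
    then show ?case by (simp add: lins linD[OF F2(1)] scale_right_distrib add_ac)
  qed
  have wS: "w \<in> S" using w by (simp add: S_def)
  \<comment> \<open>Modulo lower degree in \<open>F\<close>, the power of the perturbed operator is
    the power of \<open>F\<close> alone.\<close>
  have main: "((\<lambda>x. F x + F2 x) ^^ n) w - (F ^^ n) w \<in> Q n" for n
  proof (induction n)
    case 0 then show ?case by (simp add: Q_def span_zero)
  next
    case (Suc n)
    let ?z = "((\<lambda>x. F x + F2 x) ^^ n) w"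
    have "(F2 ((F ^^ n) w)) = (F ^^ n) (F2 w)" using pow_comm[of F F2, OF F2(3)] by simp
    then have "F2 ((F ^^ n) w) \<in> Q (Suc n)"
      unfolding Q_def using F2S[OF wS] by (intro span_base CollectI exI[of _ n] exI[of _ "F2 w"]) simp
    with QF[OF Suc] have "F (?z - (F ^^ n) w) + F2 (?z - (F ^^ n) w) + F2 ((F ^^ n) w) \<in> Q (Suc n)"
      unfolding Q_def by (rule span_add)
    then show ?case by (simp add: lins linD[OF F2(1)] algebra_simps)
  qed
  have "(E ^^ K) q = 0" if "q \<in> Q K" for q
    using that unfolding Q_def
  proof (induction rule: span_induct_alt)
    case base then show ?case using linD(3)[OF lin_pow[OF lin(1)]] by simp
  next
    case (step d x q)
    then obtain a y where x: "x = (F ^^ a) y" "a < K" "y \<in> S" by auto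
    have "(E ^^ K) x = 0"
      using x singular_pow(2)[of y c a] pow_zero_mono[OF lin(1), of "Suc a" x K] by (simp add: S_def)
    then show ?case using step by (simp add: linD[OF lin_pow[OF lin(1)]])
  qed
  \<comment> \<open>As the perturbed power vanishes, \<open>F^K w\<close> itself lies in
    \<open>Q K\<close>, while \<open>E^K F^K w\<close> is a nonzero multiple of
    \<open>w\<close>.\<close>
  from this[OF main[of K]] have "(E ^^ K) ((F ^^ K) w) = 0"
    using nil by (simp add: linD[OF lin_pow[OF lin(1)]])
  then show ?thesis
    unfolding singular_pow(1)[OF w] using c by (simp del: of_nat_Suc)
qed

end

subsection \<open>Powers of ideals\<close>

context cring
begin

definition prodl :: "'a list \<Rightarrow> 'a" where
  "prodl cs = foldr (\<otimes>) cs \<one>"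

lemma prodl_simps [simp]: "prodl [] = \<one>" "prodl (c # cs) = c \<otimes> prodl cs"
  by (simp_all add: prodl_def)

lemma prodl_closed [simp]: "set cs \<subseteq> carrier R \<Longrightarrow> prodl cs \<in> carrier R"
  by (induction cs) auto

lemma ideal_pow_ideal: "ideal I R \<Longrightarrow> ideal (ideal_pow R I n) R"
  by (induction n) (auto simp: oneideal ideal_prod_is_ideal)

lemma ideal_pow_closed: "ideal I R \<Longrightarrow> x \<in> ideal_pow R I n \<Longrightarrow> x \<in> carrier R"
  using ideal_pow_ideal ideal.Icarr by metis

lemma ideal_pow_Suc_subset: "ideal I R \<Longrightarrow> ideal_pow R I (Suc n) \<subseteq> ideal_pow R I n"
  using ideal_prod_inter[OF _ ideal_pow_ideal] by auto

lemma ideal_pow_antimono: "ideal I R \<Longrightarrow> m \<le> n \<Longrightarrow> ideal_pow R I n \<subseteq> ideal_pow R I m"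
  by (rule lift_Suc_antimono_le[of "ideal_pow R I"]) (use ideal_pow_Suc_subset in auto)

lemma ideal_pow_subset: "ideal I R \<Longrightarrow> n > 0 \<Longrightarrow> ideal_pow R I n \<subseteq> I"
  using ideal_pow_antimono[of I 1 n] ideal_prod_inter[of I "carrier R"] oneideal by fastforce

lemma ideal_prod_mono: "I \<subseteq> I' \<Longrightarrow> J \<subseteq> J' \<Longrightarrow> ideal_prod R I J \<subseteq> ideal_prod R I' J'"
proof
  fix x assume "I \<subseteq> I'" "J \<subseteq> J'" "x \<in> ideal_prod R I J"
  from this(3) this(1,2) show "x \<in> ideal_prod R I' J'"
    by induction (auto intro: ideal_prod.intros)
qed

lemma ideal_pow_mono: "I \<subseteq> J \<Longrightarrow> ideal_pow R I n \<subseteq> ideal_pow R J n"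
proof (induction n)
  case (Suc n)
  then show ?case using ideal_prod_mono[of I J "ideal_pow R I n" "ideal_pow R J n"] by simp
qed simp

lemma ideal_pow_add:
  assumes "ideal I R"
  shows "ideal_pow R I (m + n) = ideal_prod R (ideal_pow R I m) (ideal_pow R I n)"
proof (induction m)
  case 0
  then show ?case
    using ideal_prod_one ideal_prod_commute[OF oneideal] ideal_pow_ideal[OF assms, of n] by simp
next
  case (Suc m)
  then show ?case
    using ideal_prod_assoc[OF assms ideal_pow_ideal[OF assms, of m] ideal_pow_ideal[OF assms, of n]] by simp
qed

lemma ideal_pow_prod:
  assumes I: "ideal I R" and J: "ideal J R"
  shows "ideal_prod R (ideal_pow R I n) (ideal_pow R J n) \<subseteq> ideal_pow R (ideal_prod R I J) n"
proof (induction n)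
  case 0 then show ?case using ideal_prod_in_carrier[OF oneideal oneideal] by simp
next
  case (Suc n)
  let ?I = "ideal_pow R I n" and ?J = "ideal_pow R J n"
  have i: "ideal ?I R" "ideal ?J R" using I J by (auto intro: ideal_pow_ideal)
  have "ideal_prod R (ideal_prod R I ?I) (ideal_prod R J ?J) = ideal_prod R (ideal_prod R I J) (ideal_prod R ?I ?J)"
    using I J i by (metis ideal_prod_assoc ideal_prod_commute ideal_prod_is_ideal)
  then show ?case using Suc ideal_prod_mono[OF order.refl Suc] by simp
qed

text \<open>Elements of the n-th power are sums of n-fold products of elements of \<open>I\<close>
  with a coefficient \<open>c\<close> from the ring. The coefficient matters for
  \<open>n = 0\<close>, where the power is the whole ring and the only empty product is the
  unit.\<close>

lemma ideal_pow_induct [consumes 2, case_names add prod]: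
  assumes "ideal I R" "x \<in> ideal_pow R I n"
    and "\<And>x y. x \<in> carrier R \<Longrightarrow> y \<in> carrier R \<Longrightarrow> P x \<Longrightarrow> P y \<Longrightarrow> P (x \<oplus> y)"
    and "\<And>c cs. c \<in> carrier R \<Longrightarrow> set cs \<subseteq> I \<Longrightarrow> length cs = n \<Longrightarrow> P (c \<otimes> prodl cs)"
  shows "P x"
  using assms(2-4)
proof (induction n arbitrary: x P)
  case 0
  from 0(3)[of x "[]"] 0(1) show ?case by simp
next
  case (Suc n)
  have Ic: "I \<subseteq> carrier R" using ideal.Icarr[OF assms(1)] by (rule subsetI)
  \<comment> \<open>The induction hypothesis is used for the predicate saying that \<open>P\<close>
    holds after multiplication by \<open>i\<close>; this is why \<open>P\<close> is
    generalised.\<close>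
  have step: "P (i \<otimes> y)" if i: "i \<in> I" and y: "y \<in> ideal_pow R I n" for i y
  proof (rule Suc.IH[OF y])
    have ic: "i \<in> carrier R" using i Ic by auto
    show "P (i \<otimes> (x \<oplus> y))" if "x \<in> carrier R" "y \<in> carrier R" "P (i \<otimes> x)" "P (i \<otimes> y)" for x y
      using Suc.prems(2)[of "i \<otimes> x" "i \<otimes> y"] that ic by (simp add: r_distr)
    show "P (i \<otimes> (c \<otimes> prodl cs))" if "c \<in> carrier R" "set cs \<subseteq> I" "length cs = n" for c cs
      using Suc.prems(3)[of c "i # cs"] that ic i Ic prodl_closed[of cs] by (simp add: m_lcomm)
  qed
  from Suc.prems(1) have "x \<in> ideal_prod R I (ideal_pow R I n)" by simp
  then show ?case
  proof induction
    case (prod i j) then show ?case by (rule step)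
  next
    case (sum s1 s2)
    then show ?case
      using ideal_prod_in_carrier[OF assms(1) ideal_pow_ideal[OF assms(1), of n]] by (blast intro: Suc.prems(2))
  qed
qed

text \<open>Coprimality passes to products by \<open>1 - ab = (1 - a) + a (1 - b)\<close>, and is
  symmetric by replacing \<open>e\<close> with \<open>1 - e\<close>. It is applied to the powers of
  \<open>J\<close> against \<open>I\<close>, and then, after an exchange, to the powers of
  \<open>I\<close> against a fixed power of \<open>J\<close>.\<close>

lemma coprime_ideal_pow:
  assumes I: "ideal I R" and J: "ideal J R" and "I <+> J = carrier R"
  shows "\<exists>e\<in>ideal_pow R J n. \<one> \<ominus> e \<in> ideal_pow R I n"
proof -
  have pr: "\<exists>e\<in>ideal_prod R J K. \<one> \<ominus> e \<in> I"
    if I: "ideal I R" and J: "ideal J R" and K: "ideal K R"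
      and e: "\<exists>e\<in>J. \<one> \<ominus> e \<in> I" "\<exists>e\<in>K. \<one> \<ominus> e \<in> I" for I J K
  proof -
    obtain a b where ab: "a \<in> J" "\<one> \<ominus> a \<in> I" "b \<in> K" "\<one> \<ominus> b \<in> I" using e by blast
    have c: "a \<in> carrier R" "b \<in> carrier R" using ab J K by (auto dest: ideal.Icarr)
    have "\<one> \<ominus> a \<otimes> b = (\<one> \<ominus> a) \<oplus> a \<otimes> (\<one> \<ominus> b)" using c by algebra
    moreover have "(\<one> \<ominus> a) \<oplus> a \<otimes> (\<one> \<ominus> b) \<in> I"
      using ab c by (intro additive_subgroup.a_closed[OF ideal.axioms(1)[OF I]] ideal.I_l_closed[OF I])
    ultimately show ?thesis using ab by (intro bexI[of _ "a \<otimes> b"]) (auto intro: ideal_prod.prod)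
  qed
  have sym: "\<exists>e\<in>I. \<one> \<ominus> e \<in> J" if J: "ideal J R" and e: "\<exists>e\<in>J. \<one> \<ominus> e \<in> I" for I J
  proof -
    obtain e where e: "e \<in> J" "\<one> \<ominus> e \<in> I" using e by blast
    have "e \<in> carrier R" using ideal.Icarr[OF J e(1)] .
    then have "\<one> \<ominus> (\<one> \<ominus> e) = e" by algebra
    with e show ?thesis by (intro bexI[of _ "\<one> \<ominus> e"]) auto
  qed
  have one: "\<exists>e\<in>carrier R. \<one> \<ominus> e \<in> I" if "ideal I R" for I
    using that additive_subgroup.zero_closed[OF ideal.axioms(1)[OF that]] by (intro bexI[of _ \<one>]) (auto simp: a_minus_def r_neg)
  have "\<one> \<in> I <+> J" using assms(3) by simp
  then obtain i j where ij: "i \<in> I" "j \<in> J" "\<one> = i \<oplus> j" by (auto simp: set_add_def')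
  have ijc: "i \<in> carrier R" "j \<in> carrier R" using ij I J by (auto dest: ideal.Icarr)
  have "\<one> \<ominus> j = i" using ijc unfolding ij(3) by algebra
  then have e1: "\<exists>e\<in>J. \<one> \<ominus> e \<in> I" using ij by (intro bexI[of _ j]) simp_all
  have f: "\<exists>e\<in>ideal_pow R J n. \<one> \<ominus> e \<in> I" for n
    by (induction n) (use one[OF I] pr[OF I J ideal_pow_ideal[OF J] e1] in auto)
  have e2: "\<exists>e\<in>I. \<one> \<ominus> e \<in> ideal_pow R J n"
    by (rule sym[OF ideal_pow_ideal[OF J] f])
  have g: "\<exists>e\<in>ideal_pow R I k. \<one> \<ominus> e \<in> ideal_pow R J n" for k
    by (induction k) (use one[OF ideal_pow_ideal[OF J]] pr[OF ideal_pow_ideal[OF J] I ideal_pow_ideal[OF I] e2] in auto)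
  show ?thesis by (rule sym[OF ideal_pow_ideal[OF I] g])
qed

text \<open>For \<open>a\<close> in both powers, \<open>a = a e + (1 - e) a\<close> lies in the
  product of the two powers, hence in the power of the product ideal.\<close>

lemma coprime_ideal_pow_Int:
  assumes I: "ideal I R" and J: "ideal J R" and "I <+> J = carrier R"
  shows "ideal_pow R I n \<inter> ideal_pow R J n \<subseteq> ideal_pow R (I \<inter> J) n"
proof
  fix a assume a: "a \<in> ideal_pow R I n \<inter> ideal_pow R J n"
  obtain e where e: "e \<in> ideal_pow R J n" "\<one> \<ominus> e \<in> ideal_pow R I n"
    using coprime_ideal_pow[OF assms] by blast
  have c: "a \<in> carrier R" "e \<in> carrier R" using a e ideal_pow_closed I J by auto
  have "a \<otimes> e \<oplus> (\<one> \<ominus> e) \<otimes> a \<in> ideal_prod R (ideal_pow R I n) (ideal_pow R J n)"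
    using a e by (intro ideal_prod.sum ideal_prod.prod) auto
  moreover have "a = a \<otimes> e \<oplus> (\<one> \<ominus> e) \<otimes> a" using c by algebra
  ultimately have "a \<in> ideal_pow R (ideal_prod R I J) n" using ideal_pow_prod[OF I J] by auto
  then show "a \<in> ideal_pow R (I \<inter> J) n"
    using ideal_pow_mono[OF ideal_prod_inter[OF I J]] by blast
qed

end

subsection \<open>Highest weight vectors of the current algebra of \<open>sl\<^sub>2\<close>\<close>

text \<open>\<open>E a\<close>, \<open>T a\<close> and \<open>H a\<close> are the actions of
  \<open>e \<otimes> a\<close>, \<open>f \<otimes> a\<close> and \<open>h \<otimes> a\<close>. The
  relations are those that move \<open>E\<close> and \<open>H\<close> to the right through a product
  of \<open>T\<close>s until they meet the highest weight vector \<open>v\<close>.\<close>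

locale sl2_current = cvec sc + A?: cring A
  for sc :: "complex \<Rightarrow> 'u::ab_group_add \<Rightarrow> 'u" and A :: "('a, 'm) ring_scheme" (structure) +
  fixes E T H :: "'a \<Rightarrow> 'u \<Rightarrow> 'u" and I :: "'a set" and v :: 'u and \<theta> :: "'a \<Rightarrow> complex"
  assumes I: "ideal I A"
    and lin: "a \<in> carrier A \<Longrightarrow> lin (E a)" "a \<in> carrier A \<Longrightarrow> lin (T a)" "a \<in> carrier A \<Longrightarrow> lin (H a)"
    and T_add: "a \<in> carrier A \<Longrightarrow> b \<in> carrier A \<Longrightarrow> T (a \<oplus> b) x = T a x + T b x"
    and ET: "a \<in> carrier A \<Longrightarrow> b \<in> carrier A \<Longrightarrow> E a (T b x) = T b (E a x) + H (a \<otimes> b) x"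
    and HT: "a \<in> carrier A \<Longrightarrow> b \<in> carrier A \<Longrightarrow> H a (T b x) = T b (H a x) - sc 2 (T (a \<otimes> b) x)"
    and Ev: "a \<in> carrier A \<Longrightarrow> E a v = 0"
    and Hv: "a \<in> carrier A \<Longrightarrow> H a v = sc (\<theta> a) v"
    and \<theta>I: "a \<in> I \<Longrightarrow> \<theta> a = 0"
begin

lemma Icarr: "a \<in> I \<Longrightarrow> a \<in> carrier A"
  using I by (rule ideal.Icarr)

lemma HI: "a \<in> I \<Longrightarrow> H a v = 0"
  by (simp add: Hv Icarr \<theta>I)

text \<open>\<open>pos d k x\<close>: the vector \<open>x\<close> is a nonempty sum of vectors \<open>T c\<^sub>1 (\<dots> (T c\<^sub>k v))\<close> with
  \<open>c\<^sub>1 \<cdots> c\<^sub>k = d\<close>. For \<open>a\<close> in \<open>I\<close>, the operator \<open>E a\<close> maps such a sum to \<open>-2\<close> times a sum of the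
  same shape with one factor less and \<open>d\<close> replaced by \<open>a d\<close>; as there are no signs, nothing
  cancels.\<close>

inductive pos :: "'a \<Rightarrow> nat \<Rightarrow> 'u \<Rightarrow> bool" where
  base: "set cs \<subseteq> carrier A \<Longrightarrow> d = prodl cs \<Longrightarrow> k = length cs \<Longrightarrow> pos d k (foldr T cs v)"
| add: "pos d k x \<Longrightarrow> pos d k y \<Longrightarrow> pos d k (x + y)"

lemma T_pos: "pos d k x \<Longrightarrow> c \<in> carrier A \<Longrightarrow> pos (c \<otimes> d) (Suc k) (T c x)"
proof (induction rule: pos.induct)
  case (base cs d k)
  then show ?case using pos.base[of "c # cs"] by simp
next
  case (add d k x y)
  then show ?case using linD(1)[OF lin(2), of c] pos.add by simp
qed

text \<open>\<open>H b\<close> acts as a derivation: moving it through the word multiplies one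
  factor at a time by \<open>b\<close>, with coefficient \<open>-2\<close>, and at the end it kills
  \<open>v\<close> because \<open>b\<close> lies in \<open>I\<close>. The word must be nonempty, as
  \<open>pos\<close> admits no empty sum.\<close>

lemma H_word:
  assumes "b \<in> I" "set cs \<subseteq> carrier A" "cs \<noteq> []"
  shows "\<exists>y. H b (foldr T cs v) = - sc 2 y \<and> pos (b \<otimes> prodl cs) (length cs) y"
  using assms(2,3)
proof (induction cs)
  case (Cons c cs)
  let ?X = "foldr T cs v"
  have bc: "b \<in> carrier A" "c \<in> carrier A" using assms(1) Icarr Cons.prems by auto
  have 1: "pos (b \<otimes> prodl (c # cs)) (length (c # cs)) (T (b \<otimes> c) ?X)"
    using pos.base[of "(b \<otimes> c) # cs"] Cons.prems bc by (simp add: m_assoc)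
  show ?case
  proof (cases "cs = []")
    case True
    then show ?thesis using 1 HT[OF bc, of v] HI[OF assms(1)] linD(3)[OF lin(2)[OF bc(2)]]
      by (intro exI[of _ "T (b \<otimes> c) v"]) simp
  next
    case False
    then obtain y where y: "H b ?X = - sc 2 y" "pos (b \<otimes> prodl cs) (length cs) y"
      using Cons by auto
    have "c \<otimes> (b \<otimes> prodl cs) = b \<otimes> prodl (c # cs)"
      using bc Cons.prems prodl_closed[of cs] by (simp add: m_lcomm)
    then have "pos (b \<otimes> prodl (c # cs)) (length (c # cs)) (T c y)"
      using T_pos[OF y(2) bc(2)] by simp
    from pos.add[OF this 1] show ?thesis
      using HT[OF bc, of ?X] y(1) linD[OF lin(2)[OF bc(2)]]
      by (intro exI[of _ "T c y + T (b \<otimes> c) ?X"]) (simp add: scale_right_distrib)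
  qed
qed simp

text \<open>Passing \<open>E a\<close> through a factor \<open>T c\<close> leaves
  \<open>H (a c)\<close> in its place, with \<open>a c\<close> in \<open>I\<close>, and
  \<open>H_word\<close> evaluates it on the rest. When nothing is to the right of that factor the
  result is zero, so words of length at most one are killed.\<close>

lemma E_word:
  assumes a: "a \<in> I" and "set cs \<subseteq> carrier A"
  shows "length cs \<le> 1 \<Longrightarrow> E a (foldr T cs v) = 0"
    and "length cs \<ge> 2 \<Longrightarrow> \<exists>y. E a (foldr T cs v) = - sc 2 y \<and> pos (a \<otimes> prodl cs) (length cs - 1) y"
proof -
  have ac: "a \<in> carrier A" using Icarr a by auto
  have short: "E a (foldr T cs v) = 0" if "length cs \<le> 1" "set cs \<subseteq> carrier A" for cs
  proof (cases cs)
    case Nil then show ?thesis using Ev ac by simp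
  next
    case (Cons c cs')
    then have "cs = [c]" "c \<in> carrier A" using that by auto
    then show ?thesis
      using ET[OF ac, of c v] HI[of "a \<otimes> c"] ideal.I_r_closed[OF I a] Ev ac linD(3)[OF lin(2)] by simp
  qed
  show "length cs \<le> 1 \<Longrightarrow> E a (foldr T cs v) = 0" using short assms(2) by blast
  show "\<exists>y. E a (foldr T cs v) = - sc 2 y \<and> pos (a \<otimes> prodl cs) (length cs - 1) y" if "length cs \<ge> 2"
    using that assms(2)
  proof (induction cs)
    case (Cons c cs)
    let ?X = "foldr T cs v"
    have c: "c \<in> carrier A" "set cs \<subseteq> carrier A" "cs \<noteq> []" using Cons.prems by auto
    have "a \<otimes> c \<in> I" using ideal.I_r_closed[OF I a] c by simp
    from H_word[OF this c(2,3)] obtain z where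
      z: "H (a \<otimes> c) ?X = - sc 2 z" "pos (a \<otimes> c \<otimes> prodl cs) (length cs) z" by blast
    have z': "pos (a \<otimes> prodl (c # cs)) (length (c # cs) - 1) z"
      using z(2) c ac prodl_closed[of cs] by (simp add: m_assoc)
    show ?case
    proof (cases "length cs \<le> 1")
      case True
      then show ?thesis
        using z' z(1) ET[OF ac c(1), of ?X] short[OF True c(2)] linD(3)[OF lin(2)[OF c(1)]]
        by (intro exI[of _ z]) simp
    next
      case False
      then obtain y where y: "E a ?X = - sc 2 y" "pos (a \<otimes> prodl cs) (length cs - 1) y"
        using Cons.IH c by auto
      have "c \<otimes> (a \<otimes> prodl cs) = a \<otimes> prodl (c # cs)"
        using ac c prodl_closed[of cs] by (simp add: m_lcomm)
      moreover have "Suc (length cs - 1) = length cs" using False by simp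
      ultimately have "pos (a \<otimes> prodl (c # cs)) (length (c # cs) - 1) (T c y)"
        using T_pos[OF y(2) c(1)] by (simp del: One_nat_def)
      from pos.add[OF this z'] show ?thesis
        using ET[OF ac c(1), of ?X] y(1) z(1) linD[OF lin(2)[OF c(1)]]
        by (intro exI[of _ "T c y + z"]) (simp add: scale_right_distrib)
    qed
  qed simp
qed

lemma E_pos:
  assumes "a \<in> I" "pos d k x" "k \<ge> 2"
  shows "\<exists>y. E a x = - sc 2 y \<and> pos (a \<otimes> d) (k - 1) y"
  using assms(2,3)
proof (induction rule: pos.induct)
  case (base cs d k)
  then show ?case using E_word(2)[OF assms(1)] by auto
next
  case (add d k x y)
  then obtain x' y' where "E a x = - sc 2 x'" "pos (a \<otimes> d) (k - 1) x'" "E a y = - sc 2 y'" "pos (a \<otimes> d) (k - 1) y'"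
    by blast
  then show ?case
    using linD(1)[OF lin(1)[OF Icarr[OF assms(1)]]] pos.add
    by (intro exI[of _ "x' + y'"]) (simp add: scale_right_distrib)
qed

text \<open>Each summand is \<open>T d v\<close> itself, so the number of summands is the factor
  \<open>k\<close>. Here the absence of signs pays: \<open>k\<close> is positive.\<close>

lemma pos_one: "pos d (Suc 0) x \<Longrightarrow> \<exists>k>0. x = sc (of_nat k) (T d v)"
proof (induction d "Suc 0" x rule: pos.induct)
  case (base cs d)
  then obtain c where "cs = [c]" by (metis length_0_conv length_Suc_conv)
  with base show ?case by (intro exI[of _ 1]) auto
next
  case (add d x y)
  then obtain j k where "j > 0" "k > 0" "x = sc (of_nat j) (T d v)" "y = sc (of_nat k) (T d v)" by blast
  then show ?case by (intro exI[of _ "j + k"]) (simp add: scale_left_distrib)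
qed

text \<open>The vanishing vector is the word of \<open>n + 1\<close> units. Applying
  \<open>E\<close> of \<open>n\<close> elements of \<open>I\<close> in turn, and dividing by
  \<open>-2\<close> each time, leaves a positive multiple of \<open>T\<close> of their product on
  \<open>v\<close>, which must be zero. Sums and ring coefficients then reach the whole power of
  \<open>I\<close>.\<close>

lemma T_ideal_pow:
  assumes nil: "(T \<one> ^^ Suc n) v = 0" and a: "a \<in> ideal_pow A I n"
  shows "T a v = 0"
proof (cases "n = 0")
  \<comment> \<open>For \<open>n = 0\<close> there is no \<open>E\<close> to apply. The relation
    between \<open>H a\<close> and \<open>T 1\<close> turns \<open>T 1 v = 0\<close> into
    \<open>T a v = 0\<close> for every \<open>a\<close> instead.\<close>
  case True
  then have 1: "T \<one> v = 0" and ac: "a \<in> carrier A" using assms by auto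
  have "H a (T \<one> v) = T \<one> (sc (\<theta> a) v) - sc 2 (T a v)"
    using HT[OF ac one_closed] Hv[OF ac] ac by simp
  then show ?thesis
    using 1 linD(2)[OF lin(2)[OF one_closed]] linD(3)[OF lin(3)[OF ac]] by simp
next
  case False
  have Isub: "I \<subseteq> carrier A" using Icarr by auto
  have ex: "\<exists>y. pos (prodl as) (Suc n - length as) y \<and> y = 0" if "set as \<subseteq> I" "length as \<le> n" for as
    using that
  proof (induction as)
    case Nil
    have "foldr T (replicate k \<one>) v = (T \<one> ^^ k) v" "prodl (replicate k \<one>) = \<one>" for k
      by (induction k) auto
    then have "pos \<one> (Suc n) ((T \<one> ^^ Suc n) v)"
      using pos.base[of "replicate (Suc n) \<one>"] by (metis length_replicate one_closed set_replicate_Suc subsetI singletonD)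
    then show ?case using nil by (intro exI[of _ "(T \<one> ^^ Suc n) v"]) simp
  next
    case (Cons a as)
    then have y: "pos (prodl as) (Suc n - length as) 0" by auto
    have "Suc n - length as \<ge> 2" using Cons.prems by simp
    from E_pos[OF _ y this, of a] obtain y where "E a 0 = - sc 2 y" "pos (a \<otimes> prodl as) (Suc n - length as - 1) y"
      using Cons.prems by auto
    moreover have "E a 0 = 0" using linD(3)[OF lin(1)] Cons.prems Icarr by simp
    ultimately show ?case by (intro exI[of _ y]) simp
  qed
  have prod: "T (prodl as) v = 0" if "set as \<subseteq> I" "length as = n" for as
  proof -
    have "pos (prodl as) (Suc n - length as) 0"
      using ex[OF that(1)] that(2) by auto
    then have "pos (prodl as) (Suc 0) 0" using that(2) by (simp add: Suc_diff_le)
    from pos_one[OF this] obtain k where "k > 0" "0 = sc (of_nat k) (T (prodl as) v)" by blast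
    then show ?thesis by simp
  qed
  show ?thesis
    using I a
  proof (induction rule: ideal_pow_induct)
    case (add x y) then show ?case by (simp add: T_add)
  next
    case (prod c cs)
    \<comment> \<open>The coefficient \<open>c\<close> is absorbed into the first factor, which
      exists since \<open>n > 0\<close> and stays in \<open>I\<close>.\<close>
    then obtain b bs where b: "cs = b # bs" using False by (cases cs) auto
    have "c \<otimes> b \<in> I" using ideal.I_l_closed[OF I] prod b by simp
    then have "T (prodl ((c \<otimes> b) # bs)) v = 0"
      using prod b by (intro \<open>\<And>as. set as \<subseteq> I \<Longrightarrow> length as = n \<Longrightarrow> T (prodl as) v = 0\<close>) auto
    moreover have "prodl ((c \<otimes> b) # bs) = c \<otimes> prodl cs"
      using prod b Isub prodl_closed[of bs] by (simp add: m_assoc subset_iff)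
    ultimately show ?case by simp
  qed
qed

end

section \<open>The triangular decomposition of a Kac--Moody algebra\<close>

lemma lin_subspaceD:
  assumes "cmod V" "lin_subspace V K"
  shows "x \<in> K \<Longrightarrow> x \<in> carrier V" "\<zero>\<^bsub>V\<^esub> \<in> K" "x \<in> K \<Longrightarrow> y \<in> K \<Longrightarrow> x \<oplus>\<^bsub>V\<^esub> y \<in> K"
    "x \<in> K \<Longrightarrow> c \<odot>\<^bsub>V\<^esub> x \<in> K"
  using assms(2) unfolding lin_subspace_iff[OF assms(1)] by auto

context kac_moody
begin

lemma G_cmod: "cmod G"
  by (rule module_axioms)

lemmas gs = cmod_simps[OF G_cmod] cmod_ac[OF G_cmod]

abbreviation br (\<open>[_,_]\<^sub>G\<close>) where "[x,y]\<^sub>G \<equiv> brkt G x y"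

lemma br_lin: "x \<in> carrier G \<Longrightarrow> lin_map G G (brkt G x)" "y \<in> carrier G \<Longrightarrow> lin_map G G (\<lambda>x. brkt G x y)"
  by (auto intro!: lin_mapI simp: brkt_closed brkt_add_left brkt_add_right brkt_smult_left brkt_smult_right)

lemmas brs = brkt_closed lin_mapD[OF br_lin(1)] lin_mapD[OF br_lin(2)]

lemma br_antisym: "x \<in> carrier G \<Longrightarrow> y \<in> carrier G \<Longrightarrow> [x,y]\<^sub>G = (-1) \<odot>\<^bsub>G\<^esub> [y,x]\<^sub>G"
proof -
  assume x: "x \<in> carrier G" and y: "y \<in> carrier G"
  have "[x,y]\<^sub>G \<oplus>\<^bsub>G\<^esub> [y,x]\<^sub>G = \<zero>\<^bsub>G\<^esub>"
  proof -
    have "[x \<oplus>\<^bsub>G\<^esub> y,x \<oplus>\<^bsub>G\<^esub> y]\<^sub>G = [x,x]\<^sub>G \<oplus>\<^bsub>G\<^esub> [y,x]\<^sub>G \<oplus>\<^bsub>G\<^esub> ([x,y]\<^sub>G \<oplus>\<^bsub>G\<^esub> [y,y]\<^sub>G)"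
      using x y by (simp add: gs(1) brkt_add_left brkt_add_right)
    then show ?thesis using x y by (simp add: gs brkt_self brkt_closed)
  qed
  then have "[x,y]\<^sub>G \<oplus>\<^bsub>G\<^esub> (-1) \<odot>\<^bsub>G\<^esub> ((-1) \<odot>\<^bsub>G\<^esub> [y,x]\<^sub>G) = \<zero>\<^bsub>G\<^esub>"
    using x y by (simp add: gs brkt_closed)
  then show ?thesis
    using cmod_sub_eq_zero[OF G_cmod] x y gs(3) brkt_closed by metis
qed

lemma br_jacobi:
  assumes "x \<in> carrier G" "y \<in> carrier G" "z \<in> carrier G"
  shows "[x,[y,z]\<^sub>G]\<^sub>G = [[x,y]\<^sub>G,z]\<^sub>G \<oplus>\<^bsub>G\<^esub> [y,[x,z]\<^sub>G]\<^sub>G"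
proof -
  have 1: "[y,[z,x]\<^sub>G]\<^sub>G = (-1) \<odot>\<^bsub>G\<^esub> [y,[x,z]\<^sub>G]\<^sub>G"
    using assms br_antisym[of z x] by (simp add: brs)
  have 2: "[z,[x,y]\<^sub>G]\<^sub>G = (-1) \<odot>\<^bsub>G\<^esub> [[x,y]\<^sub>G,z]\<^sub>G"
    using assms br_antisym[of z "[x,y]\<^sub>G"] by (simp add: brs)
  have "[x,[y,z]\<^sub>G]\<^sub>G \<oplus>\<^bsub>G\<^esub> (-1) \<odot>\<^bsub>G\<^esub> ([[x,y]\<^sub>G,z]\<^sub>G \<oplus>\<^bsub>G\<^esub> [y,[x,z]\<^sub>G]\<^sub>G) = \<zero>\<^bsub>G\<^esub>"
    using jacobi[OF assms] assms unfolding 1 2 by (simp add: gs brkt_closed)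
  then show ?thesis
    using cmod_sub_eq_zero[OF G_cmod] assms gs(1) brkt_closed by metis
qed

lemma cartan_closed: "h \<in> cartan G \<Longrightarrow> h \<in> carrier G"
  using cartan_subspace by (auto simp: lin_subspace_iff[OF G_cmod])

lemma cartan_sub: "\<zero>\<^bsub>G\<^esub> \<in> cartan G" "h \<in> cartan G \<Longrightarrow> k \<in> cartan G \<Longrightarrow> h \<oplus>\<^bsub>G\<^esub> k \<in> cartan G"
    "h \<in> cartan G \<Longrightarrow> c \<odot>\<^bsub>G\<^esub> h \<in> cartan G"
  using cartan_subspace by (auto simp: lin_subspace_iff[OF G_cmod])

text \<open>Right-normed brackets of a word of generators. The empty word has value zero, a default
  that adds nothing to spans.\<close>

fun rbr :: "('i \<Rightarrow> 'g) \<Rightarrow> 'i list \<Rightarrow> 'g" where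
  "rbr g [] = \<zero>\<^bsub>G\<^esub>"
| "rbr g [i] = g i"
| "rbr g (i # j # w) = [g i, rbr g (j # w)]\<^sub>G"

lemma rbr_Cons: "w \<noteq> [] \<Longrightarrow> rbr g (i # w) = [g i, rbr g w]\<^sub>G"
  by (cases w) auto

lemma rbr_closed: "(\<And>i. g i \<in> carrier G) \<Longrightarrow> rbr g w \<in> carrier G"
  by (induction g w rule: rbr.induct) (auto simp: brkt_closed gs)

lemma rbr_weight:
  assumes g: "\<And>i. g i \<in> carrier G" and s: "\<And>i. [h, g i]\<^sub>G = s i \<odot>\<^bsub>G\<^esub> g i" and h: "h \<in> carrier G"
  shows "[h, rbr g w]\<^sub>G = sum_list (map s w) \<odot>\<^bsub>G\<^esub> rbr g w"
proof (induction w)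
  case Nil then show ?case using lin_map_zero[OF G_cmod G_cmod br_lin(1)[OF h]] by (simp add: gs)
next
  case (Cons i w)
  show ?case
  proof (cases "w = []")
    case False
    then show ?thesis
      using br_jacobi[OF h g rbr_closed[OF g]] Cons g[of i] rbr_closed[of g w, OF g]
      by (simp add: rbr_Cons s brs gs)
  qed (simp add: s)
qed

text \<open>Words in one kind of Chevalley generator together with the Cartan subalgebra. The latter
  is included because brackets with generators of the opposite kind end there.\<close>

definition wspan :: "('i \<Rightarrow> 'g) \<Rightarrow> 'g set" where
  "wspan g = lin_span G (cartan G \<union> range (rbr g))"

lemma wspan_subspace: "(\<And>i. g i \<in> carrier G) \<Longrightarrow> lin_subspace G (wspan g)"
  unfolding wspan_def using cartan_closed rbr_closed by (intro lin_span_subspace[OF G_cmod]) auto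

lemma wspan_base: "rbr g w \<in> wspan g" "h \<in> cartan G \<Longrightarrow> h \<in> wspan g"
  unfolding wspan_def by (auto intro: lin_span_base)

lemma wspan_mult:
  assumes b: "\<And>i. b i \<in> carrier G" and t: "\<And>h i. h \<in> cartan G \<Longrightarrow> [h, b i]\<^sub>G = t h i \<odot>\<^bsub>G\<^esub> b i"
    and x: "x \<in> wspan b"
  shows "[b j, x]\<^sub>G \<in> wspan b"
proof -
  have sub: "cartan G \<union> range (rbr b) \<subseteq> carrier G" using cartan_closed rbr_closed[OF b] by auto
  note ws = wspan_subspace[OF b, unfolded lin_subspace_iff[OF G_cmod]]
  show ?thesis
    using G_cmod sub x[unfolded wspan_def]
  proof (induction rule: lin_span_induct)
    case zero
    then show ?case using lin_map_zero[OF G_cmod G_cmod br_lin(1)[OF b]] ws by simp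
  next
    case (base y)
    consider "y \<in> cartan G" | w where "y = rbr b w" using base by auto
    then show ?case
    proof cases
      case 1
      then have "[b j, y]\<^sub>G = (- t y j) \<odot>\<^bsub>G\<^esub> rbr b [j]"
        using br_antisym[OF b, of y j] t b by (simp add: cartan_closed gs)
      moreover have "(- t y j) \<odot>\<^bsub>G\<^esub> rbr b [j] \<in> wspan b"
        by (rule lin_subspaceD(4)[OF G_cmod wspan_subspace[OF b] wspan_base(1)])
      ultimately show ?thesis by simp
    next
      case 2
      show ?thesis
      proof (cases "w = []")
        case True
        then show ?thesis using 2 lin_map_zero[OF G_cmod G_cmod br_lin(1)[OF b]] ws by simp
      next
        case False
        then show ?thesis using 2 wspan_base(1)[of b "j # w"] by (simp add: rbr_Cons)
      qed
    qed
  qed (use ws b in \<open>simp_all add: brs\<close>)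
qed

text \<open>By the Jacobi identity, \<open>[a_i, [b_j, x]]\<close> is
  \<open>[[a_i, b_j], x] + [b_j, [a_i, x]]\<close>. In the first term a Cartan element acts on a
  word by a scalar, the second is covered by induction. The families \<open>a\<close> and
  \<open>b\<close> are abstract so that the argument serves both signs.\<close>

lemma wspan_opposite:
  assumes a: "\<And>i. a i \<in> carrier G" and b: "\<And>i. b i \<in> carrier G"
    and t: "\<And>h i. h \<in> cartan G \<Longrightarrow> [h, b i]\<^sub>G = t h i \<odot>\<^bsub>G\<^esub> b i"
    and ab: "\<And>i j. [a i, b j]\<^sub>G \<in> cartan G"
  shows "[a i, rbr b w]\<^sub>G \<in> wspan b"
proof (induction w)
  case Nil
  then show ?case using lin_map_zero[OF G_cmod G_cmod br_lin(1)[OF a]] wspan_base(2)[OF cartan_sub(1)] by simp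
next
  case (Cons j w)
  show ?case
  proof (cases "w = []")
    case True then show ?thesis using ab wspan_base by simp
  next
    case False
    have "[[a i, b j]\<^sub>G, rbr b w]\<^sub>G = sum_list (map (t [a i, b j]\<^sub>G) w) \<odot>\<^bsub>G\<^esub> rbr b w"
      using ab t cartan_closed by (intro rbr_weight b) auto
    then have "[[a i, b j]\<^sub>G, rbr b w]\<^sub>G \<in> wspan b"
      using wspan_base(1) wspan_subspace[OF b] by (simp add: lin_subspace_iff[OF G_cmod])
    moreover have "[b j, [a i, rbr b w]\<^sub>G]\<^sub>G \<in> wspan b"
      by (rule wspan_mult[OF b t Cons])
    ultimately show ?thesis
      using False br_jacobi[OF a[of i] b[of j] rbr_closed[OF b]] wspan_subspace[OF b]
      by (simp add: rbr_Cons lin_subspace_iff[OF G_cmod])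
  qed
qed

abbreviation ew where "ew \<equiv> rbr (chev_e G)"
abbreviation fw where "fw \<equiv> rbr (chev_f G)"

lemma ew_closed: "ew w \<in> carrier G" and fw_closed: "fw w \<in> carrier G"
  using rbr_closed chev_e_closed chev_f_closed by auto

lemma brkt_f_e: "[chev_f G i, chev_e G j]\<^sub>G \<in> cartan G" and brkt_e_f': "[chev_e G i, chev_f G j]\<^sub>G \<in> cartan G"
proof -
  show *: "[chev_e G i, chev_f G j]\<^sub>G \<in> cartan G" for i j
    using coroot_cartan cartan_sub(1) by (simp add: brkt_e_f)
  show "[chev_f G i, chev_e G j]\<^sub>G \<in> cartan G"
    using br_antisym[OF chev_f_closed chev_e_closed, of i j] *[of j i] cartan_sub(3) by simp
qed

lemma ew_weight: "h \<in> cartan G \<Longrightarrow> [h, ew w]\<^sub>G = sum_list (map (\<lambda>i. sroot G i h) w) \<odot>\<^bsub>G\<^esub> ew w"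
  by (rule rbr_weight) (auto simp: chev_e_closed brkt_h_e cartan_closed)

lemma fw_weight: "h \<in> cartan G \<Longrightarrow> [h, fw w]\<^sub>G = (- sum_list (map (\<lambda>i. sroot G i h) w)) \<odot>\<^bsub>G\<^esub> fw w"
  using rbr_weight[of "chev_f G" h "\<lambda>i. - sroot G i h" w]
  by (simp add: chev_f_closed brkt_h_f cartan_closed uminus_sum_list_map comp_def)

lemma sum_list_sroot: "sum_list (map (\<lambda>i. sroot G i h) w) = root_of G (count_list w) h"
proof (induction w)
  case (Cons j w)
  have "(\<Sum>i\<in>UNIV. of_nat (count_list (j # w) i) * sroot G i h) =
      (\<Sum>i\<in>UNIV. (if i = j then sroot G i h else 0) + of_nat (count_list w i) * sroot G i h)"
    by (intro sum.cong) (auto simp: algebra_simps)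
  then show ?case using Cons by (simp add: root_of_def sum.distrib)
qed (simp add: root_of_def)

definition full_gens where "full_gens = cartan G \<union> range ew \<union> range fw"

lemma full_gens_subset: "full_gens \<subseteq> carrier G"
  using cartan_closed ew_closed fw_closed by (auto simp: full_gens_def)

text \<open>The elements whose bracket maps the span to itself form a subalgebra \<open>N\<close>.
  It contains the Cartan subalgebra and all Chevalley generators, so it is everything; the span is
  thus an ideal containing the generators.\<close>

lemma triangular_span: "lin_span G full_gens = carrier G"
proof -
  let ?S = "lin_span G full_gens"
  have sub: "lin_subspace G ?S" by (rule lin_span_subspace[OF G_cmod full_gens_subset])
  note Ss = sub[unfolded lin_subspace_iff[OF G_cmod]]
  have wS: "wspan (chev_e G) \<subseteq> ?S" "wspan (chev_f G) \<subseteq> ?S"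
    unfolding wspan_def by (intro lin_span_least[OF sub]; auto simp: full_gens_def intro: lin_span_base)+
  have ad: "[x, s]\<^sub>G \<in> ?S" if x: "x \<in> carrier G" and gen: "\<And>y. y \<in> full_gens \<Longrightarrow> [x, y]\<^sub>G \<in> ?S" and s: "s \<in> ?S" for x s
    using G_cmod full_gens_subset s
  proof (induction rule: lin_span_induct)
    case zero then show ?case using lin_map_zero[OF G_cmod G_cmod br_lin(1)[OF x]] Ss by simp
  qed (use x gen Ss in \<open>simp_all add: brs\<close>)
  define N where "N = {x\<in>carrier G. \<forall>s\<in>?S. [x, s]\<^sub>G \<in> ?S}"
  have "N = carrier G"
  proof (rule generated)
    show "lin_subspace G N"
      unfolding lin_subspace_iff[OF G_cmod] N_def
      using Ss lin_map_zero[OF G_cmod G_cmod br_lin(2)] by (auto simp: gs brs subset_iff)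
    show "\<forall>x\<in>N. \<forall>y\<in>N. [x, y]\<^sub>G \<in> N"
    proof (intro ballI)
      fix x y assume xy: "x \<in> N" "y \<in> N"
      have "[[x, y]\<^sub>G, s]\<^sub>G \<in> ?S" if s: "s \<in> ?S" for s
      proof -
        have sc: "s \<in> carrier G" using s Ss by auto
        have c: "x \<in> carrier G" "y \<in> carrier G" using xy by (auto simp: N_def)
        have "[[x, y]\<^sub>G, s]\<^sub>G = [x, [y, s]\<^sub>G]\<^sub>G \<oplus>\<^bsub>G\<^esub> (-1) \<odot>\<^bsub>G\<^esub> [y, [x, s]\<^sub>G]\<^sub>G"
          unfolding br_jacobi[OF c sc] using c sc cmod_sub_eq_zero[OF G_cmod, of "[y, [x, s]\<^sub>G]\<^sub>G" "[y, [x, s]\<^sub>G]\<^sub>G"]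
          by (simp add: gs(1,3,5,14) brkt_closed)
        then show ?thesis using xy s Ss by (simp add: N_def)
      qed
      then show "[x, y]\<^sub>G \<in> N" using xy by (simp add: N_def brkt_closed)
    qed
    have h: "[h, y]\<^sub>G \<in> ?S" if h: "h \<in> cartan G" and y: "y \<in> full_gens" for h y
    proof -
      have yS: "y \<in> ?S" using y by (rule lin_span_base)
      consider "y \<in> cartan G" | w where "y = ew w" | w where "y = fw w" using y by (auto simp: full_gens_def)
      then show ?thesis
        by cases (use h yS Ss in \<open>simp_all add: brkt_h_h ew_weight fw_weight\<close>)
    qed
    then show "cartan G \<subseteq> N"
      using ad[OF cartan_closed] cartan_closed unfolding N_def by blast
    have e: "[chev_e G i, y]\<^sub>G \<in> ?S" if "y \<in> full_gens" for i y
      using that wspan_mult[of "chev_e G" "\<lambda>h i. sroot G i h" y i]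
        wspan_opposite[of "chev_e G" "chev_f G" "\<lambda>h i. - sroot G i h" i] wspan_base wS
      by (auto simp: full_gens_def chev_e_closed chev_f_closed brkt_h_e brkt_h_f brkt_e_f')
    then show "range (chev_e G) \<subseteq> N"
      using ad[OF chev_e_closed e] chev_e_closed unfolding N_def by blast
    have f: "[chev_f G i, y]\<^sub>G \<in> ?S" if "y \<in> full_gens" for i y
      using that wspan_mult[of "chev_f G" "\<lambda>h i. - sroot G i h" y i]
        wspan_opposite[of "chev_f G" "chev_e G" "\<lambda>h i. sroot G i h" i] wspan_base wS
      by (auto simp: full_gens_def chev_e_closed chev_f_closed brkt_h_e brkt_h_f brkt_f_e)
    then show "range (chev_f G) \<subseteq> N"
      using ad[OF chev_f_closed f] chev_f_closed unfolding N_def by blast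
  qed
  then have ideal: "[x, s]\<^sub>G \<in> ?S" if "x \<in> carrier G" "s \<in> ?S" for x s using that by (auto simp: N_def)
  show ?thesis
  proof (rule generated[OF sub])
    show "\<forall>x\<in>?S. \<forall>y\<in>?S. [x, y]\<^sub>G \<in> ?S" using ideal Ss by blast
    have "ew [i] \<in> full_gens" "fw [i] \<in> full_gens" for i unfolding full_gens_def by blast+
    then show "range (chev_e G) \<subseteq> ?S" "range (chev_f G) \<subseteq> ?S" by (auto intro: lin_span_base)
    show "cartan G \<subseteq> ?S" by (auto simp: full_gens_def intro: lin_span_base)
  qed
qed

section \<open>The derived algebra and its root vectors\<close>

lemma derived_subspace: "lin_subspace G (derived G)"
  unfolding derived_def using brkt_closed by (intro lin_span_subspace[OF G_cmod]) auto

lemmas derived_sub = derived_subspace[unfolded lin_subspace_iff[OF G_cmod]]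

lemma derived_closed: "x \<in> derived G \<Longrightarrow> x \<in> carrier G"
  using derived_sub by auto

lemma br_derived: "x \<in> carrier G \<Longrightarrow> y \<in> carrier G \<Longrightarrow> [x,y]\<^sub>G \<in> derived G"
  unfolding derived_def by (intro lin_span_base) auto

lemma weight_vector_derived:
  assumes "x \<in> carrier G" "h \<in> carrier G" "[h, x]\<^sub>G = c \<odot>\<^bsub>G\<^esub> x" "c \<noteq> 0"
  shows "x \<in> derived G"
proof -
  have "(1 / c) \<odot>\<^bsub>G\<^esub> [h, x]\<^sub>G \<in> derived G" using br_derived[OF assms(2,1)] derived_sub by auto
  then show ?thesis using assms by (simp add: gs)
qed

lemma sroot_self: "sroot G i (coroot G i) = 2"
  by (simp add: sroot_coroot gcm_diag)

lemma chev_derived: "chev_e G i \<in> derived G" "chev_f G i \<in> derived G" "coroot G i \<in> derived G"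
proof -
  have h: "coroot G i \<in> carrier G" using coroot_cartan cartan_closed by auto
  show "chev_e G i \<in> derived G"
    using weight_vector_derived[OF chev_e_closed h] brkt_h_e[OF coroot_cartan] sroot_self by (metis zero_neq_numeral)
  show "chev_f G i \<in> derived G"
    using weight_vector_derived[OF chev_f_closed h] brkt_h_f[OF coroot_cartan] sroot_self
    by (metis neg_equal_0_iff_equal zero_neq_numeral)
  show "coroot G i \<in> derived G"
    using br_derived[OF chev_e_closed chev_f_closed, of i i] by (simp add: brkt_e_f)
qed

lemma rbr_derived: "(\<And>i. g i \<in> derived G) \<Longrightarrow> rbr g w \<in> derived G"
  by (induction g w rule: rbr.induct) (auto simp: derived_sub intro!: br_derived derived_closed)

lemma ew_derived: "ew w \<in> derived G" and fw_derived: "fw w \<in> derived G"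
  using rbr_derived chev_derived by blast+

lemma cartan'_sub: "lin_subspace G (cartan' G)"
  using derived_sub cartan_sub unfolding lin_subspace_iff[OF G_cmod] cartan'_def by auto

lemma root_of_neq_zero:
  assumes "m i \<noteq> 0" shows "\<exists>h\<in>cartan G. root_of G m h \<noteq> 0"
proof (rule ccontr)
  assume "\<not> ?thesis"
  then have "\<forall>h\<in>cartan G. (\<Sum>i\<in>UNIV. of_nat (m i) * sroot G i h) = 0" by (simp add: root_of_def)
  from sroot_indep[OF this] assms show False by simp
qed

lemma root_space_derived:
  assumes "m i \<noteq> 0" "x \<in> root_space G (\<lambda>h. s * root_of G m h)" "s \<noteq> 0"
  shows "x \<in> derived G"
proof -
  obtain h where "h \<in> cartan G" "root_of G m h \<noteq> 0" using root_of_neq_zero[of m i] assms by auto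
  then show ?thesis
    using assms by (intro weight_vector_derived[of x h "s * root_of G m h"]) (auto simp: root_space_def cartan_closed)
qed

lemma pos_root_space_derived: "m \<in> pos_roots G \<Longrightarrow> x \<in> root_space G (root_of G m) \<Longrightarrow> x \<in> derived G"
  using root_space_derived[of m _ x 1] by (auto simp: pos_roots_def)

lemma neg_root_space_derived: "m \<in> pos_roots G \<Longrightarrow> x \<in> root_space G (\<lambda>h. - root_of G m h) \<Longrightarrow> x \<in> derived G"
  using root_space_derived[of m _ x "-1"] by (auto simp: pos_roots_def)

lemma nilp_pos_derived: "nilp_pos G \<subseteq> derived G"
  unfolding nilp_pos_def using pos_root_space_derived
  by (intro lin_span_least[OF derived_subspace]) blast

text \<open>A bracket of generators may vanish, and only a nonzero one makes the content of the word
  a root; hence the alternative.\<close>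

lemma ew_nilp_pos:
  assumes "w \<noteq> []" shows "ew w = \<zero>\<^bsub>G\<^esub> \<or> (count_list w \<in> pos_roots G \<and> ew w \<in> root_space G (root_of G (count_list w)))"
proof -
  have *: "ew w \<in> root_space G (root_of G (count_list w))"
    using ew_weight ew_closed by (auto simp: root_space_def sum_list_sroot)
  have "\<exists>i. count_list w i \<noteq> 0" using assms by (cases w) auto
  with * show ?thesis by (auto simp: pos_roots_def)
qed

text \<open>Words in the generators lie in the derived algebra. Write an element of it as
  \<open>h + n\<close> with \<open>h\<close> in the Cartan subalgebra and \<open>n\<close> a
  combination of words; then \<open>h\<close> is a difference of elements of the derived algebra and
  lies in \<open>cartan'\<close>.\<close>

lemma derived_span: "derived G = lin_span G (cartan' G \<union> range ew \<union> range fw)"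
proof
  let ?D = "lin_span G (cartan' G \<union> range ew \<union> range fw)"
  have sub: "cartan' G \<union> range ew \<union> range fw \<subseteq> derived G"
    using ew_derived fw_derived by (auto simp: cartan'_def)
  show "?D \<subseteq> derived G" by (rule lin_span_least[OF derived_subspace sub])
  have D: "lin_subspace G ?D"
    using sub derived_closed by (intro lin_span_subspace[OF G_cmod]) blast
  note Ds = D[unfolded lin_subspace_iff[OF G_cmod]]
  have dec: "\<exists>h\<in>cartan G. \<exists>n\<in>?D. x = h \<oplus>\<^bsub>G\<^esub> n" if x: "x \<in> lin_span G full_gens" for x
    using G_cmod full_gens_subset x
  proof (induction rule: lin_span_induct)
    case zero then show ?case using cartan_sub(1) Ds by (metis gs(2,4))
  next
    case (add x y)
    then obtain h n h' n' where *: "h \<in> cartan G" "n \<in> ?D" "x = h \<oplus>\<^bsub>G\<^esub> n" "h' \<in> cartan G" "n' \<in> ?D" "y = h' \<oplus>\<^bsub>G\<^esub> n'" by blast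
    then have "x \<oplus>\<^bsub>G\<^esub> y = (h \<oplus>\<^bsub>G\<^esub> h') \<oplus>\<^bsub>G\<^esub> (n \<oplus>\<^bsub>G\<^esub> n')"
      using cartan_closed Ds by (simp add: gs subset_iff)
    with * show ?case using cartan_sub(2) Ds by blast
  next
    case (smult c x)
    then obtain h n where *: "h \<in> cartan G" "n \<in> ?D" "x = h \<oplus>\<^bsub>G\<^esub> n" by blast
    then have "c \<odot>\<^bsub>G\<^esub> x = c \<odot>\<^bsub>G\<^esub> h \<oplus>\<^bsub>G\<^esub> c \<odot>\<^bsub>G\<^esub> n"
      using cartan_closed Ds by (simp add: gs subset_iff)
    with * show ?case using cartan_sub(3) Ds by blast
  next
    case (base x)
    then consider "x \<in> cartan G" | "x \<in> range ew \<union> range fw" by (auto simp: full_gens_def)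
    then show ?case
    proof cases
      case 1
      then show ?thesis using Ds by (intro bexI[of _ x] bexI[of _ "\<zero>\<^bsub>G\<^esub>"]) (auto simp: gs cartan_closed)
    next
      case 2
      then have "x \<in> ?D" by (intro lin_span_base) auto
      then show ?thesis using cartan_sub(1) Ds by (intro bexI[of _ "\<zero>\<^bsub>G\<^esub>"] bexI[of _ x]) (auto simp: gs)
    qed
  qed
  show "derived G \<subseteq> ?D"
  proof
    fix x assume x: "x \<in> derived G"
    then obtain h n where hn: "h \<in> cartan G" "n \<in> ?D" "x = h \<oplus>\<^bsub>G\<^esub> n"
      using dec derived_closed triangular_span by blast
    have c: "h \<in> carrier G" "n \<in> carrier G" using hn cartan_closed Ds by auto
    have "n \<in> derived G" using hn \<open>?D \<subseteq> derived G\<close> by auto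
    then have "x \<oplus>\<^bsub>G\<^esub> (-1) \<odot>\<^bsub>G\<^esub> n \<in> derived G" using x derived_sub by blast
    moreover have "x \<oplus>\<^bsub>G\<^esub> (-1) \<odot>\<^bsub>G\<^esub> n = h"
      using c cmod_sub_eq_zero[OF G_cmod c(2,2)] by (simp add: hn(3) gs)
    ultimately have "h \<in> ?D" using hn(1) by (intro lin_span_base) (simp add: cartan'_def)
    then show "x \<in> ?D" using hn Ds by simp
  qed
qed

section \<open>Root spaces in terms of words\<close>

lemma root_of_inj:
  fixes k k' :: "'i \<Rightarrow> int"
  assumes "\<forall>h\<in>cartan G. (\<Sum>i\<in>UNIV. of_int (k i) * sroot G i h) = (\<Sum>i\<in>UNIV. of_int (k' i) * sroot G i h)"
  shows "k = k'"
proof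
  fix i
  have "\<forall>h\<in>cartan G. (\<Sum>i\<in>UNIV. (of_int (k i) - of_int (k' i)) * sroot G i h) = 0"
    using assms by (simp add: left_diff_distrib sum_subtractf)
  from sroot_indep[OF this, of i] show "k i = k' i" by simp
qed

text \<open>Words with the same content are simultaneous eigenvectors for the same weight, and
  together with the Cartan subalgebra they span. An eigenvector of a given weight therefore lies in
  the span of the words of that weight alone, and for a negative root these are words in the
  \<open>f_i\<close>.\<close>

lemma neg_root_space:
  assumes "m \<in> pos_roots G" "x \<in> root_space G (\<lambda>h. - root_of G m h)"
  shows "x \<in> lin_span G {fw w | w. w \<noteq> [] \<and> count_list w = m}"
proof (cases "x = \<zero>\<^bsub>G\<^esub>")
  case True
  have "{fw w | w. w \<noteq> [] \<and> count_list w = m} \<subseteq> carrier G" using fw_closed by auto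
  from lin_span_subspace[OF G_cmod this] show ?thesis using True by (simp add: lin_subspace_iff[OF G_cmod])
next
  case False
  \<comment> \<open>Integer vectors index words of both signs and the Cartan subalgebra (index zero)
    in one family with separated weights.\<close>
  define S :: "('i \<Rightarrow> int) \<Rightarrow> 'g set" where
    "S k = {fw w | w. w \<noteq> [] \<and> k = (\<lambda>i. - int (count_list w i))} \<union>
       {ew w | w. w \<noteq> [] \<and> k = (\<lambda>i. int (count_list w i))} \<union> {h \<in> cartan G. k = (\<lambda>_. 0)}" for k
  define wt where "wt k h = (\<Sum>i\<in>UNIV. of_int (k i) * sroot G i h)" for k :: "'i \<Rightarrow> int" and h
  have Sc: "S k \<subseteq> carrier G" for k using fw_closed ew_closed cartan_closed by (auto simp: S_def)
  note Yk = lin_span_subspace[OF G_cmod Sc]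
  have eigS: "[h, y]\<^sub>G = wt k h \<odot>\<^bsub>G\<^esub> y" if "y \<in> S k" "h \<in> cartan G" for y k h
    using that
    by (auto simp: S_def ew_weight fw_weight sum_list_sroot root_of_def wt_def sum_negf brkt_h_h gs cartan_closed)
  have eig: "[h, y]\<^sub>G = wt k h \<odot>\<^bsub>G\<^esub> y" if "y \<in> lin_span G (S k)" "h \<in> cartan G" for y k h
  proof -
    have hc: "h \<in> carrier G" using that cartan_closed by auto
    show ?thesis
      using G_cmod Sc that(1)
    proof (induction rule: lin_span_induct)
      case zero then show ?case using lin_map_zero[OF G_cmod G_cmod br_lin(1)[OF hc]] by (simp add: gs)
    next
      case (smult c y) then show ?case using hc by (simp add: brs gs mult.commute)
    qed (use hc eigS that(2) in \<open>simp_all add: brs gs\<close>)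
  qed
  have "full_gens \<subseteq> lin_span G (\<Union>k\<in>UNIV. lin_span G (S k))"
  proof
    fix y assume y: "y \<in> full_gens"
    have "\<exists>k. y \<in> lin_span G (S k)"
    proof (cases "y = \<zero>\<^bsub>G\<^esub>")
      case True
      then show ?thesis using Yk by (auto simp: lin_subspace_iff[OF G_cmod])
    next
      case False
      then consider "y \<in> cartan G" | w where "y = ew w" "w \<noteq> []" | w where "y = fw w" "w \<noteq> []"
        using y by (fastforce simp: full_gens_def)
      then have "\<exists>k. y \<in> S k"
        by cases (auto simp: S_def)
      then show ?thesis using lin_span_base[of y] by blast
    qed
    then show "y \<in> lin_span G (\<Union>k\<in>UNIV. lin_span G (S k))" by (intro lin_span_base) auto
  qed
  moreover have "lin_subspace G (lin_span G (\<Union>k\<in>UNIV. lin_span G (S k)))"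
    using Yk unfolding lin_subspace_iff[OF G_cmod]
    by (intro lin_span_subspace[OF G_cmod, unfolded lin_subspace_iff[OF G_cmod]] UN_least) blast
  ultimately have "carrier G \<subseteq> lin_span G (\<Union>k\<in>UNIV. lin_span G (S k))"
    using lin_span_least triangular_span by metis
  moreover have "x \<in> carrier G" using assms(2) by (auto simp: root_space_def)
  ultimately have x: "x \<in> lin_span G (\<Union>k\<in>UNIV. lin_span G (S k))" by blast
  have "\<exists>k\<in>UNIV. x \<in> lin_span G (S k) \<and> (\<forall>h\<in>cartan G. wt k h = - root_of G m h)"
  proof (rule eigenvector_in_sum_of_eigenspaces[OF G_cmod _ Yk _ _ x _ False])
    show "lin_map G G (brkt G h)" if "h \<in> cartan G" for h using that cartan_closed br_lin by blast
    show "\<exists>h\<in>cartan G. wt k h \<noteq> wt k' h" if "k \<noteq> k'" for k k'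
      using root_of_inj[of k k'] that unfolding wt_def by blast
  qed (use eig assms(2) in \<open>auto simp: root_space_def\<close>)
  then obtain k where k: "x \<in> lin_span G (S k)" "\<forall>h\<in>cartan G. wt k h = - root_of G m h" by blast
  have "k = (\<lambda>i. - int (m i))"
    using k(2) by (intro root_of_inj) (simp add: wt_def root_of_def sum_negf)
  \<comment> \<open>A positive root has a nonzero coefficient, so its negative is neither zero nor
    the content of a word in the \<open>e_i\<close>.\<close>
  moreover obtain i where "m i \<noteq> 0" using assms(1) by (auto simp: pos_roots_def)
  ultimately have "S k = {fw w | w. w \<noteq> [] \<and> count_list w = m}"
    by (auto simp: S_def fun_eq_iff)
  with k show ?thesis by simp
qed

end

section \<open>The Lie algebra \<open>g' \<otimes> A \<oplus> h''\<close>\<close>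

lemma lin_ext_comp:
  assumes "cmod W" "cmod W'" "lin_map W W' \<phi>" "\<And>x. x \<in> X \<Longrightarrow> f x \<in> carrier W" "Poly_Mapping.keys p \<subseteq> X"
  shows "\<phi> (lin_ext W f p) = lin_ext W' (\<lambda>x. \<phi> (f x)) p"
proof (rule free_vs_map_eq[OF assms(2) lin_map_comp[OF assms(3) lin_ext_lin_map[OF assms(1,4)]] lin_ext_lin_map[OF assms(2)] _ assms(5)])
  show "\<phi> (f x) \<in> carrier W'" if "x \<in> X" for x using that lin_mapD(1)[OF assms(3)] assms(4) by blast
  then show "\<phi> (lin_ext W f (Poly_Mapping.single x 1)) = lin_ext W' (\<lambda>x. \<phi> (f x)) (Poly_Mapping.single x 1)" if "x \<in> X" for x
    using that assms(1,2,4) by (simp add: lin_ext_single cmod_simps)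
qed

lemma lin_ext_cong:
  assumes "cmod W" "\<And>x. x \<in> Poly_Mapping.keys p \<Longrightarrow> g x \<in> carrier W" "\<And>x. x \<in> Poly_Mapping.keys p \<Longrightarrow> f x = g x"
  shows "lin_ext W f p = lin_ext W g p"
proof -
  interpret W: Module.module C_alg W by fact
  show ?thesis
    unfolding lin_ext_def using assms by (intro W.finsum_cong') auto
qed

locale curr = kac_moody G for G :: "('g, 'i::finite) km_algebra_rec" (structure) +
  fixes A :: "(complex, 'a) module" and HC :: "'g set"
  assumes HC: "cartan_complement G HC" and A_alg: "algebra C_alg A"
begin

lemma A_cmod: "cmod A" and A_cring: "cring A"
  using A_alg by (auto intro: algebra.module algebra.M_cring)

sublocale A: cring A by (rule A_cring)

lemmas as = cmod_simps[OF A_cmod]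

abbreviation amult (infixl \<open>\<star>\<close> 70) where "a \<star> b \<equiv> a \<otimes>\<^bsub>A\<^esub> b"

lemma A_mult_lin: "a \<in> carrier A \<Longrightarrow> lin_map A A (\<lambda>b. a \<star> b)" "a \<in> carrier A \<Longrightarrow> lin_map A A (\<lambda>b. b \<star> a)"
proof -
  have 1: "(c \<odot>\<^bsub>A\<^esub> x) \<star> y = c \<odot>\<^bsub>A\<^esub> (x \<star> y)" if "x \<in> carrier A" "y \<in> carrier A" for c x y
    using algebra.smult_assoc2[OF A_alg, of c x y] that by simp
  have 2: "x \<star> (c \<odot>\<^bsub>A\<^esub> y) = c \<odot>\<^bsub>A\<^esub> (x \<star> y)" if "x \<in> carrier A" "y \<in> carrier A" for c x y
    using 1[of y x c] that A.m_comm as(3) by metis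
  show "a \<in> carrier A \<Longrightarrow> lin_map A A (\<lambda>b. a \<star> b)" "a \<in> carrier A \<Longrightarrow> lin_map A A (\<lambda>b. b \<star> a)"
    by (auto intro!: lin_mapI simp: 1 2 A.r_distr A.l_distr)
qed

abbreviation DG where "DG \<equiv> derived_vs G"

lemma DG_cmod: "cmod DG"
  by (rule lin_subspace_cmod[OF G_cmod derived_subspace])

lemma HC_sub: "lin_subspace G HC" and HC_int: "x \<in> derived G \<Longrightarrow> x \<in> HC \<Longrightarrow> x = \<zero>\<^bsub>G\<^esub>"
  and HC_cartan: "x \<in> HC \<Longrightarrow> x \<in> cartan G"
  and cartan_dec: "x \<in> cartan G \<Longrightarrow> \<exists>h\<in>cartan' G. \<exists>k\<in>HC. x = h \<oplus>\<^bsub>G\<^esub> k"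
proof -
  have h: "lin_subspace G HC" "cartan' G \<inter> HC = {\<zero>\<^bsub>G\<^esub>}" "cartan' G <+>\<^bsub>G\<^esub> HC = cartan G"
    using HC by (auto simp: cartan_complement_def)
  show "lin_subspace G HC" by (rule h(1))
  show c: "x \<in> cartan G" if x: "x \<in> HC" for x
  proof -
    have "\<zero>\<^bsub>G\<^esub> \<oplus>\<^bsub>G\<^esub> x \<in> cartan' G <+>\<^bsub>G\<^esub> HC"
      using x lin_subspaceD(2)[OF G_cmod cartan'_sub] unfolding set_add_def' by blast
    then show ?thesis using h(3) gs(4)[OF lin_subspaceD(1)[OF G_cmod h(1) x]] by simp
  qed
  show "x = \<zero>\<^bsub>G\<^esub>" if "x \<in> derived G" "x \<in> HC"
    using that h(2) c[OF that(2)] unfolding cartan'_def by blast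
  show "\<exists>h\<in>cartan' G. \<exists>k\<in>HC. x = h \<oplus>\<^bsub>G\<^esub> k" if "x \<in> cartan G"
    using that unfolding h(3)[symmetric] set_add_def' by blast
qed

lemmas HCs = lin_subspaceD[OF G_cmod HC_sub]
lemmas Ds = lin_subspaceD[OF G_cmod derived_subspace]

sublocale T: ctensor DG A
  by (simp add: ctensor_def DG_cmod A_cmod)

abbreviation V where "V \<equiv> tensor_vs DG A"
abbreviation tp where "tp \<equiv> tens DG A"
abbreviation L where "L \<equiv> current_algebra G A HC"
abbreviation lp where "lp \<equiv> loop_elt G A"
definition dl :: "'g \<Rightarrow> ('g, 'a) current" where "dl h = (\<zero>\<^bsub>V\<^esub>, h)"

lemma L_simps [simp]:
  "carrier L = carrier V \<times> HC" "zero L = (\<zero>\<^bsub>V\<^esub>, \<zero>\<^bsub>G\<^esub>)"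
  "(s, h) \<oplus>\<^bsub>L\<^esub> (t, k) = (s \<oplus>\<^bsub>V\<^esub> t, h \<oplus>\<^bsub>G\<^esub> k)" "c \<odot>\<^bsub>L\<^esub> (s, h) = (c \<odot>\<^bsub>V\<^esub> s, c \<odot>\<^bsub>G\<^esub> h)"
  by (simp_all add: current_algebra_def Let_def)

lemma L_cmod: "cmod L"
  by (rule cmodI) (auto simp: T.ts gs HCs)

lemma DG_br_lin: "x \<in> carrier G \<Longrightarrow> lin_map DG DG (brkt G x)"
  "x \<in> derived G \<Longrightarrow> lin_map DG DG (\<lambda>y. brkt G y x)"
  by (auto intro!: lin_mapI simp: br_derived brs derived_closed)

lemma tmap_lin: "x \<in> carrier G \<Longrightarrow> lin_map V V (tensor_map DG A (brkt G x) (\<lambda>a. a))"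
  by (intro T.tensor_map_lin_map DG_br_lin lin_map_id)

lemma tmap_tens: "x \<in> carrier G \<Longrightarrow> y \<in> derived G \<Longrightarrow> a \<in> carrier A \<Longrightarrow>
    tensor_map DG A (brkt G x) (\<lambda>a. a) (tp y a) = tp [x,y]\<^sub>G a"
  by (simp add: T.tensor_map_tens DG_br_lin lin_map_id)

text \<open>The adjoint action of the pure tensor \<open>x \<otimes> a\<close>: \<open>ad x\<close>
  on the first factor, multiplication by \<open>a\<close> on the second.\<close>

abbreviation inn where "inn x a \<equiv> tensor_map DG A (brkt G x) (\<lambda>b. a \<star> b)"

lemma inn_lin: "x \<in> carrier G \<Longrightarrow> a \<in> carrier A \<Longrightarrow> lin_map V V (inn x a)"
  by (intro T.tensor_map_lin_map DG_br_lin A_mult_lin)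

lemma inn_tens: "x \<in> carrier G \<Longrightarrow> a \<in> carrier A \<Longrightarrow> y \<in> derived G \<Longrightarrow> b \<in> carrier A \<Longrightarrow>
    inn x a (tp y b) = tp [x,y]\<^sub>G (a \<star> b)"
  by (simp add: T.tensor_map_tens DG_br_lin A_mult_lin)

lemma inn_bilin: "t \<in> carrier V \<Longrightarrow> bilin DG A V (\<lambda>x a. inn x a t)"
proof -
  assume t: "t \<in> carrier V"
  have u: "f t = g t" if "lin_map V V f" "lin_map V V g"
    "\<And>y b. y \<in> derived G \<Longrightarrow> b \<in> carrier A \<Longrightarrow> f (tp y b) = g (tp y b)" for f g
    using T.tensor_map_unique[OF T.T_cmod that(1,2) _ t] that(3) by simp
  note il = inn_lin[OF derived_closed]
  note ac = lin_map_add[OF T.T_cmod] and sc = lin_map_smult[OF T.T_cmod]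
  note am = lin_mapD[OF A_mult_lin(2)]
  have x1: "inn (x \<oplus>\<^bsub>G\<^esub> y) a t = inn x a t \<oplus>\<^bsub>V\<^esub> inn y a t" if "x \<in> derived G" "y \<in> derived G" "a \<in> carrier A" for x y a
    using that by (intro u[OF il ac[OF il il]]) (simp_all add: Ds inn_tens derived_closed brs br_derived T.tens_add_left[simplified])
  have x2: "inn (c \<odot>\<^bsub>G\<^esub> x) a t = c \<odot>\<^bsub>V\<^esub> inn x a t" if "x \<in> derived G" "a \<in> carrier A" for x c a
    using that by (intro u[OF il sc[OF il]]) (simp_all add: Ds inn_tens derived_closed brs br_derived T.tens_smult_left[simplified])
  have a1: "inn x (a \<oplus>\<^bsub>A\<^esub> b) t = inn x a t \<oplus>\<^bsub>V\<^esub> inn x b t" if "x \<in> derived G" "a \<in> carrier A" "b \<in> carrier A" for x b a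
    using that by (intro u[OF il ac[OF il il]]) (simp_all add: Ds inn_tens derived_closed am br_derived T.tens_add_right[simplified])
  have a2: "inn x (c \<odot>\<^bsub>A\<^esub> a) t = c \<odot>\<^bsub>V\<^esub> inn x a t" if "x \<in> derived G" "a \<in> carrier A" for x c a
    using that by (intro u[OF il sc[OF il]]) (simp_all add: Ds as inn_tens derived_closed am br_derived T.tens_smult_right[simplified])
  show ?thesis
    unfolding bilin_def using x1 x2 a1 a2 lin_mapD(1)[OF il t] by (intro conjI ballI lin_mapI) simp_all
qed

text \<open>In the double sum over representatives the inner sum is a linear extension whose class
  is \<open>inn x a t\<close>, and the outer sum extends this linearly in \<open>(x, a)\<close>. So
  the bracket depends only on the two tensors and is linear in the first.\<close>

lemma loop_brkt_eq:
  assumes s: "s \<in> carrier V" and t: "t \<in> carrier V"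
  shows "loop_brkt G A s t = T.tlift V (\<lambda>x a. inn x a t) s"
proof -
  let ?F = "free_vs (carrier DG \<times> carrier A)"
  let ?g = "\<lambda>x a y b. Poly_Mapping.single ([x,y]\<^sub>G, a \<star> b) (1::complex)"
  have gc: "?g x a y b \<in> carrier ?F" if "(x, a) \<in> carrier DG \<times> carrier A" "(y, b) \<in> carrier DG \<times> carrier A" for x a y b
    using that by (auto simp: br_derived derived_closed)
  have in1: "(\<lambda>(y, b). ?g x a y b) z \<in> carrier ?F" if "(x, a) \<in> carrier DG \<times> carrier A" "z \<in> carrier DG \<times> carrier A" for x a z
    using gc[OF that(1), of "fst z" "snd z"] that(2) by (simp add: case_prod_beta)
  have in2: "lin_ext ?F (\<lambda>(y, b). ?g x a y b) q \<in> carrier ?F" if "(x, a) \<in> carrier DG \<times> carrier A" "q \<in> carrier ?F" for x a q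
    by (rule lin_mapD(1)[OF lin_ext_lin_map[OF free_vs_cmod in1[OF that(1)]] that(2)])
  have main: "tensor_cls DG A (\<Sum>(x, a)\<in>Poly_Mapping.keys p. \<Sum>(y, b)\<in>Poly_Mapping.keys q.
           Poly_Mapping.single ([x,y]\<^sub>G, a \<star> b) (Poly_Mapping.lookup p (x, a) * Poly_Mapping.lookup q (y, b)))
      = T.tlift V (\<lambda>x a. inn x a (T.cls q)) (T.cls p)" (is "tensor_cls DG A ?S = _")
    if p: "p \<in> carrier ?F" and q: "q \<in> carrier ?F" for p q
  proof -
    have pk: "Poly_Mapping.keys p \<subseteq> carrier DG \<times> carrier A" and qk: "Poly_Mapping.keys q \<subseteq> carrier DG \<times> carrier A"
      using p q by auto
    have "?S = (\<Sum>z\<in>Poly_Mapping.keys p. pscale (Poly_Mapping.lookup p z)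
        (lin_ext ?F (\<lambda>(y, b). ?g (fst z) (snd z) y b) q))"
    proof (rule sum.cong[OF refl])
      fix z assume "z \<in> Poly_Mapping.keys p"
      then have z: "(fst z, snd z) \<in> carrier DG \<times> carrier A" using pk by auto
      have "lin_ext ?F (\<lambda>(y, b). ?g (fst z) (snd z) y b) q = (\<Sum>w\<in>Poly_Mapping.keys q.
          pscale (Poly_Mapping.lookup q w) ((\<lambda>(y, b). ?g (fst z) (snd z) y b) w))"
        by (intro lin_ext_free_vs in1[OF z, unfolded free_vs_simps mem_Collect_eq] subsetD[OF qk])
      then show "(case z of (x, a) \<Rightarrow> \<Sum>(y, b)\<in>Poly_Mapping.keys q.
           Poly_Mapping.single ([x,y]\<^sub>G, a \<star> b) (Poly_Mapping.lookup p (x, a) * Poly_Mapping.lookup q (y, b))) =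
        pscale (Poly_Mapping.lookup p z) (lin_ext ?F (\<lambda>(y, b). ?g (fst z) (snd z) y b) q)"
        by (simp add: case_prod_beta pscale_sum)
    qed
    also have "\<dots> = lin_ext ?F (\<lambda>z. lin_ext ?F (\<lambda>(y, b). ?g (fst z) (snd z) y b) q) p"
    proof (rule lin_ext_free_vs[symmetric])
      fix z assume "z \<in> Poly_Mapping.keys p"
      then have "(fst z, snd z) \<in> carrier DG \<times> carrier A" using pk by auto
      from in2[OF this q] show "Poly_Mapping.keys (lin_ext ?F (\<lambda>(y, b). ?g (fst z) (snd z) y b) q) \<subseteq> carrier DG \<times> carrier A"
        by (simp only: free_vs_simps mem_Collect_eq)
    qed
    finally have S: "?S = lin_ext ?F (\<lambda>z. lin_ext ?F (\<lambda>(y, b). ?g (fst z) (snd z) y b) q) p" .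
    have "T.cls ?S = lin_ext V (\<lambda>z. T.cls (lin_ext ?F (\<lambda>(y, b). ?g (fst z) (snd z) y b) q)) p"
      unfolding S
      by (rule lin_ext_comp[OF free_vs_cmod T.T_cmod T.cls_lin_map[folded T.tensor_vs_eq] _ pk]) (rule in2[OF _ q], simp)
    also have "\<dots> = lin_ext V (\<lambda>(x, a). inn x a (T.cls q)) p"
    proof (rule lin_ext_cong[OF T.T_cmod])
      have tq: "T.cls q \<in> carrier V" using T.quot_closed[OF q] by (simp add: T.tensor_vs_eq)
      show "(case z of (x, a) \<Rightarrow> inn x a (T.cls q)) \<in> carrier V" if "z \<in> Poly_Mapping.keys p" for z
        using that pk lin_mapD(1)[OF inn_lin[OF derived_closed] tq] by (auto simp: case_prod_beta)
      fix z assume "z \<in> Poly_Mapping.keys p"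
      then have z: "(fst z, snd z) \<in> carrier DG \<times> carrier A" using pk by auto
      then have zz: "fst z \<in> carrier G" "snd z \<in> carrier A" by (auto intro: derived_closed)
      have "T.cls (lin_ext ?F (\<lambda>(y, b). ?g (fst z) (snd z) y b) q) =
          lin_ext V (\<lambda>w. T.cls ((\<lambda>(y, b). ?g (fst z) (snd z) y b) w)) q"
        by (rule lin_ext_comp[OF free_vs_cmod T.T_cmod T.cls_lin_map[folded T.tensor_vs_eq] in1[OF z] qk])
      also have "\<dots> = lin_ext V (\<lambda>(y, b). tp [fst z, y]\<^sub>G (snd z \<star> b)) q"
        by (intro arg_cong[where f="\<lambda>f. lin_ext V f q"]) (auto simp: T.tens_eq)
      also have "\<dots> = inn (fst z) (snd z) (T.cls q)"
        using T.tlift_cls[OF T.T_cmod T.tens_comp_bilin[OF DG_br_lin(1)[OF zz(1)] A_mult_lin(1)[OF zz(2)]] q]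
          T.tensor_map_eq[OF DG_br_lin(1)[OF zz(1)] A_mult_lin(1)[OF zz(2)] tq] by simp
      finally show "T.cls (lin_ext ?F (\<lambda>(y, b). ?g (fst z) (snd z) y b) q) =
        (case z of (x, a) \<Rightarrow> inn x a (T.cls q))"
        by (simp add: case_prod_beta)
    qed
    also have "\<dots> = T.tlift V (\<lambda>x a. inn x a (T.cls q)) (T.cls p)"
      using T.tlift_cls[OF T.T_cmod inn_bilin p] T.quot_closed[OF q] by (simp add: T.tensor_vs_eq)
    finally show ?thesis by (simp only: tensor_cls_def)
  qed
  obtain p where p: "p \<in> carrier ?F" "s = T.cls p" using s T.quot_obtain unfolding T.tensor_vs_eq by blast
  obtain q where q: "q \<in> carrier ?F" "t = T.cls q" using t T.quot_obtain unfolding T.tensor_vs_eq by blast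
  show ?thesis
    unfolding loop_brkt_def p(2) q(2)
  proof (rule T.cls_UN[OF p(1)], rule T.cls_UN[OF q(1)])
    fix p' q' assume "p' \<in> carrier ?F" "T.cls p' = T.cls p" "q' \<in> carrier ?F" "T.cls q' = T.cls q"
    then show "tensor_cls DG A (\<Sum>(x, a)\<in>Poly_Mapping.keys p'. \<Sum>(y, b)\<in>Poly_Mapping.keys q'.
           Poly_Mapping.single ([x,y]\<^sub>G, a \<star> b) (Poly_Mapping.lookup p' (x, a) * Poly_Mapping.lookup q' (y, b)))
      = T.tlift V (\<lambda>x a. inn x a (T.cls q)) (T.cls p)"
      by (simp only: main)
  qed
qed

lemma loop_brkt_lin: "t \<in> carrier V \<Longrightarrow> lin_map V V (\<lambda>s. loop_brkt G A s t)"
  using T.tlift_lin_map[OF T.T_cmod inn_bilin, of t] by (rule lin_map_cong) (simp_all add: loop_brkt_eq T.ts)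

lemma loop_brkt_tens: "x \<in> derived G \<Longrightarrow> a \<in> carrier A \<Longrightarrow> t \<in> carrier V \<Longrightarrow> loop_brkt G A (tp x a) t = inn x a t"
  using T.tens_closed[of x a] by (simp add: loop_brkt_eq T.tlift_tens[OF T.T_cmod inn_bilin])

lemma loop_brkt_closed: "s \<in> carrier V \<Longrightarrow> t \<in> carrier V \<Longrightarrow> loop_brkt G A s t \<in> carrier V"
  using lin_mapD(1)[OF loop_brkt_lin] by blast

lemma L_brkt: "s \<in> carrier V \<Longrightarrow> t \<in> carrier V \<Longrightarrow> h \<in> HC \<Longrightarrow> k \<in> HC \<Longrightarrow>
    brkt L (s, h) (t, k) = (loop_brkt G A s t \<oplus>\<^bsub>V\<^esub> tensor_map DG A (brkt G h) (\<lambda>a. a) t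
      \<oplus>\<^bsub>V\<^esub> (-1) \<odot>\<^bsub>V\<^esub> tensor_map DG A (brkt G k) (\<lambda>a. a) s, \<zero>\<^bsub>G\<^esub>)"
  using lin_mapD(1)[OF tmap_lin[OF HCs(1)]] loop_brkt_closed
  by (simp add: current_algebra_def Let_def T.ts)

sublocale prelie L
proof (rule prelie.intro[OF L_cmod])
  fix x y assume "x \<in> carrier L" "y \<in> carrier L"
  then show "brkt L x y \<in> carrier L"
    using lin_mapD(1)[OF tmap_lin[OF HCs(1)]] loop_brkt_closed by (auto simp: L_brkt T.ts HCs)
qed

lemma lp_eq: "lp x a = (tp x a, \<zero>\<^bsub>G\<^esub>)"
  by (simp add: loop_elt_def)

lemma lp_closed: "x \<in> derived G \<Longrightarrow> a \<in> carrier A \<Longrightarrow> lp x a \<in> carrier L"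
  using T.tens_closed[of x a] by (simp add: lp_eq HCs)

lemma dl_closed: "h \<in> HC \<Longrightarrow> dl h \<in> carrier L"
  by (simp add: dl_def T.ts)

lemma tmap_zero: "t \<in> carrier V \<Longrightarrow> tensor_map DG A (brkt G \<zero>\<^bsub>G\<^esub>) (\<lambda>a. a) t = \<zero>\<^bsub>V\<^esub>"
proof -
  assume t: "t \<in> carrier V"
  have 1: "[\<zero>\<^bsub>G\<^esub>, y]\<^sub>G = \<zero>\<^bsub>G\<^esub>" if "y \<in> carrier G" for y
    using lin_map_zero[OF G_cmod G_cmod br_lin(2)[OF that]] .
  show ?thesis
    using T.tensor_map_unique[OF T.T_cmod tmap_lin[OF gs(2)] lin_map_const_zero[OF T.T_cmod] _ t] T.tens_zero(2)
    by (simp add: tmap_tens 1 derived_closed gs)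
qed

lemma brkt_lp_lp: "x \<in> derived G \<Longrightarrow> y \<in> derived G \<Longrightarrow> a \<in> carrier A \<Longrightarrow> b \<in> carrier A \<Longrightarrow>
    brkt L (lp x a) (lp y b) = lp [x,y]\<^sub>G (a \<star> b)"
  using T.tens_closed[of x a] T.tens_closed[of y b] T.tens_closed[of "[x,y]\<^sub>G" "a \<star> b"]
  by (simp add: lp_eq L_brkt HCs tmap_zero loop_brkt_tens inn_tens derived_closed T.ts br_derived)

lemma brkt_dl_lp: "h \<in> HC \<Longrightarrow> x \<in> derived G \<Longrightarrow> a \<in> carrier A \<Longrightarrow> brkt L (dl h) (lp x a) = lp [h,x]\<^sub>G a"
  using T.tens_closed[of x a] T.tens_closed[of "[h,x]\<^sub>G" "a"]
    lin_map_zero[OF T.T_cmod T.T_cmod loop_brkt_lin, of "tp x a"]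
  by (simp add: lp_eq dl_def L_brkt HCs tmap_zero tmap_tens derived_closed T.ts br_derived)

lemma brkt_dl_dl: "h \<in> HC \<Longrightarrow> k \<in> HC \<Longrightarrow> brkt L (dl h) (dl k) = \<zero>\<^bsub>L\<^esub>"
  using lin_map_zero[OF T.T_cmod T.T_cmod loop_brkt_lin, of "\<zero>\<^bsub>V\<^esub>"]
    lin_map_zero[OF T.T_cmod T.T_cmod tmap_lin[OF HCs(1)]]
  by (simp add: dl_def L_brkt HCs T.ts)

text \<open>Scalars are absorbed by \<open>x\<close> in \<open>x \<otimes> a\<close> and by
  \<open>h\<close>, so sums of these two kinds of elements give the whole algebra.\<close>

lemma L_induct [consumes 1, case_names add lp dl]:
  assumes "X \<in> carrier L"
    and "\<And>X Y. X \<in> carrier L \<Longrightarrow> Y \<in> carrier L \<Longrightarrow> P X \<Longrightarrow> P Y \<Longrightarrow> P (X \<oplus>\<^bsub>L\<^esub> Y)"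
    and "\<And>x a. x \<in> derived G \<Longrightarrow> a \<in> carrier A \<Longrightarrow> P (lp x a)"
    and "\<And>h. h \<in> HC \<Longrightarrow> P (dl h)"
  shows "P X"
proof -
  obtain s h where X: "X = (s, h)" "s \<in> carrier V" "h \<in> HC" using assms(1) by auto
  from X(2) have "P (s, \<zero>\<^bsub>G\<^esub>)"
  proof (induction rule: T.tensor_induct)
    case (add s t)
    then show ?case using assms(2)[of "(s, \<zero>\<^bsub>G\<^esub>)" "(t, \<zero>\<^bsub>G\<^esub>)"] by (simp add: HCs gs)
  next
    case (tens x a)
    then show ?case using assms(3) by (simp add: lp_eq)
  qed
  then have "P ((s, \<zero>\<^bsub>G\<^esub>) \<oplus>\<^bsub>L\<^esub> dl h)"
    using X assms(4) dl_closed by (intro assms(2)) (auto simp: HCs)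
  then show ?thesis using X by (simp add: dl_def T.ts gs HCs)
qed

lemma lp_lin: "x \<in> derived G \<Longrightarrow> lin_map A L (lp x)" "a \<in> carrier A \<Longrightarrow> lin_map DG L (\<lambda>x. lp x a)"
  by (auto intro!: lin_mapI simp: lp_eq T.tens_closed[simplified] HCs gs as Ds T.tens_add_left[simplified] T.tens_add_right[simplified]
      T.tens_smult_left[simplified] T.tens_smult_right[simplified])

lemma dl_lin: "lin_map (G\<lparr>carrier := HC\<rparr>) L dl"
  by (auto intro!: lin_mapI simp: dl_def T.ts)

lemma g_embed:
  assumes "x \<in> derived G" "h \<in> HC"
  shows "g_embed G A HC (x \<oplus>\<^bsub>G\<^esub> h) = lp x \<one>\<^bsub>A\<^esub> \<oplus>\<^bsub>L\<^esub> dl h"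
proof -
  have c: "x \<in> carrier G" "h \<in> carrier G" using assms derived_closed HCs by auto
  have u: "x' = x \<and> h' = h" if x': "x' \<in> derived G" "h' \<in> HC" "x \<oplus>\<^bsub>G\<^esub> h = x' \<oplus>\<^bsub>G\<^esub> h'" for x' h'
  proof -
    have c': "x' \<in> carrier G" "h' \<in> carrier G" using x' derived_closed HCs by auto
    \<comment> \<open>Two decompositions differ by an element of the derived algebra that also lies
      in h'', hence by zero; this makes the definite description proper.\<close>
    have "x \<oplus>\<^bsub>G\<^esub> (-1) \<odot>\<^bsub>G\<^esub> x' = h' \<oplus>\<^bsub>G\<^esub> (-1) \<odot>\<^bsub>G\<^esub> h"
    proof -
      have "x = (x \<oplus>\<^bsub>G\<^esub> h) \<oplus>\<^bsub>G\<^esub> (-1) \<odot>\<^bsub>G\<^esub> h"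
        using c cmod_sub_eq_zero[OF G_cmod c(2,2)] by (simp add: gs(1,3,5,14))
      also have "\<dots> = x' \<oplus>\<^bsub>G\<^esub> (h' \<oplus>\<^bsub>G\<^esub> (-1) \<odot>\<^bsub>G\<^esub> h)" unfolding x'(3) using c c' by (simp add: gs(3,14))
      finally have "x \<oplus>\<^bsub>G\<^esub> (-1) \<odot>\<^bsub>G\<^esub> x' = (x' \<oplus>\<^bsub>G\<^esub> (h' \<oplus>\<^bsub>G\<^esub> (-1) \<odot>\<^bsub>G\<^esub> h)) \<oplus>\<^bsub>G\<^esub> (-1) \<odot>\<^bsub>G\<^esub> x'" by simp
      also have "\<dots> = (h' \<oplus>\<^bsub>G\<^esub> (-1) \<odot>\<^bsub>G\<^esub> h) \<oplus>\<^bsub>G\<^esub> (x' \<oplus>\<^bsub>G\<^esub> (-1) \<odot>\<^bsub>G\<^esub> x')"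
        using c c' by (simp add: gs(1,3,14,15,16))
      finally show ?thesis using c c' cmod_sub_eq_zero[OF G_cmod c'(1,1)] by (simp add: gs(1,3,5))
    qed
    moreover have "x \<oplus>\<^bsub>G\<^esub> (-1) \<odot>\<^bsub>G\<^esub> x' \<in> derived G" using assms x' Ds by simp
    moreover have "h' \<oplus>\<^bsub>G\<^esub> (-1) \<odot>\<^bsub>G\<^esub> h \<in> HC" using assms x' HCs by simp
    ultimately have "x \<oplus>\<^bsub>G\<^esub> (-1) \<odot>\<^bsub>G\<^esub> x' = \<zero>\<^bsub>G\<^esub>" "h' \<oplus>\<^bsub>G\<^esub> (-1) \<odot>\<^bsub>G\<^esub> h = \<zero>\<^bsub>G\<^esub>" using HC_int by auto
    then show ?thesis using cmod_sub_eq_zero[OF G_cmod] c c' by auto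
  qed
  have "lp x \<one>\<^bsub>A\<^esub> \<oplus>\<^bsub>L\<^esub> dl h = (tp x \<one>\<^bsub>A\<^esub>, h)"
    using T.tens_closed[of x "\<one>\<^bsub>A\<^esub>"] assms c by (simp add: lp_eq dl_def T.ts gs)
  moreover have "g_embed G A HC (x \<oplus>\<^bsub>G\<^esub> h) = (tp x \<one>\<^bsub>A\<^esub>, h)"
    unfolding g_embed_def by (rule the_equality) (use assms u in blast)+
  ultimately show ?thesis by simp
qed

lemma g_embed_derived: "x \<in> derived G \<Longrightarrow> g_embed G A HC x = lp x \<one>\<^bsub>A\<^esub>"
  using g_embed[of x "\<zero>\<^bsub>G\<^esub>"] lp_closed[of x "\<one>\<^bsub>A\<^esub>"] derived_closed[of x] T.tens_closed[of x "\<one>\<^bsub>A\<^esub>"]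
  by (simp add: HCs gs dl_def lp_eq T.ts)

lemma g_embed_closed: "h \<in> cartan G \<Longrightarrow> g_embed G A HC h \<in> carrier L"
proof -
  assume "h \<in> cartan G"
  then obtain x k where "x \<in> derived G" "k \<in> HC" "h = x \<oplus>\<^bsub>G\<^esub> k" using cartan_dec unfolding cartan'_def by blast
  then show ?thesis using g_embed cmod_simps(1)[OF L_cmod lp_closed dl_closed] by simp
qed

end

subsection \<open>Tensor products of representations\<close>

locale rep_tensor = prelie L for L :: "('l, 'm) lie_algebra_rec_scheme" +
  fixes M :: "('l, 'v, 'p) lie_rep_scheme" and N :: "('l, 'w, 'q) lie_rep_scheme"
  assumes M: "lrep L M" and N: "lrep L N"
begin

sublocale T: ctensor M N
  using lrepD(1)[OF M] lrepD(1)[OF N] by (simp add: ctensor_def)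

abbreviation MN where "MN \<equiv> tensor_rep M N"
abbreviation tn where "tn \<equiv> tens M N"

lemmas ms = cmod_simps[OF lrepD(1)[OF M]] and ns = cmod_simps[OF lrepD(1)[OF N]]

lemma MN_simps [simp]:
  "carrier MN = carrier T.T" "zero MN = zero T.T" "add MN = add T.T" "smult MN = smult T.T"
  by (simp_all add: tensor_rep_def)

lemma MN_cmod: "cmod MN"
  by (rule cmod_cong[OF T.T_cmod]) simp_all

lemma MN_lin_map: "lin_map MN W f = lin_map T.T W f" "lin_map W MN g = lin_map W T.T g"
  by (intro lin_map_carrier_cong; simp)+

lemma MN_act: "act MN x = (\<lambda>X. tensor_map M N (act M x) (\<lambda>w. w) X \<oplus>\<^bsub>T.T\<^esub> tensor_map M N (\<lambda>v. v) (act N x) X)"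
  by (simp add: tensor_rep_def)

lemma MN_act_lin: "x \<in> carrier L \<Longrightarrow> lin_map T.T T.T (act MN x)"
  unfolding MN_act
  by (intro lin_map_add T.T_cmod T.tensor_map_lin_map lrepD(2)[OF M] lrepD(2)[OF N] lin_map_id)

lemma MN_act_tens: "x \<in> carrier L \<Longrightarrow> v \<in> carrier M \<Longrightarrow> w \<in> carrier N \<Longrightarrow>
    act MN x (tn v w) = tn (act M x v) w \<oplus>\<^bsub>T.T\<^esub> tn v (act N x w)"
  by (simp add: MN_act T.tensor_map_tens lrepD(2)[OF M] lrepD(2)[OF N] lin_map_id)

text \<open>On a pure tensor the mixed terms \<open>x v \<otimes> y w\<close> and
  \<open>y v \<otimes> x w\<close> are unchanged when \<open>x\<close> and \<open>y\<close> are
  exchanged; what remains are the bracket relations in each factor.\<close>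

lemma MN_lrep: "lrep L MN"
  unfolding lrep_def
proof (intro conjI ballI MN_cmod)
  note aM = lin_mapD[OF lrepD(3)[OF M]] lrepD(5)[OF M] and aN = lin_mapD[OF lrepD(3)[OF N]] lrepD(5)[OF N]
  show "lin_map MN MN (act MN x)" if "x \<in> carrier L" for x
    using MN_act_lin[OF that] by (simp only: MN_lin_map)
  have add: "act MN (x \<oplus>\<^bsub>L\<^esub> y) X = act MN x X \<oplus>\<^bsub>T.T\<^esub> act MN y X"
    if x: "x \<in> carrier L" "y \<in> carrier L" and X: "X \<in> carrier T.T" for x y X
    by (rule T.tensor_map_unique[OF T.T_cmod MN_act_lin[OF cmod_simps(1)[OF L x]]
          lin_map_add[OF T.T_cmod MN_act_lin[OF x(1)] MN_act_lin[OF x(2)]] _ X])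
      (use x cmod_simps(1)[OF L] aM aN in \<open>simp add: MN_act_tens T.tens_add_left T.tens_add_right T.ts T.tens_closed\<close>)
  have sm: "act MN (c \<odot>\<^bsub>L\<^esub> x) X = c \<odot>\<^bsub>T.T\<^esub> act MN x X"
    if x: "x \<in> carrier L" and X: "X \<in> carrier T.T" for x c X
    by (rule T.tensor_map_unique[OF T.T_cmod MN_act_lin[OF cmod_simps(3)[OF L x]]
          lin_map_smult[OF T.T_cmod MN_act_lin[OF x]] _ X])
      (use x cmod_simps(3)[OF L] aM aN in \<open>simp add: MN_act_tens T.tens_smult_left T.tens_smult_right T.ts T.tens_closed\<close>)
  show "lin_map L MN (\<lambda>x. act MN x X)" if "X \<in> carrier MN" for X
    unfolding MN_lin_map using that add sm lin_mapD(1)[OF MN_act_lin] by (intro lin_mapI) (simp_all only: MN_simps)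
  fix x y X assume x: "x \<in> carrier L" "y \<in> carrier L" and X: "X \<in> carrier MN"
  have "act MN x (act MN y X) = act MN y (act MN x X) \<oplus>\<^bsub>T.T\<^esub> act MN (brkt L x y) X"
  proof (rule T.tensor_map_unique[OF T.T_cmod lin_map_comp[OF MN_act_lin[OF x(1)] MN_act_lin[OF x(2)]]
          lin_map_add[OF T.T_cmod lin_map_comp[OF MN_act_lin[OF x(2)] MN_act_lin[OF x(1)]] MN_act_lin[OF brkt_closed[OF x]]]])
    fix v w assume v: "v \<in> carrier M" "w \<in> carrier N"
    show "act MN x (act MN y (tn v w)) = act MN y (act MN x (tn v w)) \<oplus>\<^bsub>T.T\<^esub> act MN (brkt L x y) (tn v w)"
      using x v brkt_closed[OF x] lrepD(4)[OF M x v(1)] lrepD(4)[OF N x v(2)]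
        lin_mapD(2)[OF MN_act_lin] aM(4) aN(4)
      by (simp add: MN_act_tens T.tens_add_left T.tens_add_right T.ts T.tens_closed)
  qed (use X in simp)
  then show "act MN x (act MN y X) = act MN y (act MN x X) \<oplus>\<^bsub>MN\<^esub> act MN (brkt L x y) X"
    by (simp only: MN_simps)
qed

end

subsection \<open>Representations of the current algebra\<close>

abbreviation clin :: "(('x \<Rightarrow>\<^sub>0 complex) \<Rightarrow> ('x \<Rightarrow>\<^sub>0 complex)) \<Rightarrow> bool" where
  "clin \<equiv> cvec.lin pscale"

lemma pscale_cvec: "cvec (pscale :: complex \<Rightarrow> ('x \<Rightarrow>\<^sub>0 complex) \<Rightarrow> _)"
  by (rule cvec.intro[OF pscale_vector_space])

lemma clin_iff: "clin f \<longleftrightarrow> lin_map (free_vs UNIV) (free_vs UNIV) f"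
  by (simp add: cvec.lin_def[OF pscale_cvec] lin_map_def)

context curr
begin

lemma zero_HC: "\<zero>\<^bsub>G\<^esub> \<in> HC" by (rule HCs(2))

text \<open>A representation is determined by the operators \<open>\<tau> x a\<close> of \<open>x \<otimes> a\<close> and \<open>\<delta> h\<close> of \<open>h \<in> h''\<close>.\<close>

definition crep :: "('g \<Rightarrow> 'a \<Rightarrow> ('x \<Rightarrow>\<^sub>0 complex) \<Rightarrow> ('x \<Rightarrow>\<^sub>0 complex)) \<Rightarrow>
    ('g \<Rightarrow> ('x \<Rightarrow>\<^sub>0 complex) \<Rightarrow> ('x \<Rightarrow>\<^sub>0 complex)) \<Rightarrow> bool" where
  "crep \<tau> \<delta> \<longleftrightarrow> (\<forall>x\<in>derived G. \<forall>a\<in>carrier A. clin (\<tau> x a)) \<and> (\<forall>h\<in>HC. clin (\<delta> h)) \<and>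
    (\<forall>w. bilin DG A (free_vs UNIV) (\<lambda>x a. \<tau> x a w)) \<and>
    (\<forall>w. lin_map (G\<lparr>carrier := HC\<rparr>) (free_vs UNIV) (\<lambda>h. \<delta> h w)) \<and>
    (\<forall>x\<in>derived G. \<forall>y\<in>derived G. \<forall>a\<in>carrier A. \<forall>b\<in>carrier A. \<forall>w.
      \<tau> x a (\<tau> y b w) = \<tau> y b (\<tau> x a w) + \<tau> [x,y]\<^sub>G (a \<star> b) w) \<and>
    (\<forall>h\<in>HC. \<forall>x\<in>derived G. \<forall>a\<in>carrier A. \<forall>w. \<delta> h (\<tau> x a w) = \<tau> x a (\<delta> h w) + \<tau> [h,x]\<^sub>G a w) \<and>
    (\<forall>h\<in>HC. \<forall>k\<in>HC. \<forall>w. \<delta> h (\<delta> k w) = \<delta> k (\<delta> h w))"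

lemma crepD:
  assumes "crep \<tau> \<delta>"
  shows "x \<in> derived G \<Longrightarrow> a \<in> carrier A \<Longrightarrow> clin (\<tau> x a)" "h \<in> HC \<Longrightarrow> clin (\<delta> h)"
    "bilin DG A (free_vs UNIV) (\<lambda>x a. \<tau> x a w)" "lin_map (G\<lparr>carrier := HC\<rparr>) (free_vs UNIV) (\<lambda>h. \<delta> h w)"
    "x \<in> derived G \<Longrightarrow> y \<in> derived G \<Longrightarrow> a \<in> carrier A \<Longrightarrow> b \<in> carrier A \<Longrightarrow>
      \<tau> x a (\<tau> y b w) = \<tau> y b (\<tau> x a w) + \<tau> [x,y]\<^sub>G (a \<star> b) w"
    "h \<in> HC \<Longrightarrow> x \<in> derived G \<Longrightarrow> a \<in> carrier A \<Longrightarrow> \<delta> h (\<tau> x a w) = \<tau> x a (\<delta> h w) + \<tau> [h,x]\<^sub>G a w"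
    "h \<in> HC \<Longrightarrow> k \<in> HC \<Longrightarrow> \<delta> h (\<delta> k w) = \<delta> k (\<delta> h w)"
  using assms unfolding crep_def by blast+

lemma crep_bilinD:
  assumes "crep \<tau> \<delta>" "x \<in> derived G" "a \<in> carrier A"
  shows "y \<in> derived G \<Longrightarrow> \<tau> (x \<oplus>\<^bsub>G\<^esub> y) a w = \<tau> x a w + \<tau> y a w"
    "\<tau> (c \<odot>\<^bsub>G\<^esub> x) a w = pscale c (\<tau> x a w)"
    "b \<in> carrier A \<Longrightarrow> \<tau> x (a \<oplus>\<^bsub>A\<^esub> b) w = \<tau> x a w + \<tau> x b w"
    "\<tau> x (c \<odot>\<^bsub>A\<^esub> a) w = pscale c (\<tau> x a w)"
  using crepD(3)[OF assms(1), of w] assms(2,3) by (auto simp: bilin_def lin_map_def)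

text \<open>The converse passage, from operators to a representation: the operators of pure tensors
  are extended over the tensor product by its universal property. The carrier is the whole
  type.\<close>

definition crep_rec :: "('g \<Rightarrow> 'a \<Rightarrow> ('x \<Rightarrow>\<^sub>0 complex) \<Rightarrow> ('x \<Rightarrow>\<^sub>0 complex)) \<Rightarrow>
    ('g \<Rightarrow> ('x \<Rightarrow>\<^sub>0 complex) \<Rightarrow> ('x \<Rightarrow>\<^sub>0 complex)) \<Rightarrow> (('g, 'a) current, 'x \<Rightarrow>\<^sub>0 complex) lie_rep" where
  "crep_rec \<tau> \<delta> = \<lparr>carrier = UNIV, mult = undefined, one = undefined, zero = 0, add = (+), smult = pscale,
     act = (\<lambda>(s, h) w. T.tlift (free_vs UNIV) (\<lambda>x a. \<tau> x a w) s + \<delta> h w)\<rparr>"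

lemma crep_rec_simps [simp]:
  "carrier (crep_rec \<tau> \<delta>) = UNIV" "zero (crep_rec \<tau> \<delta>) = 0" "add (crep_rec \<tau> \<delta>) = (+)" "smult (crep_rec \<tau> \<delta>) = pscale"
  by (simp_all add: crep_rec_def)

lemma crep_rec_lin_map:
  "lin_map (crep_rec \<tau> \<delta>) W f = lin_map (free_vs UNIV) W f" "lin_map W (crep_rec \<tau> \<delta>) g = lin_map W (free_vs UNIV) g"
  by (intro lin_map_carrier_cong; simp)+

lemma crep_rec_cmod: "cmod (crep_rec \<tau> \<delta>)"
  by (rule cmod_cong[OF free_vs_cmod[of UNIV]]) simp_all

context
  fixes \<tau> :: "'g \<Rightarrow> 'a \<Rightarrow> ('x \<Rightarrow>\<^sub>0 complex) \<Rightarrow> ('x \<Rightarrow>\<^sub>0 complex)" and \<delta>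
  assumes c: "crep \<tau> \<delta>"
begin

abbreviation R where "R \<equiv> crep_rec \<tau> \<delta>"
abbreviation tt where "tt s w \<equiv> T.tlift (free_vs UNIV) (\<lambda>x a. \<tau> x a w) s"

lemma tt_lin: "lin_map V (free_vs UNIV) (\<lambda>s. tt s w)"
  by (rule T.tlift_lin_map[OF free_vs_cmod crepD(3)[OF c]])

lemmas ttD = lin_mapD(2,3)[OF tt_lin, simplified]

lemma tt_tens: "x \<in> derived G \<Longrightarrow> a \<in> carrier A \<Longrightarrow> tt (tp x a) w = \<tau> x a w"
  using T.tlift_tens[OF free_vs_cmod crepD(3)[OF c]] by simp

lemma tt_zero: "tt \<zero>\<^bsub>V\<^esub> w = 0"
  using lin_map_zero[OF T.T_cmod free_vs_cmod tt_lin] by simp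

lemma R_act: "act R (s, h) w = tt s w + \<delta> h w"
  by (simp add: crep_rec_def)

lemma \<delta>_zero: "\<delta> \<zero>\<^bsub>G\<^esub> w = 0"
  using lin_mapD(3)[OF crepD(4)[OF c], of "\<zero>\<^bsub>G\<^esub>" 0 w] by (simp add: zero_HC gs pscale_simps)

lemma R_act_lp: "x \<in> derived G \<Longrightarrow> a \<in> carrier A \<Longrightarrow> act R (lp x a) w = \<tau> x a w"
  by (simp add: lp_eq R_act tt_tens \<delta>_zero)

lemma R_act_dl: "act R (dl h) w = \<delta> h w"
  by (simp add: dl_def R_act tt_zero)

lemma clinD:
  assumes "clin f" shows "f (x + y) = f x + f y" "f (pscale d x) = pscale d (f x)" "f 0 = 0" "f (- x) = - f x" "f (x - y) = f x - f y"
  using cvec.linD[OF pscale_cvec assms] by auto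

lemma R_act_clin: "X \<in> carrier L \<Longrightarrow> clin (act R X)"
proof (induction rule: L_induct)
  case (add X Y)
  obtain s h t k where XY: "X = (s, h)" "Y = (t, k)" "s \<in> carrier V" "h \<in> HC" "t \<in> carrier V" "k \<in> HC"
    using add by auto
  have "act R (X \<oplus>\<^bsub>L\<^esub> Y) w = act R X w + act R Y w" for w
    using XY lin_mapD(2)[OF crepD(4)[OF c], of h k w] by (simp add: R_act ttD algebra_simps)
  then have "act R (X \<oplus>\<^bsub>L\<^esub> Y) = (\<lambda>w. act R X w + act R Y w)" by auto
  with add show ?case by (auto simp: cvec.lin_def[OF pscale_cvec] pscale_simps)
next
  case (lp x a)
  then have "act R (lp x a) = \<tau> x a" by (auto simp: R_act_lp)
  then show ?case using crepD(1)[OF c] lp by simp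
next
  case (dl h)
  have "act R (dl h) = \<delta> h" by (auto simp: R_act_dl)
  then show ?case using crepD(2)[OF c] dl by simp
qed

lemma R_lin: "lin_map L (free_vs UNIV) (\<lambda>X. act R X w)"
proof (rule lin_mapI)
  fix X Y assume "X \<in> carrier L" "Y \<in> carrier L"
  then show "act R (X \<oplus>\<^bsub>L\<^esub> Y) w = act R X w \<oplus>\<^bsub>free_vs UNIV\<^esub> act R Y w"
    using lin_mapD(2)[OF crepD(4)[OF c], of _ _ w] by (auto simp: R_act ttD algebra_simps)
next
  fix d X assume "X \<in> carrier L"
  then show "act R (d \<odot>\<^bsub>L\<^esub> X) w = d \<odot>\<^bsub>free_vs UNIV\<^esub> act R X w"
    using lin_mapD(3)[OF crepD(4)[OF c], of _ d w] by (auto simp: R_act ttD pscale_simps)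
qed simp

lemma tt_clin: "s \<in> carrier V \<Longrightarrow> clin (tt s)"
proof -
  assume s: "s \<in> carrier V"
  then have "act R (s, \<zero>\<^bsub>G\<^esub>) = tt s" by (auto simp: R_act \<delta>_zero)
  then show ?thesis using R_act_clin[of "(s, \<zero>\<^bsub>G\<^esub>)"] s by (simp add: zero_HC)
qed

text \<open>The bracket relation is known for pure tensors. Both sides are additive in
  \<open>s\<close> and in \<open>t\<close>, so two nested inductions over tensors extend it.\<close>

lemma tt_tt:
  assumes s: "s \<in> carrier V" and t: "t \<in> carrier V"
  shows "tt s (tt t w) = tt t (tt s w) + tt (loop_brkt G A s t) w"
  using s
proof (induction rule: T.tensor_induct)
  case (add s1 s2)
  then show ?case
    using t clinD[OF tt_clin[OF t]] lin_mapD(2)[OF loop_brkt_lin[OF t]]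
    by (simp add: ttD loop_brkt_closed algebra_simps)
next
  case (tens x a)
  then have x: "x \<in> derived G" "x \<in> carrier G" and a: "a \<in> carrier A" using derived_closed by auto
  have "\<tau> x a (tt t w) = tt t (\<tau> x a w) + tt (inn x a t) w"
    using t
  proof (induction rule: T.tensor_induct)
    case (add t1 t2)
    then show ?case
      using lin_mapD[OF inn_lin[OF x(2) a]] clinD[OF crepD(1)[OF c x(1) a]] by (simp add: ttD algebra_simps)
  next
    case (tens y b)
    then show ?case using x a crepD(5)[OF c x(1) _ a] by (simp add: tt_tens inn_tens br_derived derived_closed)
  qed
  then show ?case using x a t by (simp add: tt_tens loop_brkt_tens)
qed

lemma \<delta>_tt:
  assumes h: "h \<in> HC" and t: "t \<in> carrier V"
  shows "\<delta> h (tt t w) = tt t (\<delta> h w) + tt (tensor_map DG A (brkt G h) (\<lambda>a. a) t) w"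
  using t
proof (induction rule: T.tensor_induct)
  case (add t1 t2)
  then show ?case
    using lin_mapD[OF tmap_lin[OF HCs(1)[OF h]]] clinD[OF crepD(2)[OF c h]] by (simp add: ttD algebra_simps)
next
  case (tens y b)
  then show ?case using h crepD(6)[OF c h] by (simp add: tt_tens tmap_tens HCs br_derived derived_closed)
qed

lemma R_lrep: "lrep L R"
  unfolding lrep_def
proof (intro conjI ballI crep_rec_cmod)
  show "lin_map R R (act R X)" if "X \<in> carrier L" for X
    using R_act_clin[OF that] by (simp add: clin_iff crep_rec_lin_map)
  show "lin_map L R (\<lambda>X. act R X w)" for w
    using R_lin by (simp add: crep_rec_lin_map)
  fix X Y w assume "X \<in> carrier L" "Y \<in> carrier L"
  then obtain s h t k where XY: "X = (s, h)" "Y = (t, k)" and m: "s \<in> carrier V" "h \<in> HC" "t \<in> carrier V" "k \<in> HC"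
    by auto
  let ?h = "tensor_map DG A (brkt G h) (\<lambda>a. a) t" and ?k = "tensor_map DG A (brkt G k) (\<lambda>a. a) s"
  have cl: "?h \<in> carrier V" "?k \<in> carrier V" "loop_brkt G A s t \<in> carrier V"
    using m lin_mapD(1)[OF tmap_lin[OF HCs(1)]] loop_brkt_closed by auto
  have "act R (brkt L X Y) w = tt (loop_brkt G A s t) w + tt ?h w - tt ?k w"
    using cl m by (simp add: XY L_brkt R_act \<delta>_zero ttD T.ts pscale_minus)
  then show "act R X (act R Y w) = act R Y (act R X w) \<oplus>\<^bsub>R\<^esub> act R (brkt L X Y) w"
    using m clinD[OF tt_clin] clinD[OF crepD(2)[OF c]] tt_tt[OF m(1,3)] \<delta>_tt[OF m(2,3)] \<delta>_tt[OF m(4,1)] crepD(7)[OF c m(2,4)]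
    by (simp add: XY R_act algebra_simps)
qed

end

end

subsection \<open>Modules over the current algebra\<close>

context curr
begin

abbreviation ge where "ge \<equiv> g_embed G A HC"

lemma lp_zero: "a \<in> carrier A \<Longrightarrow> lp \<zero>\<^bsub>G\<^esub> a = \<zero>\<^bsub>L\<^esub>"
  using lin_map_zero[OF DG_cmod L_cmod lp_lin(2)] by simp

lemma cartan'_derived: "h \<in> cartan' G \<Longrightarrow> h \<in> derived G"
  by (simp add: cartan'_def)

lemma cartan_obtain:
  assumes "h \<in> cartan G"
  obtains h' k where "h' \<in> cartan' G" "k \<in> HC" "h = h' \<oplus>\<^bsub>G\<^esub> k" "ge h = lp h' \<one>\<^bsub>A\<^esub> \<oplus>\<^bsub>L\<^esub> dl k"
  using cartan_dec[OF assms] g_embed cartan'_derived by blast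

lemma ge_chev: "ge (chev_e G i) = lp (chev_e G i) \<one>\<^bsub>A\<^esub>" "ge (chev_f G i) = lp (chev_f G i) \<one>\<^bsub>A\<^esub>"
  "ge (coroot G i) = lp (coroot G i) \<one>\<^bsub>A\<^esub>"
  by (simp_all add: g_embed_derived chev_derived)

context
  fixes N :: "(('g, 'a) current, 'v, 'n) lie_rep_scheme"
  assumes N: "lrep L N"
begin

lemmas ns = cmod_simps[OF lrepD(1)[OF N]] cmod_ac[OF lrepD(1)[OF N]]
lemmas act_lp_lin = lin_mapD[OF lrepD(2)[OF N lp_closed]]
lemmas act_dl_lin = lin_mapD[OF lrepD(2)[OF N dl_closed]]

lemma act_add: "X \<in> carrier L \<Longrightarrow> Y \<in> carrier L \<Longrightarrow> m \<in> carrier N \<Longrightarrow> act N (X \<oplus>\<^bsub>L\<^esub> Y) m = act N X m \<oplus>\<^bsub>N\<^esub> act N Y m"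
  using lin_mapD(2)[OF lrepD(3)[OF N]] by blast

lemma act_lp_bilin: "m \<in> carrier N \<Longrightarrow> bilin DG A N (\<lambda>x a. act N (lp x a) m)"
  unfolding bilin_def
proof (intro conjI ballI)
  fix a assume "m \<in> carrier N" "a \<in> carrier A"
  then show "lin_map DG N (\<lambda>x. act N (lp x a) m)"
    using lin_map_comp[OF lrepD(3)[OF N] lp_lin(2)] by blast
next
  fix x assume "m \<in> carrier N" "x \<in> carrier DG"
  then show "lin_map A N (\<lambda>a. act N (lp x a) m)"
    using lin_map_comp[OF lrepD(3)[OF N] lp_lin(1)] by simp
qed

lemma act_lp_bilinD:
  assumes "x \<in> derived G" "a \<in> carrier A" "m \<in> carrier N"
  shows "y \<in> derived G \<Longrightarrow> act N (lp (x \<oplus>\<^bsub>G\<^esub> y) a) m = act N (lp x a) m \<oplus>\<^bsub>N\<^esub> act N (lp y a) m"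
    "act N (lp (d \<odot>\<^bsub>G\<^esub> x) a) m = d \<odot>\<^bsub>N\<^esub> act N (lp x a) m"
    "b \<in> carrier A \<Longrightarrow> act N (lp x (a \<oplus>\<^bsub>A\<^esub> b)) m = act N (lp x a) m \<oplus>\<^bsub>N\<^esub> act N (lp x b) m"
  using act_lp_bilin[OF assms(3)] assms(1,2) by (auto simp: bilin_def lin_map_def)

lemma act_lp_zero: "a \<in> carrier A \<Longrightarrow> m \<in> carrier N \<Longrightarrow> act N (lp \<zero>\<^bsub>G\<^esub> a) m = \<zero>\<^bsub>N\<^esub>"
  using lin_map_zero[OF L_cmod lrepD(1)[OF N] lrepD(3)[OF N]] lp_zero by simp

lemma act_lp_closed: "x \<in> derived G \<Longrightarrow> a \<in> carrier A \<Longrightarrow> m \<in> carrier N \<Longrightarrow> act N (lp x a) m \<in> carrier N"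
  and act_dl_closed: "h \<in> HC \<Longrightarrow> m \<in> carrier N \<Longrightarrow> act N (dl h) m \<in> carrier N"
  using lrepD(5)[OF N] lp_closed dl_closed by blast+

lemma act_lp_lp:
  "x \<in> derived G \<Longrightarrow> y \<in> derived G \<Longrightarrow> a \<in> carrier A \<Longrightarrow> b \<in> carrier A \<Longrightarrow> m \<in> carrier N \<Longrightarrow>
    act N (lp x a) (act N (lp y b) m) = act N (lp y b) (act N (lp x a) m) \<oplus>\<^bsub>N\<^esub> act N (lp [x,y]\<^sub>G (a \<star> b)) m"
  by (subst lrepD(4)[OF N lp_closed lp_closed]) (simp_all only: brkt_lp_lp)

lemma act_dl_lp:
  "h \<in> HC \<Longrightarrow> x \<in> derived G \<Longrightarrow> a \<in> carrier A \<Longrightarrow> m \<in> carrier N \<Longrightarrow>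
    act N (dl h) (act N (lp x a) m) = act N (lp x a) (act N (dl h) m) \<oplus>\<^bsub>N\<^esub> act N (lp [h,x]\<^sub>G a) m"
  by (subst lrepD(4)[OF N dl_closed lp_closed]) (simp_all only: brkt_dl_lp)

lemma act_dl_dl:
  "h \<in> HC \<Longrightarrow> k \<in> HC \<Longrightarrow> m \<in> carrier N \<Longrightarrow> act N (dl h) (act N (dl k) m) = act N (dl k) (act N (dl h) m)"
  using lrepD(4)[OF N dl_closed dl_closed, of h k m] brkt_dl_dl[of h k]
    lin_map_zero[OF L_cmod lrepD(1)[OF N] lrepD(3)[OF N], of m] act_dl_closed by (simp add: ns)

lemma act_ge:
  assumes "h' \<in> cartan' G" "k \<in> HC" "m \<in> carrier N"
  shows "act N (ge (h' \<oplus>\<^bsub>G\<^esub> k)) m = act N (lp h' \<one>\<^bsub>A\<^esub>) m \<oplus>\<^bsub>N\<^esub> act N (dl k) m"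
  using assms g_embed[of h' k] by (simp only: cartan'_derived) (simp add: act_add[OF lp_closed dl_closed] cartan'_derived)

lemma act_ge_lp:
  assumes h: "h \<in> cartan G" and x: "x \<in> derived G" "a \<in> carrier A" "m \<in> carrier N"
  shows "act N (ge h) (act N (lp x a) m) = act N (lp x a) (act N (ge h) m) \<oplus>\<^bsub>N\<^esub> act N (lp [h,x]\<^sub>G a) m"
proof -
  obtain h' k where hk: "h' \<in> cartan' G" "k \<in> HC" "h = h' \<oplus>\<^bsub>G\<^esub> k" using cartan_dec[OF h] by blast
  have c: "h' \<in> derived G" "h' \<in> carrier G" "k \<in> carrier G" "x \<in> carrier G"
    using hk x cartan'_derived derived_closed HCs by auto
  have "[h,x]\<^sub>G = [h',x]\<^sub>G \<oplus>\<^bsub>G\<^esub> [k,x]\<^sub>G" using c by (simp add: hk(3) brs)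
  then show ?thesis
    unfolding hk(3) using hk c x act_lp_closed act_dl_closed act_lp_lp[OF c(1) x(1) A.one_closed x(2,3)]
      act_dl_lp[OF hk(2) x]
    by (simp add: act_ge act_lp_lin act_lp_bilinD(1) br_derived ns)
qed

lemma rep_submodule_currI:
  assumes K: "lin_subspace N K"
    and "\<And>x a m. x \<in> derived G \<Longrightarrow> a \<in> carrier A \<Longrightarrow> m \<in> K \<Longrightarrow> act N (lp x a) m \<in> K"
    and "\<And>h m. h \<in> HC \<Longrightarrow> m \<in> K \<Longrightarrow> act N (dl h) m \<in> K"
  shows "rep_submodule L N K"
  unfolding rep_submodule_def
proof (intro conjI ballI K)
  note Ks = lin_subspaceD[OF lrepD(1)[OF N] K]
  fix X m assume "X \<in> carrier L" and m: "m \<in> K"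
  then show "act N X m \<in> K"
    by (induction rule: L_induct) (use assms Ks in \<open>simp_all add: act_add\<close>)
qed

end

text \<open>Operators are conjugated with the retract. In a product of two of them \<pi> follows
  \<iota> in the middle and cancels, so the relations hold on the whole free space and not only on
  the image of the module; on the kernel of \<pi> all operators are zero.\<close>

lemma curr_embedding:
  fixes N :: "(('g, 'a) current, 'v, 'n) lie_rep_scheme"
  assumes N: "lrep L N"
  obtains \<iota> :: "'v \<Rightarrow> ('v \<Rightarrow>\<^sub>0 complex)" and \<pi> \<tau> \<delta>
  where "crep \<tau> \<delta>" "lin_map N (free_vs UNIV) \<iota>" "lin_map (free_vs UNIV) N \<pi>"
    "\<And>m. m \<in> carrier N \<Longrightarrow> \<pi> (\<iota> m) = m"
    "\<And>x a p. \<tau> x a p = \<iota> (act N (lp x a) (\<pi> p))" "\<And>h p. \<delta> h p = \<iota> (act N (dl h) (\<pi> p))"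
proof -
  obtain \<iota> :: "'v \<Rightarrow> ('v \<Rightarrow>\<^sub>0 complex)" and \<pi>
    where \<iota>: "lin_map N (free_vs UNIV) \<iota>" and \<pi>: "lin_map (free_vs UNIV) N \<pi>"
    and \<pi>\<iota>: "\<And>v. v \<in> carrier N \<Longrightarrow> \<pi> (\<iota> v) = v"
    using cmod_retract[OF lrepD(1)[OF N]] by blast
  note \<iota>D = lin_mapD[OF \<iota>, simplified] and \<pi>D = lin_mapD[OF \<pi>, simplified]
  define \<tau> where "\<tau> x a p = \<iota> (act N (lp x a) (\<pi> p))" for x a p
  define \<delta> where "\<delta> h p = \<iota> (act N (dl h) (\<pi> p))" for h p
  note cl = act_lp_closed[OF N] act_dl_closed[OF N] \<pi>D(1)
  have "crep \<tau> \<delta>"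
    unfolding crep_def
  proof (intro conjI ballI allI)
    fix x a assume "x \<in> derived G" "a \<in> carrier A"
    then show "clin (\<tau> x a)"
      unfolding clin_iff \<tau>_def by (intro lin_map_comp[OF \<iota>] lin_map_comp[OF lrepD(2)[OF N lp_closed] \<pi>])
  next
    fix h assume "h \<in> HC"
    then show "clin (\<delta> h)"
      unfolding clin_iff \<delta>_def by (intro lin_map_comp[OF \<iota>] lin_map_comp[OF lrepD(2)[OF N dl_closed] \<pi>])
  next
    fix w
    show "bilin DG A (free_vs UNIV) (\<lambda>x a. \<tau> x a w)"
      using act_lp_bilin[OF N \<pi>D(1)[of w]] unfolding bilin_def \<tau>_def
      by (intro conjI ballI lin_map_comp[OF \<iota>]) simp_all
    show "lin_map (G\<lparr>carrier := HC\<rparr>) (free_vs UNIV) (\<lambda>h. \<delta> h w)"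
      unfolding \<delta>_def by (rule lin_map_comp[OF \<iota> lin_map_comp[OF lrepD(3)[OF N \<pi>D(1)] dl_lin]])
  next
    fix x y a b w assume "x \<in> derived G" "y \<in> derived G" "a \<in> carrier A" "b \<in> carrier A"
    then show "\<tau> x a (\<tau> y b w) = \<tau> y b (\<tau> x a w) + \<tau> [x,y]\<^sub>G (a \<star> b) w"
      unfolding \<tau>_def using act_lp_lp[OF N, of x y a b "\<pi> w"] by (simp add: \<pi>\<iota> cl \<iota>D(2)[symmetric] br_derived derived_closed)
  next
    fix h x a w assume "h \<in> HC" "x \<in> derived G" "a \<in> carrier A"
    then show "\<delta> h (\<tau> x a w) = \<tau> x a (\<delta> h w) + \<tau> [h,x]\<^sub>G a w"
      unfolding \<tau>_def \<delta>_def using act_dl_lp[OF N, of h x a "\<pi> w"] by (simp add: \<pi>\<iota> cl \<iota>D(2)[symmetric] br_derived derived_closed HCs)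
  next
    fix h k w assume "h \<in> HC" "k \<in> HC"
    then show "\<delta> h (\<delta> k w) = \<delta> k (\<delta> h w)"
      unfolding \<delta>_def using act_dl_dl[OF N, of h k "\<pi> w"] by (simp add: \<pi>\<iota> cl)
  qed
  with \<iota> \<pi> \<pi>\<iota> \<tau>_def \<delta>_def that show thesis by blast
qed

lemma coroot_chev: "[coroot G i, chev_e G i]\<^sub>G = 2 \<odot>\<^bsub>G\<^esub> chev_e G i" "[coroot G i, chev_f G i]\<^sub>G = (-2) \<odot>\<^bsub>G\<^esub> chev_f G i"
  by (simp_all add: brkt_h_e brkt_h_f coroot_cartan sroot_self)

lemma crep_sl2:
  assumes c: "crep \<tau> \<delta>"
  shows "sl2_triple pscale (\<tau> (chev_e G i) \<one>\<^bsub>A\<^esub>) (\<tau> (chev_f G i) \<one>\<^bsub>A\<^esub>) (\<tau> (coroot G i) \<one>\<^bsub>A\<^esub>)"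
proof -
  note b = crepD(5)[OF c _ _ A.one_closed A.one_closed] and s = crep_bilinD(2)[OF c _ A.one_closed]
  show ?thesis
    unfolding sl2_triple_def sl2_triple_axioms_def
    using crepD(1)[OF c] b[of "chev_e G i" "chev_f G i"] b[of "coroot G i" "chev_e G i"] b[of "coroot G i" "chev_f G i"]
    by (simp add: pscale_cvec chev_derived brkt_e_f coroot_chev s)
      (metis pscale_minus pscale_simps(3) mult_minus1)
qed

subsection \<open>Highest weight vectors\<close>

text \<open>The conditions are stated on generators only. \<open>hwv_act\<close> and
  \<open>act_hwv\<close> show that they amount to the relation
  \<open>(n + h) m = \<psi>(h) m\<close> defining the induced module.\<close>

definition hwv :: "(('g, 'a) current, 'v, 'n) lie_rep_scheme \<Rightarrow> (('g, 'a) current \<Rightarrow> complex) \<Rightarrow> 'v \<Rightarrow> bool" where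
  "hwv N \<psi> m \<longleftrightarrow> m \<in> carrier N \<and> (\<forall>x\<in>nilp_pos G. \<forall>a\<in>carrier A. act N (lp x a) m = \<zero>\<^bsub>N\<^esub>) \<and>
    (\<forall>h\<in>cartan' G. \<forall>a\<in>carrier A. act N (lp h a) m = \<psi> (lp h a) \<odot>\<^bsub>N\<^esub> m) \<and>
    (\<forall>h\<in>HC. act N (dl h) m = \<psi> (dl h) \<odot>\<^bsub>N\<^esub> m)"

lemma tensor_sub_subspace: "S \<subseteq> derived G \<Longrightarrow> lin_subspace V (tensor_sub G A S)"
  unfolding tensor_sub_def using T.tens_closed by (intro lin_span_subspace[OF T.T_cmod]) auto

lemma tensor_sub_base: "x \<in> S \<Longrightarrow> a \<in> carrier A \<Longrightarrow> tp x a \<in> tensor_sub G A S"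
  unfolding tensor_sub_def by (intro lin_span_base) auto

abbreviation PP where "PP \<equiv> current_nilp_pos G A"
abbreviation HH where "HH \<equiv> current_cartan G A HC"

lemma cartan'_derived_subset: "cartan' G \<subseteq> derived G"
  using cartan'_derived by auto

lemma PP_subset: "PP \<subseteq> carrier L" and HH_subset: "HH \<subseteq> carrier L"
  using lin_subspaceD(1)[OF T.T_cmod tensor_sub_subspace[OF nilp_pos_derived]]
    lin_subspaceD(1)[OF T.T_cmod tensor_sub_subspace[OF cartan'_derived_subset]]
  by (auto simp: current_nilp_pos_def current_cartan_def zero_HC)

lemma lp_PP: "x \<in> nilp_pos G \<Longrightarrow> a \<in> carrier A \<Longrightarrow> lp x a \<in> PP"
  and lp_HH: "h \<in> cartan' G \<Longrightarrow> a \<in> carrier A \<Longrightarrow> lp h a \<in> HH" and dl_HH: "h \<in> HC \<Longrightarrow> dl h \<in> HH"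
  using lin_subspaceD(2)[OF T.T_cmod tensor_sub_subspace[OF cartan'_derived_subset]]
  by (auto simp: lp_eq dl_def current_nilp_pos_def current_cartan_def tensor_sub_base zero_HC)

lemma zero_PP: "\<zero>\<^bsub>L\<^esub> \<in> PP" and zero_HH: "\<zero>\<^bsub>L\<^esub> \<in> HH"
  using lin_subspaceD(2)[OF T.T_cmod tensor_sub_subspace[OF nilp_pos_derived]]
    lin_subspaceD(2)[OF T.T_cmod tensor_sub_subspace[OF cartan'_derived_subset]]
  by (auto simp: current_nilp_pos_def current_cartan_def zero_HC)

lemma HH_subspace: "lin_subspace L HH"
  unfolding lin_subspace_iff[OF L_cmod] current_cartan_def
  using lin_subspaceD[OF T.T_cmod tensor_sub_subspace[OF cartan'_derived_subset]] HCs by auto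

end

text \<open>\<open>nn i\<close> is the value of the highest weight on the i-th simple coroot, as a
  natural number; it is the exponent of \<open>I\<close> in the relation at
  \<open>f_i\<close>.\<close>

locale hw_data = curr G A HC for G :: "('g, 'i::finite) km_algebra_rec" (structure) and A :: "(complex, 'a) module" and HC +
  fixes \<psi> :: "('g, 'a) current \<Rightarrow> complex" and I :: "'a set" and nn :: "'i \<Rightarrow> nat"
  assumes \<psi>: "lin_functional (L\<lparr>carrier := HH\<rparr>) \<psi>"
    and I: "ideal I A"
    and nn: "\<psi> (lp (coroot G i) \<one>\<^bsub>A\<^esub>) = of_nat (nn i)"
begin

lemma \<psi>_add: "x \<in> HH \<Longrightarrow> y \<in> HH \<Longrightarrow> \<psi> (x \<oplus>\<^bsub>L\<^esub> y) = \<psi> x + \<psi> y" and \<psi>_smult: "x \<in> HH \<Longrightarrow> \<psi> (c \<odot>\<^bsub>L\<^esub> x) = c * \<psi> x"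
  using \<psi> by (auto simp: lin_functional_def)

lemma \<psi>_zero: "\<psi> \<zero>\<^bsub>L\<^esub> = 0"
  using \<psi>_smult[OF zero_HH, of 0] cmod_simps(11)[OF L_cmod, of 0] by simp

lemma hwv_act:
  fixes N :: "(('g, 'a) current, 'v, 'n) lie_rep_scheme"
  assumes N: "lrep L N" and m: "hwv N \<psi> m" and n: "n \<in> PP" and h: "h \<in> HH"
  shows "act N (n \<oplus>\<^bsub>L\<^esub> h) m = \<psi> h \<odot>\<^bsub>N\<^esub> m"
proof -
  have mc: "m \<in> carrier N" using m by (simp add: hwv_def)
  note ns = cmod_simps[OF lrepD(1)[OF N]]
  note aL = lin_mapD[OF lrepD(3)[OF N mc]]
  obtain s where s: "n = (s, \<zero>\<^bsub>G\<^esub>)" "s \<in> tensor_sub G A (nilp_pos G)" using n by (auto simp: current_nilp_pos_def)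
  have sub: "{tp x a | x a. x \<in> nilp_pos G \<and> a \<in> carrier A} \<subseteq> carrier V"
    "{tp x a | x a. x \<in> cartan' G \<and> a \<in> carrier A} \<subseteq> carrier V"
    using T.tens_closed nilp_pos_derived cartan'_derived_subset by auto
  have "act N (s, \<zero>\<^bsub>G\<^esub>) m = \<zero>\<^bsub>N\<^esub>"
    using T.T_cmod sub(1) s(2)[unfolded tensor_sub_def]
  proof (induction rule: lin_span_induct)
    case zero then show ?case using act_lp_zero[OF N A.one_closed mc] by (simp add: lp_zero[OF A.one_closed])
  next
    case (add x y)
    then show ?case using aL(2)[of "(x, \<zero>\<^bsub>G\<^esub>)" "(y, \<zero>\<^bsub>G\<^esub>)"] by (simp add: zero_HC gs ns)
  next
    case (smult c x)
    then show ?case using aL(3)[of "(x, \<zero>\<^bsub>G\<^esub>)" c] by (simp add: zero_HC gs ns)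
  next
    case (base x) then show ?case using m by (auto simp: hwv_def lp_eq)
  qed
  then have 1: "act N n m = \<zero>\<^bsub>N\<^esub>" by (simp add: s)
  obtain t k where t: "h = (t, k)" "t \<in> tensor_sub G A (cartan' G)" "k \<in> HC" using h by (auto simp: current_cartan_def)
  have HH: "(x, \<zero>\<^bsub>G\<^esub>) \<in> HH" if "x \<in> tensor_sub G A (cartan' G)" for x
    using that by (simp add: current_cartan_def zero_HC)
  have "t \<in> tensor_sub G A (cartan' G) \<and> act N (t, \<zero>\<^bsub>G\<^esub>) m = \<psi> (t, \<zero>\<^bsub>G\<^esub>) \<odot>\<^bsub>N\<^esub> m"
    using T.T_cmod sub(2) t(2)[unfolded tensor_sub_def]
  proof (induction rule: lin_span_induct)
    case zero
    then show ?case using act_lp_zero[OF N A.one_closed mc] \<psi>_zero lin_subspaceD(2)[OF T.T_cmod tensor_sub_subspace[OF cartan'_derived_subset]]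
      by (simp add: lp_zero[OF A.one_closed] ns mc)
  next
    case (add x y)
    then show ?case using aL(2)[of "(x, \<zero>\<^bsub>G\<^esub>)" "(y, \<zero>\<^bsub>G\<^esub>)"] \<psi>_add[OF HH HH, of x y]
        lin_subspaceD(3)[OF T.T_cmod tensor_sub_subspace[OF cartan'_derived_subset]]
      by (simp add: zero_HC gs ns mc)
  next
    case (smult c x)
    then show ?case using aL(3)[of "(x, \<zero>\<^bsub>G\<^esub>)" c] \<psi>_smult[OF HH, of x c]
        lin_subspaceD(4)[OF T.T_cmod tensor_sub_subspace[OF cartan'_derived_subset]]
      by (simp add: zero_HC gs ns mc)
  next
    case (base x) then show ?case using m by (auto simp: hwv_def lp_eq tensor_sub_base)
  qed
  then have 2: "act N (t, \<zero>\<^bsub>G\<^esub>) m = \<psi> (t, \<zero>\<^bsub>G\<^esub>) \<odot>\<^bsub>N\<^esub> m" by blast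
  have h_eq: "h = (t, \<zero>\<^bsub>G\<^esub>) \<oplus>\<^bsub>L\<^esub> dl k"
    using t lin_subspaceD(1)[OF T.T_cmod tensor_sub_subspace[OF cartan'_derived_subset] t(2)] by (simp add: dl_def T.ts gs HCs)
  have c: "(t, \<zero>\<^bsub>G\<^esub>) \<in> carrier L" "dl k \<in> carrier L" using HH_subset HH[OF t(2)] dl_closed[OF t(3)] by auto
  have 3: "act N h m = \<psi> h \<odot>\<^bsub>N\<^esub> m"
    unfolding h_eq using aL(2)[OF c] 2 m t \<psi>_add[OF HH[OF t(2)] dl_HH[OF t(3)]] by (simp add: hwv_def ns mc del: L_simps)
  have "n \<in> carrier L" "h \<in> carrier L" using n h PP_subset HH_subset by auto
  then show ?thesis using aL(2)[of n h] 1 3 by (simp add: ns mc del: L_simps)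
qed

lemma act_hwv:
  fixes N :: "(('g, 'a) current, 'v, 'n) lie_rep_scheme"
  assumes N: "lrep L N" and m: "m \<in> carrier N"
    and hw: "\<And>n h. n \<in> PP \<Longrightarrow> h \<in> HH \<Longrightarrow> act N (n \<oplus>\<^bsub>L\<^esub> h) m = \<psi> h \<odot>\<^bsub>N\<^esub> m"
  shows "hwv N \<psi> m"
  unfolding hwv_def
proof (intro conjI ballI m)
  note ls' = cmod_simps(4,5)[OF L_cmod]
  fix x a assume "x \<in> nilp_pos G" "a \<in> carrier A"
  then show "act N (lp x a) m = \<zero>\<^bsub>N\<^esub>"
    using hw[OF lp_PP zero_HH, of x a] ls'(2)[OF subsetD[OF PP_subset lp_PP]] \<psi>_zero m cmod_simps(10)[OF lrepD(1)[OF N] m]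
    by (simp del: L_simps)
next
  fix h a assume "h \<in> cartan' G" "a \<in> carrier A"
  then show "act N (lp h a) m = \<psi> (lp h a) \<odot>\<^bsub>N\<^esub> m"
    using hw[OF zero_PP lp_HH, of h a] cmod_simps(4)[OF L_cmod lp_closed] cartan'_derived by simp
next
  fix h assume "h \<in> HC"
  then show "act N (dl h) m = \<psi> (dl h) \<odot>\<^bsub>N\<^esub> m"
    using hw[OF zero_PP dl_HH, of h] cmod_simps(4)[OF L_cmod dl_closed] by simp
qed

abbreviation lam where "lam h \<equiv> \<psi> (ge h)"

lemma hwv_ge:
  fixes N :: "(('g, 'a) current, 'v, 'n) lie_rep_scheme"
  assumes N: "lrep L N" and m: "hwv N \<psi> m" and h: "h \<in> cartan G"
  shows "act N (ge h) m = lam h \<odot>\<^bsub>N\<^esub> m"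
proof -
  obtain h' k where *: "h' \<in> cartan' G" "k \<in> HC" "h = h' \<oplus>\<^bsub>G\<^esub> k" "ge h = lp h' \<one>\<^bsub>A\<^esub> \<oplus>\<^bsub>L\<^esub> dl k"
    using cartan_obtain[OF h] .
  have "ge h \<in> HH"
    unfolding *(4) using * lp_HH dl_HH by (intro lin_subspaceD(3)[OF L_cmod HH_subspace]) auto
  from hwv_act[OF N m zero_PP this] show ?thesis
    using cmod_simps(4)[OF L_cmod g_embed_closed[OF h]] by simp
qed

end

subsection \<open>Weights of highest weight modules\<close>

text \<open>Since \<open>K\<close> is invariant, an exponent that works may be increased, so two
  vectors have a common one. It is used with \<open>K\<close> zero and with \<open>K\<close> a
  submodule.\<close>

lemma nilpotent_mod_subspace:
  assumes M: "cmod M" and f: "lin_map M M f" and K: "lin_subspace M K" and inv: "\<And>x. x \<in> K \<Longrightarrow> f x \<in> K"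
  shows "lin_subspace M {w\<in>carrier M. \<exists>n. (f ^^ n) w \<in> K}"
proof -
  note Ks = lin_subspaceD[OF M K]
  have cl: "x \<in> carrier M \<Longrightarrow> (f ^^ n) x \<in> carrier M" for x n
    by (induction n) (auto simp: lin_mapD[OF f])
  have add: "x \<in> carrier M \<Longrightarrow> y \<in> carrier M \<Longrightarrow> (f ^^ n) (x \<oplus>\<^bsub>M\<^esub> y) = (f ^^ n) x \<oplus>\<^bsub>M\<^esub> (f ^^ n) y" for x y n
    by (induction n) (auto simp: lin_mapD[OF f] cl)
  have sm: "x \<in> carrier M \<Longrightarrow> (f ^^ n) (c \<odot>\<^bsub>M\<^esub> x) = c \<odot>\<^bsub>M\<^esub> (f ^^ n) x" for x c n
    by (induction n) (auto simp: lin_mapD[OF f] cl)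
  have invn: "x \<in> K \<Longrightarrow> (f ^^ n) x \<in> K" for x n
    by (induction n) (auto simp: inv)
  have mono: "(f ^^ m) x \<in> K" if "(f ^^ n) x \<in> K" "n \<le> m" for x n m
    using invn[OF that(1), of "m - n"] that(2) funpow_add[of "m - n" n f] by simp
  show ?thesis
    unfolding lin_subspace_iff[OF M]
  proof (intro conjI ballI allI)
    show "\<zero>\<^bsub>M\<^esub> \<in> {w\<in>carrier M. \<exists>n. (f ^^ n) w \<in> K}"
      using Ks(2) cmod_simps(2)[OF M] by (auto intro!: exI[of _ 0])
    fix x assume x: "x \<in> {w\<in>carrier M. \<exists>n. (f ^^ n) w \<in> K}"
    then show "c \<odot>\<^bsub>M\<^esub> x \<in> {w\<in>carrier M. \<exists>n. (f ^^ n) w \<in> K}" for c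
      using Ks(4) cmod_simps(3)[OF M] by (auto simp: sm)
    fix y assume y: "y \<in> {w\<in>carrier M. \<exists>n. (f ^^ n) w \<in> K}"
    obtain m n where mn: "(f ^^ m) x \<in> K" "(f ^^ n) y \<in> K" using x y by auto
    have "(f ^^ (max m n)) (x \<oplus>\<^bsub>M\<^esub> y) \<in> K"
      using x y Ks(3)[OF mono[OF mn(1), of "max m n"] mono[OF mn(2), of "max m n"]] by (simp add: add)
    then show "x \<oplus>\<^bsub>M\<^esub> y \<in> {w\<in>carrier M. \<exists>n. (f ^^ n) w \<in> K}"
      using x y cmod_simps(1)[OF M] by auto
  qed auto
qed

lemma cyclicD: "cyclic_rep L N v \<Longrightarrow> rep_submodule L N K \<Longrightarrow> v \<in> K \<Longrightarrow> K = carrier N"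
  by (simp add: cyclic_rep_def)

lemma rep_hom_pow:
  assumes "lrep L M" "rep_hom L M N f" "x \<in> carrier L" "m \<in> carrier M"
  shows "f ((act M x ^^ n) m) = (act N x ^^ n) (f m)" "(act M x ^^ n) m \<in> carrier M"
proof -
  show c: "(act M x ^^ n) m \<in> carrier M" for n
    by (induction n) (use assms lrepD(5)[OF assms(1)] in auto)
  show "f ((act M x ^^ n) m) = (act N x ^^ n) (f m)"
    by (induction n) (use assms c in \<open>auto simp: rep_hom_def\<close>)
qed

context curr
begin

lemma e_closed: "lp (chev_e G i) \<one>\<^bsub>A\<^esub> \<in> carrier L" and f_closed: "lp (chev_f G i) \<one>\<^bsub>A\<^esub> \<in> carrier L"
  and h_closed: "lp (coroot G i) \<one>\<^bsub>A\<^esub> \<in> carrier L"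
  using lp_closed[OF chev_derived(1) A.one_closed] lp_closed[OF chev_derived(2) A.one_closed]
    lp_closed[OF chev_derived(3) A.one_closed] by blast+

abbreviation eop where "eop N i \<equiv> act N (lp (chev_e G i) \<one>\<^bsub>A\<^esub>)"
abbreviation fop where "fop N i \<equiv> act N (lp (chev_f G i) \<one>\<^bsub>A\<^esub>)"

lemma f_nil_bound:
  fixes N :: "(('g, 'a) current, 'v, 'n) lie_rep_scheme"
  assumes N: "lrep L N" and nil: "\<And>w. w \<in> carrier N \<Longrightarrow> \<exists>n. (fop N i ^^ n) w = \<zero>\<^bsub>N\<^esub>"
    and w: "w \<in> carrier N" "(eop N i ^^ k) w = \<zero>\<^bsub>N\<^esub>" "act N (lp (coroot G i) \<one>\<^bsub>A\<^esub>) w = c \<odot>\<^bsub>N\<^esub> w"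
  shows "(fop N i ^^ nil_bound c k) w = \<zero>\<^bsub>N\<^esub>"
proof -
  obtain \<iota> :: "'v \<Rightarrow> ('v \<Rightarrow>\<^sub>0 complex)" and \<pi> \<tau> \<delta>
    where cr: "crep \<tau> \<delta>" and \<iota>: "lin_map N (free_vs UNIV) \<iota>" and \<pi>: "lin_map (free_vs UNIV) N \<pi>"
    and \<pi>\<iota>: "\<And>m. m \<in> carrier N \<Longrightarrow> \<pi> (\<iota> m) = m"
    and \<tau>: "\<And>x a p. \<tau> x a p = \<iota> (act N (lp x a) (\<pi> p))" and "\<And>h p. \<delta> h p = \<iota> (act N (dl h) (\<pi> p))"
    by (rule curr_embedding[OF N], rule that)
  note \<iota>D = lin_mapD[OF \<iota>, simplified] and \<pi>D = lin_mapD[OF \<pi>, simplified]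
  have \<iota>0: "\<iota> \<zero>\<^bsub>N\<^esub> = 0" using lin_map_zero[OF lrepD(1)[OF N] free_vs_cmod \<iota>] by simp
  have inj: "m = \<zero>\<^bsub>N\<^esub>" if "m \<in> carrier N" "\<iota> m = 0" for m
    using that \<pi>\<iota> \<iota>0 cmod_simps(2)[OF lrepD(1)[OF N]] by metis
  have cl: "(act N (lp x \<one>\<^bsub>A\<^esub>) ^^ n) m \<in> carrier N" if "x \<in> derived G" "m \<in> carrier N" for x n m
    using that act_lp_closed[OF N _ A.one_closed] by (induction n) auto
  have pow: "(\<tau> x \<one>\<^bsub>A\<^esub> ^^ n) (\<iota> m) = \<iota> ((act N (lp x \<one>\<^bsub>A\<^esub>) ^^ n) m)" if "x \<in> derived G" "m \<in> carrier N" for x n m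
    by (induction n) (simp_all add: \<tau> \<pi>\<iota> cl that)
  interpret sl2_triple pscale "\<tau> (chev_e G i) \<one>\<^bsub>A\<^esub>" "\<tau> (chev_f G i) \<one>\<^bsub>A\<^esub>" "\<tau> (coroot G i) \<one>\<^bsub>A\<^esub>"
    by (rule crep_sl2[OF cr])
  have "\<exists>n. (\<tau> (chev_f G i) \<one>\<^bsub>A\<^esub> ^^ n) p = 0" for p
  proof -
    \<comment> \<open>The vector \<open>p\<close> need not come from the module, but one application
      of the operator lands in the image of \<iota>, where the hypothesis applies; the exponent
      grows by one.\<close>
    let ?q = "fop N i (\<pi> p)"
    have q: "?q \<in> carrier N" using act_lp_closed[OF N chev_derived(2) A.one_closed \<pi>D(1)] .
    obtain n where "(fop N i ^^ n) ?q = \<zero>\<^bsub>N\<^esub>" using nil[OF q] by blast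
    then have "(\<tau> (chev_f G i) \<one>\<^bsub>A\<^esub> ^^ n) (\<tau> (chev_f G i) \<one>\<^bsub>A\<^esub> p) = 0"
      using pow[OF chev_derived(2) q] by (simp add: \<tau>[of _ _ p] \<iota>0)
    then show ?thesis by (intro exI[of _ "Suc n"]) (simp add: funpow_swap1)
  qed
  moreover have "(\<tau> (chev_e G i) \<one>\<^bsub>A\<^esub> ^^ k) (\<iota> w) = 0"
    using pow[OF chev_derived(1) w(1)] w(2) \<iota>0 by simp
  moreover have "\<tau> (coroot G i) \<one>\<^bsub>A\<^esub> (\<iota> w) = pscale c (\<iota> w)"
    using w by (simp add: \<tau> \<pi>\<iota> \<iota>D)
  ultimately have "(\<tau> (chev_f G i) \<one>\<^bsub>A\<^esub> ^^ nil_bound c k) (\<iota> w) = 0"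
    by (intro nil_bound)
  then show ?thesis
    using pow[OF chev_derived(2) w(1)] inj[OF cl[OF chev_derived(2) w(1)]] by simp
qed

end

context hw_data
begin

text \<open>The weight space of weight
  \<lambda>\<open>-\<close>\<Sum>\<open>m_i\<close>\<alpha>\<open>_i\<close>. Only natural
  coefficients occur, the highest weight being the top.\<close>

definition wts :: "(('g, 'a) current, 'v, 'n) lie_rep_scheme \<Rightarrow> ('i \<Rightarrow> nat) \<Rightarrow> 'v set" where
  "wts N m = {w\<in>carrier N. \<forall>h\<in>cartan G. act N (ge h) w = (lam h - root_of G m h) \<odot>\<^bsub>N\<^esub> w}"

lemma root_of_add: "root_of G (\<lambda>i. m i + m' i) h = root_of G m h + root_of G m' h"
  by (simp add: root_of_def algebra_simps sum.distrib)

lemma wts_subspace: "lrep L N \<Longrightarrow> lin_subspace N (wts N m)"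
proof -
  assume N: "lrep L N"
  note s = lin_mapD[OF lrepD(2)[OF N g_embed_closed]]
  note z = lin_map_zero[OF lrepD(1)[OF N] lrepD(1)[OF N] lrepD(2)[OF N g_embed_closed]]
  show ?thesis
    unfolding lin_subspace_iff[OF lrepD(1)[OF N]] wts_def
    by (auto simp: s z cmod_simps[OF lrepD(1)[OF N]] mult.commute)
qed

lemma act_fw_wts:
  assumes N: "lrep L N" and w: "w \<in> wts N m" and a: "a \<in> carrier A"
  shows "act N (lp (fw ws) a) w \<in> wts N (\<lambda>i. m i + count_list ws i)"
proof -
  have wc: "w \<in> carrier N" using w by (simp add: wts_def)
  note c = act_lp_closed[OF N fw_derived a wc]
  have "act N (ge h) (act N (lp (fw ws) a) w) = (lam h - root_of G (\<lambda>i. m i + count_list ws i) h) \<odot>\<^bsub>N\<^esub> act N (lp (fw ws) a) w"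
    if h: "h \<in> cartan G" for h
  proof -
    have "act N (ge h) (act N (lp (fw ws) a) w) = act N (lp (fw ws) a) (act N (ge h) w) \<oplus>\<^bsub>N\<^esub> act N (lp [h, fw ws]\<^sub>G a) w"
      by (rule act_ge_lp[OF N h fw_derived a wc])
    also have "\<dots> = (lam h - root_of G m h) \<odot>\<^bsub>N\<^esub> act N (lp (fw ws) a) w \<oplus>\<^bsub>N\<^esub> (- root_of G (count_list ws) h) \<odot>\<^bsub>N\<^esub> act N (lp (fw ws) a) w"
      using w h wc a fw_derived by (simp add: wts_def fw_weight sum_list_sroot act_lp_lin[OF N] act_lp_bilinD(2)[OF N])
    also have "\<dots> = ((lam h - root_of G m h) + (- root_of G (count_list ws) h)) \<odot>\<^bsub>N\<^esub> act N (lp (fw ws) a) w"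
      by (rule cmod_simps(6)[OF lrepD(1)[OF N] c, symmetric])
    finally show ?thesis by (simp add: root_of_add diff_diff_eq)
  qed
  with c show ?thesis by (simp add: wts_def)
qed

text \<open>The subspace that U(N^- \<otimes> A) generates from \<open>v\<close>, as an inductive
  set so that statements about a whole highest weight module can be proved by rule
  induction.\<close>

inductive_set neg_span :: "(('g, 'a) current, 'v, 'n) lie_rep_scheme \<Rightarrow> 'v \<Rightarrow> 'v set"
  for N :: "(('g, 'a) current, 'v, 'n) lie_rep_scheme" and v where
  vec: "v \<in> neg_span N v"
| add: "w \<in> neg_span N v \<Longrightarrow> w' \<in> neg_span N v \<Longrightarrow> w \<oplus>\<^bsub>N\<^esub> w' \<in> neg_span N v"
| smult: "w \<in> neg_span N v \<Longrightarrow> c \<odot>\<^bsub>N\<^esub> w \<in> neg_span N v"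
| low: "w \<in> neg_span N v \<Longrightarrow> a \<in> carrier A \<Longrightarrow> act N (lp (fw ws) a) w \<in> neg_span N v"

section \<open>Spanning, weights and integrability of highest weight modules\<close>

context
  fixes N :: "(('g, 'a) current, 'v, 'n) lie_rep_scheme" and v
  assumes N: "lrep L N" and cyc: "cyclic_rep L N v" and hw: "hwv N \<psi> v"
begin

lemmas nvs = cmod_simps[OF lrepD(1)[OF N]]

lemma v_closed: "v \<in> carrier N" using hw by (simp add: hwv_def)

lemma neg_span_closed: "w \<in> neg_span N v \<Longrightarrow> w \<in> carrier N"
  by (induction rule: neg_span.induct) (use v_closed act_lp_closed[OF N fw_derived] nvs in auto)

lemma neg_span_zero: "\<zero>\<^bsub>N\<^esub> \<in> neg_span N v"
  using neg_span.smult[OF neg_span.vec, where c=0 and N=N and v=v] nvs(10)[OF v_closed] by simp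

lemma neg_span_lp_vec:
  assumes x: "x \<in> derived G" and a: "a \<in> carrier A" shows "act N (lp x a) v \<in> neg_span N v"
proof -
  have sub: "cartan' G \<union> range ew \<union> range fw \<subseteq> carrier G"
    using cartan'_derived ew_closed fw_closed derived_closed by auto
  have "x \<in> derived G \<and> act N (lp x a) v \<in> neg_span N v"
    using G_cmod sub x[unfolded derived_span]
  proof (induction rule: lin_span_induct)
    case zero
    show ?case using act_lp_zero[OF N a v_closed] neg_span_zero Ds(2) by simp
  next
    case (add x y)
    then show ?case using Ds(3) a v_closed by (auto simp: act_lp_bilinD(1)[OF N] intro: neg_span.add)
  next
    case (smult c x)
    then show ?case using Ds(4) a v_closed by (auto simp: act_lp_bilinD(2)[OF N] intro: neg_span.smult)
  next
    case (base x)
    then consider "x \<in> cartan' G" | ws where "x = ew ws" | ws where "x = fw ws" by auto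
    then show ?case
    proof cases
      case 1
      then show ?thesis using hw a cartan'_derived by (auto simp: hwv_def intro: neg_span.intros)
    next
      case 2
      have "act N (lp (ew ws) a) v = \<zero>\<^bsub>N\<^esub>"
      proof (cases "ws = [] \<or> ew ws = \<zero>\<^bsub>G\<^esub>")
        case True
        then show ?thesis using act_lp_zero[OF N a v_closed] by auto
      next
        case False
        then have "ew ws \<in> (\<Union>m\<in>pos_roots G. root_space G (root_of G m))" using ew_nilp_pos by blast
        then have "ew ws \<in> nilp_pos G" unfolding nilp_pos_def by (rule lin_span_base)
        then show ?thesis using hw a by (simp add: hwv_def)
      qed
      then show ?thesis using 2 neg_span_zero ew_derived by simp
    next
      case 3
      then show ?thesis using neg_span.low[OF neg_span.vec a] fw_derived by simp
    qed
  qed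
  then show ?thesis ..
qed

text \<open>Moving \<open>x\<close> past a lowering operator leaves \<open>x\<close> acting on the
  shorter vector and a bracket acting on it. The bracket is again in the derived algebra, so the
  hypothesis, kept general in \<open>x\<close> and \<open>a\<close>, covers both.\<close>

lemma neg_span_lp: "w \<in> neg_span N v \<Longrightarrow> x \<in> derived G \<Longrightarrow> a \<in> carrier A \<Longrightarrow> act N (lp x a) w \<in> neg_span N v"
proof (induction arbitrary: x a rule: neg_span.induct)
  case vec then show ?case by (rule neg_span_lp_vec)
next
  case (add w w')
  then show ?case using neg_span_closed by (simp add: act_lp_lin[OF N] neg_span.add)
next
  case (smult w c)
  then show ?case using neg_span_closed by (simp add: act_lp_lin[OF N] neg_span.smult)
next
  case (low w b ws)
  have wc: "w \<in> carrier N" using low neg_span_closed by blast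
  have "act N (lp x a) (act N (lp (fw ws) b) w) =
      act N (lp (fw ws) b) (act N (lp x a) w) \<oplus>\<^bsub>N\<^esub> act N (lp [x, fw ws]\<^sub>G (a \<star> b)) w"
    by (rule act_lp_lp[OF N low(4) fw_derived low(5,2) wc])
  then show ?case
    using low br_derived[OF derived_closed[OF low(4)] fw_closed] by (auto intro!: neg_span.add neg_span.low)
qed

lemma neg_span_dl: "w \<in> neg_span N v \<Longrightarrow> h \<in> HC \<Longrightarrow> act N (dl h) w \<in> neg_span N v"
proof (induction rule: neg_span.induct)
  case vec then show ?case using hw by (auto simp: hwv_def intro: neg_span.intros)
next
  case (add w w')
  then show ?case using neg_span_closed by (simp add: act_dl_lin[OF N] neg_span.add)
next
  case (smult w c)
  then show ?case using neg_span_closed by (simp add: act_dl_lin[OF N] neg_span.smult)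
next
  case (low w b ws)
  have wc: "w \<in> carrier N" using low neg_span_closed by blast
  have "act N (dl h) (act N (lp (fw ws) b) w) =
      act N (lp (fw ws) b) (act N (dl h) w) \<oplus>\<^bsub>N\<^esub> act N (lp [h, fw ws]\<^sub>G b) w"
    by (rule act_dl_lp[OF N low(4) fw_derived low(2) wc])
  then show ?case
    using low br_derived[OF HCs(1)[OF low(4)] fw_closed] by (auto intro!: neg_span.add neg_span.low neg_span_lp)
qed

lemma neg_span_carrier: "neg_span N v = carrier N"
proof -
  have "lin_subspace N (neg_span N v)"
    unfolding lin_subspace_iff[OF lrepD(1)[OF N]]
    using neg_span_closed neg_span_zero by (auto intro: neg_span.intros)
  then have "rep_submodule L N (neg_span N v)"
    by (rule rep_submodule_currI[OF N _ neg_span_lp neg_span_dl])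
  then show ?thesis by (rule cyclicD[OF cyc _ neg_span.vec])
qed

lemma v_wts: "v \<in> wts N (\<lambda>_. 0)"
  using v_closed hwv_ge[OF N hw] by (simp add: wts_def root_of_def)

lemma wts_span: "lin_span N (\<Union>m. wts N m) = carrier N"
proof
  let ?S = "lin_span N (\<Union>m. wts N m)"
  have sub: "(\<Union>m. wts N m) \<subseteq> carrier N" by (auto simp: wts_def)
  note S = lin_subspaceD[OF lrepD(1)[OF N] lin_span_subspace[OF lrepD(1)[OF N] sub]]
  show "?S \<subseteq> carrier N" using S by auto
  have low: "act N (lp (fw ws) a) w \<in> ?S" if w: "w \<in> ?S" and a: "a \<in> carrier A" for ws a w
    using lrepD(1)[OF N] sub w
  proof (induction rule: lin_span_induct)
    case zero
    then show ?case
      using lin_map_zero[OF lrepD(1)[OF N] lrepD(1)[OF N] lrepD(2)[OF N lp_closed[OF fw_derived a]]] S by simp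
  next
    case (base w)
    then show ?case using act_fw_wts[OF N _ a] by (auto intro!: lin_span_base)
  qed (use S in \<open>simp_all add: act_lp_lin[OF N fw_derived a]\<close>)
  have "w \<in> ?S" if "w \<in> neg_span N v" for w
    using that
  proof (induction rule: neg_span.induct)
    case vec
    show ?case using v_wts by (auto intro: lin_span_base)
  qed (use S low in auto)
  then show "carrier N \<subseteq> ?S" using neg_span_carrier by auto
qed

text \<open>The module is the sum of its weight spaces, all of weight \<lambda>\<open>- k\<close>
  with natural coefficients. A nonzero vector obtained by applying \<open>e_i\<close> once more than
  \<open>m i\<close> times would have coefficient \<open>-1\<close> at
  \<alpha>\<open>_i\<close>.\<close>

lemma e_nilpotent_wts:
  assumes w: "w \<in> wts N m" shows "(eop N i ^^ Suc (m i)) w = \<zero>\<^bsub>N\<^esub>"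
proof (rule ccontr)
  assume nz: "(eop N i ^^ Suc (m i)) w \<noteq> \<zero>\<^bsub>N\<^esub>"
  have wc: "w \<in> carrier N" using w by (simp add: wts_def)
  have cl: "(eop N i ^^ n) w \<in> carrier N" for n
    using wc act_lp_closed[OF N chev_derived(1) A.one_closed] by (induction n) auto
  have eig: "act N (ge h) ((eop N i ^^ n) w) = (lam h - root_of G m h + of_nat n * sroot G i h) \<odot>\<^bsub>N\<^esub> (eop N i ^^ n) w"
    if h: "h \<in> cartan G" for h n
  proof (induction n)
    case 0 then show ?case using w h by (simp add: wts_def)
  next
    case (Suc n)
    let ?w = "(eop N i ^^ n) w" and ?c = "lam h - root_of G m h + of_nat n * sroot G i h"
    have "act N (ge h) (eop N i ?w) = eop N i (act N (ge h) ?w) \<oplus>\<^bsub>N\<^esub> act N (lp [h, chev_e G i]\<^sub>G \<one>\<^bsub>A\<^esub>) ?w"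
      by (rule act_ge_lp[OF N h chev_derived(1) A.one_closed cl])
    also have "\<dots> = ?c \<odot>\<^bsub>N\<^esub> eop N i ?w \<oplus>\<^bsub>N\<^esub> sroot G i h \<odot>\<^bsub>N\<^esub> eop N i ?w"
      unfolding Suc brkt_h_e[OF h] using cl chev_derived by (simp add: act_lp_lin[OF N] act_lp_bilinD(2)[OF N])
    also have "\<dots> = (?c + sroot G i h) \<odot>\<^bsub>N\<^esub> eop N i ?w"
      using nvs(6)[OF cl[of "Suc n"]] by simp
    finally show ?case by (simp add: algebra_simps)
  qed
  have "\<exists>k\<in>UNIV. (eop N i ^^ Suc (m i)) w \<in> wts N k \<and>
      (\<forall>h\<in>cartan G. lam h - root_of G k h = lam h - root_of G m h + of_nat (Suc (m i)) * sroot G i h)"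
  proof (rule eigenvector_in_sum_of_eigenspaces[OF lrepD(1)[OF N] lrepD(2)[OF N g_embed_closed] wts_subspace[OF N] _ _ _ eig nz])
    show "act N (ge h) y = (lam h - root_of G k h) \<odot>\<^bsub>N\<^esub> y" if "y \<in> wts N k" "h \<in> cartan G" for k y h
      using that by (simp add: wts_def)
    show "\<exists>h\<in>cartan G. lam h - root_of G k h \<noteq> lam h - root_of G k' h" if "k \<noteq> k'" for k k'
    proof (rule ccontr)
      assume "\<not> ?thesis"
      then have "(\<lambda>i. int (k i)) = (\<lambda>i. int (k' i))" by (intro root_of_inj) (simp add: root_of_def)
      then show False using that by (auto simp: fun_eq_iff)
    qed
    show "(eop N i ^^ Suc (m i)) w \<in> lin_span N (\<Union>k\<in>UNIV. wts N k)" unfolding wts_span by (rule cl)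
  qed
  then obtain k where k: "\<forall>h\<in>cartan G. lam h - root_of G k h = lam h - root_of G m h + of_nat (Suc (m i)) * sroot G i h" by blast
  have "(\<lambda>j. int (k j)) = (\<lambda>j. int (m j) - (if j = i then int (Suc (m i)) else 0))"
  proof (rule root_of_inj, rule ballI)
    fix h assume "h \<in> cartan G"
    then have *: "root_of G k h = root_of G m h - of_nat (Suc (m i)) * sroot G i h" using k by (simp add: algebra_simps)
    have "(\<Sum>j\<in>UNIV. of_int (int (m j) - (if j = i then int (Suc (m i)) else 0)) * sroot G j h) =
      (\<Sum>j\<in>UNIV. of_nat (m j) * sroot G j h - (if j = i then of_nat (Suc (m i)) * sroot G j h else 0))"
      by (intro sum.cong) (auto simp: algebra_simps)
    then show "(\<Sum>j\<in>UNIV. of_int (int (k j)) * sroot G j h) =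
        (\<Sum>j\<in>UNIV. of_int (int (m j) - (if j = i then int (Suc (m i)) else 0)) * sroot G j h)"
      using * by (simp add: root_of_def sum_subtractf)
  qed
  from fun_cong[OF this, of i] show False by simp
qed

text \<open>In a highest weight module the weight spaces span, which gives diagonalizability, and
  the \<open>e_i\<close> are nilpotent on each weight vector and hence on sums of them. What is left
  of integrability is the condition on the \<open>f_i\<close>.\<close>

lemma integrable_iff: "integrable_rep G A HC N \<longleftrightarrow> (\<forall>i. \<forall>w\<in>carrier N. \<exists>n. (fop N i ^^ n) w = \<zero>\<^bsub>N\<^esub>)"
proof -
  let ?B = "{w \<in> carrier N. \<exists>\<mu>. \<forall>h\<in>cartan G. act N (ge h) w = \<mu> h \<odot>\<^bsub>N\<^esub> w}"
  have "lin_span N (\<Union>m. wts N m) \<subseteq> lin_span N ?B"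
    by (intro lin_span_least lin_span_subspace lrepD(1)[OF N]) (auto simp: wts_def intro!: lin_span_base)
  moreover have "lin_span N ?B \<subseteq> carrier N"
    using lin_subspaceD(1)[OF lrepD(1)[OF N] lin_span_subspace[OF lrepD(1)[OF N]], of ?B] by auto
  ultimately have 1: "lin_span N ?B = carrier N" using wts_span by auto
  have 2: "\<exists>n. (eop N i ^^ n) w = \<zero>\<^bsub>N\<^esub>" if "w \<in> carrier N" for i w
  proof -
    have z: "lin_subspace N {\<zero>\<^bsub>N\<^esub>}" by (rule lin_subspace_zero[OF lrepD(1)[OF N]])
    have e: "lin_map N N (eop N i)" by (rule lrepD(2)[OF N e_closed])
    have "lin_subspace N {w\<in>carrier N. \<exists>n. (eop N i ^^ n) w \<in> {\<zero>\<^bsub>N\<^esub>}}"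
      using lin_map_zero[OF lrepD(1)[OF N] lrepD(1)[OF N] e] by (intro nilpotent_mod_subspace[OF lrepD(1)[OF N] e z]) auto
    moreover have "(\<Union>m. wts N m) \<subseteq> {w\<in>carrier N. \<exists>n. (eop N i ^^ n) w \<in> {\<zero>\<^bsub>N\<^esub>}}"
    proof
      fix w assume "w \<in> (\<Union>m. wts N m)"
      then obtain m where m: "w \<in> wts N m" by auto
      then have "w \<in> carrier N" by (simp add: wts_def)
      with e_nilpotent_wts[OF m, of i] show "w \<in> {w\<in>carrier N. \<exists>n. (eop N i ^^ n) w \<in> {\<zero>\<^bsub>N\<^esub>}}" by blast
    qed
    ultimately have "lin_span N (\<Union>m. wts N m) \<subseteq> {w\<in>carrier N. \<exists>n. (eop N i ^^ n) w \<in> {\<zero>\<^bsub>N\<^esub>}}"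
      by (rule lin_span_least)
    then show ?thesis using that wts_span by auto
  qed
  show ?thesis unfolding integrable_rep_def ge_chev using 1 2 by blast
qed

end

end

subsection \<open>The modules \<open>M(\<psi>, I)\<close> and \<open>W(\<psi>, I)\<close>\<close>

context hw_data
begin

text \<open>The relations at the simple roots imply those at all positive roots (\<open>relv_rootrel\<close> below),
  because \<open>N\<^sup>-\<close> is spanned by iterated brackets of the \<open>f\<^sub>i\<close>.\<close>

definition relv :: "(('g, 'a) current, 'v, 'n) lie_rep_scheme \<Rightarrow> 'v \<Rightarrow> bool" where
  "relv N m \<longleftrightarrow> (\<forall>i. \<forall>a\<in>ideal_pow A I (nn i). act N (lp (chev_f G i) a) m = \<zero>\<^bsub>N\<^esub>)"

definition rootrel :: "(('g, 'a) current, 'v, 'n) lie_rep_scheme \<Rightarrow> 'v \<Rightarrow> bool" where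
  "rootrel N v \<longleftrightarrow> (\<forall>x a m. m \<in> pos_roots G \<and> x \<in> root_space G (\<lambda>h. - root_of G m h) \<and>
     a \<in> ideal_pow A I (wt_pairing G (\<lambda>h. \<psi> (ge h)) m) \<longrightarrow> act N (lp x a) v = \<zero>\<^bsub>N\<^esub>)"

lemma wt_pairing_eq: "wt_pairing G (\<lambda>h. \<psi> (ge h)) m = (\<Sum>i\<in>UNIV. m i * nn i)"
proof -
  have "(\<Sum>i\<in>UNIV. of_nat (m i) * \<psi> (ge (coroot G i))) = of_nat (\<Sum>i\<in>UNIV. m i * nn i)"
    by (simp add: ge_chev nn)
  then show ?thesis unfolding wt_pairing_def by (intro the_equality) (simp_all only: of_nat_eq_iff)
qed

lemma sum_list_nn: "sum_list (map nn ws) = (\<Sum>i\<in>UNIV. count_list ws i * nn i)"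
proof (induction ws)
  case (Cons j ws)
  have "(\<Sum>i\<in>UNIV. count_list (j # ws) i * nn i) = (\<Sum>i\<in>UNIV. (if i = j then nn i else 0) + count_list ws i * nn i)"
    by (intro sum.cong) auto
  then show ?case using Cons by (simp add: sum.distrib)
qed simp

lemma ideal_pow_carrier: "a \<in> ideal_pow A I n \<Longrightarrow> a \<in> carrier A"
  by (rule A.ideal_pow_closed[OF I])

text \<open>A power of \<open>I\<close> with exponent a sum is a product of powers, and the bracket
  of \<open>f_i \<otimes> a\<close> with \<open>fw ws \<otimes> b\<close> carries the coefficient
  \<open>a b\<close>. Both factors kill the vector, so their commutator does too.\<close>

lemma relv_fw:
  fixes N :: "(('g, 'a) current, 'v, 'n) lie_rep_scheme"
  assumes N: "lrep L N" and m: "m \<in> carrier N" and r: "relv N m"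
    and "ws \<noteq> []" "a \<in> ideal_pow A I (sum_list (map nn ws))"
  shows "act N (lp (fw ws) a) m = \<zero>\<^bsub>N\<^esub>"
  using assms(4,5)
proof (induction ws arbitrary: a)
  case (Cons i ws)
  show ?case
  proof (cases "ws = []")
    case True
    then show ?thesis using Cons r by (simp add: relv_def)
  next
    case False
    have "a \<in> ideal_prod A (ideal_pow A I (nn i)) (ideal_pow A I (sum_list (map nn ws)))"
      using Cons.prems(2) A.ideal_pow_add[OF I] by simp
    then have "a \<in> carrier A \<and> act N (lp (fw (i # ws)) a) m = \<zero>\<^bsub>N\<^esub>"
    proof (induction rule: ideal_prod.induct)
      case (prod a b)
      have c: "a \<in> carrier A" "b \<in> carrier A" using prod ideal_pow_carrier by auto
      note z = lin_map_zero[OF lrepD(1)[OF N] lrepD(1)[OF N] lrepD(2)[OF N lp_closed]]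
      have a0: "act N (lp (chev_f G i) a) m = \<zero>\<^bsub>N\<^esub>" using r prod by (simp add: relv_def)
      have b0: "act N (lp (fw ws) b) m = \<zero>\<^bsub>N\<^esub>" using Cons.IH[OF False prod(2)] .
      have "act N (lp (chev_f G i) a) (act N (lp (fw ws) b) m) =
          act N (lp (fw ws) b) (act N (lp (chev_f G i) a) m) \<oplus>\<^bsub>N\<^esub> act N (lp [chev_f G i, fw ws]\<^sub>G (a \<star> b)) m"
        by (rule act_lp_lp[OF N chev_derived(2) fw_derived c m])
      then have "act N (lp [chev_f G i, fw ws]\<^sub>G (a \<star> b)) m = \<zero>\<^bsub>N\<^esub>"
        unfolding a0 b0 z[OF chev_derived(2) c(1)] z[OF fw_derived c(2)]
        using act_lp_closed[OF N br_derived[OF chev_f_closed fw_closed] A.m_closed[OF c] m] cmod_simps(4)[OF lrepD(1)[OF N]] by metis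
      then show ?case using False c by (simp add: rbr_Cons)
    next
      case (sum a b)
      then show ?case
        using act_lp_bilinD(3)[OF N fw_derived _ m, of a b "i # ws"] cmod_simps(2,4)[OF lrepD(1)[OF N]] by simp
    qed
    then show ?thesis ..
  qed
qed simp

lemma relv_rootrel:
  fixes N :: "(('g, 'a) current, 'v, 'n) lie_rep_scheme"
  assumes N: "lrep L N" and m: "m \<in> carrier N" and r: "relv N m"
  shows "rootrel N m"
  unfolding rootrel_def
proof (intro allI impI, elim conjE)
  fix x a and k :: "'i \<Rightarrow> nat"
  assume k: "k \<in> pos_roots G" and x: "x \<in> root_space G (\<lambda>h. - root_of G k h)"
    and a: "a \<in> ideal_pow A I (wt_pairing G (\<lambda>h. \<psi> (ge h)) k)"
  have ac: "a \<in> carrier A" using a by (rule ideal_pow_carrier)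
  have sub: "{fw w | w. w \<noteq> [] \<and> count_list w = k} \<subseteq> carrier G" using fw_closed by auto
  have "x \<in> derived G \<and> act N (lp x a) m = \<zero>\<^bsub>N\<^esub>"
    using G_cmod sub neg_root_space[OF k x]
  proof (induction rule: lin_span_induct)
    case zero then show ?case using act_lp_zero[OF N ac m] Ds(2) by simp
  next
    case (add x y)
    then show ?case using Ds(3) act_lp_bilinD(1)[OF N _ ac m] cmod_simps(2,4)[OF lrepD(1)[OF N]] by simp
  next
    case (smult c x)
    then show ?case using Ds(4) act_lp_bilinD(2)[OF N _ ac m] cmod_simps(11)[OF lrepD(1)[OF N]] by simp
  next
    case (base x)
    then obtain ws where "x = fw ws" "ws \<noteq> []" "count_list ws = k" by auto
    then show ?case using relv_fw[OF N m r, of ws a] a fw_derived by (auto simp: wt_pairing_eq sum_list_nn)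
  qed
  then show "act N (lp x a) m = \<zero>\<^bsub>N\<^esub>" ..
qed

definition simple :: "'i \<Rightarrow> 'i \<Rightarrow> nat" where "simple i j = (if j = i then 1 else 0)"

lemma root_of_simple: "root_of G (simple i) h = sroot G i h"
proof -
  have "root_of G (simple i) h = (\<Sum>j\<in>UNIV. if j = i then sroot G j h else 0)"
    unfolding root_of_def simple_def by (intro sum.cong) auto
  then show ?thesis by simp
qed

text \<open>Otherwise the coroot, being its bracket with \<open>f_i\<close>, would vanish, whereas
  \<alpha>\<open>_i\<close> takes the value 2 on it.\<close>

lemma chev_e_nonzero: "chev_e G i \<noteq> \<zero>\<^bsub>G\<^esub>"
proof
  assume "chev_e G i = \<zero>\<^bsub>G\<^esub>"
  then have "coroot G i = \<zero>\<^bsub>G\<^esub>"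
    using brkt_e_f[of i i] lin_map_zero[OF G_cmod G_cmod br_lin(2)[OF chev_f_closed]] by simp
  moreover have "sroot G i (0 \<odot>\<^bsub>G\<^esub> coroot G i) = 0 * sroot G i (coroot G i)"
    using sroot_functional[of i] coroot_cartan[of i] by (simp add: lin_functional_def)
  ultimately show False using sroot_self[of i] gs(11) by simp
qed

lemma simple_pos_root: "simple i \<in> pos_roots G"
proof -
  have "chev_e G i \<in> root_space G (root_of G (simple i))"
    by (simp add: root_space_def root_of_simple brkt_h_e chev_e_closed)
  moreover have "simple i i \<noteq> 0" by (simp add: simple_def)
  ultimately show ?thesis using chev_e_nonzero[of i] unfolding pos_roots_def by blast
qed

lemma rootrel_relv: "rootrel N m \<Longrightarrow> relv N m"
  unfolding relv_def
proof (intro allI ballI)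
  fix i a assume r: "rootrel N m" and a: "a \<in> ideal_pow A I (nn i)"
  have "(\<Sum>j\<in>UNIV. simple i j * nn j) = (\<Sum>j\<in>UNIV. if j = i then nn j else 0)"
    unfolding simple_def by (intro sum.cong) auto
  then have "(\<Sum>j\<in>UNIV. simple i j * nn j) = nn i" by simp
  moreover have "chev_f G i \<in> root_space G (\<lambda>h. - root_of G (simple i) h)"
    by (simp add: root_space_def root_of_simple brkt_h_f chev_f_closed)
  ultimately show "act N (lp (chev_f G i) a) m = \<zero>\<^bsub>N\<^esub>"
    using r[unfolded rootrel_def wt_pairing_eq, rule_format, of "simple i" "chev_f G i" a] a simple_pos_root[of i] by simp
qed

section \<open>The module M(\<psi>, I) and its universal property\<close>

sublocale VS: verma_setup L PP HH \<psi>
  by (rule verma_setup.intro[OF prelie_axioms verma_setup_axioms.intro[OF PP_subset HH_subset]])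

abbreviation HV where "HV \<equiv> hw_verma G A HC \<psi>"
abbreviation hv where "hv \<equiv> hw_vec G A HC \<psi>"
abbreviation HQ where "HQ \<equiv> hw_quot G A HC \<psi> I"

lemma HV_eq: "HV = VS.VM" and hv_eq: "hv = VS.vv"
  by (simp_all add: hw_verma_def hw_vec_def)

lemma HV_lrep: "lrep L HV" and HV_cyclic: "cyclic_rep L HV hv"
  unfolding HV_eq hv_eq by (rule VS.verma_lrep VS.verma_cyclic)+

lemma hv_closed: "hv \<in> carrier HV"
  using HV_cyclic by (simp add: cyclic_rep_def)

lemma HV_hwv: "hwv HV \<psi> hv"
  by (rule act_hwv[OF HV_lrep hv_closed]) (simp only: HV_eq hv_eq VS.verma_hw)

definition relset where
  "relset = {act HV (lp x a) hv | x a m. m \<in> pos_roots G \<and> x \<in> root_space G (\<lambda>h. - root_of G m h) \<and>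
     a \<in> ideal_pow A I (wt_pairing G (\<lambda>h. \<psi> (ge h)) m)}"

lemma relset_subset: "relset \<subseteq> carrier HV"
  unfolding relset_def
  using act_lp_closed[OF HV_lrep neg_root_space_derived ideal_pow_carrier hv_closed] by auto

definition RK where "RK = gen_submodule L HV relset"

lemma HQ_eq: "HQ = quot_rep HV RK"
  by (simp add: hw_quot_def RK_def relset_def)

lemmas RKs = gen_submodule_rep[OF HV_lrep relset_subset, folded RK_def]

sublocale HQq: qrep L HV RK
  by (rule qrep.intro[OF prelie_axioms qrep_axioms.intro[OF HV_lrep RKs(1)]])

definition qv where "qv = HQq.cls hv"

lemma HQ_lrep: "lrep L HQ" and HQ_cyclic: "cyclic_rep L HQ qv"
  unfolding HQ_eq qv_def by (rule HQq.QR_lrep HQq.QR_cyclic[OF HV_cyclic])+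

lemma hom_hwv:
  fixes N :: "(('g, 'a) current, 'v, 'n) lie_rep_scheme" and N' :: "(('g, 'a) current, 'w, 'k) lie_rep_scheme"
  assumes N: "lrep L N" "lrep L N'" and f: "rep_hom L N N' f" and m: "hwv N \<psi> m"
  shows "hwv N' \<psi> (f m)"
proof -
  have mc: "m \<in> carrier N" using m by (simp add: hwv_def)
  have fl: "lin_map N N' f" and fa: "\<And>X. X \<in> carrier L \<Longrightarrow> act N' X (f m) = f (act N X m)"
    using f mc by (auto simp: rep_hom_def)
  note z = lin_map_zero[OF lrepD(1)[OF N(1)] lrepD(1)[OF N(2)] fl]
  show ?thesis
    using m nilp_pos_derived
    by (auto simp: hwv_def fa[OF lp_closed] fa[OF dl_closed] cartan'_derived z lin_mapD[OF fl] subset_iff)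
qed

lemma hom_relv:
  fixes N :: "(('g, 'a) current, 'v, 'n) lie_rep_scheme" and N' :: "(('g, 'a) current, 'w, 'k) lie_rep_scheme"
  assumes N: "lrep L N" "lrep L N'" and f: "rep_hom L N N' f" and m: "m \<in> carrier N" and r: "relv N m"
  shows "relv N' (f m)"
proof -
  have fl: "lin_map N N' f" and fa: "\<And>X. X \<in> carrier L \<Longrightarrow> act N' X (f m) = f (act N X m)"
    using f m by (auto simp: rep_hom_def)
  note z = lin_map_zero[OF lrepD(1)[OF N(1)] lrepD(1)[OF N(2)] fl]
  show ?thesis
    using r by (auto simp: relv_def fa[OF lp_closed] chev_derived ideal_pow_carrier z)
qed

lemma cls_hom: "rep_hom L HV HQ HQq.cls"
  unfolding HQ_eq by (rule HQq.cls_rep_hom)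

lemma HQ_hwv: "hwv HQ \<psi> qv"
  unfolding qv_def by (rule hom_hwv[OF HV_lrep HQ_lrep cls_hom HV_hwv])

lemma HQ_relv: "relv HQ qv"
proof (rule rootrel_relv, unfold rootrel_def, intro allI impI)
  fix x a m assume *: "m \<in> pos_roots G \<and> x \<in> root_space G (\<lambda>h. - root_of G m h) \<and>
     a \<in> ideal_pow A I (wt_pairing G (\<lambda>h. \<psi> (ge h)) m)"
  then have r: "act HV (lp x a) hv \<in> relset" unfolding relset_def by blast
  have X: "lp x a \<in> carrier L" using * neg_root_space_derived ideal_pow_carrier lp_closed by blast
  have "act HQ (lp x a) qv = HQq.cls (act HV (lp x a) hv)"
    unfolding HQ_eq qv_def by (rule HQq.QR_act[OF X hv_closed])
  also have "\<dots> = \<zero>\<^bsub>HQ\<^esub>"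
    using HQq.cls_zero_iff[of "act HV (lp x a) hv"] r relset_subset RKs(2) by (auto simp: HQ_eq)
  finally show "act HQ (lp x a) qv = \<zero>\<^bsub>HQ\<^esub>" .
qed

text \<open>The quotient imposes relations at all positive roots while the hypothesis speaks of the
  simple ones; \<open>relv_rootrel\<close> closes the gap.\<close>

lemma HQ_universal:
  fixes N :: "(('g, 'a) current, 'v, 'n) lie_rep_scheme"
  assumes N: "lrep L N" and m: "hwv N \<psi> m" and r: "relv N m"
  shows "\<exists>f. rep_hom L HQ N f \<and> f qv = m"
proof -
  have mc: "m \<in> carrier N" using m by (simp add: hwv_def)
  obtain f where f: "rep_hom L HV N f" "f hv = m"
    using VS.verma_universal[OF N mc hwv_act[OF N m]] unfolding HV_eq hv_eq by blast
  have rr: "rootrel N m" by (rule relv_rootrel[OF N mc r])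
  have K: "rep_submodule L HV {w\<in>carrier HV. f w = \<zero>\<^bsub>N\<^esub>}" by (rule rep_hom_kernel[OF HV_lrep N f(1)])
  have "relset \<subseteq> {w\<in>carrier HV. f w = \<zero>\<^bsub>N\<^esub>}"
  proof
    fix w assume w: "w \<in> relset"
    then obtain x a k where *: "w = act HV (lp x a) hv" "k \<in> pos_roots G" "x \<in> root_space G (\<lambda>h. - root_of G k h)"
      "a \<in> ideal_pow A I (wt_pairing G (\<lambda>h. \<psi> (ge h)) k)" unfolding relset_def by blast
    have X: "lp x a \<in> carrier L" using * neg_root_space_derived ideal_pow_carrier lp_closed by blast
    have "f w = act N (lp x a) m" unfolding *(1) using f X hv_closed by (auto simp: rep_hom_def)
    also have "\<dots> = \<zero>\<^bsub>N\<^esub>" using rr * unfolding rootrel_def by blast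
    finally show "w \<in> {w\<in>carrier HV. f w = \<zero>\<^bsub>N\<^esub>}" using w relset_subset by blast
  qed
  then have ker: "f w = \<zero>\<^bsub>N\<^esub>" if "w \<in> RK" for w using RKs(3)[OF K] that by blast
  have "HQq.qlift f qv = m" unfolding qv_def using HQq.qlift_rep_hom(2)[OF N f(1) ker hv_closed] f(2) by simp
  then show ?thesis using HQq.qlift_rep_hom(1)[OF N f(1) ker] unfolding HQ_eq by blast
qed

subsection \<open>The maximal integrable quotient\<close>

abbreviation W where "W \<equiv> weyl_module G A HC \<psi> I"

definition intK where "intK = {K. rep_submodule L HQ K \<and> integrable_rep G A HC (quot_rep HQ K)}"

lemma quot_integrable_iff:
  assumes K: "rep_submodule L HQ K"
  shows "integrable_rep G A HC (quot_rep HQ K) \<longleftrightarrow> (\<forall>i. \<forall>w\<in>carrier HQ. \<exists>n. (fop HQ i ^^ n) w \<in> K)"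
proof -
  interpret q: qrep L HQ K
    by (rule qrep.intro[OF prelie_axioms qrep_axioms.intro[OF HQ_lrep K]])
  note c = q.cls_rep_hom
  note iff = integrable_iff[OF q.QR_lrep q.QR_cyclic[OF HQ_cyclic] hom_hwv[OF HQ_lrep q.QR_lrep c HQ_hwv]]
  have p: "(fop q.QR i ^^ n) (q.cls w) = \<zero>\<^bsub>q.QR\<^esub> \<longleftrightarrow> (fop HQ i ^^ n) w \<in> K" if "w \<in> carrier HQ" for i n w
    using rep_hom_pow[OF HQ_lrep c f_closed that, of n] q.cls_zero_iff by (simp flip: rep_hom_pow(1)[OF HQ_lrep c f_closed that])
  show ?thesis
    unfolding iff using p by (auto simp: q.quot_carrier)
qed

lemma intK_carrier: "carrier HQ \<in> intK"
  unfolding intK_def using quot_integrable_iff[OF rep_submodule_carrier[OF HQ_lrep]] rep_submodule_carrier[OF HQ_lrep]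
  by (auto intro!: exI[of _ 0])

text \<open>Nilpotency of \<open>f_i\<close> modulo each \<open>K\<close> separately would allow
  exponents that grow with \<open>K\<close>. On a weight vector \<open>nil_bound\<close> gives an
  exponent depending only on the weight and on the power of \<open>e_i\<close> that kills it, so one
  power of \<open>f_i\<close> lies in all \<open>K\<close> simultaneously. Weight vectors span, and
  sums are handled by the maximum.\<close>

lemma intK_Inter: "\<Inter> intK \<in> intK"
proof -
  have sub: "rep_submodule L HQ (\<Inter> intK)"
    using intK_carrier by (intro rep_submodule_Inter[OF HQ_lrep]) (auto simp: intK_def)
  have f: "lin_map HQ HQ (fop HQ i)" for i by (rule lrepD(2)[OF HQ_lrep f_closed])
  have low: "\<exists>n. (fop HQ i ^^ n) w \<in> \<Inter> intK" if w: "w \<in> wts HQ m" for w m i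
  proof -
    have wc: "w \<in> carrier HQ" using w by (simp add: wts_def)
    let ?c = "lam (coroot G i) - root_of G m (coroot G i)"
    have h: "act HQ (lp (coroot G i) \<one>\<^bsub>A\<^esub>) w = ?c \<odot>\<^bsub>HQ\<^esub> w"
      using w coroot_cartan[of i] unfolding wts_def by (simp flip: ge_chev(3))
    have "(fop HQ i ^^ nil_bound ?c (Suc (m i))) w \<in> K" if K: "K \<in> intK" for K
    proof -
      have K': "rep_submodule L HQ K" "integrable_rep G A HC (quot_rep HQ K)" using K by (auto simp: intK_def)
      interpret q: qrep L HQ K
        by (rule qrep.intro[OF prelie_axioms qrep_axioms.intro[OF HQ_lrep K'(1)]])
      note c = q.cls_rep_hom
      have "\<exists>n. (fop q.QR i ^^ n) X = \<zero>\<^bsub>q.QR\<^esub>" if "X \<in> carrier q.QR" for X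
        using K'(2) integrable_iff[OF q.QR_lrep q.QR_cyclic[OF HQ_cyclic] hom_hwv[OF HQ_lrep q.QR_lrep c HQ_hwv]] that by blast
      moreover have "q.cls w \<in> carrier q.QR" using wc q.quot_closed by simp
      moreover have "(eop q.QR i ^^ Suc (m i)) (q.cls w) = \<zero>\<^bsub>q.QR\<^esub>"
        using rep_hom_pow(1)[OF HQ_lrep c e_closed wc, of "Suc (m i)" i] e_nilpotent_wts[OF HQ_lrep HQ_cyclic HQ_hwv w, of i]
          lin_map_zero[OF lrepD(1)[OF HQ_lrep] lrepD(1)[OF q.QR_lrep], of q.cls] c by (simp only: rep_hom_def)
      moreover have "act q.QR (lp (coroot G i) \<one>\<^bsub>A\<^esub>) (q.cls w) = ?c \<odot>\<^bsub>q.QR\<^esub> q.cls w"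
        using q.QR_act[OF h_closed wc, of i] h q.quot_smult[OF wc] by simp
      ultimately have "(fop q.QR i ^^ nil_bound ?c (Suc (m i))) (q.cls w) = \<zero>\<^bsub>q.QR\<^esub>"
        by (rule f_nil_bound[OF q.QR_lrep])
      then show ?thesis
        using rep_hom_pow[OF HQ_lrep c f_closed wc, of "nil_bound ?c (Suc (m i))" i] q.cls_zero_iff by simp
    qed
    then show ?thesis by blast
  qed
  have "\<exists>n. (fop HQ i ^^ n) w \<in> \<Inter> intK" if "w \<in> carrier HQ" for w i
  proof -
    have "lin_subspace HQ {w\<in>carrier HQ. \<exists>n. (fop HQ i ^^ n) w \<in> \<Inter> intK}"
      by (rule nilpotent_mod_subspace[OF lrepD(1)[OF HQ_lrep] f rep_submoduleD(1)[OF sub] rep_submoduleD(2)[OF sub f_closed]])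
    moreover have "(\<Union>m. wts HQ m) \<subseteq> {w\<in>carrier HQ. \<exists>n. (fop HQ i ^^ n) w \<in> \<Inter> intK}"
    proof
      fix w assume "w \<in> (\<Union>m. wts HQ m)"
      then obtain m where m: "w \<in> wts HQ m" by auto
      then have "w \<in> carrier HQ" by (simp add: wts_def)
      with low[OF m] show "w \<in> {w\<in>carrier HQ. \<exists>n. (fop HQ i ^^ n) w \<in> \<Inter> intK}" by blast
    qed
    ultimately have "lin_span HQ (\<Union>m. wts HQ m) \<subseteq> {w\<in>carrier HQ. \<exists>n. (fop HQ i ^^ n) w \<in> \<Inter> intK}"
      by (rule lin_span_least)
    then show ?thesis using that wts_span[OF HQ_lrep HQ_cyclic HQ_hwv] by blast
  qed
  then show ?thesis using sub quot_integrable_iff[OF sub] by (simp add: intK_def)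
qed

definition WK where "WK = \<Inter> intK"

text \<open>The least element in the definition exists because the intersection of all candidates is
  itself a candidate.\<close>

lemma W_eq: "W = quot_rep HQ WK"
proof -
  have "(LEAST K. K \<in> intK) = WK"
    unfolding WK_def using intK_Inter by (intro Least_equality) auto
  then show ?thesis by (simp add: weyl_module_def intK_def)
qed

lemma WK_sub: "rep_submodule L HQ WK" and WK_int: "integrable_rep G A HC (quot_rep HQ WK)"
  using intK_Inter by (simp_all add: WK_def intK_def)

sublocale Wq: qrep L HQ WK
  by (rule qrep.intro[OF prelie_axioms qrep_axioms.intro[OF HQ_lrep WK_sub]])

definition wv where "wv = Wq.cls qv"

lemma W_lrep: "lrep L W" and W_cyclic: "cyclic_rep L W wv"
  unfolding W_eq wv_def by (rule Wq.QR_lrep Wq.QR_cyclic[OF HQ_cyclic])+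

lemma Wcls_hom: "rep_hom L HQ W Wq.cls"
  unfolding W_eq by (rule Wq.cls_rep_hom)

lemma W_hwv: "hwv W \<psi> wv"
  unfolding wv_def by (rule hom_hwv[OF HQ_lrep W_lrep Wcls_hom HQ_hwv])

lemma W_relv: "relv W wv"
  using HQ_hwv unfolding wv_def by (intro hom_relv[OF HQ_lrep W_lrep Wcls_hom _ HQ_relv]) (simp add: hwv_def)

lemma W_f_nilpotent: "w \<in> carrier W \<Longrightarrow> \<exists>n. (fop W i ^^ n) w = \<zero>\<^bsub>W\<^esub>"
  using WK_int integrable_iff[OF W_lrep W_cyclic W_hwv] unfolding W_eq by blast

text \<open>Nilpotency is asked only on a submodule \<open>S\<close> containing \<open>m\<close>:
  the map from M(\<psi>, I) has its image in \<open>S\<close>, so its kernel belongs to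
  \<open>intK\<close>. This form fits the partial actions, whose behaviour on the whole free space
  is unknown.\<close>

theorem weyl_universal:
  fixes N :: "(('g, 'a) current, 'v, 'n) lie_rep_scheme"
  assumes N: "lrep L N" and m: "hwv N \<psi> m" and r: "relv N m"
    and S: "rep_submodule L N S" "m \<in> S" and nil: "\<And>i w. w \<in> S \<Longrightarrow> \<exists>n. (fop N i ^^ n) w = \<zero>\<^bsub>N\<^esub>"
  shows "\<exists>f. rep_hom L W N f \<and> f wv = m"
proof -
  obtain f where f: "rep_hom L HQ N f" "f qv = m" using HQ_universal[OF N m r] by blast
  let ?K = "{w\<in>carrier HQ. f w = \<zero>\<^bsub>N\<^esub>}"
  have K: "rep_submodule L HQ ?K" by (rule rep_hom_kernel[OF HQ_lrep N f(1)])
  have qc: "qv \<in> carrier HQ" using HQ_hwv by (simp add: hwv_def)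
  have "{w\<in>carrier HQ. f w \<in> S} = carrier HQ"
    by (rule cyclicD[OF HQ_cyclic rep_hom_vimage[OF HQ_lrep N f(1) S(1)]]) (use qc f(2) S(2) in simp)
  then have fS: "f w \<in> S" if "w \<in> carrier HQ" for w using that by blast
  have "\<exists>n. (fop HQ i ^^ n) w \<in> ?K" if w: "w \<in> carrier HQ" for i w
    using nil[OF fS[OF w], of i] rep_hom_pow[OF HQ_lrep f(1) f_closed w, of _ i] by auto
  then have "?K \<in> intK" using K quot_integrable_iff[OF K] by (simp add: intK_def)
  then have ker: "f w = \<zero>\<^bsub>N\<^esub>" if "w \<in> WK" for w using that by (auto simp: WK_def)
  have "Wq.qlift f wv = m" unfolding wv_def using Wq.qlift_rep_hom(2)[OF N f(1) ker qc] f(2) by simp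
  then show ?thesis using Wq.qlift_rep_hom(1)[OF N f(1) ker] unfolding W_eq by blast
qed

text \<open>The vectors with this property form a submodule: exchanging \<open>x \<otimes> a\<close>
  and \<open>y \<otimes> b\<close> produces \<open>[x,y] \<otimes> ab\<close>, and \<open>ab\<close>
  stays in the power of \<open>I\<close>. The generator belongs to it by the highest weight
  conditions and by \<open>relv_fw\<close>. The exponent depends on \<open>w\<close> and on
  \<open>x\<close>.\<close>

lemma smooth:
  fixes N :: "(('g, 'a) current, 'v, 'n) lie_rep_scheme"
  assumes N: "lrep L N" and cyc: "cyclic_rep L N v" and hw: "hwv N \<psi> v" and r: "relv N v"
    and \<psi>I: "\<And>h a. h \<in> cartan' G \<Longrightarrow> a \<in> I \<Longrightarrow> \<psi> (lp h a) = 0"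
    and w: "w \<in> carrier N" and x: "x \<in> derived G"
  shows "\<exists>n. \<forall>a\<in>ideal_pow A I n. act N (lp x a) w = \<zero>\<^bsub>N\<^esub>"
proof -
  define S where "S = {w\<in>carrier N. \<forall>x\<in>derived G. \<exists>n. \<forall>a\<in>ideal_pow A I n. act N (lp x a) w = \<zero>\<^bsub>N\<^esub>}"
  note nsN = cmod_simps[OF lrepD(1)[OF N]]
  note z = lin_map_zero[OF lrepD(1)[OF N] lrepD(1)[OF N] lrepD(2)[OF N lp_closed]]
  note zd = lin_map_zero[OF lrepD(1)[OF N] lrepD(1)[OF N] lrepD(2)[OF N dl_closed]]
  have vc: "v \<in> carrier N" using hw by (simp add: hwv_def)
  have mono: "a \<in> ideal_pow A I n" if "a \<in> ideal_pow A I m" "n \<le> m" for a m n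
    using A.ideal_pow_antimono[OF I that(2)] that(1) by auto
  have two: "\<exists>n. \<forall>a\<in>ideal_pow A I n. P a \<and> Q a"
    if p: "\<exists>n. \<forall>a\<in>ideal_pow A I n. P a" and q: "\<exists>n. \<forall>a\<in>ideal_pow A I n. Q a" for P Q
  proof -
    obtain n1 n2 where "\<forall>a\<in>ideal_pow A I n1. P a" "\<forall>a\<in>ideal_pow A I n2. Q a" using p q by blast
    then show ?thesis using mono by (intro exI[of _ "max n1 n2"]) (meson max.cobounded1 max.cobounded2)
  qed
  have SD: "\<exists>n. \<forall>a\<in>ideal_pow A I n. act N (lp x a) w = \<zero>\<^bsub>N\<^esub>" if "w \<in> S" "x \<in> derived G" for w x
    using that unfolding S_def by blast
  have Sc: "w \<in> carrier N" if "w \<in> S" for w using that by (simp add: S_def)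
  have SI: "w \<in> S" if "w \<in> carrier N" "\<And>x. x \<in> derived G \<Longrightarrow> \<exists>n. \<forall>a\<in>ideal_pow A I n. act N (lp x a) w = \<zero>\<^bsub>N\<^esub>" for w
    using that unfolding S_def by blast
  have sub: "lin_subspace N S"
    unfolding lin_subspace_iff[OF lrepD(1)[OF N]]
  proof (intro conjI ballI allI)
    show "\<zero>\<^bsub>N\<^esub> \<in> S" using z ideal_pow_carrier by (intro SI nsN(2)) auto
    show "S \<subseteq> carrier N" using Sc by auto
    fix w assume w: "w \<in> S"
    show "c \<odot>\<^bsub>N\<^esub> w \<in> S" for c
    proof (rule SI)
      fix x assume x: "x \<in> derived G"
      obtain n where "\<forall>a\<in>ideal_pow A I n. act N (lp x a) w = \<zero>\<^bsub>N\<^esub>" using SD[OF w x] by blast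
      then show "\<exists>n. \<forall>a\<in>ideal_pow A I n. act N (lp x a) (c \<odot>\<^bsub>N\<^esub> w) = \<zero>\<^bsub>N\<^esub>"
        using x Sc[OF w] ideal_pow_carrier by (intro exI[of _ n]) (simp add: act_lp_lin[OF N] nsN)
    qed (use Sc[OF w] nsN in simp)
    fix w' assume w': "w' \<in> S"
    show "w \<oplus>\<^bsub>N\<^esub> w' \<in> S"
    proof (rule SI)
      fix x assume x: "x \<in> derived G"
      obtain n where "\<forall>a\<in>ideal_pow A I n. act N (lp x a) w = \<zero>\<^bsub>N\<^esub> \<and> act N (lp x a) w' = \<zero>\<^bsub>N\<^esub>"
        using two[OF SD[OF w x] SD[OF w' x]] by blast
      then show "\<exists>n. \<forall>a\<in>ideal_pow A I n. act N (lp x a) (w \<oplus>\<^bsub>N\<^esub> w') = \<zero>\<^bsub>N\<^esub>"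
        using x Sc[OF w] Sc[OF w'] ideal_pow_carrier by (intro exI[of _ n]) (simp add: act_lp_lin[OF N] nsN)
    qed (use Sc[OF w] Sc[OF w'] nsN in simp)
  qed
  have "rep_submodule L N S"
  proof (rule rep_submodule_currI[OF N sub])
    fix y b w assume y: "y \<in> derived G" "b \<in> carrier A" and w: "w \<in> S"
    show "act N (lp y b) w \<in> S"
    proof (rule SI[OF act_lp_closed[OF N y Sc[OF w]]])
      fix x assume x: "x \<in> derived G"
      have xy: "[x,y]\<^sub>G \<in> derived G" using x y br_derived derived_closed by blast
      obtain n where n: "\<forall>a\<in>ideal_pow A I n. act N (lp x a) w = \<zero>\<^bsub>N\<^esub> \<and> act N (lp [x,y]\<^sub>G a) w = \<zero>\<^bsub>N\<^esub>"
        using two[OF SD[OF w x] SD[OF w xy]] by blast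
      have "act N (lp x a) (act N (lp y b) w) = \<zero>\<^bsub>N\<^esub>" if a: "a \<in> ideal_pow A I n" for a
      proof -
        have "a \<star> b \<in> ideal_pow A I n" using ideal.I_r_closed[OF A.ideal_pow_ideal[OF I] a y(2)] .
        then show ?thesis
          using act_lp_lp[OF N x y(1) ideal_pow_carrier[OF a] y(2) Sc[OF w]] n a z[OF y] nsN(2,4) by simp
      qed
      then show "\<exists>n. \<forall>a\<in>ideal_pow A I n. act N (lp x a) (act N (lp y b) w) = \<zero>\<^bsub>N\<^esub>" by blast
    qed
  next
    fix h w assume h: "h \<in> HC" and w: "w \<in> S"
    show "act N (dl h) w \<in> S"
    proof (rule SI[OF act_dl_closed[OF N h Sc[OF w]]])
      fix x assume x: "x \<in> derived G"
      have hx: "[h,x]\<^sub>G \<in> derived G" using x h br_derived derived_closed HCs by blast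
      obtain n where n: "\<forall>a\<in>ideal_pow A I n. act N (lp x a) w = \<zero>\<^bsub>N\<^esub> \<and> act N (lp [h,x]\<^sub>G a) w = \<zero>\<^bsub>N\<^esub>"
        using two[OF SD[OF w x] SD[OF w hx]] by blast
      have "act N (lp x a) (act N (dl h) w) = \<zero>\<^bsub>N\<^esub>" if a: "a \<in> ideal_pow A I n" for a
        using act_dl_lp[OF N h x ideal_pow_carrier[OF a] Sc[OF w]] n a zd[OF h]
          nsN(5)[OF act_lp_closed[OF N x ideal_pow_carrier[OF a] act_dl_closed[OF N h Sc[OF w]]]] by simp
      then show "\<exists>n. \<forall>a\<in>ideal_pow A I n. act N (lp x a) (act N (dl h) w) = \<zero>\<^bsub>N\<^esub>" by blast
    qed
  qed
  moreover have "v \<in> S"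
  proof (rule SI[OF vc])
    fix x assume x: "x \<in> derived G"
    have sub: "cartan' G \<union> range ew \<union> range fw \<subseteq> carrier G"
      using cartan'_derived ew_closed fw_closed derived_closed by auto
    have "x \<in> derived G \<and> (\<exists>n. \<forall>a\<in>ideal_pow A I n. act N (lp x a) v = \<zero>\<^bsub>N\<^esub>)"
      using G_cmod sub x[unfolded derived_span]
    proof (induction rule: lin_span_induct)
      case zero
      show ?case using act_lp_zero[OF N _ vc] ideal_pow_carrier Ds(2) by blast
    next
      case (add x y)
      then obtain n where "\<forall>a\<in>ideal_pow A I n. act N (lp x a) v = \<zero>\<^bsub>N\<^esub> \<and> act N (lp y a) v = \<zero>\<^bsub>N\<^esub>"
        using two[of "\<lambda>a. act N (lp x a) v = \<zero>\<^bsub>N\<^esub>" "\<lambda>a. act N (lp y a) v = \<zero>\<^bsub>N\<^esub>"] by blast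
      then show ?case
        using add Ds(3) vc ideal_pow_carrier by (intro conjI exI[of _ n]) (simp_all add: act_lp_bilinD(1)[OF N] nsN)
    next
      case (smult c x)
      then obtain n where "\<forall>a\<in>ideal_pow A I n. act N (lp x a) v = \<zero>\<^bsub>N\<^esub>" by blast
      then show ?case
        using smult Ds(4) vc ideal_pow_carrier by (intro conjI exI[of _ n]) (simp_all add: act_lp_bilinD(2)[OF N] nsN)
    next
      case (base x)
      then consider "x \<in> cartan' G" | ws where "x = ew ws" | ws where "x = fw ws" by auto
      then show ?case
      proof cases
        \<comment> \<open>On Cartan elements the weight vanishes with coefficients in
          \<open>I\<close>, so the exponent 1 suffices.\<close>
        case 1
        have "ideal_pow A I 1 \<subseteq> I" by (rule A.ideal_pow_subset[OF I]) simp
        then have "\<forall>a\<in>ideal_pow A I 1. act N (lp x a) v = \<zero>\<^bsub>N\<^esub>"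
          using 1 hw \<psi>I[OF 1] nsN(10)[OF vc] ideal.Icarr[OF I] unfolding hwv_def by (metis subsetD)
        then show ?thesis using cartan'_derived[OF 1] by blast
      next
        case 2
        have "act N (lp (ew ws) a) v = \<zero>\<^bsub>N\<^esub>" if a: "a \<in> carrier A" for a
        proof (cases "ws = [] \<or> ew ws = \<zero>\<^bsub>G\<^esub>")
          case True
          then show ?thesis using act_lp_zero[OF N a vc] by auto
        next
          case False
          then have "ew ws \<in> (\<Union>m\<in>pos_roots G. root_space G (root_of G m))" using ew_nilp_pos by blast
          then have "ew ws \<in> nilp_pos G" unfolding nilp_pos_def by (rule lin_span_base)
          then show ?thesis using hw a by (simp add: hwv_def)
        qed
        then show ?thesis using 2 ew_derived ideal_pow_carrier by blast
      next
        case 3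
        show ?thesis
        proof (cases "ws = []")
          case True
          then show ?thesis using 3 act_lp_zero[OF N _ vc] ideal_pow_carrier Ds(2) by auto
        next
          case False
          then show ?thesis using 3 relv_fw[OF N vc r False] fw_derived by blast
        qed
      qed
    qed
    then show "\<exists>n. \<forall>a\<in>ideal_pow A I n. act N (lp x a) v = \<zero>\<^bsub>N\<^esub>" ..
  qed
  ultimately have "S = carrier N" by (rule cyclicD[OF cyc])
  then show ?thesis using w x SD by blast
qed

end

section \<open>Splitting the action along coprime ideals\<close>

lemma eventually_eq_unique:
  assumes "\<forall>\<^sub>F n in sequentially. X n = u" "\<forall>\<^sub>F n in sequentially. X n = w"
  shows "u = w"
proof -
  have "\<forall>\<^sub>F n in sequentially. u = w"
    using assms by eventually_elim simp
  then show ?thesis by simp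
qed

text \<open>The assumptions are phrased so that exchanging \<open>I\<close> with \<open>J\<close>
  and \<open>e\<close> with \<open>e'\<close> gives another instance. Smoothness is required for the
  intersection of the two powers, which is where the errors made by changing \<open>n\<close> will
  lie.\<close>

locale split_action = curr G A HC for G :: "('g, 'i::finite) km_algebra_rec" (structure) and A :: "(complex, 'a) module" and HC +
  fixes I J :: "'a set" and e e' :: "nat \<Rightarrow> 'a"
    and \<tau> :: "'g \<Rightarrow> 'a \<Rightarrow> ('x \<Rightarrow>\<^sub>0 complex) \<Rightarrow> ('x \<Rightarrow>\<^sub>0 complex)" and \<delta>
  assumes I: "ideal I A" and J: "ideal J A"
    and e: "e n \<in> ideal_pow A J n" "e' n \<in> ideal_pow A I n" and e'_eq: "e' n = \<one>\<^bsub>A\<^esub> \<ominus>\<^bsub>A\<^esub> e n"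
    and c: "crep \<tau> \<delta>"
    and sm: "x \<in> derived G \<Longrightarrow> \<exists>n. \<forall>a\<in>ideal_pow A I n \<inter> ideal_pow A J n. \<tau> x a p = 0"
begin

lemma e_closed: "e n \<in> carrier A" using A.ideal_pow_closed[OF J e(1)] .

lemma e'_closed: "e' n \<in> carrier A" using A.ideal_pow_closed[OF I e(2)] .

lemma powI_mono: "a \<in> ideal_pow A I n \<Longrightarrow> m \<le> n \<Longrightarrow> a \<in> ideal_pow A I m"
  and powJ_mono: "a \<in> ideal_pow A J n \<Longrightarrow> m \<le> n \<Longrightarrow> a \<in> ideal_pow A J m"
  using A.ideal_pow_antimono[OF I] A.ideal_pow_antimono[OF J] by blast+

lemma eventually_null:
  assumes x: "x \<in> derived G"
  shows "\<forall>\<^sub>F n in sequentially. \<forall>a\<in>ideal_pow A I n \<inter> ideal_pow A J n. \<tau> x a p = 0"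
proof -
  obtain n where n: "\<forall>a\<in>ideal_pow A I n \<inter> ideal_pow A J n. \<tau> x a p = 0" using sm[OF x] by blast
  show ?thesis
    unfolding eventually_sequentially
    using n powI_mono powJ_mono by (intro exI[of _ n]) blast
qed

lemma \<tau>_cong_null:
  assumes "x \<in> derived G" "a \<in> carrier A" "b \<in> carrier A" "\<tau> x (a \<ominus>\<^bsub>A\<^esub> b) p = 0"
  shows "\<tau> x a p = \<tau> x b p"
proof -
  have "a = (a \<ominus>\<^bsub>A\<^esub> b) \<oplus>\<^bsub>A\<^esub> b" using assms by algebra
  then have "\<tau> x a p = \<tau> x (a \<ominus>\<^bsub>A\<^esub> b) p + \<tau> x b p"
    using crep_bilinD(3)[OF c assms(1), of "a \<ominus>\<^bsub>A\<^esub> b" b p] assms by simp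
  then show ?thesis using assms(4) by simp
qed

text \<open>The sequence \<open>\<tau> x (a \<star> e n) p\<close> is eventually constant; its limit is the part of the action
  that factors through the \<open>I\<close>-adic completion of \<open>A\<close>.\<close>

definition \<tau>' :: "'g \<Rightarrow> 'a \<Rightarrow> ('x \<Rightarrow>\<^sub>0 complex) \<Rightarrow> ('x \<Rightarrow>\<^sub>0 complex)" where
  "\<tau>' x a p = (THE u. \<forall>\<^sub>F n in sequentially. \<tau> x (a \<star> e n) p = u)"

text \<open>Changing \<open>n\<close> to \<open>m\<close> changes the coefficient by
  \<open>a (e m - e n) = a (e' n - e' m)\<close>. The first form lies in the n-th power of
  \<open>J\<close>, the second in that of \<open>I\<close>, so for large \<open>n\<close> the change
  acts as zero on \<open>p\<close>.\<close>

lemma eventually_\<tau>':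
  assumes x: "x \<in> derived G" and a: "a \<in> carrier A"
  shows "\<forall>\<^sub>F n in sequentially. \<tau> x (a \<star> e n) p = \<tau>' x a p"
proof -
  obtain n where n: "\<forall>a\<in>ideal_pow A I n \<inter> ideal_pow A J n. \<tau> x a p = 0" using sm[OF x] by blast
  have "\<tau> x (a \<star> e m) p = \<tau> x (a \<star> e n) p" if m: "m \<ge> n" for m
  proof (rule \<tau>_cong_null[OF x])
    note iI = A.ideal_pow_ideal[OF I, of n] and iJ = A.ideal_pow_ideal[OF J, of n]
    have E: "a \<star> e m \<ominus>\<^bsub>A\<^esub> a \<star> e n = a \<star> (e' n \<ominus>\<^bsub>A\<^esub> e' m)" "a \<star> e m \<ominus>\<^bsub>A\<^esub> a \<star> e n = a \<star> (e m \<ominus>\<^bsub>A\<^esub> e n)"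
      unfolding e'_eq using a e_closed[of n] e_closed[of m] by algebra+
    have m: "e' n \<ominus>\<^bsub>A\<^esub> e' m \<in> ideal_pow A I n" "e m \<ominus>\<^bsub>A\<^esub> e n \<in> ideal_pow A J n"
      using e powI_mono[OF e(2) m] powJ_mono[OF e(1) m]
        additive_subgroup.a_closed[OF ideal.axioms(1)[OF iI]] additive_subgroup.a_inv_closed[OF ideal.axioms(1)[OF iI]]
        additive_subgroup.a_closed[OF ideal.axioms(1)[OF iJ]] additive_subgroup.a_inv_closed[OF ideal.axioms(1)[OF iJ]]
      unfolding a_minus_def[of A "e' n"] a_minus_def[of A "e m"] by blast+
    have "a \<star> e m \<ominus>\<^bsub>A\<^esub> a \<star> e n \<in> ideal_pow A I n" unfolding E(1) by (rule ideal.I_l_closed[OF iI m(1) a])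
    moreover have "a \<star> e m \<ominus>\<^bsub>A\<^esub> a \<star> e n \<in> ideal_pow A J n" unfolding E(2) by (rule ideal.I_l_closed[OF iJ m(2) a])
    ultimately show "\<tau> x (a \<star> e m \<ominus>\<^bsub>A\<^esub> a \<star> e n) p = 0" using n by blast
  qed (use a e_closed in auto)
  then have 1: "\<forall>\<^sub>F m in sequentially. \<tau> x (a \<star> e m) p = \<tau> x (a \<star> e n) p"
    unfolding eventually_sequentially by blast
  then have "\<tau>' x a p = \<tau> x (a \<star> e n) p"
    unfolding \<tau>'_def using eventually_eq_unique by (intro the_equality) blast+
  with 1 show ?thesis by simp
qed

lemma \<tau>'_eqI:
  assumes "x \<in> derived G" "a \<in> carrier A" "\<forall>\<^sub>F n in sequentially. \<tau> x (a \<star> e n) p = u"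
  shows "\<tau>' x a p = u"
  using eventually_eq_unique[OF eventually_\<tau>'[OF assms(1,2)] assms(3)] .

lemma \<tau>'_clin:
  assumes x: "x \<in> derived G" and a: "a \<in> carrier A" shows "clin (\<tau>' x a)"
  unfolding cvec.lin_def[OF pscale_cvec]
proof (intro conjI allI)
  fix p q d
  note ae = A.m_closed[OF a e_closed]
  note cl = clinD[OF c crepD(1)[OF c x ae]]
  show "\<tau>' x a (p + q) = \<tau>' x a p + \<tau>' x a q"
    by (rule \<tau>'_eqI[OF x a], rule eventually_elim2[OF eventually_\<tau>'[OF x a, of p] eventually_\<tau>'[OF x a, of q]], simp add: cl)
  show "\<tau>' x a (pscale d p) = pscale d (\<tau>' x a p)"
    by (rule \<tau>'_eqI[OF x a], rule eventually_mono[OF eventually_\<tau>'[OF x a, of p]], simp add: cl)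
qed

lemma \<tau>'_bilin: "bilin DG A (free_vs UNIV) (\<lambda>x a. \<tau>' x a p)"
proof -
  note ec = A.m_closed[OF _ e_closed]
  have 1: "\<tau>' (x \<oplus>\<^bsub>G\<^esub> y) a p = \<tau>' x a p + \<tau>' y a p" if x: "x \<in> derived G" "y \<in> derived G" and a: "a \<in> carrier A" for x y a
    by (rule \<tau>'_eqI[OF Ds(3)[OF x] a], rule eventually_elim2[OF eventually_\<tau>'[OF x(1) a, of p] eventually_\<tau>'[OF x(2) a, of p]], simp add: crep_bilinD(1)[OF c x(1) ec[OF a] x(2)])
  have 2: "\<tau>' (d \<odot>\<^bsub>G\<^esub> x) a p = pscale d (\<tau>' x a p)" if x: "x \<in> derived G" and a: "a \<in> carrier A" for d x a
    by (rule \<tau>'_eqI[OF Ds(4)[OF x] a], rule eventually_mono[OF eventually_\<tau>'[OF x a, of p]], simp add: crep_bilinD(2)[OF c x ec[OF a]])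
  have 3: "\<tau>' x (a \<oplus>\<^bsub>A\<^esub> b) p = \<tau>' x a p + \<tau>' x b p" if x: "x \<in> derived G" and a: "a \<in> carrier A" "b \<in> carrier A" for x a b
    by (rule \<tau>'_eqI[OF x A.a_closed[OF a]], rule eventually_elim2[OF eventually_\<tau>'[OF x a(1), of p] eventually_\<tau>'[OF x a(2), of p]], simp add: A.l_distr a e_closed crep_bilinD(3)[OF c x ec[OF a(1)] ec[OF a(2)]])
  have 4: "\<tau>' x (d \<odot>\<^bsub>A\<^esub> a) p = pscale d (\<tau>' x a p)" if x: "x \<in> derived G" and a: "a \<in> carrier A" for d x a
    by (rule \<tau>'_eqI[OF x as(3)[OF a]], rule eventually_mono[OF eventually_\<tau>'[OF x a, of p]], simp add: lin_mapD(3)[OF A_mult_lin(2)[OF e_closed] a] crep_bilinD(4)[OF c x ec[OF a]])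
  show ?thesis
    unfolding bilin_def using 1 2 3 4 by (intro conjI ballI lin_mapI) simp_all
qed

text \<open>\<open>e n\<close> is idempotent up to terms that act as zero:
  \<open>e n - (e n)^2 = (e n) (e' n)\<close> lies in both n-th powers. This one fact gives the
  bracket relation of each part and the commutation of the two parts.\<close>

lemma eventually_mult_null:
  assumes z: "z \<in> derived G" and a: "a \<in> carrier A"
  shows "\<forall>\<^sub>F n in sequentially. \<tau> z (a \<star> (e n \<star> e' n)) p = 0"
  using eventually_null[OF z, of p]
proof eventually_elim
  case (elim n)
  have "a \<star> (e n \<star> e' n) \<in> ideal_pow A I n \<inter> ideal_pow A J n"
    using ideal.I_l_closed[OF A.ideal_pow_ideal[OF I] ideal.I_l_closed[OF A.ideal_pow_ideal[OF I] e(2)[of n] e_closed[of n]] a]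
      ideal.I_l_closed[OF A.ideal_pow_ideal[OF J] ideal.I_r_closed[OF A.ideal_pow_ideal[OF J] e(1)[of n] e'_closed[of n]] a]
    by blast
  with elim show ?case by blast
qed

lemma \<tau>'_br:
  assumes x: "x \<in> derived G" and y: "y \<in> derived G" and a: "a \<in> carrier A" and b: "b \<in> carrier A"
  shows "\<tau>' x a (\<tau>' y b p) = \<tau>' y b (\<tau>' x a p) + \<tau>' [x,y]\<^sub>G (a \<star> b) p"
proof (rule \<tau>'_eqI[OF x a])
  have xy: "[x,y]\<^sub>G \<in> derived G" using x y br_derived derived_closed by blast
  have ab: "a \<star> b \<in> carrier A" using a b by simp
  show "\<forall>\<^sub>F n in sequentially. \<tau> x (a \<star> e n) (\<tau>' y b p) = \<tau>' y b (\<tau>' x a p) + \<tau>' [x,y]\<^sub>G (a \<star> b) p"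
    using eventually_\<tau>'[OF y b, of p] eventually_\<tau>'[OF x a, of p] eventually_\<tau>'[OF y b, of "\<tau>' x a p"]
      eventually_\<tau>'[OF xy ab, of p] eventually_mult_null[OF xy ab, of p]
  proof eventually_elim
    case (elim n)
    note en = e_closed[of n]
    \<comment> \<open>The error term on the right is the one that
      \<open>eventually_mult_null\<close> discards.\<close>
    have "(a \<star> b) \<star> e n = (a \<star> e n) \<star> (b \<star> e n) \<oplus>\<^bsub>A\<^esub> (a \<star> b) \<star> (e n \<star> e' n)"
      unfolding e'_eq using a b en by algebra
    then have "\<tau> [x,y]\<^sub>G ((a \<star> b) \<star> e n) p = \<tau> [x,y]\<^sub>G ((a \<star> e n) \<star> (b \<star> e n)) p"
      using crep_bilinD(3)[OF c xy, of "(a \<star> e n) \<star> (b \<star> e n)" "(a \<star> b) \<star> (e n \<star> e' n)" p] elim(5) a b en e'_closed[of n] by simp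
    then show ?case
      using crepD(5)[OF c x y A.m_closed[OF a en] A.m_closed[OF b en], of p] elim by simp
  qed
qed

lemma \<tau>'_\<delta>:
  assumes h: "h \<in> HC" and x: "x \<in> derived G" and a: "a \<in> carrier A"
  shows "\<delta> h (\<tau>' x a p) = \<tau>' x a (\<delta> h p) + \<tau>' [h,x]\<^sub>G a p"
proof -
  have hx: "[h,x]\<^sub>G \<in> derived G" using x h br_derived derived_closed HCs by blast
  have "\<forall>\<^sub>F n in sequentially. \<delta> h (\<tau>' x a p) = \<tau>' x a (\<delta> h p) + \<tau>' [h,x]\<^sub>G a p"
    using eventually_\<tau>'[OF x a, of p] eventually_\<tau>'[OF x a, of "\<delta> h p"] eventually_\<tau>'[OF hx a, of p]
  proof eventually_elim
    case (elim n)
    then show ?case using crepD(6)[OF c h x A.m_closed[OF a e_closed], of n p] by simp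
  qed
  then show ?thesis by simp
qed

text \<open>A scalar commutes with everything, so subtracting a linear functional from the action of
  h'' keeps all relations. The freedom is used to give \<open>v\<close> the required weight on
  h''.\<close>

lemma crep_\<tau>':
  assumes \<kappa>: "\<And>h k. h \<in> HC \<Longrightarrow> k \<in> HC \<Longrightarrow> \<kappa> (h \<oplus>\<^bsub>G\<^esub> k) = \<kappa> h + \<kappa> k" "\<And>d h. h \<in> HC \<Longrightarrow> \<kappa> (d \<odot>\<^bsub>G\<^esub> h) = d * \<kappa> h"
  shows "crep \<tau>' (\<lambda>h p. \<delta> h p - pscale (\<kappa> h) p)"
proof -
  interpret P: vector_space "pscale :: complex \<Rightarrow> ('x \<Rightarrow>\<^sub>0 complex) \<Rightarrow> _" by (rule pscale_vector_space)
  show ?thesis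
    unfolding crep_def
  proof (intro conjI ballI allI)
    show "clin (\<tau>' x a)" if "x \<in> derived G" "a \<in> carrier A" for x a by (rule \<tau>'_clin[OF that])
    show "clin (\<lambda>p. \<delta> h p - pscale (\<kappa> h) p)" if "h \<in> HC" for h
      using clinD[OF c crepD(2)[OF c that]]
      by (simp add: cvec.lin_def[OF pscale_cvec] P.scale_right_distrib P.scale_right_diff_distrib P.scale_left_commute mult.commute)
    show "bilin DG A (free_vs UNIV) (\<lambda>x a. \<tau>' x a w)" for w by (rule \<tau>'_bilin)
    show "lin_map (G\<lparr>carrier := HC\<rparr>) (free_vs UNIV) (\<lambda>h. \<delta> h w - pscale (\<kappa> h) w)" for w
      using lin_mapD[OF crepD(4)[OF c, where w=w]] \<kappa>
      by (intro lin_mapI) (simp_all add: P.scale_left_distrib P.scale_right_diff_distrib)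
    show "\<tau>' x a (\<tau>' y b w) = \<tau>' y b (\<tau>' x a w) + \<tau>' [x,y]\<^sub>G (a \<star> b) w"
      if "x \<in> derived G" "y \<in> derived G" "a \<in> carrier A" "b \<in> carrier A" for x y a b w by (rule \<tau>'_br[OF that])
    show "\<delta> h (\<tau>' x a w) - pscale (\<kappa> h) (\<tau>' x a w) = \<tau>' x a (\<delta> h w - pscale (\<kappa> h) w) + \<tau>' [h,x]\<^sub>G a w"
      if "h \<in> HC" "x \<in> derived G" "a \<in> carrier A" for h x a w
      using \<tau>'_\<delta>[OF that] clinD[OF c \<tau>'_clin[OF that(2,3)]] by simp
    show "\<delta> h (\<delta> k w - pscale (\<kappa> k) w) - pscale (\<kappa> h) (\<delta> k w - pscale (\<kappa> k) w) =
        \<delta> k (\<delta> h w - pscale (\<kappa> h) w) - pscale (\<kappa> k) (\<delta> h w - pscale (\<kappa> h) w)" if "h \<in> HC" "k \<in> HC" for h k w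
      by (simp add: clinD[OF c crepD(2)[OF c that(1)]] clinD[OF c crepD(2)[OF c that(2)]] crepD(7)[OF c that]
          P.scale_right_diff_distrib mult.commute)
  qed
qed

end

locale split_pair = split_action G A HC I J e e' \<tau> \<delta> + S2: split_action G A HC J I e' e \<tau> \<delta>
  for G :: "('g, 'i::finite) km_algebra_rec" (structure) and A :: "(complex, 'a) module" and HC I J e e'
    and \<tau> :: "'g \<Rightarrow> 'a \<Rightarrow> ('x \<Rightarrow>\<^sub>0 complex) \<Rightarrow> ('x \<Rightarrow>\<^sub>0 complex)" and \<delta>
begin

abbreviation \<tau>1 where "\<tau>1 \<equiv> \<tau>'"
abbreviation \<tau>2 where "\<tau>2 \<equiv> S2.\<tau>'"

lemma \<tau>_split:
  assumes x: "x \<in> derived G" and a: "a \<in> carrier A"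
  shows "\<tau> x a p = \<tau>1 x a p + \<tau>2 x a p"
proof -
  have "\<forall>\<^sub>F n in sequentially. \<tau> x a p = \<tau>1 x a p + \<tau>2 x a p"
    using eventually_\<tau>'[OF x a, of p] S2.eventually_\<tau>'[OF x a, of p]
  proof eventually_elim
    case (elim n)
    have "a = a \<star> e n \<oplus>\<^bsub>A\<^esub> a \<star> e' n" unfolding e'_eq using a e_closed[of n] by algebra
    then show ?case
      using crep_bilinD(3)[OF c x A.m_closed[OF a e_closed[of n]] A.m_closed[OF a e'_closed[of n]], of p] elim by simp
  qed
  then show ?thesis by simp
qed

text \<open>The commutator of the two operators has coefficient
  \<open>(a e)(b e') = (a b)(e e')\<close>, which acts as zero for large \<open>n\<close>.\<close>

lemma \<tau>_commute:
  assumes x: "x \<in> derived G" and y: "y \<in> derived G" and a: "a \<in> carrier A" and b: "b \<in> carrier A"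
  shows "\<tau>1 x a (\<tau>2 y b p) = \<tau>2 y b (\<tau>1 x a p)"
proof (rule \<tau>'_eqI[OF x a])
  have xy: "[x,y]\<^sub>G \<in> derived G" using x y br_derived derived_closed by blast
  have ab: "a \<star> b \<in> carrier A" using a b by simp
  show "\<forall>\<^sub>F n in sequentially. \<tau> x (a \<star> e n) (\<tau>2 y b p) = \<tau>2 y b (\<tau>1 x a p)"
    using S2.eventually_\<tau>'[OF y b, of p] eventually_\<tau>'[OF x a, of p] S2.eventually_\<tau>'[OF y b, of "\<tau>1 x a p"]
      eventually_mult_null[OF xy ab, of p]
  proof eventually_elim
    case (elim n)
    have "(a \<star> e n) \<star> (b \<star> e' n) = (a \<star> b) \<star> (e n \<star> e' n)"
      using a b e_closed[of n] e'_closed[of n] by (simp add: A.m_ac)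
    then show ?case
      using crepD(5)[OF c x y A.m_closed[OF a e_closed[of n]] A.m_closed[OF b e'_closed[of n]], of p] elim by simp
  qed
qed

end

section \<open>The homomorphism from the tensor product\<close>

locale split_weyl = split_pair G A HC I J e e' \<tau> \<delta> + D1: hw_data G A HC \<psi>1 I n1 + D2: hw_data G A HC \<psi>2 J n2
  for G :: "('g, 'i::finite) km_algebra_rec" (structure) and A :: "(complex, 'a) module" and HC I J e e'
    and \<tau> :: "'g \<Rightarrow> 'a \<Rightarrow> ('x \<Rightarrow>\<^sub>0 complex) \<Rightarrow> ('x \<Rightarrow>\<^sub>0 complex)" and \<delta> \<psi>1 \<psi>2 n1 n2 +
  fixes v :: "'x \<Rightarrow>\<^sub>0 complex"
  assumes \<psi>1I: "h \<in> cartan' G \<Longrightarrow> a \<in> I \<Longrightarrow> \<psi>1 (lp h a) = 0"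
    and \<psi>2J: "h \<in> cartan' G \<Longrightarrow> a \<in> J \<Longrightarrow> \<psi>2 (lp h a) = 0"
    and v_pos: "x \<in> nilp_pos G \<Longrightarrow> a \<in> carrier A \<Longrightarrow> \<tau> x a v = 0"
    and v_cartan: "h \<in> cartan' G \<Longrightarrow> a \<in> carrier A \<Longrightarrow> \<tau> h a v = pscale (\<psi>1 (lp h a) + \<psi>2 (lp h a)) v"
    and v_compl: "h \<in> HC \<Longrightarrow> \<delta> h v = pscale (\<psi>1 (dl h) + \<psi>2 (dl h)) v"
    and nil: "\<exists>n. (\<tau> (chev_f G i) \<one>\<^bsub>A\<^esub> ^^ n) p = 0"
begin

text \<open>The full action of h'' serves for the first part; only its eigenvalue on
  \<open>v\<close> is corrected from \<psi>\<open>1 +\<close>\<psi>\<open>2\<close> to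
  \<psi>\<open>1\<close>. Consequently the h''-actions of the two parts do not add up to
  \<delta>.\<close>

definition \<delta>1 where "\<delta>1 h p = \<delta> h p - pscale (\<psi>2 (dl h)) p"

lemma crep1: "crep \<tau>1 \<delta>1"
  unfolding \<delta>1_def[abs_def]
proof (rule crep_\<tau>')
  fix h k d assume h: "h \<in> HC"
  show "\<psi>2 (dl (d \<odot>\<^bsub>G\<^esub> h)) = d * \<psi>2 (dl h)"
    using D2.\<psi>_smult[OF dl_HH[OF h], of d] lin_mapD(3)[OF dl_lin, of h d] h by simp
  assume k: "k \<in> HC"
  show "\<psi>2 (dl (h \<oplus>\<^bsub>G\<^esub> k)) = \<psi>2 (dl h) + \<psi>2 (dl k)"
    using D2.\<psi>_add[OF dl_HH[OF h] dl_HH[OF k]] lin_mapD(2)[OF dl_lin, of h k] h k by simp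
qed

abbreviation R1 where "R1 \<equiv> crep_rec \<tau>1 \<delta>1"

lemmas R1_lrep = R_lrep[OF crep1] and R1_lp = R_act_lp[OF crep1] and R1_dl = R_act_dl[OF crep1]

text \<open>\<psi>\<open>2\<close> vanishes on the coefficient \<open>a e\<close>, which lies in
  \<open>J\<close>, and \<psi>\<open>1\<close> on \<open>a e'\<close>, which lies in
  \<open>I\<close>. The condition \<open>n > 0\<close> is there because the zeroth power is the
  whole ring.\<close>

lemma \<psi>1_split:
  assumes h: "h \<in> cartan' G" and a: "a \<in> carrier A" and n: "n > 0"
  shows "\<psi>1 (lp h (a \<star> e n)) + \<psi>2 (lp h (a \<star> e n)) = \<psi>1 (lp h a)"
proof -
  have hd: "h \<in> derived G" using cartan'_derived[OF h] .
  have J: "e n \<in> J" and I: "e' n \<in> I" using e(1)[of n] e(2)[of n] A.ideal_pow_subset[OF J n] A.ideal_pow_subset[OF I n] by auto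
  have ae: "a \<star> e n \<in> J" "a \<star> e' n \<in> I" using ideal.I_l_closed[OF S2.I J a] ideal.I_l_closed[OF S2.J I a] .
  have c: "a \<star> e n \<in> carrier A" "a \<star> e' n \<in> carrier A" using a e_closed e'_closed by auto
  have "a = a \<star> e n \<oplus>\<^bsub>A\<^esub> a \<star> e' n" unfolding e'_eq using a e_closed[of n] by algebra
  then have "lp h a = lp h (a \<star> e n) \<oplus>\<^bsub>L\<^esub> lp h (a \<star> e' n)"
    using lin_mapD(2)[OF lp_lin(1)[OF hd] c] by simp
  then have "\<psi>1 (lp h a) = \<psi>1 (lp h (a \<star> e n)) + \<psi>1 (lp h (a \<star> e' n))"
    using D1.\<psi>_add[OF lp_HH[OF h c(1)] lp_HH[OF h c(2)]] by simp
  then show ?thesis using \<psi>1I[OF h ae(2)] \<psi>2J[OF h ae(1)] by simp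
qed

lemma \<tau>1_pos: "x \<in> nilp_pos G \<Longrightarrow> a \<in> carrier A \<Longrightarrow> \<tau>1 x a v = 0"
  using nilp_pos_derived v_pos e_closed by (intro \<tau>'_eqI) auto

lemma \<tau>1_cartan:
  assumes h: "h \<in> cartan' G" and a: "a \<in> carrier A" shows "\<tau>1 h a v = pscale (\<psi>1 (lp h a)) v"
proof (rule \<tau>'_eqI[OF cartan'_derived[OF h] a])
  show "\<forall>\<^sub>F n in sequentially. \<tau> h (a \<star> e n) v = pscale (\<psi>1 (lp h a)) v"
    using eventually_gt_at_top[of 0]
    by eventually_elim (use h a e_closed in \<open>simp add: v_cartan \<psi>1_split\<close>)
qed

lemma hwv1: "hwv R1 \<psi>1 v"
  unfolding hwv_def using nilp_pos_derived
  by (auto simp: R1_lp R1_dl \<tau>1_pos \<tau>1_cartan cartan'_derived \<delta>1_def v_compl pscale_simps)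

lemma coroot_cartan': "coroot G i \<in> cartan' G"
  by (simp add: cartan'_def coroot_cartan chev_derived)

lemma chev_e_nilp: "chev_e G i \<in> nilp_pos G"
proof -
  have "ew [i] \<noteq> \<zero>\<^bsub>G\<^esub>" "[i] \<noteq> []" using D1.chev_e_nonzero by simp_all
  then have "ew [i] \<in> (\<Union>m\<in>pos_roots G. root_space G (root_of G m))" using ew_nilp_pos by blast
  from lin_span_base[OF this] show ?thesis unfolding nilp_pos_def by simp
qed

text \<open>The vector \<open>F\<^sub>1\<^sup>n\<^sup>+\<^sup>1 v\<close> is singular of weight \<open>-n-2\<close>, and \<open>F\<^sub>1 + F\<^sub>2\<close> is locally nilpotent.\<close>

lemma \<tau>1_f_pow: "(\<tau>1 (chev_f G i) \<one>\<^bsub>A\<^esub> ^^ Suc (n1 i)) v = 0"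
proof -
  let ?F = "\<tau>1 (chev_f G i) \<one>\<^bsub>A\<^esub>" and ?u = "(\<tau>1 (chev_f G i) \<one>\<^bsub>A\<^esub> ^^ Suc (n1 i)) v"
  interpret sl2_triple pscale "\<tau>1 (chev_e G i) \<one>\<^bsub>A\<^esub>" ?F "\<tau>1 (coroot G i) \<one>\<^bsub>A\<^esub>"
    by (rule crep_sl2[OF crep1])
  note F2 = S2.\<tau>'_clin[OF chev_derived(2) A.one_closed, of i]
  note com = \<tau>_commute[OF _ chev_derived(2) A.one_closed A.one_closed]
  have E: "\<tau>1 (chev_e G i) \<one>\<^bsub>A\<^esub> v = 0" by (rule \<tau>1_pos[OF chev_e_nilp A.one_closed])
  have H: "\<tau>1 (coroot G i) \<one>\<^bsub>A\<^esub> v = pscale (of_nat (n1 i)) v"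
    using \<tau>1_cartan[OF coroot_cartan' A.one_closed, of i] D1.nn by simp
  have 1: "\<tau>1 (chev_e G i) \<one>\<^bsub>A\<^esub> ?u = 0"
    \<comment> \<open>The coefficient \<open>(n+1)(c-n)\<close> is zero, since the weight
      \<open>c\<close> of \<open>v\<close> equals \<open>n = n1 i\<close>.\<close>
    unfolding E_pow_F[OF H] E using linD(3)[OF lin_pow[OF lin(2)]] linD(3)[OF lin(2)] by (simp add: pscale_simps)
  have 2: "\<tau>1 (coroot G i) \<one>\<^bsub>A\<^esub> ?u = pscale (of_nat (n1 i) - 2 * of_nat (Suc (n1 i))) ?u"
    by (rule H_pow[OF H])
  have 3: "of_nat (n1 i) - 2 * of_nat (Suc (n1 i)) \<noteq> (of_nat j :: complex)" for j
  proof
    assume "of_nat (n1 i) - 2 * of_nat (Suc (n1 i)) = (of_nat j :: complex)"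
    then have "of_nat (n1 i) = (of_nat (j + 2 * Suc (n1 i)) :: complex)"
      by (simp only: diff_eq_eq of_nat_add of_nat_mult of_nat_numeral)
    then have "n1 i = j + 2 * Suc (n1 i)" by (simp only: of_nat_eq_iff)
    then show False by simp
  qed
  obtain K where 4: "((\<lambda>x. ?F x + \<tau>2 (chev_f G i) \<one>\<^bsub>A\<^esub> x) ^^ K) ?u = 0"
  proof -
    have "\<tau> (chev_f G i) \<one>\<^bsub>A\<^esub> = (\<lambda>x. ?F x + \<tau>2 (chev_f G i) \<one>\<^bsub>A\<^esub> x)"
      by (rule ext) (rule \<tau>_split[OF chev_derived(2) A.one_closed])
    then show ?thesis using that nil[of i ?u] by auto
  qed
  show ?thesis
    by (rule singular_nilpotent_perturbation[OF F2 com[OF chev_derived(1)] com[OF chev_derived(2)] com[OF chev_derived(3)] 1 2 3 4])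
qed

text \<open>The first partial action restricted to the triple of index \<open>i\<close> is a current
  algebra of sl_2. Its Cartan weight on \<open>v\<close> vanishes on \<open>I\<close>, and
  \<open>\<tau>1_f_pow\<close> supplies the vanishing power.\<close>

lemma relv1: "D1.relv R1 v"
  unfolding D1.relv_def
proof (intro allI ballI)
  fix i a assume a: "a \<in> ideal_pow A I (n1 i)"
  note b = crepD(5)[OF crep1] and s = crep_bilinD(2)[OF crep1]
  interpret sl2_current pscale A "\<tau>1 (chev_e G i)" "\<tau>1 (chev_f G i)" "\<tau>1 (coroot G i)" I v "\<lambda>a. \<psi>1 (lp (coroot G i) a)"
  proof (intro sl2_current.intro pscale_cvec A_cring sl2_current_axioms.intro)
    fix a b x assume ab: "a \<in> carrier A" "b \<in> carrier A"
    show "\<tau>1 (chev_f G i) (a \<oplus>\<^bsub>A\<^esub> b) x = \<tau>1 (chev_f G i) a x + \<tau>1 (chev_f G i) b x"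
      by (rule crep_bilinD(3)[OF crep1 chev_derived(2) ab])
    show "\<tau>1 (chev_e G i) a (\<tau>1 (chev_f G i) b x) = \<tau>1 (chev_f G i) b (\<tau>1 (chev_e G i) a x) + \<tau>1 (coroot G i) (a \<star> b) x"
      using b[of "chev_e G i" "chev_f G i" a b x] ab chev_derived by (simp add: brkt_e_f)
    show "\<tau>1 (coroot G i) a (\<tau>1 (chev_f G i) b x) = \<tau>1 (chev_f G i) b (\<tau>1 (coroot G i) a x) - pscale 2 (\<tau>1 (chev_f G i) (a \<star> b) x)"
      using b[of "coroot G i" "chev_f G i" a b x] ab chev_derived s[OF chev_derived(2)[of i] A.m_closed[OF ab], of "-2" x]
        pscale_simps(3)[of "-1" 2 "\<tau>1 (chev_f G i) (a \<star> b) x"]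
      by (simp add: coroot_chev pscale_minus)
  qed (use crepD(1)[OF crep1] chev_derived \<tau>1_pos[OF chev_e_nilp] \<tau>1_cartan[OF coroot_cartan'] \<psi>1I[OF coroot_cartan'] S2.J
      in auto)
  have "\<tau>1 (chev_f G i) a v = 0" by (rule T_ideal_pow[OF \<tau>1_f_pow a])
  then show "act R1 (lp (chev_f G i) a) v = \<zero>\<^bsub>R1\<^esub>"
    using R1_lp[OF chev_derived(2) D1.ideal_pow_carrier[OF a]] by simp
qed

text \<open>Every result about the first partial action becomes available for the second.\<close>

lemma swap: "split_weyl G A HC J I e' e \<tau> \<delta> \<psi>2 \<psi>1 n2 n1 v"
  by (intro split_weyl.intro split_pair.intro split_weyl_axioms.intro S2.split_action_axioms split_action_axioms
      D1.hw_data_axioms D2.hw_data_axioms nil v_pos \<psi>1I \<psi>2J) (simp_all add: v_cartan v_compl add.commute)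

text \<open>Let \<open>S\<close> be the set of vectors on which all second parts \<open>F2\<close>
  of the \<open>f_i\<close> are nilpotent. On \<open>S\<close> the first part is the difference of
  the commuting locally nilpotent operators \<open>F\<close> and \<open>F2\<close>, hence locally
  nilpotent. \<open>S\<close> is stable under the first action, because \<open>F2\<close> commutes
  with it and is rescaled by the adjoint action of h'', and it contains \<open>v\<close> by the
  exchanged form of \<open>\<tau>1_f_pow\<close>.\<close>

lemma hom1: "\<exists>\<phi>. rep_hom L D1.W R1 \<phi> \<and> \<phi> D1.wv = v"
proof -
  interpret sw: split_weyl G A HC J I e' e \<tau> \<delta> \<psi>2 \<psi>1 n2 n1 v by (rule swap)
  interpret P: cvec "pscale :: complex \<Rightarrow> ('x \<Rightarrow>\<^sub>0 complex) \<Rightarrow> _" by (rule pscale_cvec)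
  define F2 where "F2 i = \<tau>2 (chev_f G i) \<one>\<^bsub>A\<^esub>" for i
  have F2: "clin (F2 i)" for i unfolding F2_def by (rule S2.\<tau>'_clin[OF chev_derived(2) A.one_closed])
  note F2n = P.linD[OF P.lin_pow[OF F2]]
  define S where "S = {p. \<forall>i. \<exists>k. (F2 i ^^ k) p = 0}"
  have "lin_subspace R1 S"
    unfolding lin_subspace_iff[OF crep_rec_cmod]
  proof (intro conjI ballI allI)
    show "S \<subseteq> carrier R1" by simp
    show "\<zero>\<^bsub>R1\<^esub> \<in> S" using F2n(3) by (auto simp: S_def)
    show "c \<odot>\<^bsub>R1\<^esub> p \<in> S" if p: "p \<in> S" for c p
      unfolding S_def
    proof (intro CollectI allI)
      fix i
      obtain k where "(F2 i ^^ k) p = 0" using p unfolding S_def by blast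
      then show "\<exists>k. (F2 i ^^ k) (c \<odot>\<^bsub>R1\<^esub> p) = 0" using F2n(2)[of k i c p] by (intro exI[of _ k]) simp
    qed
    show "p \<oplus>\<^bsub>R1\<^esub> q \<in> S" if pq: "p \<in> S" "q \<in> S" for p q
      unfolding S_def
    proof (intro CollectI allI)
      fix i
      obtain k l where "(F2 i ^^ k) p = 0" "(F2 i ^^ l) q = 0" using pq unfolding S_def by blast
      then have "(F2 i ^^ max k l) (p + q) = 0"
        using P.pow_zero_mono[OF F2, of k i p "max k l"] P.pow_zero_mono[OF F2, of l i q "max k l"] by (simp add: F2n)
      then show "\<exists>k. (F2 i ^^ k) (p \<oplus>\<^bsub>R1\<^esub> q) = 0" by auto
    qed
  qed
  then have "rep_submodule L R1 S"
  proof (rule rep_submodule_currI[OF R1_lrep])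
    fix x a p assume x: "x \<in> derived G" "a \<in> carrier A" and p: "p \<in> S"
    show "act R1 (lp x a) p \<in> S"
      unfolding S_def R1_lp[OF x]
    proof (intro CollectI allI)
      fix i
      obtain k where k: "(F2 i ^^ k) p = 0" using p unfolding S_def by blast
      have "(F2 i ^^ k) (\<tau>1 x a p) = \<tau>1 x a ((F2 i ^^ k) p)"
        by (rule P.pow_comm) (simp add: F2_def \<tau>_commute[OF x(1) chev_derived(2) x(2) A.one_closed])
      then show "\<exists>k. (F2 i ^^ k) (\<tau>1 x a p) = 0" using k P.linD(3)[OF \<tau>'_clin[OF x]] by auto
    qed
  next
    fix h p assume h: "h \<in> HC" and p: "p \<in> S"
    show "act R1 (dl h) p \<in> S"
      unfolding S_def R1_dl
    proof (intro CollectI allI)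
      fix i
      obtain k where k: "(F2 i ^^ k) p = 0" using p unfolding S_def by blast
      have d: "\<delta> h (F2 i q) = F2 i (\<delta> h q) + pscale (- sroot G i h) (F2 i q)" for q
        using S2.\<tau>'_\<delta>[OF h chev_derived(2) A.one_closed, of i q] HC_cartan[OF h]
          S2.\<tau>'_bilin[of q] chev_derived(2)[of i] by (simp add: F2_def brkt_h_f bilin_def lin_map_def)
      \<comment> \<open>Each exchange of \<delta>\<open>h\<close> with \<open>F2\<close> contributes
        \<alpha>\<open>_i(h)\<close>, so \<open>n\<close> exchanges contribute \<open>n\<close>
        times that.\<close>
      have "(F2 i ^^ n) (\<delta> h p) = \<delta> h ((F2 i ^^ n) p) + pscale (of_nat n * sroot G i h) ((F2 i ^^ n) p)" for n
      proof (induction n)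
        case (Suc n)
        let ?q = "(F2 i ^^ n) p"
        have "(F2 i ^^ Suc n) (\<delta> h p) = F2 i (\<delta> h ?q) + pscale (of_nat n * sroot G i h) (F2 i ?q)"
          using Suc P.linD[OF F2] by simp
        also have "F2 i (\<delta> h ?q) = \<delta> h (F2 i ?q) + pscale (sroot G i h) (F2 i ?q)"
          unfolding d by (simp add: P.scale_minus_left)
        finally show ?case by (simp add: P.scale_left_distrib algebra_simps)
      qed (simp add: pscale_simps)
      from this[of k] have "(F2 i ^^ k) (\<delta> h p) = 0" using k P.linD(3)[OF crepD(2)[OF c h]] by simp
      then show "\<exists>k. (F2 i ^^ k) (\<delta>1 h p) = 0" using k by (intro exI[of _ k]) (simp add: \<delta>1_def F2n)
    qed
  qed
  moreover have "v \<in> S" using sw.\<tau>1_f_pow unfolding S_def F2_def by blast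
  moreover have "\<exists>n. (fop R1 i ^^ n) p = \<zero>\<^bsub>R1\<^esub>" if p: "p \<in> S" for i p
  proof -
    let ?F = "\<tau> (chev_f G i) \<one>\<^bsub>A\<^esub>"
    note sp = \<tau>_split[OF chev_derived(2) A.one_closed, of i, folded F2_def]
    obtain k l where k: "(F2 i ^^ k) p = 0" and l: "(?F ^^ l) p = 0" using p nil unfolding S_def by blast
    \<comment> \<open>The sign is carried along so that the difference can be treated as a sum of
      commuting nilpotent operators.\<close>
    have neg: "((\<lambda>q. - F2 i q) ^^ n) q = pscale ((-1) ^ n) ((F2 i ^^ n) q)" for n q
      by (induction n) (simp_all add: pscale_simps P.linD[OF F2] P.scale_minus_left)
    have F: "fop R1 i = (\<lambda>q. ?F q + - F2 i q)"
      by (rule ext) (simp add: R1_lp[OF chev_derived(2) A.one_closed] sp)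
    have com: "\<tau>1 (chev_f G i) \<one>\<^bsub>A\<^esub> (F2 i q) = F2 i (\<tau>1 (chev_f G i) \<one>\<^bsub>A\<^esub> q)" for q
      unfolding F2_def by (rule \<tau>_commute[OF chev_derived(2) chev_derived(2) A.one_closed A.one_closed])
    have "(fop R1 i ^^ (l + k)) p = 0"
      unfolding F
    proof (rule P.commuting_nilpotent_sum)
      show "clin ?F" by (rule crepD(1)[OF c chev_derived(2) A.one_closed])
      show "clin (\<lambda>q. - F2 i q)" using P.linD[OF F2] by (simp add: P.lin_def)
      show "?F (- F2 i q) = - F2 i (?F q)" for q
        using P.linD[OF F2] P.linD[OF \<tau>'_clin[OF chev_derived(2) A.one_closed]] by (simp add: sp com)
      show "((\<lambda>q. - F2 i q) ^^ k) p = 0" unfolding neg k by simp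
    qed (rule l)
    then show ?thesis by auto
  qed
  ultimately show ?thesis by (rule D1.weyl_universal[OF R1_lrep hwv1 relv1])
qed

text \<open>The operators \<open>\<tau>2 y b\<close> act on these maps by composition, and a map is determined by its value
  at the generator. So every vector generated from \<open>v\<close> by the \<open>\<tau>2 y b\<close> is the value of a unique
  map, which gives the bilinear pairing of \<open>W(\<psi>\<^sub>1, I)\<close> and \<open>W(\<psi>\<^sub>2, J)\<close>.\<close>

definition hom_space where
  "hom_space = {\<phi>. lin_map D1.W (free_vs UNIV) \<phi> \<and>
     (\<forall>x\<in>derived G. \<forall>a\<in>carrier A. \<forall>m\<in>carrier D1.W. \<phi> (act D1.W (lp x a) m) = \<tau>1 x a (\<phi> m))}"

lemma hom_spaceD:
  assumes "\<phi> \<in> hom_space"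
  shows "lin_map D1.W (free_vs UNIV) \<phi>"
    "x \<in> derived G \<Longrightarrow> a \<in> carrier A \<Longrightarrow> m \<in> carrier D1.W \<Longrightarrow> \<phi> (act D1.W (lp x a) m) = \<tau>1 x a (\<phi> m)"
    "m \<in> carrier D1.W \<Longrightarrow> m' \<in> carrier D1.W \<Longrightarrow> \<phi> (m \<oplus>\<^bsub>D1.W\<^esub> m') = \<phi> m + \<phi> m'"
    "m \<in> carrier D1.W \<Longrightarrow> \<phi> (k \<odot>\<^bsub>D1.W\<^esub> m) = pscale k (\<phi> m)"
  using assms lin_mapD[of D1.W "free_vs UNIV" \<phi>] by (auto simp: hom_space_def)

text \<open>Equivariance under g' \<otimes> A determines a map, because lowering operators generate
  the module from its highest weight vector. Equivariance under h'' would be lost on composing with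
  \<tau>\<open>2 y b\<close>, as the action of h'' does not in general commute with it.\<close>

lemma hom_space_eq:
  assumes "\<phi> \<in> hom_space" "\<phi>' \<in> hom_space" "\<phi> D1.wv = \<phi>' D1.wv" "m \<in> carrier D1.W"
  shows "\<phi> m = \<phi>' m"
proof -
  note D = D1.W_lrep D1.W_cyclic D1.W_hwv
  have "m \<in> D1.neg_span D1.W D1.wv" using assms(4) D1.neg_span_carrier[OF D] by simp
  then show ?thesis
  proof (induction rule: D1.neg_span.induct)
    case vec show ?case by (rule assms(3))
  next
    case (add w w')
    then show ?case using D1.neg_span_closed[OF D] by (simp add: hom_spaceD(3)[OF assms(1)] hom_spaceD(3)[OF assms(2)])
  next
    case (smult w c)
    then show ?case using D1.neg_span_closed[OF D] by (simp add: hom_spaceD(4)[OF assms(1)] hom_spaceD(4)[OF assms(2)])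
  next
    case (low w a ws)
    then show ?case using D1.neg_span_closed[OF D]
      by (simp add: hom_spaceD(2)[OF assms(1) fw_derived] hom_spaceD(2)[OF assms(2) fw_derived])
  qed
qed

lemma hom_spaceI:
  assumes "\<And>m m'. m \<in> carrier D1.W \<Longrightarrow> m' \<in> carrier D1.W \<Longrightarrow> \<phi> (m \<oplus>\<^bsub>D1.W\<^esub> m') = \<phi> m + \<phi> m'"
    and "\<And>k m. m \<in> carrier D1.W \<Longrightarrow> \<phi> (k \<odot>\<^bsub>D1.W\<^esub> m) = pscale k (\<phi> m)"
    and "\<And>x a m. x \<in> derived G \<Longrightarrow> a \<in> carrier A \<Longrightarrow> m \<in> carrier D1.W \<Longrightarrow> \<phi> (act D1.W (lp x a) m) = \<tau>1 x a (\<phi> m)"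
  shows "\<phi> \<in> hom_space"
  unfolding hom_space_def using assms by (auto intro!: lin_mapI)

lemma hom_space_add: "\<phi> \<in> hom_space \<Longrightarrow> \<phi>' \<in> hom_space \<Longrightarrow> (\<lambda>m. \<phi> m + \<phi>' m) \<in> hom_space"
  by (rule hom_spaceI) (simp_all add: hom_spaceD pscale_simps clinD[OF c \<tau>'_clin] add_ac)

lemma hom_space_smult: "\<phi> \<in> hom_space \<Longrightarrow> (\<lambda>m. pscale k (\<phi> m)) \<in> hom_space"
  by (rule hom_spaceI) (simp_all add: hom_spaceD pscale_simps(2) clinD[OF c \<tau>'_clin] pscale_commute)

lemma hom_space_\<tau>2: "\<phi> \<in> hom_space \<Longrightarrow> y \<in> derived G \<Longrightarrow> b \<in> carrier A \<Longrightarrow> (\<lambda>m. \<tau>2 y b (\<phi> m)) \<in> hom_space"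
  by (rule hom_spaceI) (simp_all add: hom_spaceD clinD[OF c S2.\<tau>'_clin] \<tau>_commute)

sublocale W12: rep_tensor L D1.W D2.W
  by (rule rep_tensor.intro[OF prelie_axioms rep_tensor_axioms.intro[OF D1.W_lrep D2.W_lrep]])

text \<open>The pairing \<beta>\<open>m m'\<close> evaluates at \<open>m\<close> the unique map
  sending the first generator to \<phi>\<open>2 m'\<close>. Acting on \<open>m\<close> gives
  \<tau>\<open>1\<close> by membership in \<open>hom_space\<close>, acting on \<open>m'\<close>
  gives \<tau>\<open>2\<close> by uniqueness, and on a pure tensor the two add up to \<tau>.\<close>

lemma tensor_hom: "\<exists>\<Psi>. lin_map W12.T.T (free_vs UNIV) \<Psi> \<and> \<Psi> (W12.tn D1.wv D2.wv) = v \<and>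
    (\<forall>x\<in>derived G. \<forall>a\<in>carrier A. \<forall>X\<in>carrier W12.T.T. \<Psi> (act W12.MN (lp x a) X) = \<tau> x a (\<Psi> X))"
proof -
  interpret sw: split_weyl G A HC J I e' e \<tau> \<delta> \<psi>2 \<psi>1 n2 n1 v by (rule swap)
  obtain \<phi>1 where \<phi>1: "rep_hom L D1.W R1 \<phi>1" "\<phi>1 D1.wv = v" using hom1 by blast
  have \<phi>1H: "\<phi>1 \<in> hom_space"
    using \<phi>1(1) lp_closed unfolding hom_space_def rep_hom_def crep_rec_lin_map by (auto simp del: L_simps simp: R1_lp)
  obtain \<phi>2 where \<phi>2: "rep_hom L D2.W sw.R1 \<phi>2" "\<phi>2 D2.wv = v" using sw.hom1 by blast
  have "\<phi>2 \<in> sw.hom_space"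
    using \<phi>2(1) lp_closed unfolding sw.hom_space_def rep_hom_def crep_rec_lin_map by (auto simp del: L_simps simp: sw.R1_lp)
  note \<phi>2D = sw.hom_spaceD[OF this]
  note D = D2.W_lrep D2.W_cyclic D2.W_hwv
  \<comment> \<open>Start from \<phi>\<open>1\<close>, which corresponds to the generator, and
    follow the lowering operators generating the second module; each is matched by composing with
    the operator of \<tau>\<open>2\<close>.\<close>
  have ex: "\<exists>\<phi>. \<phi> \<in> hom_space \<and> \<phi> D1.wv = \<phi>2 m" if "m \<in> carrier D2.W" for m
    using that[folded D2.neg_span_carrier[OF D]]
  proof (induction rule: D2.neg_span.induct)
    case vec show ?case using \<phi>1H \<phi>1(2) \<phi>2(2) by auto
  next
    case (add w w')
    then show ?case using \<phi>2D(3) D2.neg_span_closed[OF D] hom_space_add by fastforce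
  next
    case (smult w k)
    then show ?case using \<phi>2D(4) D2.neg_span_closed[OF D] hom_space_smult by fastforce
  next
    case (low w a ws)
    then show ?case using \<phi>2D(2)[OF fw_derived] D2.neg_span_closed[OF D] hom_space_\<tau>2[OF _ fw_derived] by fastforce
  qed
  define \<beta> where "\<beta> m m' = (SOME \<phi>. \<phi> \<in> hom_space \<and> \<phi> D1.wv = \<phi>2 m') m" for m m'
  have \<beta>: "(\<lambda>m. \<beta> m m') \<in> hom_space" "\<beta> D1.wv m' = \<phi>2 m'" if "m' \<in> carrier D2.W" for m'
    using someI_ex[OF ex[OF that]] unfolding \<beta>_def by auto
  have \<beta>_eq: "\<beta> m m' = \<phi> m" if "m' \<in> carrier D2.W" "m \<in> carrier D1.W" "\<phi> \<in> hom_space" "\<phi> D1.wv = \<phi>2 m'" for \<phi> m m'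
    using hom_space_eq[OF \<beta>(1)[OF that(1)] that(3) _ that(2)] \<beta>(2)[OF that(1)] that(4) by simp
  note n1 = cmod_simps[OF lrepD(1)[OF D1.W_lrep]] and n2 = cmod_simps[OF lrepD(1)[OF D2.W_lrep]]
  \<comment> \<open>Although \<beta> is defined by choice, uniqueness of the chosen maps makes it
    linear in the second argument.\<close>
  have bil: "bilin D1.W D2.W (free_vs UNIV) \<beta>"
    unfolding bilin_def
  proof (intro conjI ballI)
    show "lin_map D1.W (free_vs UNIV) (\<lambda>m. \<beta> m m')" if "m' \<in> carrier D2.W" for m'
      by (rule hom_spaceD(1)[OF \<beta>(1)[OF that]])
    fix m assume m: "m \<in> carrier D1.W"
    show "lin_map D2.W (free_vs UNIV) (\<beta> m)"
    proof (rule lin_mapI)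
      fix m1 m2 assume "m1 \<in> carrier D2.W" "m2 \<in> carrier D2.W"
      then show "\<beta> m (m1 \<oplus>\<^bsub>D2.W\<^esub> m2) = \<beta> m m1 \<oplus>\<^bsub>free_vs UNIV\<^esub> \<beta> m m2"
        using \<beta>_eq[OF _ m hom_space_add[OF \<beta>(1) \<beta>(1)], of "m1 \<oplus>\<^bsub>D2.W\<^esub> m2" m1 m2] n2(1) \<beta>(2) \<phi>2D(3) by simp
    next
      fix k m1 assume "m1 \<in> carrier D2.W"
      then show "\<beta> m (k \<odot>\<^bsub>D2.W\<^esub> m1) = k \<odot>\<^bsub>free_vs UNIV\<^esub> \<beta> m m1"
        using \<beta>_eq[OF _ m hom_space_smult[OF \<beta>(1)], of "k \<odot>\<^bsub>D2.W\<^esub> m1" m1 k] n2(3) \<beta>(2) \<phi>2D(4) by simp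
    qed simp
  qed
  note lin = W12.T.tlift_lin_map[OF free_vs_cmod bil] and tens = W12.T.tlift_tens[OF free_vs_cmod bil]
  let ?\<Psi> = "W12.T.tlift (free_vs UNIV) \<beta>"
  have wv: "D1.wv \<in> carrier D1.W" "D2.wv \<in> carrier D2.W" using D1.W_hwv D2.W_hwv by (auto simp: hwv_def)
  have "?\<Psi> (W12.tn D1.wv D2.wv) = v" using tens[OF wv] \<beta>(2)[OF wv(2)] \<phi>2(2) by simp
  moreover have "?\<Psi> (act W12.MN (lp x a) X) = \<tau> x a (?\<Psi> X)" if x: "x \<in> derived G" "a \<in> carrier A" and X: "X \<in> carrier W12.T.T" for x a X
  proof (rule W12.T.tensor_map_unique[OF free_vs_cmod lin_map_comp[OF lin W12.MN_act_lin[OF lp_closed[OF x]]] lin_map_comp[OF _ lin] _ X])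
    show "lin_map (free_vs UNIV) (free_vs UNIV) (\<tau> x a)" using crepD(1)[OF c x] by (simp add: clin_iff)
    fix m m' assume m: "m \<in> carrier D1.W" "m' \<in> carrier D2.W"
    note cl = act_lp_closed[OF D1.W_lrep x m(1)] act_lp_closed[OF D2.W_lrep x m(2)]
    have "\<beta> m (act D2.W (lp x a) m') = \<tau>2 x a (\<beta> m m')"
      using \<beta>_eq[OF cl(2) m(1) hom_space_\<tau>2[OF \<beta>(1)[OF m(2)] x]] \<beta>(2)[OF m(2)] \<phi>2D(2)[OF x m(2)] by simp
    moreover have "\<beta> (act D1.W (lp x a) m) m' = \<tau>1 x a (\<beta> m m')"
      by (rule hom_spaceD(2)[OF \<beta>(1)[OF m(2)] x m(1)])
    ultimately show "?\<Psi> (act W12.MN (lp x a) (W12.tn m m')) = \<tau> x a (?\<Psi> (W12.tn m m'))"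
      unfolding W12.MN_act_tens[OF lp_closed[OF x] m] lin_mapD(2)[OF lin W12.T.tens_closed[OF cl(1) m(2)] W12.T.tens_closed[OF m(1) cl(2)]]
        tens[OF cl(1) m(2)] tens[OF m(1) cl(2)] tens[OF m] \<tau>_split[OF x] by simp
  qed
  ultimately show ?thesis using lin by blast
qed

end

section \<open>The isomorphism\<close>

locale weyl_pair = curr G A HC + D1: hw_data G A HC \<psi>1 I n1 + D2: hw_data G A HC \<psi>2 J n2
  for G :: "('g, 'i::finite) km_algebra_rec" (structure) and A :: "(complex, 'a) module" and HC \<psi>1 I n1 \<psi>2 J n2 +
  assumes IJ: "I <+>\<^bsub>A\<^esub> J = carrier A"
    and \<psi>1I: "h \<in> cartan' G \<Longrightarrow> a \<in> I \<Longrightarrow> \<psi>1 (loop_elt G A h a) = 0"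
    and \<psi>2J: "h \<in> cartan' G \<Longrightarrow> a \<in> J \<Longrightarrow> \<psi>2 (loop_elt G A h a) = 0"
begin

sublocale D: hw_data G A HC "\<lambda>y. \<psi>1 y + \<psi>2 y" "I \<inter> J" "\<lambda>i. n1 i + n2 i"
proof (intro hw_data.intro hw_data_axioms.intro curr_axioms)
  show "lin_functional (L\<lparr>carrier := HH\<rparr>) (\<lambda>y. \<psi>1 y + \<psi>2 y)"
    using D1.\<psi> D2.\<psi> by (simp add: lin_functional_def algebra_simps)
  show "ideal (I \<inter> J) A" by (rule A.i_intersect[OF D1.I D2.I])
qed (simp add: D1.nn D2.nn)

sublocale W12: rep_tensor L D1.W D2.W
  by (rule rep_tensor.intro[OF prelie_axioms rep_tensor_axioms.intro[OF D1.W_lrep D2.W_lrep]])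

abbreviation v where "v \<equiv> W12.tn D1.wv D2.wv"

lemma wv_closed: "D1.wv \<in> carrier D1.W" "D2.wv \<in> carrier D2.W"
  using D1.W_hwv D2.W_hwv by (auto simp: hwv_def)

lemma v_closed: "v \<in> carrier W12.MN"
  using W12.T.tens_closed[OF wv_closed] by simp

lemma MN_act_lp: "x \<in> derived G \<Longrightarrow> a \<in> carrier A \<Longrightarrow> m \<in> carrier D1.W \<Longrightarrow> m' \<in> carrier D2.W \<Longrightarrow>
    act W12.MN (lp x a) (W12.tn m m') = W12.tn (act D1.W (lp x a) m) m' \<oplus>\<^bsub>W12.T.T\<^esub> W12.tn m (act D2.W (lp x a) m')"
  and MN_act_dl: "h \<in> HC \<Longrightarrow> m \<in> carrier D1.W \<Longrightarrow> m' \<in> carrier D2.W \<Longrightarrow>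
    act W12.MN (dl h) (W12.tn m m') = W12.tn (act D1.W (dl h) m) m' \<oplus>\<^bsub>W12.T.T\<^esub> W12.tn m (act D2.W (dl h) m')"
  using W12.MN_act_tens[OF lp_closed] W12.MN_act_tens[OF dl_closed] by blast+

section \<open>The tensor product of the two generators as a highest weight vector, and nilpotency
  on the tensor product\<close>

lemma v_hwv: "hwv W12.MN (\<lambda>y. \<psi>1 y + \<psi>2 y) v"
  unfolding hwv_def
proof (intro conjI ballI v_closed)
  note h1 = D1.W_hwv[unfolded hwv_def] and h2 = D2.W_hwv[unfolded hwv_def]
  note tz = W12.T.tens_zero(1)[OF wv_closed(1)] W12.T.tens_zero(2)[OF wv_closed(2)]
  have sm: "W12.tn (c \<odot>\<^bsub>D1.W\<^esub> D1.wv) D2.wv \<oplus>\<^bsub>W12.T.T\<^esub> W12.tn D1.wv (d \<odot>\<^bsub>D2.W\<^esub> D2.wv) = (c + d) \<odot>\<^bsub>W12.MN\<^esub> v" for c d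
    using wv_closed W12.T.tens_closed[OF wv_closed] by (simp add: W12.T.tens_smult_left W12.T.tens_smult_right W12.T.ts)
  show "act W12.MN (lp x a) v = \<zero>\<^bsub>W12.MN\<^esub>" if x: "x \<in> nilp_pos G" and a: "a \<in> carrier A" for x a
  proof -
    have "x \<in> derived G" using x nilp_pos_derived by auto
    then show ?thesis using x a h1 h2 by (simp add: MN_act_lp wv_closed tz W12.T.ts)
  qed
  show "act W12.MN (lp h a) v = (\<psi>1 (lp h a) + \<psi>2 (lp h a)) \<odot>\<^bsub>W12.MN\<^esub> v" if h: "h \<in> cartan' G" and a: "a \<in> carrier A" for h a
    using h a h1 h2 sm by (simp add: MN_act_lp wv_closed cartan'_derived)
  show "act W12.MN (dl h) v = (\<psi>1 (dl h) + \<psi>2 (dl h)) \<odot>\<^bsub>W12.MN\<^esub> v" if h: "h \<in> HC" for h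
    using h h1 h2 sm by (simp add: MN_act_dl wv_closed)
qed

text \<open>The power of \<open>I \<inter> J\<close> with the summed exponent lies in the power of
  \<open>I\<close> with exponent \<open>n1 i\<close> and in that of \<open>J\<close> with exponent
  \<open>n2 i\<close>, so each of the two terms of the action vanishes.\<close>

lemma v_relv: "D.relv W12.MN v"
  unfolding D.relv_def
proof (intro allI ballI)
  fix i a assume a: "a \<in> ideal_pow A (I \<inter> J) (n1 i + n2 i)"
  have "a \<in> ideal_pow A I (n1 i)"
    using a A.ideal_pow_mono[of "I \<inter> J" I "n1 i + n2 i"] A.ideal_pow_antimono[OF D1.I, of "n1 i" "n1 i + n2 i"] by auto
  moreover have "a \<in> ideal_pow A J (n2 i)"
    using a A.ideal_pow_mono[of "I \<inter> J" J "n1 i + n2 i"] A.ideal_pow_antimono[OF D2.I, of "n2 i" "n1 i + n2 i"] by auto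
  ultimately show "act W12.MN (lp (chev_f G i) a) v = \<zero>\<^bsub>W12.MN\<^esub>"
    using D1.W_relv D2.W_relv D.ideal_pow_carrier[OF a] W12.T.tens_zero(1)[OF wv_closed(1)] W12.T.tens_zero(2)[OF wv_closed(2)]
    by (simp add: MN_act_lp chev_derived wv_closed D1.relv_def D2.relv_def W12.T.ts)
qed

text \<open>On pure tensors this is the argument for sums of commuting nilpotent operators, by
  induction on the sum of the two exponents; pure tensors span.\<close>

lemma MN_f_nilpotent:
  assumes "X \<in> carrier W12.MN" shows "\<exists>n. (fop W12.MN i ^^ n) X = \<zero>\<^bsub>W12.MN\<^esub>"
proof -
  have F: "lin_map W12.T.T W12.T.T (fop W12.MN i)" by (rule W12.MN_act_lin[OF f_closed])
  have z: "fop W12.MN i \<zero>\<^bsub>W12.T.T\<^esub> = \<zero>\<^bsub>W12.T.T\<^esub>" by (rule lin_map_zero[OF W12.T.T_cmod W12.T.T_cmod F])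
  have zn: "(fop W12.MN i ^^ n) \<zero>\<^bsub>W12.T.T\<^esub> = \<zero>\<^bsub>W12.T.T\<^esub>" for n by (induction n) (simp_all add: z)
  have addn: "(fop W12.MN i ^^ n) (X \<oplus>\<^bsub>W12.T.T\<^esub> Y) = (fop W12.MN i ^^ n) X \<oplus>\<^bsub>W12.T.T\<^esub> (fop W12.MN i ^^ n) Y"
    if "X \<in> carrier W12.T.T" "Y \<in> carrier W12.T.T" for X Y n
    using that by (induction n arbitrary: X Y) (simp_all add: funpow_swap1 lin_mapD[OF F] del: funpow.simps(2) add: funpow_Suc_right)
  have f1: "fop D1.W i m \<in> carrier D1.W" if "m \<in> carrier D1.W" for m using lrepD(5)[OF D1.W_lrep f_closed that] .
  have f2: "fop D2.W i m \<in> carrier D2.W" if "m \<in> carrier D2.W" for m using lrepD(5)[OF D2.W_lrep f_closed that] .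
  have pure: "(fop W12.MN i ^^ (a + b)) (W12.tn m m') = \<zero>\<^bsub>W12.T.T\<^esub>"
    if "m \<in> carrier D1.W" "m' \<in> carrier D2.W" "(fop D1.W i ^^ a) m = \<zero>\<^bsub>D1.W\<^esub>" "(fop D2.W i ^^ b) m' = \<zero>\<^bsub>D2.W\<^esub>" for a b m m'
    using that
  proof (induction "a + b" arbitrary: a b m m')
    case 0
    then show ?case using W12.T.tens_zero(1) by simp
  next
    case (Suc n)
    show ?case
    proof (cases "a = 0 \<or> b = 0")
      case True
      then have "W12.tn m m' = \<zero>\<^bsub>W12.T.T\<^esub>" using Suc.prems W12.T.tens_zero by auto
      then show ?thesis using zn by simp
    next
      case False
      then obtain a' b' where ab: "a = Suc a'" "b = Suc b'" by (metis not0_implies_Suc)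
      have 1: "(fop W12.MN i ^^ n) (W12.tn (fop D1.W i m) m') = \<zero>\<^bsub>W12.T.T\<^esub>"
        using Suc.hyps(1)[of a' b "fop D1.W i m" m'] Suc.hyps(2) Suc.prems ab f1 by (simp add: funpow_swap1)
      have 2: "(fop W12.MN i ^^ n) (W12.tn m (fop D2.W i m')) = \<zero>\<^bsub>W12.T.T\<^esub>"
        using Suc.hyps(1)[of a b' m "fop D2.W i m'"] Suc.hyps(2) Suc.prems ab f2 by (simp add: funpow_swap1)
      have "(fop W12.MN i ^^ Suc n) (W12.tn m m') = (fop W12.MN i ^^ n) (fop W12.MN i (W12.tn m m'))" by (simp add: funpow_swap1)
      also have "\<dots> = \<zero>\<^bsub>W12.T.T\<^esub>"
        unfolding W12.MN_act_tens[OF f_closed Suc.prems(1,2)]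
        using addn[OF W12.T.tens_closed[OF f1 Suc.prems(2)] W12.T.tens_closed[OF Suc.prems(1) f2], of m m' n] Suc.prems 1 2 by (simp add: W12.T.ts)
      finally show ?thesis using Suc.hyps(2) by simp
    qed
  qed
  have "lin_subspace W12.T.T {w\<in>carrier W12.T.T. \<exists>n. (fop W12.MN i ^^ n) w \<in> {\<zero>\<^bsub>W12.T.T\<^esub>}}"
    using z by (intro nilpotent_mod_subspace[OF W12.T.T_cmod F lin_subspace_zero[OF W12.T.T_cmod]]) simp
  moreover have "{W12.tn m m' | m m'. m \<in> carrier D1.W \<and> m' \<in> carrier D2.W} \<subseteq> {w\<in>carrier W12.T.T. \<exists>n. (fop W12.MN i ^^ n) w \<in> {\<zero>\<^bsub>W12.T.T\<^esub>}}"
    using pure D1.W_f_nilpotent[of _ i] D2.W_f_nilpotent[of _ i] W12.T.tens_closed by blast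
  ultimately have "lin_span W12.T.T {W12.tn m m' | m m'. m \<in> carrier D1.W \<and> m' \<in> carrier D2.W} \<subseteq> {w\<in>carrier W12.T.T. \<exists>n. (fop W12.MN i ^^ n) w \<in> {\<zero>\<^bsub>W12.T.T\<^esub>}}"
    by (rule lin_span_least)
  then show ?thesis using assms unfolding W12.T.tensor_span by auto
qed

section \<open>Generation of the tensor product by the product of the two generators\<close>

context
  fixes K assumes K: "rep_submodule L W12.MN K" and vK: "v \<in> K"
begin

lemma Ksub: "lin_subspace W12.T.T K"
  using rep_submoduleD(1)[OF K] W12.MN_cmod W12.T.T_cmod by (simp add: lin_subspace_iff)

lemmas Ks = lin_subspaceD[OF W12.T.T_cmod Ksub]

lemma K_cancel:
  assumes "X \<in> carrier W12.T.T" "Y \<in> carrier W12.T.T" "X \<oplus>\<^bsub>W12.T.T\<^esub> Y \<in> K"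
  shows "Y \<in> K \<Longrightarrow> X \<in> K" "X \<in> K \<Longrightarrow> Y \<in> K"
proof -
  have *: "X \<in> K" if "X \<in> carrier W12.T.T" "Y \<in> carrier W12.T.T" "X \<oplus>\<^bsub>W12.T.T\<^esub> Y \<in> K" "Y \<in> K" for X Y
  proof -
    have "Y \<oplus>\<^bsub>W12.T.T\<^esub> (-1) \<odot>\<^bsub>W12.T.T\<^esub> Y = \<zero>\<^bsub>W12.T.T\<^esub>" using cmod_sub_eq_zero[OF W12.T.T_cmod that(2,2)] by simp
    then have "X = (X \<oplus>\<^bsub>W12.T.T\<^esub> Y) \<oplus>\<^bsub>W12.T.T\<^esub> (-1) \<odot>\<^bsub>W12.T.T\<^esub> Y"
      using cmod_ac(1)[OF W12.T.T_cmod that(1,2) cmod_simps(3)[OF W12.T.T_cmod that(2), of "-1"]] cmod_simps(5)[OF W12.T.T_cmod that(1)] by simp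
    then show ?thesis using Ks(3)[OF that(3) Ks(4)[OF that(4)]] by metis
  qed
  show "Y \<in> K \<Longrightarrow> X \<in> K" by (rule *[OF assms])
  show "X \<in> K \<Longrightarrow> Y \<in> K" using *[OF assms(2,1)] assms cmod_ac(2)[OF W12.T.T_cmod assms(1,2)] by simp
qed

text \<open>With \<open>e\<close> chosen for the larger exponent, \<open>x \<otimes> ae\<close>
  kills \<open>m'\<close> and acts on \<open>m\<close> like \<open>x \<otimes> a\<close>; its action
  on the tensor is therefore the first vector. The second is the full action of
  \<open>x \<otimes> a\<close> minus the first.\<close>

lemma K_lp:
  assumes x: "x \<in> derived G" and a: "a \<in> carrier A" and m: "m \<in> carrier D1.W" "m' \<in> carrier D2.W" and t: "W12.tn m m' \<in> K"
  shows "W12.tn (act D1.W (lp x a) m) m' \<in> K" "W12.tn m (act D2.W (lp x a) m') \<in> K"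
proof -
  have "\<exists>p. \<forall>a\<in>ideal_pow A I p. act D1.W (lp x a) m = \<zero>\<^bsub>D1.W\<^esub>"
    by (rule D1.smooth[OF D1.W_lrep D1.W_cyclic D1.W_hwv D1.W_relv \<psi>1I m(1) x])
  then obtain p where p: "\<forall>a\<in>ideal_pow A I p. act D1.W (lp x a) m = \<zero>\<^bsub>D1.W\<^esub>" ..
  have "\<exists>q. \<forall>a\<in>ideal_pow A J q. act D2.W (lp x a) m' = \<zero>\<^bsub>D2.W\<^esub>"
    by (rule D2.smooth[OF D2.W_lrep D2.W_cyclic D2.W_hwv D2.W_relv \<psi>2J m(2) x])
  then obtain q where q: "\<forall>a\<in>ideal_pow A J q. act D2.W (lp x a) m' = \<zero>\<^bsub>D2.W\<^esub>" ..
  obtain e where e: "e \<in> ideal_pow A J (max p q)" "\<one>\<^bsub>A\<^esub> \<ominus>\<^bsub>A\<^esub> e \<in> ideal_pow A I (max p q)"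
    using A.coprime_ideal_pow[OF D1.I D2.I IJ] by blast
  let ?b = "a \<star> e" and ?c = "a \<star> (\<one>\<^bsub>A\<^esub> \<ominus>\<^bsub>A\<^esub> e)"
  have ec: "e \<in> carrier A" using e(1) D2.ideal_pow_carrier by blast
  have bc: "?b \<in> carrier A" "?c \<in> carrier A" using a ec by auto
  have "e \<in> ideal_pow A J q" "\<one>\<^bsub>A\<^esub> \<ominus>\<^bsub>A\<^esub> e \<in> ideal_pow A I p"
    using e A.ideal_pow_antimono[OF D2.I, of q "max p q"] A.ideal_pow_antimono[OF D1.I, of p "max p q"] by auto
  then have "?b \<in> ideal_pow A J q" "?c \<in> ideal_pow A I p"
    using ideal.I_l_closed[OF A.ideal_pow_ideal[OF D2.I] _ a] ideal.I_l_closed[OF A.ideal_pow_ideal[OF D1.I] _ a] by auto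
  then have 1: "act D1.W (lp x ?c) m = \<zero>\<^bsub>D1.W\<^esub>" and 2: "act D2.W (lp x ?b) m' = \<zero>\<^bsub>D2.W\<^esub>" using p q by auto
  note cl = act_lp_closed[OF D1.W_lrep x a m(1)] act_lp_closed[OF D1.W_lrep x bc(1) m(1)] act_lp_closed[OF D2.W_lrep x a m(2)]
  have "a = ?b \<oplus>\<^bsub>A\<^esub> ?c" using a ec by algebra
  then have "act D1.W (lp x a) m = act D1.W (lp x ?b) m \<oplus>\<^bsub>D1.W\<^esub> act D1.W (lp x ?c) m"
    using act_lp_bilinD(3)[OF D1.W_lrep x bc(1) m(1) bc(2)] by simp
  then have 3: "act D1.W (lp x a) m = act D1.W (lp x ?b) m" using 1 cmod_simps(5)[OF lrepD(1)[OF D1.W_lrep] cl(2)] by simp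
  have "act W12.MN (lp x ?b) (W12.tn m m') \<in> K" by (rule rep_submoduleD(2)[OF K lp_closed[OF x bc(1)] t])
  then show 4: "W12.tn (act D1.W (lp x a) m) m' \<in> K"
    unfolding 3 MN_act_lp[OF x bc(1) m] 2 W12.T.tens_zero(1)[OF m(1)] cmod_simps(5)[OF W12.T.T_cmod W12.T.tens_closed[OF cl(2) m(2)]] .
  have "act W12.MN (lp x a) (W12.tn m m') \<in> K" by (rule rep_submoduleD(2)[OF K lp_closed[OF x a] t])
  then show "W12.tn m (act D2.W (lp x a) m') \<in> K"
    unfolding MN_act_lp[OF x a m] using 4 by (rule K_cancel(2)[OF W12.T.tens_closed[OF cl(1) m(2)] W12.T.tens_closed[OF m(1) cl(3)]])
qed

lemma K_carrier: "K = carrier W12.T.T"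
proof
  \<comment> \<open>The action of h'' cannot be separated by \<open>e\<close>. The second factor is
    held at its generator, where h'' acts by a scalar that can be subtracted inside
    \<open>K\<close>.\<close>
  have 1: "W12.tn m D2.wv \<in> K" if "m \<in> carrier D1.W" for m
  proof -
    let ?S = "{m\<in>carrier D1.W. W12.tn m D2.wv \<in> K}"
    have "lin_subspace D1.W ?S"
      unfolding lin_subspace_iff[OF lrepD(1)[OF D1.W_lrep]]
      using Ks wv_closed(2) W12.T.tens_zero(2) by (auto simp: W12.T.tens_add_left W12.T.tens_smult_left W12.ms)
    then have "rep_submodule L D1.W ?S"
    proof (rule rep_submodule_currI[OF D1.W_lrep])
      show "act D1.W (lp x a) m \<in> ?S" if "x \<in> derived G" "a \<in> carrier A" "m \<in> ?S" for x a m
        using that K_lp(1)[OF that(1,2) _ wv_closed(2)] act_lp_closed[OF D1.W_lrep] by simp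
      fix h m assume h: "h \<in> HC" and m: "m \<in> ?S"
      then have mc: "m \<in> carrier D1.W" "W12.tn m D2.wv \<in> K" by auto
      have w: "act D2.W (dl h) D2.wv = \<psi>2 (dl h) \<odot>\<^bsub>D2.W\<^esub> D2.wv" using D2.W_hwv h by (simp add: hwv_def)
      have "act W12.MN (dl h) (W12.tn m D2.wv) \<in> K" by (rule rep_submoduleD(2)[OF K dl_closed[OF h] mc(2)])
      then have "W12.tn (act D1.W (dl h) m) D2.wv \<oplus>\<^bsub>W12.T.T\<^esub> \<psi>2 (dl h) \<odot>\<^bsub>W12.T.T\<^esub> W12.tn m D2.wv \<in> K"
        using MN_act_dl[OF h mc(1) wv_closed(2)] W12.T.tens_smult_right[OF mc(1) wv_closed(2)] w by simp
      then have "W12.tn (act D1.W (dl h) m) D2.wv \<in> K"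
        by (rule K_cancel(1)[OF W12.T.tens_closed[OF act_dl_closed[OF D1.W_lrep h mc(1)] wv_closed(2)]
              cmod_simps(3)[OF W12.T.T_cmod W12.T.tens_closed[OF mc(1) wv_closed(2)]] _ Ks(4)[OF mc(2)]])
      then show "act D1.W (dl h) m \<in> ?S" using act_dl_closed[OF D1.W_lrep h mc(1)] by simp
    qed
    then have "?S = carrier D1.W" by (rule cyclicD[OF D1.W_cyclic]) (use vK wv_closed in simp)
    then show ?thesis using that by blast
  qed
  \<comment> \<open>Quantifying over all \<open>m\<close> lets the term in which h'' moves the first
    factor be recognised as lying in \<open>K\<close>.\<close>
  have 2: "\<forall>m\<in>carrier D1.W. W12.tn m m' \<in> K" if "m' \<in> carrier D2.W" for m'
  proof -
    let ?S = "{m'\<in>carrier D2.W. \<forall>m\<in>carrier D1.W. W12.tn m m' \<in> K}"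
    have "lin_subspace D2.W ?S"
      unfolding lin_subspace_iff[OF lrepD(1)[OF D2.W_lrep]]
      using Ks W12.T.tens_zero(1) by (auto simp: W12.T.tens_add_right W12.T.tens_smult_right W12.ns)
    then have "rep_submodule L D2.W ?S"
    proof (rule rep_submodule_currI[OF D2.W_lrep])
      show "act D2.W (lp x a) m \<in> ?S" if "x \<in> derived G" "a \<in> carrier A" "m \<in> ?S" for x a m
        using that K_lp(2)[OF that(1,2)] act_lp_closed[OF D2.W_lrep] by simp
      fix h m' assume h: "h \<in> HC" and m': "m' \<in> ?S"
      then have mc: "m' \<in> carrier D2.W" by auto
      have "W12.tn m (act D2.W (dl h) m') \<in> K" if m: "m \<in> carrier D1.W" for m
      proof -
        note c = act_dl_closed[OF D1.W_lrep h m] act_dl_closed[OF D2.W_lrep h mc]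
        have "act W12.MN (dl h) (W12.tn m m') \<in> K" using rep_submoduleD(2)[OF K dl_closed[OF h]] m m' by blast
        moreover have "W12.tn (act D1.W (dl h) m) m' \<in> K" using c(1) m' by blast
        ultimately show ?thesis
          unfolding MN_act_dl[OF h m mc] by (rule K_cancel(2)[OF W12.T.tens_closed[OF c(1) mc] W12.T.tens_closed[OF m c(2)]])
      qed
      then show "act D2.W (dl h) m' \<in> ?S" using act_dl_closed[OF D2.W_lrep h mc] by simp
    qed
    then have "?S = carrier D2.W" by (rule cyclicD[OF D2.W_cyclic]) (use 1 wv_closed in simp)
    then show ?thesis using that by blast
  qed
  show "K \<subseteq> carrier W12.T.T" using Ks(1) by auto
  have "lin_span W12.T.T {W12.tn m m' | m m'. m \<in> carrier D1.W \<and> m' \<in> carrier D2.W} \<subseteq> K"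
    using 2 by (intro lin_span_least[OF Ksub]) blast
  then show "carrier W12.T.T \<subseteq> K" unfolding W12.T.tensor_span .
qed

end

text \<open>\<open>split_weyl\<close> is applied to the retract of W into a free space, so \<Psi>
  has values in that space. The last clause is its equivariance at tensors whose image comes from W,
  which is all that the comparison with \<iota> uses.\<close>

lemma splitting_exists:
  obtains \<iota> :: "('g, 'a) current verma_carrier set set set \<Rightarrow> (('g, 'a) current verma_carrier set set set \<Rightarrow>\<^sub>0 complex)" and \<Psi> where
    "\<And>w w'. w \<in> carrier D.W \<Longrightarrow> w' \<in> carrier D.W \<Longrightarrow> \<iota> w = \<iota> w' \<Longrightarrow> w = w'"
    "lin_map D.W (free_vs UNIV) \<iota>" "lin_map W12.T.T (free_vs UNIV) \<Psi>" "\<Psi> v = \<iota> D.wv"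
    "\<And>x a X w. x \<in> derived G \<Longrightarrow> a \<in> carrier A \<Longrightarrow> X \<in> carrier W12.T.T \<Longrightarrow> w \<in> carrier D.W \<Longrightarrow> \<Psi> X = \<iota> w \<Longrightarrow>
      \<Psi> (act W12.MN (lp x a) X) = \<iota> (act D.W (lp x a) w)"
proof -
  obtain \<iota> :: "('g, 'a) current verma_carrier set set set \<Rightarrow> (('g, 'a) current verma_carrier set set set \<Rightarrow>\<^sub>0 complex)" and \<pi> \<tau> \<delta>
    where cr: "crep \<tau> \<delta>" and \<iota>: "lin_map D.W (free_vs UNIV) \<iota>" and \<pi>: "lin_map (free_vs UNIV) D.W \<pi>"
    and \<pi>\<iota>: "\<And>m. m \<in> carrier D.W \<Longrightarrow> \<pi> (\<iota> m) = m"
    and \<tau>: "\<And>x a p. \<tau> x a p = \<iota> (act D.W (lp x a) (\<pi> p))" and \<delta>: "\<And>h p. \<delta> h p = \<iota> (act D.W (dl h) (\<pi> p))"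
    by (rule curr_embedding[OF D.W_lrep], rule that)
  note \<iota>D = lin_mapD[OF \<iota>, simplified] and \<pi>D = lin_mapD[OF \<pi>, simplified]
  have \<iota>0: "\<iota> \<zero>\<^bsub>D.W\<^esub> = 0" using lin_map_zero[OF lrepD(1)[OF D.W_lrep] free_vs_cmod \<iota>] by simp
  obtain e where e: "\<And>n. e n \<in> ideal_pow A J n" "\<And>n. \<one>\<^bsub>A\<^esub> \<ominus>\<^bsub>A\<^esub> e n \<in> ideal_pow A I n"
    using A.coprime_ideal_pow[OF D1.I D2.I IJ] by metis
  have ec: "e n \<in> carrier A" for n using e(1) D2.ideal_pow_carrier by blast
  have ee: "\<one>\<^bsub>A\<^esub> \<ominus>\<^bsub>A\<^esub> (\<one>\<^bsub>A\<^esub> \<ominus>\<^bsub>A\<^esub> e n) = e n" for n using ec[of n] by algebra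
  \<comment> \<open>Smoothness of W holds for powers of \<open>I \<inter> J\<close>; coprimality
    turns it into the required form for intersections of powers.\<close>
  have sm: "\<exists>n. \<forall>a\<in>ideal_pow A I n \<inter> ideal_pow A J n. \<tau> x a p = 0" if x: "x \<in> derived G" for x p
  proof -
    have z: "\<psi>1 (lp h a) + \<psi>2 (lp h a) = 0" if "h \<in> cartan' G" "a \<in> I \<inter> J" for h a
      using that \<psi>1I \<psi>2J by simp
    have "\<exists>n. \<forall>a\<in>ideal_pow A (I \<inter> J) n. act D.W (lp x a) (\<pi> p) = \<zero>\<^bsub>D.W\<^esub>"
      by (rule D.smooth[OF D.W_lrep D.W_cyclic D.W_hwv D.W_relv z \<pi>D(1) x])
    then obtain n where "\<forall>a\<in>ideal_pow A (I \<inter> J) n. act D.W (lp x a) (\<pi> p) = \<zero>\<^bsub>D.W\<^esub>" ..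
    then show ?thesis using A.coprime_ideal_pow_Int[OF D1.I D2.I IJ, of n] \<iota>0 by (intro exI[of _ n]) (auto simp: \<tau>)
  qed
  have wc: "D.wv \<in> carrier D.W" using D.W_hwv by (simp add: hwv_def)
  note hw = D.W_hwv[unfolded hwv_def]
  have S1: "split_action G A HC I J e (\<lambda>n. \<one>\<^bsub>A\<^esub> \<ominus>\<^bsub>A\<^esub> e n) \<tau> \<delta>"
    by (intro split_action.intro split_action_axioms.intro curr_axioms D1.I D2.I e cr sm refl)
  have S2: "split_action G A HC J I (\<lambda>n. \<one>\<^bsub>A\<^esub> \<ominus>\<^bsub>A\<^esub> e n) e \<tau> \<delta>"
    using sm by (intro split_action.intro split_action_axioms.intro curr_axioms D1.I D2.I e cr ee[symmetric]) (simp add: Int_commute)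
  have nil: "\<exists>n. (\<tau> (chev_f G i) \<one>\<^bsub>A\<^esub> ^^ n) p = 0" for i p
  proof -
    \<comment> \<open>Again one application of the operator moves an arbitrary \<open>p\<close> into
      the image of \<iota>, where nilpotency on W is available.\<close>
    let ?q = "fop D.W i (\<pi> p)"
    have q: "?q \<in> carrier D.W" using act_lp_closed[OF D.W_lrep chev_derived(2) A.one_closed \<pi>D(1)] .
    have cl: "(fop D.W i ^^ n) ?q \<in> carrier D.W" for n
      by (induction n) (use q act_lp_closed[OF D.W_lrep chev_derived(2) A.one_closed] in auto)
    have pow: "(\<tau> (chev_f G i) \<one>\<^bsub>A\<^esub> ^^ n) (\<iota> ?q) = \<iota> ((fop D.W i ^^ n) ?q)" for n
      by (induction n) (simp_all add: \<tau> \<pi>\<iota> cl)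
    obtain n where "(fop D.W i ^^ n) ?q = \<zero>\<^bsub>D.W\<^esub>" using D.W_f_nilpotent[OF q] by blast
    then have "(\<tau> (chev_f G i) \<one>\<^bsub>A\<^esub> ^^ n) (\<tau> (chev_f G i) \<one>\<^bsub>A\<^esub> p) = 0"
      using pow by (simp add: \<tau>[of _ _ p] \<iota>0)
    then show ?thesis by (intro exI[of _ "Suc n"]) (simp add: funpow_swap1)
  qed
  have SW: "split_weyl G A HC I J e (\<lambda>n. \<one>\<^bsub>A\<^esub> \<ominus>\<^bsub>A\<^esub> e n) \<tau> \<delta> \<psi>1 \<psi>2 n1 n2 (\<iota> D.wv)"
    using hw by (intro split_weyl.intro split_pair.intro split_weyl_axioms.intro S1 S2 D1.hw_data_axioms D2.hw_data_axioms \<psi>1I \<psi>2J nil)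
      (simp_all add: \<tau> \<delta> \<pi>\<iota> wc \<iota>0 \<iota>D)
  obtain \<Psi> where \<Psi>: "lin_map W12.T.T (free_vs UNIV) \<Psi>" "\<Psi> v = \<iota> D.wv"
    "\<forall>x\<in>derived G. \<forall>a\<in>carrier A. \<forall>X\<in>carrier W12.T.T. \<Psi> (act W12.MN (lp x a) X) = \<tau> x a (\<Psi> X)"
    using split_weyl.tensor_hom[OF SW] by blast
  show thesis
  proof (rule that[OF _ \<iota> \<Psi>(1,2)])
    show "w = w'" if "w \<in> carrier D.W" "w' \<in> carrier D.W" "\<iota> w = \<iota> w'" for w w'
      using arg_cong[OF that(3), of \<pi>] by (simp only: \<pi>\<iota> that(1,2))
    show "\<Psi> (act W12.MN (lp x a) X) = \<iota> (act D.W (lp x a) w)"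
      if "x \<in> derived G" "a \<in> carrier A" "X \<in> carrier W12.T.T" "w \<in> carrier D.W" "\<Psi> X = \<iota> w" for x a X w
      using that \<Psi>(3) by (simp add: \<tau> \<pi>\<iota>)
  qed
qed

text \<open>The universal property of W gives \<Phi>. Its image is a submodule containing the
  product of the generators, hence everything. Composed with \<Psi> it becomes the injective map
  \<iota>, so \<Phi> is injective.\<close>

lemma weyl_tensor_iso: "rep_isomorphic L D.W W12.MN"
proof -
  have "\<exists>f. rep_hom L D.W W12.MN f \<and> f D.wv = v"
    by (rule D.weyl_universal[OF W12.MN_lrep v_hwv v_relv rep_submodule_carrier[OF W12.MN_lrep] v_closed MN_f_nilpotent])
  then obtain \<Phi> where \<Phi>: "rep_hom L D.W W12.MN \<Phi>" "\<Phi> D.wv = v" by blast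
  have \<Phi>l: "lin_map D.W W12.T.T \<Phi>" and \<Phi>a: "\<And>x m. x \<in> carrier L \<Longrightarrow> m \<in> carrier D.W \<Longrightarrow> \<Phi> (act D.W x m) = act W12.MN x (\<Phi> m)"
    using \<Phi>(1) by (auto simp: rep_hom_def W12.MN_lin_map)
  note \<Phi>D = lin_mapD[OF \<Phi>l]
  note D = D.W_lrep D.W_cyclic D.W_hwv
  note nW = cmod_simps[OF lrepD(1)[OF D.W_lrep]]
  have "rep_submodule L W12.MN (\<Phi> ` carrier D.W)"
    unfolding rep_submodule_def lin_subspace_iff[OF W12.MN_cmod]
  proof (intro conjI ballI allI)
    show "\<Phi> ` carrier D.W \<subseteq> carrier W12.MN" using \<Phi>D(1) by auto
    show "\<zero>\<^bsub>W12.MN\<^esub> \<in> \<Phi> ` carrier D.W"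
      unfolding W12.MN_simps by (rule image_eqI[where f=\<Phi> and x="\<zero>\<^bsub>D.W\<^esub>", OF lin_map_zero[OF lrepD(1)[OF D.W_lrep] W12.T.T_cmod \<Phi>l, symmetric] nW(2)])
    fix X assume "X \<in> \<Phi> ` carrier D.W"
    then obtain w where w: "w \<in> carrier D.W" "X = \<Phi> w" by blast
    show "k \<odot>\<^bsub>W12.MN\<^esub> X \<in> \<Phi> ` carrier D.W" for k
      unfolding W12.MN_simps w(2) by (rule image_eqI[where f=\<Phi>, OF \<Phi>D(3)[where c=k, OF w(1), symmetric] nW(3)[OF w(1)]])
    show "act W12.MN y X \<in> \<Phi> ` carrier D.W" if "y \<in> carrier L" for y
      unfolding w(2) by (rule image_eqI[where f=\<Phi>, OF \<Phi>a[OF that w(1), symmetric] lrepD(5)[OF D.W_lrep that w(1)]])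
    fix Y assume "Y \<in> \<Phi> ` carrier D.W"
    then obtain w' where w': "w' \<in> carrier D.W" "Y = \<Phi> w'" by blast
    show "X \<oplus>\<^bsub>W12.MN\<^esub> Y \<in> \<Phi> ` carrier D.W"
      unfolding W12.MN_simps w(2) w'(2) by (rule image_eqI[where f=\<Phi>, OF \<Phi>D(2)[OF w(1) w'(1), symmetric] nW(1)[OF w(1) w'(1)]])
  qed
  moreover have "D.wv \<in> carrier D.W" using D.W_hwv by (simp add: hwv_def)
  then have "v \<in> \<Phi> ` carrier D.W" by (rule image_eqI[where f=\<Phi>, OF \<Phi>(2)[symmetric]])
  ultimately have surj: "\<Phi> ` carrier D.W = carrier W12.MN" using K_carrier by simp
  obtain \<iota> :: "('g, 'a) current verma_carrier set set set \<Rightarrow> (('g, 'a) current verma_carrier set set set \<Rightarrow>\<^sub>0 complex)" and \<Psi> where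
    inj: "\<And>w w'. w \<in> carrier D.W \<Longrightarrow> w' \<in> carrier D.W \<Longrightarrow> \<iota> w = \<iota> w' \<Longrightarrow> w = w'"
    and \<iota>: "lin_map D.W (free_vs UNIV) \<iota>" and \<Psi>: "lin_map W12.T.T (free_vs UNIV) \<Psi>" "\<Psi> v = \<iota> D.wv"
    and act: "\<And>x a X w. x \<in> derived G \<Longrightarrow> a \<in> carrier A \<Longrightarrow> X \<in> carrier W12.T.T \<Longrightarrow> w \<in> carrier D.W \<Longrightarrow> \<Psi> X = \<iota> w \<Longrightarrow>
      \<Psi> (act W12.MN (lp x a) X) = \<iota> (act D.W (lp x a) w)"
    by (rule splitting_exists, rule that)
  note \<iota>D = lin_mapD[OF \<iota>, simplified] and \<Psi>D = lin_mapD[OF \<Psi>(1), simplified]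
  \<comment> \<open>Both sides agree on the generator and are compatible with sums, scalars and
    lowering operators, which together reach all of W; h'' never enters.\<close>
  have \<Psi>\<Phi>: "\<Psi> (\<Phi> w) = \<iota> w" if "w \<in> carrier D.W" for w
    using that[folded D.neg_span_carrier[OF D]]
  proof (induction rule: D.neg_span.induct)
    case vec show ?case using \<Phi>(2) \<Psi>(2) by simp
  next
    case (add w w')
    then have c: "w \<in> carrier D.W" "w' \<in> carrier D.W" using D.neg_span_closed[OF D] by auto
    show ?case using add.IH \<Phi>D(2)[OF c] \<iota>D(2)[OF c] \<Psi>D(2)[OF \<Phi>D(1)[OF c(1)] \<Phi>D(1)[OF c(2)]] by simp
  next
    case (smult w k)
    then have c: "w \<in> carrier D.W" using D.neg_span_closed[OF D] by auto
    show ?case using smult.IH \<Phi>D(3)[OF c] \<iota>D(3)[OF c] \<Psi>D(3)[OF \<Phi>D(1)[OF c]] by simp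
  next
    case (low w a ws)
    then have c: "w \<in> carrier D.W" using D.neg_span_closed[OF D] by auto
    show ?case
      using act[OF fw_derived low(2) \<Phi>D(1)[OF c] c low.IH] \<Phi>a[OF lp_closed[OF fw_derived low(2)] c] by simp
  qed
  have "inj_on \<Phi> (carrier D.W)"
  proof (rule inj_onI)
    fix w w' assume w: "w \<in> carrier D.W" "w' \<in> carrier D.W" "\<Phi> w = \<Phi> w'"
    show "w = w'" by (rule inj[OF w(1,2)]) (simp only: \<Psi>\<Phi>[OF w(1), symmetric] \<Psi>\<Phi>[OF w(2), symmetric] w(3))
  qed
  then have "bij_betw \<Phi> (carrier D.W) (carrier W12.MN)" using surj by (simp add: bij_betw_def)
  then show ?thesis unfolding rep_isomorphic_def using \<Phi>D(2,3) \<Phi>a by (intro exI[of _ \<Phi>]) simp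
qed

end

lemma nat_pairing:
  assumes "dominant_integral G lam"
  obtains n where "\<And>i. lam (coroot G i) = of_nat (n i)"
  using assms unfolding dominant_integral_def Nats_def by (auto simp: image_iff) metis

theorem theorem4p2:
  fixes G :: "('g, 'i::finite) km_algebra_rec"
    and A :: "(complex, 'a) module"
    and HC :: "'g set"
    and I J :: "'a set"
    and \<psi>1 \<psi>2 :: "('g, 'a) current \<Rightarrow> complex"
    and lam mu :: "'g \<Rightarrow> complex"
  assumes "kac_moody G"
    and "cartan_complement G HC"
    and "fg_comm_alg A"
    and "cofinite_ideal A I" and "cofinite_ideal A J"
    and "I <+>\<^bsub>A\<^esub> J = carrier A"
    and "lin_functional ((current_algebra G A HC)\<lparr>carrier := current_cartan G A HC\<rparr>) \<psi>1"
    and "lin_functional ((current_algebra G A HC)\<lparr>carrier := current_cartan G A HC\<rparr>) \<psi>2"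
    and "\<forall>h\<in>cartan' G. \<forall>a\<in>I. \<psi>1 (loop_elt G A h a) = 0"
    and "\<forall>h\<in>cartan' G. \<forall>a\<in>J. \<psi>2 (loop_elt G A h a) = 0"
    and "\<forall>h\<in>cartan G. \<psi>1 (g_embed G A HC h) = lam h"
    and "\<forall>h\<in>cartan G. \<psi>2 (g_embed G A HC h) = mu h"
    and "dominant_integral G lam" and "dominant_integral G mu"
  shows "rep_isomorphic (current_algebra G A HC)
           (weyl_module G A HC (\<lambda>y. \<psi>1 y + \<psi>2 y) (I \<inter> J))
           (tensor_rep (weyl_module G A HC \<psi>1 I) (weyl_module G A HC \<psi>2 J))"
proof -
  have c: "curr G A HC"
    using assms(1-3) by (intro curr.intro curr_axioms.intro) (simp_all add: fg_comm_alg_def)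
  obtain n1 where n1: "\<And>i. lam (coroot G i) = of_nat (n1 i)" using nat_pairing[OF assms(13)] by blast
  obtain n2 where n2: "\<And>i. mu (coroot G i) = of_nat (n2 i)" using nat_pairing[OF assms(14)] by blast
  have "\<psi>1 (loop_elt G A (coroot G i) \<one>\<^bsub>A\<^esub>) = of_nat (n1 i)" "\<psi>2 (loop_elt G A (coroot G i) \<one>\<^bsub>A\<^esub>) = of_nat (n2 i)" for i
    using assms(11,12) n1 n2 kac_moody.coroot_cartan[OF assms(1), of i] by (simp_all flip: curr.ge_chev(3)[OF c])
  then have "weyl_pair G A HC \<psi>1 I n1 \<psi>2 J n2"
    using assms by (intro weyl_pair.intro weyl_pair_axioms.intro hw_data.intro hw_data_axioms.intro c)
      (simp_all add: cofinite_ideal_def)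
  then show ?thesis by (rule weyl_pair.weyl_tensor_iso)
qed

end
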